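(* Let $k$ be a commutative rig and let $(\mathcal C,\otimes,I)$ be a $k$-linear symmetric monoidal category with finite biproducts such that: $\mathcal C$ admits algebraically-free commutative monoids $SX$ ($X\in\mathcal C$); and $\mathcal C$ admits all set-indexed coproducts of the unit object $I$, and these are preserved by the tensor product in each variable. Then there exists an initial monoidal differential modality $P^\partial$ on $\mathcal C$ (an initial object in the category of monoidal differential modalities on $\mathcal C$), and its underlying functor is given on objects by $$P^\partial X=\bigoplus_{x\colon I\to X}SX,$$ the coproduct of copies of $SX$ indexed by the set of maps $x\colon I\to X$ in $\mathcal C$.
   Context: Associativity and unit constraints are suppressed; $\sigma$ denotes the symmetry. A commutative rig is a commutative "ring without negatives". A symmetric monoidal category is $k$-linear if each hom-set is a $k$-module and composition and tensor of morphisms are $k$-linear in each variable. Algebraically-free commutative monoids. For $X\in\mathcal C$, a commuting $X$-action is a pair $(A,\alpha\colon A\otimes X\to A)$ with $\alpha\circ(\alpha\otimes X)\circ(A\otimes\sigma_{X,X})=\alpha\circ(\alpha\otimes X)$; a map $(A,\alpha)\to(B,\beta)$ is $f\colon A\to B$ with $f\circ\alpha=\beta\circ(f\otimes X)$; these form the category $\mathsf{CAct}[X]$. $\mathcal C$ admits algebraically-free commutative monoids if for each $X$ there is given a commutative monoid $(SX,\mathsf u^S_X,\nabla^S_X)$ and a map $\eta^S_X\colon X\to SX$ exhibiting it as the free commutative monoid on $X$, such that the functor $\mathsf{Mod}[SX]\to\mathsf{CAct}[X]$, $(A,\rho)\mapsto(A,\rho\circ(A\otimes\eta^S_X))$, from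 right $SX$-modules is an isomorphism of categories. A coalgebra modality on $\mathcal C$ is a comonad $(!,\varepsilon,\delta)$ with natural maps $\mathsf e_X\colon !X\to I$, $\Delta_X\colon !X\to !X\otimes !X$ making each $!X$ a cocommutative comonoid such that each $\delta_X\colon !X\to !!X$ is a comonoid morphism. A monoidal comonad is a comonad with maps $m_I\colon I\to !I$ and natural $m_{X,Y}\colon !X\otimes !Y\to !(X\otimes Y)$ making $!$ a (lax) symmetric monoidal functor and $\varepsilon,\delta$ monoidal natural transformations. A monoidal coalgebra modality is a comonad with both structures such that: $m_I$ and $m_{X,Y}$ are comonoid homomorphisms (where $I$ is the trivial comonoid and $!X\otimes !Y$ has counit $\mathsf e_X\otimes\mathsf e_Y$ and comultiplication $(1\otimes\sigma\otimes1)\circ(\Delta_X\otimes\Delta_Y)$), and $\mathsf e_X\colon(!X,\delta_X)\to(I,m_I)$ and $\Delta_X\colon(!X,\delta_X)\to(!X\otimes !X,\,m_{!X,!X}\circ(\delta_X\otimes\delta_X))$ are morphisms of $!$-coalgebras. A monoidal differential modality is a monoidal coalgebra modality with a natural family $\mathsf d_X\colon !X\otimes X\to !X$ satisfying - constant rule: $\mathsf e_X\circ\mathsf d_X=0$; - product rule: $\Delta_X\circ\mathsf d_X=\big[(!X\otimes\mathsf d_X)+(\mathsf d_X\otimes !X)\circ(!X\otimes\sigma_{!X,X})\big]\circ(\Delta_X\otimes X)$; - linear rule: $\varepsilon_X\circ\mathsf d_X=\mathsf e_X\otimes X$; - chain rule: $\delta_X\circ\mathsf d_X=\mathsf d_{!X}\circ(\delta_X\otimes\mathsf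 d_X)\circ(\Delta_X\otimes X)$; - interchange rule: $\mathsf d_X\circ(\mathsf d_X\otimes X)\circ(!X\otimes\sigma_{X,X})=\mathsf d_X\circ(\mathsf d_X\otimes X)$. A morphism of monoidal differential modalities $\varphi\colon !^1\to !^2$ is a natural transformation which is a comonad morphism ($\varepsilon^2\varphi=\varepsilon^1$, $\delta^2\varphi=(\varphi\varphi)\delta^1$), is monoidal, has comonoid homomorphisms as components, and satisfies $\varphi_X\circ\mathsf d^1_X=\mathsf d^2_X\circ(\varphi_X\otimes X)$. *)

theory Defs
  imports "HOL-Library.Equipollence" "HOL-Library.FuncSet"
begin

section \<open>Categories\<close>

record ('o, 'm) cat =
  Obj :: "'o set"
  Arr :: "'m set"
  Dom :: "'m \<Rightarrow> 'o"
  Cod :: "'m \<Rightarrow> 'o"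
  Ident :: "'o \<Rightarrow> 'm" ("\<one>\<index>")
  Comp :: "'m \<Rightarrow> 'm \<Rightarrow> 'm" (infixr "\<bullet>\<index>" 55)

definition Hom :: "('o, 'm, 'z) cat_scheme \<Rightarrow> 'o \<Rightarrow> 'o \<Rightarrow> 'm set" ("hom\<index>") where
  "Hom C X Y = {f \<in> Arr C. Dom C f = X \<and> Cod C f = Y}"

locale category =
  fixes C :: "('o, 'm, 'z) cat_scheme" (structure)
  assumes Dom_Obj: "f \<in> Arr C \<Longrightarrow> Dom C f \<in> Obj C"
    and Cod_Obj: "f \<in> Arr C \<Longrightarrow> Cod C f \<in> Obj C"
    and Ident_Hom: "X \<in> Obj C \<Longrightarrow> \<one> X \<in> hom X X"
    and Comp_Hom: "f \<in> hom X Y \<Longrightarrow> g \<in> hom Y Z \<Longrightarrow> g \<bullet> f \<in> hom X Z"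
    and Comp_Ident: "f \<in> hom X Y \<Longrightarrow> f \<bullet> \<one> X = f"
    and Ident_Comp: "f \<in> hom X Y \<Longrightarrow> \<one> Y \<bullet> f = f"
    and Comp_assoc: "f \<in> hom W X \<Longrightarrow> g \<in> hom X Y \<Longrightarrow> h \<in> hom Y Z \<Longrightarrow>
      (h \<bullet> g) \<bullet> f = h \<bullet> (g \<bullet> f)"

definition is_inverse :: "('o, 'm, 'z) cat_scheme \<Rightarrow> 'm \<Rightarrow> 'm \<Rightarrow> bool" where
  "is_inverse C f g \<longleftrightarrow>
     f \<in> Arr C \<and> g \<in> Hom C (Cod C f) (Dom C f) \<and>
     Comp C g f = Ident C (Dom C f) \<and> Comp C f g = Ident C (Cod C f)"

definition is_iso :: "('o, 'm, 'z) cat_scheme \<Rightarrow> 'm \<Rightarrow> bool" where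
  "is_iso C f \<longleftrightarrow> (\<exists>g. is_inverse C f g)"

definition iso_inv :: "('o, 'm, 'z) cat_scheme \<Rightarrow> 'm \<Rightarrow> 'm" ("Inv\<index>") where
  "iso_inv C f = (THE g. is_inverse C f g)"

definition initial_object :: "('o, 'm, 'z) cat_scheme \<Rightarrow> 'o \<Rightarrow> bool" where
  "initial_object C X \<longleftrightarrow> X \<in> Obj C \<and> (\<forall>Y\<in>Obj C. \<exists>!f. f \<in> Hom C X Y)"

definition terminal_object :: "('o, 'm, 'z) cat_scheme \<Rightarrow> 'o \<Rightarrow> bool" where
  "terminal_object C X \<longleftrightarrow> X \<in> Obj C \<and> (\<forall>Y\<in>Obj C. \<exists>!f. f \<in> Hom C Y X)"

definition is_coproduct ::
    "('o, 'm, 'z) cat_scheme \<Rightarrow> 'j set \<Rightarrow> ('j \<Rightarrow> 'o) \<Rightarrow> 'o \<Rightarrow> ('j \<Rightarrow> 'm) \<Rightarrow> bool" where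
  "is_coproduct C J A B \<iota> \<longleftrightarrow>
     B \<in> Obj C \<and> (\<forall>j\<in>J. \<iota> j \<in> Hom C (A j) B) \<and>
     (\<forall>Y\<in>Obj C. \<forall>f. (\<forall>j\<in>J. f j \<in> Hom C (A j) Y) \<longrightarrow>
        (\<exists>!h. h \<in> Hom C B Y \<and> (\<forall>j\<in>J. Comp C h (\<iota> j) = f j)))"

definition is_functor ::
    "('a, 'f, 'y) cat_scheme \<Rightarrow> ('b, 'g, 'z) cat_scheme \<Rightarrow> ('a \<Rightarrow> 'b) \<Rightarrow> ('f \<Rightarrow> 'g) \<Rightarrow> bool" where
  "is_functor C D FO FA \<longleftrightarrow>
     (\<forall>X\<in>Obj C. FO X \<in> Obj D) \<and>
     (\<forall>X Y. \<forall>f\<in>Hom C X Y. FA f \<in> Hom D (FO X) (FO Y)) \<and>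
     (\<forall>X\<in>Obj C. FA (Ident C X) = Ident D (FO X)) \<and>
     (\<forall>X Y Z. \<forall>f\<in>Hom C X Y. \<forall>g\<in>Hom C Y Z. FA (Comp C g f) = Comp D (FA g) (FA f))"

definition is_iso_of_categories ::
    "('a, 'f, 'y) cat_scheme \<Rightarrow> ('b, 'g, 'z) cat_scheme \<Rightarrow> ('a \<Rightarrow> 'b) \<Rightarrow> ('f \<Rightarrow> 'g) \<Rightarrow> bool" where
  "is_iso_of_categories C D FO FA \<longleftrightarrow>
     is_functor C D FO FA \<and>
     (\<exists>GO GA. is_functor D C GO GA \<and>
        (\<forall>X\<in>Obj C. GO (FO X) = X) \<and> (\<forall>f\<in>Arr C. GA (FA f) = f) \<and>
        (\<forall>X\<in>Obj D. FO (GO X) = X) \<and> (\<forall>f\<in>Arr D. FA (GA f) = f))"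


section \<open>Symmetric monoidal categories\<close>

record ('o, 'm) smcat = "('o, 'm) cat" +
  TensO :: "'o \<Rightarrow> 'o \<Rightarrow> 'o" (infixr "\<otimes>\<index>" 70)
  TensA :: "'m \<Rightarrow> 'm \<Rightarrow> 'm" (infixr "\<boxtimes>\<index>" 70)
  UnitO :: "'o" ("\<I>\<index>")
  Assoc :: "'o \<Rightarrow> 'o \<Rightarrow> 'o \<Rightarrow> 'm" ("\<a>\<index>")
  LUnit :: "'o \<Rightarrow> 'm" ("\<l>\<index>")
  RUnit :: "'o \<Rightarrow> 'm" ("\<r>\<index>")
  Symm :: "'o \<Rightarrow> 'o \<Rightarrow> 'm" ("\<s>\<index>")

locale symmetric_monoidal_category = category C
  for C :: "('o, 'm, 'z) smcat_scheme" (structure) +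
  assumes TensO_Obj: "X \<in> Obj C \<Longrightarrow> Y \<in> Obj C \<Longrightarrow> X \<otimes> Y \<in> Obj C"
    and UnitO_Obj: "\<I> \<in> Obj C"
    and TensA_Hom: "f \<in> hom X X' \<Longrightarrow> g \<in> hom Y Y' \<Longrightarrow> f \<boxtimes> g \<in> hom (X \<otimes> Y) (X' \<otimes> Y')"
    and TensA_Ident: "X \<in> Obj C \<Longrightarrow> Y \<in> Obj C \<Longrightarrow> \<one> X \<boxtimes> \<one> Y = \<one> (X \<otimes> Y)"
    and TensA_Comp: "f \<in> hom X X' \<Longrightarrow> f' \<in> hom X' X'' \<Longrightarrow> g \<in> hom Y Y' \<Longrightarrow> g' \<in> hom Y' Y'' \<Longrightarrow>
      (f' \<bullet> f) \<boxtimes> (g' \<bullet> g) = (f' \<boxtimes> g') \<bullet> (f \<boxtimes> g)"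
    and Assoc_Hom: "X \<in> Obj C \<Longrightarrow> Y \<in> Obj C \<Longrightarrow> Z \<in> Obj C \<Longrightarrow>
      \<a> X Y Z \<in> hom ((X \<otimes> Y) \<otimes> Z) (X \<otimes> (Y \<otimes> Z))"
    and Assoc_iso: "X \<in> Obj C \<Longrightarrow> Y \<in> Obj C \<Longrightarrow> Z \<in> Obj C \<Longrightarrow> is_iso C (\<a> X Y Z)"
    and Assoc_natural: "f \<in> hom X X' \<Longrightarrow> g \<in> hom Y Y' \<Longrightarrow> h \<in> hom Z Z' \<Longrightarrow>
      \<a> X' Y' Z' \<bullet> ((f \<boxtimes> g) \<boxtimes> h) = (f \<boxtimes> (g \<boxtimes> h)) \<bullet> \<a> X Y Z"
    and LUnit_Hom: "X \<in> Obj C \<Longrightarrow> \<l> X \<in> hom (\<I> \<otimes> X) X"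
    and LUnit_iso: "X \<in> Obj C \<Longrightarrow> is_iso C (\<l> X)"
    and LUnit_natural: "f \<in> hom X Y \<Longrightarrow> \<l> Y \<bullet> (\<one> \<I> \<boxtimes> f) = f \<bullet> \<l> X"
    and RUnit_Hom: "X \<in> Obj C \<Longrightarrow> \<r> X \<in> hom (X \<otimes> \<I>) X"
    and RUnit_iso: "X \<in> Obj C \<Longrightarrow> is_iso C (\<r> X)"
    and RUnit_natural: "f \<in> hom X Y \<Longrightarrow> \<r> Y \<bullet> (f \<boxtimes> \<one> \<I>) = f \<bullet> \<r> X"
    and Symm_Hom: "X \<in> Obj C \<Longrightarrow> Y \<in> Obj C \<Longrightarrow> \<s> X Y \<in> hom (X \<otimes> Y) (Y \<otimes> X)"
    and Symm_natural: "f \<in> hom X X' \<Longrightarrow> g \<in> hom Y Y' \<Longrightarrow>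
      \<s> X' Y' \<bullet> (f \<boxtimes> g) = (g \<boxtimes> f) \<bullet> \<s> X Y"
    and pentagon: "W \<in> Obj C \<Longrightarrow> X \<in> Obj C \<Longrightarrow> Y \<in> Obj C \<Longrightarrow> Z \<in> Obj C \<Longrightarrow>
      (\<one> W \<boxtimes> \<a> X Y Z) \<bullet> \<a> W (X \<otimes> Y) Z \<bullet> (\<a> W X Y \<boxtimes> \<one> Z)
        = \<a> W X (Y \<otimes> Z) \<bullet> \<a> (W \<otimes> X) Y Z"
    and triangle: "X \<in> Obj C \<Longrightarrow> Y \<in> Obj C \<Longrightarrow>
      (\<one> X \<boxtimes> \<l> Y) \<bullet> \<a> X \<I> Y = \<r> X \<boxtimes> \<one> Y"
    and hexagon: "X \<in> Obj C \<Longrightarrow> Y \<in> Obj C \<Longrightarrow> Z \<in> Obj C \<Longrightarrow>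
      \<a> Y Z X \<bullet> \<s> X (Y \<otimes> Z) \<bullet> \<a> X Y Z
        = (\<one> Y \<boxtimes> \<s> X Z) \<bullet> \<a> Y X Z \<bullet> (\<s> X Y \<boxtimes> \<one> Z)"
    and Symm_Symm: "X \<in> Obj C \<Longrightarrow> Y \<in> Obj C \<Longrightarrow> \<s> Y X \<bullet> \<s> X Y = \<one> (X \<otimes> Y)"

text \<open>The map \<open>1 \<otimes> \<sigma> \<otimes> 1\<close> from \<open>(W \<otimes> X) \<otimes> (Y \<otimes> Z)\<close> to \<open>(W \<otimes> Y) \<otimes> (X \<otimes> Z)\<close>.\<close>

definition MidSwap :: "('o, 'm, 'z) smcat_scheme \<Rightarrow> 'o \<Rightarrow> 'o \<Rightarrow> 'o \<Rightarrow> 'o \<Rightarrow> 'm" where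
  "MidSwap C W X Y Z =
     Inv\<^bsub>C\<^esub> (\<a>\<^bsub>C\<^esub> W Y (X \<otimes>\<^bsub>C\<^esub> Z)) \<bullet>\<^bsub>C\<^esub>
     (\<one>\<^bsub>C\<^esub> W \<boxtimes>\<^bsub>C\<^esub>
        (\<a>\<^bsub>C\<^esub> Y X Z \<bullet>\<^bsub>C\<^esub> (\<s>\<^bsub>C\<^esub> X Y \<boxtimes>\<^bsub>C\<^esub> \<one>\<^bsub>C\<^esub> Z) \<bullet>\<^bsub>C\<^esub> Inv\<^bsub>C\<^esub> (\<a>\<^bsub>C\<^esub> X Y Z))) \<bullet>\<^bsub>C\<^esub>
     \<a>\<^bsub>C\<^esub> W X (Y \<otimes>\<^bsub>C\<^esub> Z)"


section \<open>Linear structure and biproducts\<close>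

record ('o, 'm, 'k) linsmcat = "('o, 'm) smcat" +
  Zero :: "'o \<Rightarrow> 'o \<Rightarrow> 'm" ("\<zero>\<index>")
  Add :: "'m \<Rightarrow> 'm \<Rightarrow> 'm" (infixl "\<oplus>\<index>" 53)
  Scale :: "'k \<Rightarrow> 'm \<Rightarrow> 'm" (infixr "\<odot>\<index>" 75)

text \<open>The sort of \<open>'k\<close> says exactly that \<open>'k\<close> is a commutative rig; unlike
  \<open>comm_semiring_1\<close> it does not exclude the rig in which 0 = 1.\<close>

locale linear_symmetric_monoidal_category = symmetric_monoidal_category C
  for C :: "('o, 'm, 'k::{comm_semiring_0,comm_monoid_mult}, 'z) linsmcat_scheme" (structure) +
  assumes Zero_Hom: "X \<in> Obj C \<Longrightarrow> Y \<in> Obj C \<Longrightarrow> \<zero> X Y \<in> hom X Y"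
    and Add_Hom: "f \<in> hom X Y \<Longrightarrow> g \<in> hom X Y \<Longrightarrow> f \<oplus> g \<in> hom X Y"
    and Scale_Hom: "f \<in> hom X Y \<Longrightarrow> c \<odot> f \<in> hom X Y"
    and Add_assoc: "f \<in> hom X Y \<Longrightarrow> g \<in> hom X Y \<Longrightarrow> h \<in> hom X Y \<Longrightarrow>
      (f \<oplus> g) \<oplus> h = f \<oplus> (g \<oplus> h)"
    and Add_commute: "f \<in> hom X Y \<Longrightarrow> g \<in> hom X Y \<Longrightarrow> f \<oplus> g = g \<oplus> f"
    and Zero_Add: "f \<in> hom X Y \<Longrightarrow> \<zero> X Y \<oplus> f = f"
    and Scale_Add: "f \<in> hom X Y \<Longrightarrow> g \<in> hom X Y \<Longrightarrow> c \<odot> (f \<oplus> g) = c \<odot> f \<oplus> c \<odot> g"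
    and Scale_Zero: "X \<in> Obj C \<Longrightarrow> Y \<in> Obj C \<Longrightarrow> c \<odot> \<zero> X Y = \<zero> X Y"
    and add_Scale: "f \<in> hom X Y \<Longrightarrow> (c + c') \<odot> f = c \<odot> f \<oplus> c' \<odot> f"
    and zero_Scale: "f \<in> hom X Y \<Longrightarrow> 0 \<odot> f = \<zero> X Y"
    and mult_Scale: "f \<in> hom X Y \<Longrightarrow> (c * c') \<odot> f = c \<odot> (c' \<odot> f)"
    and one_Scale: "f \<in> hom X Y \<Longrightarrow> 1 \<odot> f = f"
    and Comp_Add: "f \<in> hom X Y \<Longrightarrow> f' \<in> hom X Y \<Longrightarrow> g \<in> hom Y Z \<Longrightarrow>
      g \<bullet> (f \<oplus> f') = (g \<bullet> f) \<oplus> (g \<bullet> f')"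
    and Add_Comp: "f \<in> hom X Y \<Longrightarrow> g \<in> hom Y Z \<Longrightarrow> g' \<in> hom Y Z \<Longrightarrow>
      (g \<oplus> g') \<bullet> f = (g \<bullet> f) \<oplus> (g' \<bullet> f)"
    and Comp_Zero: "X \<in> Obj C \<Longrightarrow> g \<in> hom Y Z \<Longrightarrow> g \<bullet> \<zero> X Y = \<zero> X Z"
    and Zero_Comp: "f \<in> hom X Y \<Longrightarrow> Z \<in> Obj C \<Longrightarrow> \<zero> Y Z \<bullet> f = \<zero> X Z"
    and Comp_Scale: "f \<in> hom X Y \<Longrightarrow> g \<in> hom Y Z \<Longrightarrow> g \<bullet> (c \<odot> f) = c \<odot> (g \<bullet> f)"
    and Scale_Comp: "f \<in> hom X Y \<Longrightarrow> g \<in> hom Y Z \<Longrightarrow> (c \<odot> g) \<bullet> f = c \<odot> (g \<bullet> f)"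
    and TensA_Add: "f \<in> hom X Y \<Longrightarrow> g \<in> hom X' Y' \<Longrightarrow> g' \<in> hom X' Y' \<Longrightarrow>
      f \<boxtimes> (g \<oplus> g') = (f \<boxtimes> g) \<oplus> (f \<boxtimes> g')"
    and Add_TensA: "f \<in> hom X Y \<Longrightarrow> f' \<in> hom X Y \<Longrightarrow> g \<in> hom X' Y' \<Longrightarrow>
      (f \<oplus> f') \<boxtimes> g = (f \<boxtimes> g) \<oplus> (f' \<boxtimes> g)"
    and TensA_Zero: "f \<in> hom X Y \<Longrightarrow> X' \<in> Obj C \<Longrightarrow> Y' \<in> Obj C \<Longrightarrow>
      f \<boxtimes> \<zero> X' Y' = \<zero> (X \<otimes> X') (Y \<otimes> Y')"
    and Zero_TensA: "X \<in> Obj C \<Longrightarrow> Y \<in> Obj C \<Longrightarrow> g \<in> hom X' Y' \<Longrightarrow>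
      \<zero> X Y \<boxtimes> g = \<zero> (X \<otimes> X') (Y \<otimes> Y')"
    and TensA_Scale: "f \<in> hom X Y \<Longrightarrow> g \<in> hom X' Y' \<Longrightarrow> f \<boxtimes> (c \<odot> g) = c \<odot> (f \<boxtimes> g)"
    and Scale_TensA: "f \<in> hom X Y \<Longrightarrow> g \<in> hom X' Y' \<Longrightarrow> (c \<odot> f) \<boxtimes> g = c \<odot> (f \<boxtimes> g)"

definition is_biproduct ::
    "('o, 'm, 'k, 'z) linsmcat_scheme \<Rightarrow> 'o \<Rightarrow> 'o \<Rightarrow> 'o \<Rightarrow> 'm \<Rightarrow> 'm \<Rightarrow> 'm \<Rightarrow> 'm \<Rightarrow> bool" where
  "is_biproduct C X Y B p q i j \<longleftrightarrow>
     B \<in> Obj C \<and>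
     p \<in> Hom C B X \<and> q \<in> Hom C B Y \<and> i \<in> Hom C X B \<and> j \<in> Hom C Y B \<and>
     p \<bullet>\<^bsub>C\<^esub> i = \<one>\<^bsub>C\<^esub> X \<and> q \<bullet>\<^bsub>C\<^esub> j = \<one>\<^bsub>C\<^esub> Y \<and>
     p \<bullet>\<^bsub>C\<^esub> j = \<zero>\<^bsub>C\<^esub> Y X \<and> q \<bullet>\<^bsub>C\<^esub> i = \<zero>\<^bsub>C\<^esub> X Y \<and>
     (i \<bullet>\<^bsub>C\<^esub> p) \<oplus>\<^bsub>C\<^esub> (j \<bullet>\<^bsub>C\<^esub> q) = \<one>\<^bsub>C\<^esub> B"

definition has_finite_biproducts :: "('o, 'm, 'k, 'z) linsmcat_scheme \<Rightarrow> bool" where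
  "has_finite_biproducts C \<longleftrightarrow>
     (\<exists>Z. initial_object C Z \<and> terminal_object C Z) \<and>
     (\<forall>X\<in>Obj C. \<forall>Y\<in>Obj C. \<exists>B p q i j. is_biproduct C X Y B p q i j)"


section \<open>Set-indexed coproducts of the unit\<close>

text \<open>The distinction between sets and proper classes is kept by a parameter \<open>small\<close>, telling
  which collections of indices are sets. Taking every \<open>J :: 'i set\<close> to be small is no option: if
  \<open>'i\<close> is at least as large as the type of arrows and the coproduct of copies of \<open>\<I>\<close> indexed by all
  of \<open>'i\<close> exists then, by cardinality, any two parallel arrows out of \<open>\<I>\<close> agree, so that the
  category is trivial.\<close>

locale smallness =
  fixes small :: "'i set \<Rightarrow> bool"
  assumes small_finite: "finite J \<Longrightarrow> small J"
    and small_lepoll: "small J \<Longrightarrow> K \<lesssim> J \<Longrightarrow> small K"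
    and small_UN: "small J \<Longrightarrow> (\<And>j. j \<in> J \<Longrightarrow> small (F j)) \<Longrightarrow> small (\<Union>j\<in>J. F j)"

text \<open>Local smallness is required only of the hom-sets that index a coproduct in the theorem.\<close>

definition has_small_points ::
    "('o, 'm, 'z) smcat_scheme \<Rightarrow> ('i set \<Rightarrow> bool) \<Rightarrow> bool" where
  "has_small_points C small \<longleftrightarrow> (\<forall>X\<in>Obj C. \<exists>J. small J \<and> Hom C \<I>\<^bsub>C\<^esub> X \<approx> J)"

definition has_small_coproducts_of_unit ::
    "('o, 'm, 'z) smcat_scheme \<Rightarrow> ('i set \<Rightarrow> bool) \<Rightarrow> bool" where
  "has_small_coproducts_of_unit C small \<longleftrightarrow>
     (\<forall>J. small J \<longrightarrow> (\<exists>B \<iota>. is_coproduct C J (\<lambda>_. \<I>\<^bsub>C\<^esub>) B \<iota>))"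

definition tensor_preserves_small_coproducts_of_unit ::
    "('o, 'm, 'z) smcat_scheme \<Rightarrow> ('i set \<Rightarrow> bool) \<Rightarrow> bool" where
  "tensor_preserves_small_coproducts_of_unit C small \<longleftrightarrow>
     (\<forall>J B \<iota>. small J \<longrightarrow> is_coproduct C J (\<lambda>_. \<I>\<^bsub>C\<^esub>) B \<iota> \<longrightarrow>
        (\<forall>X\<in>Obj C.
           is_coproduct C J (\<lambda>_. X \<otimes>\<^bsub>C\<^esub> \<I>\<^bsub>C\<^esub>) (X \<otimes>\<^bsub>C\<^esub> B) (\<lambda>j. \<one>\<^bsub>C\<^esub> X \<boxtimes>\<^bsub>C\<^esub> \<iota> j) \<and>
           is_coproduct C J (\<lambda>_. \<I>\<^bsub>C\<^esub> \<otimes>\<^bsub>C\<^esub> X) (B \<otimes>\<^bsub>C\<^esub> X) (\<lambda>j. \<iota> j \<boxtimes>\<^bsub>C\<^esub> \<one>\<^bsub>C\<^esub> X)))"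


section \<open>Algebraically-free commutative monoids\<close>

locale commutative_monoid = symmetric_monoidal_category C
  for C :: "('o, 'm, 'z) smcat_scheme" (structure) +
  fixes M :: 'o and u n :: 'm
  assumes carrier: "M \<in> Obj C"
    and unit_Hom: "u \<in> hom \<I> M"
    and mult_Hom: "n \<in> hom (M \<otimes> M) M"
    and left_unit: "n \<bullet> (u \<boxtimes> \<one> M) = \<l> M"
    and right_unit: "n \<bullet> (\<one> M \<boxtimes> u) = \<r> M"
    and assoc: "n \<bullet> (n \<boxtimes> \<one> M) = n \<bullet> (\<one> M \<boxtimes> n) \<bullet> \<a> M M M"
    and commute: "n \<bullet> \<s> M M = n"

definition monoid_hom ::
    "('o, 'm, 'z) smcat_scheme \<Rightarrow> 'o \<times> 'm \<times> 'm \<Rightarrow> 'o \<times> 'm \<times> 'm \<Rightarrow> 'm \<Rightarrow> bool" where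
  "monoid_hom C = (\<lambda>(M, u, n) (M', u', n') h.
     h \<in> Hom C M M' \<and> h \<bullet>\<^bsub>C\<^esub> u = u' \<and> h \<bullet>\<^bsub>C\<^esub> n = n' \<bullet>\<^bsub>C\<^esub> (h \<boxtimes>\<^bsub>C\<^esub> h))"

definition free_commutative_monoid ::
    "('o, 'm, 'z) smcat_scheme \<Rightarrow> 'o \<Rightarrow> 'o \<Rightarrow> 'm \<Rightarrow> 'm \<Rightarrow> 'm \<Rightarrow> bool" where
  "free_commutative_monoid C X M u n \<eta> \<longleftrightarrow>
     commutative_monoid C M u n \<and> \<eta> \<in> Hom C X M \<and>
     (\<forall>M' u' n' f. commutative_monoid C M' u' n' \<and> f \<in> Hom C X M' \<longrightarrow>
        (\<exists>!h. monoid_hom C (M, u, n) (M', u', n') h \<and> h \<bullet>\<^bsub>C\<^esub> \<eta> = f))"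

text \<open>Objects are pairs \<open>(A, \<alpha>)\<close> with \<open>\<alpha> : A \<otimes> Y \<rightarrow> A\<close>, taken from a given class; an arrow
  carries its domain and codomain, so that hom-sets are disjoint.\<close>

definition action_category ::
    "('o, 'm, 'z) smcat_scheme \<Rightarrow> 'o \<Rightarrow> ('o \<times> 'm) set \<Rightarrow> ('o \<times> 'm, ('o \<times> 'm) \<times> 'm \<times> ('o \<times> 'm)) cat"
  where
  "action_category C Y \<A> =
     \<lparr>Obj = \<A>,
      Arr = {((A, \<alpha>), f, (B, \<beta>)) | A \<alpha> f B \<beta>. (A, \<alpha>) \<in> \<A> \<and> (B, \<beta>) \<in> \<A> \<and>
               f \<in> Hom C A B \<and> f \<bullet>\<^bsub>C\<^esub> \<alpha> = \<beta> \<bullet>\<^bsub>C\<^esub> (f \<boxtimes>\<^bsub>C\<^esub> \<one>\<^bsub>C\<^esub> Y)},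
      Dom = (\<lambda>(a, f, b). a),
      Cod = (\<lambda>(a, f, b). b),
      Ident = (\<lambda>(A, \<alpha>). ((A, \<alpha>), \<one>\<^bsub>C\<^esub> A, (A, \<alpha>))),
      Comp = (\<lambda>(b', g, c) (a, f, b). (a, g \<bullet>\<^bsub>C\<^esub> f, c))\<rparr>"

definition right_module ::
    "('o, 'm, 'z) smcat_scheme \<Rightarrow> 'o \<Rightarrow> 'm \<Rightarrow> 'm \<Rightarrow> 'o \<Rightarrow> 'm \<Rightarrow> bool" where
  "right_module C M u n A \<rho> \<longleftrightarrow>
     A \<in> Obj C \<and> \<rho> \<in> Hom C (A \<otimes>\<^bsub>C\<^esub> M) A \<and>
     \<rho> \<bullet>\<^bsub>C\<^esub> (\<one>\<^bsub>C\<^esub> A \<boxtimes>\<^bsub>C\<^esub> u) = \<r>\<^bsub>C\<^esub> A \<and>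
     \<rho> \<bullet>\<^bsub>C\<^esub> (\<rho> \<boxtimes>\<^bsub>C\<^esub> \<one>\<^bsub>C\<^esub> M) = \<rho> \<bullet>\<^bsub>C\<^esub> (\<one>\<^bsub>C\<^esub> A \<boxtimes>\<^bsub>C\<^esub> n) \<bullet>\<^bsub>C\<^esub> \<a>\<^bsub>C\<^esub> A M M"

definition Mod where
  "Mod C M u n = action_category C M {(A, \<rho>). right_module C M u n A \<rho>}"

definition commuting_action ::
    "('o, 'm, 'z) smcat_scheme \<Rightarrow> 'o \<Rightarrow> 'o \<Rightarrow> 'm \<Rightarrow> bool" where
  "commuting_action C X A \<alpha> \<longleftrightarrow>
     A \<in> Obj C \<and> \<alpha> \<in> Hom C (A \<otimes>\<^bsub>C\<^esub> X) A \<and>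
     \<alpha> \<bullet>\<^bsub>C\<^esub> (\<alpha> \<boxtimes>\<^bsub>C\<^esub> \<one>\<^bsub>C\<^esub> X) \<bullet>\<^bsub>C\<^esub>
         Inv\<^bsub>C\<^esub> (\<a>\<^bsub>C\<^esub> A X X) \<bullet>\<^bsub>C\<^esub> (\<one>\<^bsub>C\<^esub> A \<boxtimes>\<^bsub>C\<^esub> \<s>\<^bsub>C\<^esub> X X) \<bullet>\<^bsub>C\<^esub> \<a>\<^bsub>C\<^esub> A X X
       = \<alpha> \<bullet>\<^bsub>C\<^esub> (\<alpha> \<boxtimes>\<^bsub>C\<^esub> \<one>\<^bsub>C\<^esub> X)"

definition CAct where
  "CAct C X = action_category C X {(A, \<alpha>). commuting_action C X A \<alpha>}"

definition restrict_action ::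
    "('o, 'm, 'z) smcat_scheme \<Rightarrow> 'm \<Rightarrow> 'o \<times> 'm \<Rightarrow> 'o \<times> 'm" where
  "restrict_action C \<eta> = (\<lambda>(A, \<rho>). (A, \<rho> \<bullet>\<^bsub>C\<^esub> (\<one>\<^bsub>C\<^esub> A \<boxtimes>\<^bsub>C\<^esub> \<eta>)))"

definition algebraically_free_commutative_monoids ::
    "('o, 'm, 'z) smcat_scheme \<Rightarrow> ('o \<Rightarrow> 'o) \<Rightarrow> ('o \<Rightarrow> 'm) \<Rightarrow> ('o \<Rightarrow> 'm) \<Rightarrow> ('o \<Rightarrow> 'm) \<Rightarrow> bool" where
  "algebraically_free_commutative_monoids C S u n \<eta> \<longleftrightarrow>
     (\<forall>X\<in>Obj C.
        free_commutative_monoid C X (S X) (u X) (n X) (\<eta> X) \<and>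
        is_iso_of_categories (Mod C (S X) (u X) (n X)) (CAct C X)
          (restrict_action C (\<eta> X))
          (\<lambda>(a, f, b). (restrict_action C (\<eta> X) a, f, restrict_action C (\<eta> X) b)))"


section \<open>Monoidal differential modalities\<close>

record ('o, 'm) modality =
  Bang :: "'o \<Rightarrow> 'o"
  BangA :: "'m \<Rightarrow> 'm"
  eps :: "'o \<Rightarrow> 'm"
  del :: "'o \<Rightarrow> 'm"
  cou :: "'o \<Rightarrow> 'm"  (* the counit e *)
  com :: "'o \<Rightarrow> 'm"  (* the comultiplication Delta *)
  munit :: "'m"  (* m_I *)
  mtens :: "'o \<Rightarrow> 'o \<Rightarrow> 'm"  (* m_{X,Y} *)
  der :: "'o \<Rightarrow> 'm"  (* the deriving transformation d *)

locale comonad = category C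
  for C :: "('o, 'm, 'z) cat_scheme" (structure) +
  fixes T :: "('o, 'm) modality"
  assumes Bang_functor: "is_functor C C (Bang T) (BangA T)"
    and eps_Hom: "X \<in> Obj C \<Longrightarrow> eps T X \<in> hom (Bang T X) X"
    and eps_natural: "f \<in> hom X Y \<Longrightarrow> eps T Y \<bullet> BangA T f = f \<bullet> eps T X"
    and del_Hom: "X \<in> Obj C \<Longrightarrow> del T X \<in> hom (Bang T X) (Bang T (Bang T X))"
    and del_natural: "f \<in> hom X Y \<Longrightarrow> del T Y \<bullet> BangA T f = BangA T (BangA T f) \<bullet> del T X"
    and eps_del: "X \<in> Obj C \<Longrightarrow> eps T (Bang T X) \<bullet> del T X = \<one> (Bang T X)"
    and Bang_eps_del: "X \<in> Obj C \<Longrightarrow> BangA T (eps T X) \<bullet> del T X = \<one> (Bang T X)"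
    and del_del: "X \<in> Obj C \<Longrightarrow> del T (Bang T X) \<bullet> del T X = BangA T (del T X) \<bullet> del T X"

locale cocommutative_comonoid = symmetric_monoidal_category C
  for C :: "('o, 'm, 'z) smcat_scheme" (structure) +
  fixes A :: 'o and e d :: 'm
  assumes carrier: "A \<in> Obj C"
    and counit_Hom: "e \<in> hom A \<I>"
    and comult_Hom: "d \<in> hom A (A \<otimes> A)"
    and left_counit: "\<l> A \<bullet> (e \<boxtimes> \<one> A) \<bullet> d = \<one> A"
    and right_counit: "\<r> A \<bullet> (\<one> A \<boxtimes> e) \<bullet> d = \<one> A"
    and coassoc: "\<a> A A A \<bullet> (d \<boxtimes> \<one> A) \<bullet> d = (\<one> A \<boxtimes> d) \<bullet> d"
    and cocommute: "\<s> A A \<bullet> d = d"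

definition comonoid_hom ::
    "('o, 'm, 'z) smcat_scheme \<Rightarrow> 'o \<times> 'm \<times> 'm \<Rightarrow> 'o \<times> 'm \<times> 'm \<Rightarrow> 'm \<Rightarrow> bool" where
  "comonoid_hom C = (\<lambda>(A, e, d) (A', e', d') h.
     h \<in> Hom C A A' \<and> e' \<bullet>\<^bsub>C\<^esub> h = e \<and> d' \<bullet>\<^bsub>C\<^esub> h = (h \<boxtimes>\<^bsub>C\<^esub> h) \<bullet>\<^bsub>C\<^esub> d)"

definition bang_comonoid :: "('o, 'm) modality \<Rightarrow> 'o \<Rightarrow> 'o \<times> 'm \<times> 'm" where
  "bang_comonoid T X = (Bang T X, cou T X, com T X)"

definition unit_comonoid :: "('o, 'm, 'z) smcat_scheme \<Rightarrow> 'o \<times> 'm \<times> 'm" where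
  "unit_comonoid C = (\<I>\<^bsub>C\<^esub>, \<one>\<^bsub>C\<^esub> \<I>\<^bsub>C\<^esub>, Inv\<^bsub>C\<^esub> (\<l>\<^bsub>C\<^esub> \<I>\<^bsub>C\<^esub>))"

definition tensor_comonoid ::
    "('o, 'm, 'z) smcat_scheme \<Rightarrow> 'o \<times> 'm \<times> 'm \<Rightarrow> 'o \<times> 'm \<times> 'm \<Rightarrow> 'o \<times> 'm \<times> 'm" where
  "tensor_comonoid C = (\<lambda>(A, e, d) (A', e', d').
     (A \<otimes>\<^bsub>C\<^esub> A', \<l>\<^bsub>C\<^esub> \<I>\<^bsub>C\<^esub> \<bullet>\<^bsub>C\<^esub> (e \<boxtimes>\<^bsub>C\<^esub> e'), MidSwap C A A A' A' \<bullet>\<^bsub>C\<^esub> (d \<boxtimes>\<^bsub>C\<^esub> d')))"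

locale coalgebra_modality = symmetric_monoidal_category C + comonad C T
  for C :: "('o, 'm, 'z) smcat_scheme" (structure) and T :: "('o, 'm) modality" +
  assumes comonoid: "X \<in> Obj C \<Longrightarrow> cocommutative_comonoid C (Bang T X) (cou T X) (com T X)"
    and cou_natural: "f \<in> hom X Y \<Longrightarrow> cou T Y \<bullet> BangA T f = cou T X"
    and com_natural: "f \<in> hom X Y \<Longrightarrow>
      com T Y \<bullet> BangA T f = (BangA T f \<boxtimes> BangA T f) \<bullet> com T X"
    and del_comonoid_hom: "X \<in> Obj C \<Longrightarrow>
      comonoid_hom C (bang_comonoid T X) (bang_comonoid T (Bang T X)) (del T X)"

locale monoidal_comonad = symmetric_monoidal_category C + comonad C T
  for C :: "('o, 'm, 'z) smcat_scheme" (structure) and T :: "('o, 'm) modality" +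
  assumes munit_Hom: "munit T \<in> hom \<I> (Bang T \<I>)"
    and mtens_Hom: "X \<in> Obj C \<Longrightarrow> Y \<in> Obj C \<Longrightarrow>
      mtens T X Y \<in> hom (Bang T X \<otimes> Bang T Y) (Bang T (X \<otimes> Y))"
    and mtens_natural: "f \<in> hom X X' \<Longrightarrow> g \<in> hom Y Y' \<Longrightarrow>
      mtens T X' Y' \<bullet> (BangA T f \<boxtimes> BangA T g) = BangA T (f \<boxtimes> g) \<bullet> mtens T X Y"
    and mtens_assoc: "X \<in> Obj C \<Longrightarrow> Y \<in> Obj C \<Longrightarrow> Z \<in> Obj C \<Longrightarrow>
      mtens T X (Y \<otimes> Z) \<bullet> (\<one> (Bang T X) \<boxtimes> mtens T Y Z) \<bullet> \<a> (Bang T X) (Bang T Y) (Bang T Z)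
        = BangA T (\<a> X Y Z) \<bullet> mtens T (X \<otimes> Y) Z \<bullet> (mtens T X Y \<boxtimes> \<one> (Bang T Z))"
    and mtens_left_unit: "X \<in> Obj C \<Longrightarrow>
      BangA T (\<l> X) \<bullet> mtens T \<I> X \<bullet> (munit T \<boxtimes> \<one> (Bang T X)) = \<l> (Bang T X)"
    and mtens_right_unit: "X \<in> Obj C \<Longrightarrow>
      BangA T (\<r> X) \<bullet> mtens T X \<I> \<bullet> (\<one> (Bang T X) \<boxtimes> munit T) = \<r> (Bang T X)"
    and mtens_symm: "X \<in> Obj C \<Longrightarrow> Y \<in> Obj C \<Longrightarrow>
      BangA T (\<s> X Y) \<bullet> mtens T X Y = mtens T Y X \<bullet> \<s> (Bang T X) (Bang T Y)"
    and eps_munit: "eps T \<I> \<bullet> munit T = \<one> \<I>"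
    and eps_mtens: "X \<in> Obj C \<Longrightarrow> Y \<in> Obj C \<Longrightarrow>
      eps T (X \<otimes> Y) \<bullet> mtens T X Y = eps T X \<boxtimes> eps T Y"
    and del_munit: "del T \<I> \<bullet> munit T = BangA T (munit T) \<bullet> munit T"
    and del_mtens: "X \<in> Obj C \<Longrightarrow> Y \<in> Obj C \<Longrightarrow>
      del T (X \<otimes> Y) \<bullet> mtens T X Y
        = BangA T (mtens T X Y) \<bullet> mtens T (Bang T X) (Bang T Y) \<bullet> (del T X \<boxtimes> del T Y)"

definition bang_coalgebra_hom ::
    "('o, 'm, 'z) cat_scheme \<Rightarrow> ('o, 'm) modality \<Rightarrow> 'o \<times> 'm \<Rightarrow> 'o \<times> 'm \<Rightarrow> 'm \<Rightarrow> bool" where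
  "bang_coalgebra_hom C T = (\<lambda>(A, a) (B, b) h. h \<in> Hom C A B \<and> b \<bullet>\<^bsub>C\<^esub> h = BangA T h \<bullet>\<^bsub>C\<^esub> a)"

locale monoidal_coalgebra_modality = coalgebra_modality C T + monoidal_comonad C T
  for C :: "('o, 'm, 'z) smcat_scheme" (structure) and T :: "('o, 'm) modality" +
  assumes munit_comonoid_hom: "comonoid_hom C (unit_comonoid C) (bang_comonoid T \<I>) (munit T)"
    and mtens_comonoid_hom: "X \<in> Obj C \<Longrightarrow> Y \<in> Obj C \<Longrightarrow>
      comonoid_hom C (tensor_comonoid C (bang_comonoid T X) (bang_comonoid T Y))
        (bang_comonoid T (X \<otimes> Y)) (mtens T X Y)"
    and cou_coalgebra_hom: "X \<in> Obj C \<Longrightarrow>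
      bang_coalgebra_hom C T (Bang T X, del T X) (\<I>, munit T) (cou T X)"
    and com_coalgebra_hom: "X \<in> Obj C \<Longrightarrow>
      bang_coalgebra_hom C T (Bang T X, del T X)
        (Bang T X \<otimes> Bang T X, mtens T (Bang T X) (Bang T X) \<bullet> (del T X \<boxtimes> del T X)) (com T X)"

locale monoidal_differential_modality =
  linear_symmetric_monoidal_category C + monoidal_coalgebra_modality C T
  for C :: "('o, 'm, 'k::{comm_semiring_0,comm_monoid_mult}, 'z) linsmcat_scheme" (structure)
    and T :: "('o, 'm) modality" +
  assumes der_Hom: "X \<in> Obj C \<Longrightarrow> der T X \<in> hom (Bang T X \<otimes> X) (Bang T X)"
    and der_natural: "f \<in> hom X Y \<Longrightarrow> der T Y \<bullet> (BangA T f \<boxtimes> f) = BangA T f \<bullet> der T X"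
    and constant_rule: "X \<in> Obj C \<Longrightarrow> cou T X \<bullet> der T X = \<zero> (Bang T X \<otimes> X) \<I>"
    and product_rule: "X \<in> Obj C \<Longrightarrow>
      com T X \<bullet> der T X =
        ((\<one> (Bang T X) \<boxtimes> der T X) \<oplus>
         ((der T X \<boxtimes> \<one> (Bang T X)) \<bullet> Inv (\<a> (Bang T X) X (Bang T X)) \<bullet>
            (\<one> (Bang T X) \<boxtimes> \<s> (Bang T X) X)))
        \<bullet> \<a> (Bang T X) (Bang T X) X \<bullet> (com T X \<boxtimes> \<one> X)"
    and linear_rule: "X \<in> Obj C \<Longrightarrow> eps T X \<bullet> der T X = \<l> X \<bullet> (cou T X \<boxtimes> \<one> X)"
    and chain_rule: "X \<in> Obj C \<Longrightarrow>
      del T X \<bullet> der T X =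
        der T (Bang T X) \<bullet> (del T X \<boxtimes> der T X) \<bullet>
          \<a> (Bang T X) (Bang T X) X \<bullet> (com T X \<boxtimes> \<one> X)"
    and interchange_rule: "X \<in> Obj C \<Longrightarrow>
      der T X \<bullet> (der T X \<boxtimes> \<one> X) \<bullet>
          Inv (\<a> (Bang T X) X X) \<bullet> (\<one> (Bang T X) \<boxtimes> \<s> X X) \<bullet> \<a> (Bang T X) X X
        = der T X \<bullet> (der T X \<boxtimes> \<one> X)"

definition modality_morphism ::
    "('o, 'm, 'k, 'z) linsmcat_scheme \<Rightarrow> ('o, 'm) modality \<Rightarrow> ('o, 'm) modality \<Rightarrow> ('o \<Rightarrow> 'm) \<Rightarrow> bool"
  where
  "modality_morphism C T T' \<phi> \<longleftrightarrow>
     (\<forall>X\<in>Obj C. \<phi> X \<in> Hom C (Bang T X) (Bang T' X)) \<and>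
     (\<forall>X Y. \<forall>f\<in>Hom C X Y. \<phi> Y \<bullet>\<^bsub>C\<^esub> BangA T f = BangA T' f \<bullet>\<^bsub>C\<^esub> \<phi> X) \<and>
     (\<forall>X\<in>Obj C. eps T' X \<bullet>\<^bsub>C\<^esub> \<phi> X = eps T X) \<and>
     (\<forall>X\<in>Obj C. del T' X \<bullet>\<^bsub>C\<^esub> \<phi> X = BangA T' (\<phi> X) \<bullet>\<^bsub>C\<^esub> \<phi> (Bang T X) \<bullet>\<^bsub>C\<^esub> del T X) \<and>
     \<phi> \<I>\<^bsub>C\<^esub> \<bullet>\<^bsub>C\<^esub> munit T = munit T' \<and>
     (\<forall>X\<in>Obj C. \<forall>Y\<in>Obj C.
        \<phi> (X \<otimes>\<^bsub>C\<^esub> Y) \<bullet>\<^bsub>C\<^esub> mtens T X Y = mtens T' X Y \<bullet>\<^bsub>C\<^esub> (\<phi> X \<boxtimes>\<^bsub>C\<^esub> \<phi> Y)) \<and>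
     (\<forall>X\<in>Obj C. comonoid_hom C (bang_comonoid T X) (bang_comonoid T' X) (\<phi> X)) \<and>
     (\<forall>X\<in>Obj C. \<phi> X \<bullet>\<^bsub>C\<^esub> der T X = der T' X \<bullet>\<^bsub>C\<^esub> (\<phi> X \<boxtimes>\<^bsub>C\<^esub> \<one>\<^bsub>C\<^esub> X))"

text \<open>Families of arrows are made extensional, since their values outside \<open>Obj C\<close> must not
  distinguish morphisms.\<close>

definition modality_category ::
    "('o, 'm, 'k::{comm_semiring_0,comm_monoid_mult}, 'z) linsmcat_scheme \<Rightarrow>
     (('o, 'm) modality, ('o, 'm) modality \<times> ('o \<Rightarrow> 'm) \<times> ('o, 'm) modality) cat" where
  "modality_category C =
     \<lparr>Obj = {T. monoidal_differential_modality C T},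
      Arr = {(T, \<phi>, T') | T \<phi> T'. monoidal_differential_modality C T \<and>
               monoidal_differential_modality C T' \<and>
               modality_morphism C T T' \<phi> \<and> \<phi> \<in> extensional (Obj C)},
      Dom = (\<lambda>(T, \<phi>, T'). T),
      Cod = (\<lambda>(T, \<phi>, T'). T'),
      Ident = (\<lambda>T. (T, \<lambda>X\<in>Obj C. \<one>\<^bsub>C\<^esub> (Bang T X), T)),
      Comp = (\<lambda>(T2, \<psi>, T3) (T1, \<phi>, T2'). (T1, \<lambda>X\<in>Obj C. \<psi> X \<bullet>\<^bsub>C\<^esub> \<phi> X, T3))\<rparr>"

end

theory Submission
  imports Defs
begin

text \<open>The object \<open>P X\<close> is the free commuting \<open>X\<close>-action on the points \<open>\<I> \<rightarrow> X\<close> of \<open>X\<close>. Modules over \<open>S X\<close> are the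
same as commuting \<open>X\<close>-actions, so \<open>V \<otimes> S X\<close> is the free commuting \<open>X\<close>-action on \<open>V\<close>
(\<open>extend_universal\<close>). If \<open>K\<close> is the coproduct of copies of \<open>\<I>\<close> indexed by the points of \<open>X\<close>,
then \<open>K \<otimes> S X\<close> is the coproduct of copies of \<open>S X\<close>, and action maps \<open>W \<otimes> K \<otimes> S X \<rightarrow> A\<close> correspond to
families of maps \<open>W \<rightarrow> A\<close> indexed by the points (\<open>free_action_points\<close>).

The action \<open>p \<cdot> x\<close> is read as the derivative at \<open>p\<close> in the direction \<open>x\<close>, and freeness says
that a map out of \<open>P X\<close> which differentiates as prescribed by an action is determined by its values at
the points. Commuting actions are closed under \<open>\<otimes>\<close> by the Leibniz rule, so freeness yields a
counit and a comultiplication that satisfy the constant and product rules by construction, and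
the comonoid laws are equations between action maps that need only be checked at the points
(\<open>free_action_diff_comonoid\<close>).

All further structure comes from linear differential equations. Given \<open>g : P X \<rightarrow> Y\<close> and a commuting
\<open>Y\<close>-action \<open>A\<close>, the equation \<open>f(p \<cdot> x) = \<alpha>(f(p\<^sub>1), g(p\<^sub>2 \<cdot> x))\<close> has exactly one solution
\<open>f : P X \<rightarrow> A\<close> with given values at the points: \<open>f\<close> solves it iff \<open>p \<mapsto> f(p\<^sub>1) \<otimes> p\<^sub>2\<close> is an action map
into a suitable action on \<open>A \<otimes> P X\<close> (\<open>ode_unique\<close>, \<open>ode_exists\<close>). For an object \<open>A\<close> with the same
kind of structure and \<open>g\<close> the linear part \<open>\<epsilon> \<circ> f\<close>, the equation is the chain rule. Comonoid maps that
satisfy it and preserve points are called smooth; a smooth map out of a free object exists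
and is unique for every prescribed linear part (\<open>smooth_lift\<close>, \<open>smooth_unique\<close>). Since free objects
are closed under \<open>\<otimes>\<close> (\<open>tens_free\<close>) and the structure maps of the monoidal category are smooth, the functor,
\<open>\<delta>\<close>, \<open>m\<^sub>I\<close> and \<open>m\<close> can be defined by their linear parts, and each axiom of a monoidal differential
modality becomes an equation between linear parts.

For initiality, let \<open>T\<close> be any monoidal differential modality. Every \<open>T X\<close> carries the same structure,
with points \<open>T x \<circ> m\<^sub>I\<close>, and the structure maps of \<open>T\<close> are smooth. For \<open>m\<close> this is not an axiom; it
holds because \<open>m\<close> composed with the Seely map \<open>T (X \<oplus> Y) \<rightarrow> T X \<otimes> T Y\<close> is a map of coalgebras and the
Seely map is a split epimorphism (\<open>mtens_smooth\<close>). The smooth maps \<open>P X \<rightarrow> T X\<close> with linear part \<open>\<epsilon>\<close>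
then form a morphism of modalities by uniqueness of smooth maps, and a morphism is unique because
it is an action map whose values at the points are forced (\<open>P_initial\<close>).

Equations between maps are verified on generalised elements, as in Sweedler notation. An element is an arrow
out of the tensor product of some variables, and variables whose type is a comonoid may be used
several times or not at all; coherence is dealt with once, in the construction of contexts of such variables.\<close>


section \<open>Typing and inverses\<close>

lemma is_iso_inverse:
  assumes "category C" "is_iso C f"
  shows "is_inverse C f (iso_inv C f)"
proof -
  interpret category C by fact
  obtain g where g: "is_inverse C f g" using assms(2) by (auto simp: is_iso_def)
  have "h = g" if "is_inverse C f h" for h
  proof -
    have f: "f \<in> Hom C (Dom C f) (Cod C f)" using g by (auto simp: is_inverse_def Hom_def)
    have gh: "g \<in> Hom C (Cod C f) (Dom C f)" "h \<in> Hom C (Cod C f) (Dom C f)"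
      using g that by (auto simp: is_inverse_def)
    have "h = Comp C h (Comp C f g)" using g gh Comp_Ident by (simp add: is_inverse_def)
    also have "\<dots> = Comp C (Comp C h f) g" using Comp_assoc[OF gh(1) f gh(2)] by simp
    also have "\<dots> = g" using that gh Ident_Comp by (simp add: is_inverse_def)
    finally show ?thesis .
  qed
  with g show ?thesis unfolding iso_inv_def by (rule theI)
qed

context category
begin

text \<open>The axioms are restated with membership in \<open>Arr\<close> and equations for \<open>Dom\<close> and \<open>Cod\<close> in place of
hom-sets: then the simplifier can decide composability without being told the end points. Primed names
refer to these variants.\<close>

lemma Obj_Dom [simp]: "f \<in> Arr C \<Longrightarrow> Dom C f \<in> Obj C"
  and Obj_Cod [simp]: "f \<in> Arr C \<Longrightarrow> Cod C f \<in> Obj C"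
  by (fact Dom_Obj Cod_Obj)+

lemma typ_Ident [simp]:
  assumes "X \<in> Obj C"
  shows "\<one> X \<in> Arr C" "Dom C (\<one> X) = X" "Cod C (\<one> X) = X"
  using Ident_Hom[OF assms] by (auto simp: Hom_def)

lemma typ_Comp [simp]:
  assumes "f \<in> Arr C" "g \<in> Arr C" "Dom C g = Cod C f"
  shows "g \<bullet> f \<in> Arr C" "Dom C (g \<bullet> f) = Dom C f" "Cod C (g \<bullet> f) = Cod C g"
  using Comp_Hom[of f "Dom C f" "Cod C f" g "Cod C g"] assms by (auto simp: Hom_def)

lemma Comp_Ident' [simp]: "f \<in> Arr C \<Longrightarrow> X = Dom C f \<Longrightarrow> f \<bullet> \<one> X = f"
  and Ident_Comp' [simp]: "f \<in> Arr C \<Longrightarrow> X = Cod C f \<Longrightarrow> \<one> X \<bullet> f = f"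
  by (auto intro: Comp_Ident Ident_Comp simp: Hom_def)

lemma Comp_assoc' [simp]:
  "f \<in> Arr C \<Longrightarrow> g \<in> Arr C \<Longrightarrow> h \<in> Arr C \<Longrightarrow> Dom C g = Cod C f \<Longrightarrow> Dom C h = Cod C g \<Longrightarrow>
    (h \<bullet> g) \<bullet> f = h \<bullet> g \<bullet> f"
  using Comp_assoc[of f "Dom C f" "Cod C f" g "Cod C g" h "Cod C h"] by (auto simp: Hom_def)

text \<open>Composites are associated to the right, so an equation between composites is usually needed in
the form in which a further factor follows.\<close>

lemma Comp_left:
  "g \<bullet> f = k \<Longrightarrow> f \<in> Arr C \<Longrightarrow> g \<in> Arr C \<Longrightarrow> h \<in> Arr C \<Longrightarrow> Dom C g = Cod C f \<Longrightarrow>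
    Dom C f = Cod C h \<Longrightarrow> g \<bullet> f \<bullet> h = k \<bullet> h"
  by (metis Comp_assoc')

text \<open>Kept apart from \<open>is_iso\<close> so that simplification proves invertibility from the closure
properties below instead of producing an existential quantifier.\<close>

definition iso :: "'m \<Rightarrow> bool" where
  "iso f \<longleftrightarrow> is_iso C f"

lemma iso_inverse [simp]:
  assumes "iso f"
  shows "f \<in> Arr C" "Inv f \<in> Arr C" "Dom C (Inv f) = Cod C f" "Cod C (Inv f) = Dom C f"
    "Inv f \<bullet> f = \<one> (Dom C f)" "f \<bullet> Inv f = \<one> (Cod C f)"
  using is_iso_inverse[OF category_axioms, of f] assms
  by (auto simp: iso_def is_inverse_def Hom_def)

lemma iso_cancel [simp]:
  assumes "iso f"
  shows "g \<in> Arr C \<Longrightarrow> Cod C g = Dom C f \<Longrightarrow> Inv f \<bullet> f \<bullet> g = g"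
    "g \<in> Arr C \<Longrightarrow> Cod C g = Cod C f \<Longrightarrow> f \<bullet> Inv f \<bullet> g = g"
  using assms by (metis iso_inverse Comp_assoc' Ident_Comp')+

lemma isoI:
  assumes "f \<in> Arr C" "g \<in> Arr C" "Dom C g = Cod C f" "Cod C g = Dom C f"
    "g \<bullet> f = \<one> (Dom C f)" "f \<bullet> g = \<one> (Cod C f)"
  shows "iso f"
  using assms unfolding iso_def is_iso_def is_inverse_def Hom_def by auto

lemma iso_Ident [simp]: "X \<in> Obj C \<Longrightarrow> iso (\<one> X)"
  by (rule isoI[where g = "\<one> X"]) auto

lemma iso_Inv [simp]: "iso f \<Longrightarrow> iso (Inv f)"
  by (rule isoI[where g = f]) auto

lemma iso_Comp:
  assumes "iso f" "iso g" "Dom C g = Cod C f"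
  shows "iso (g \<bullet> f)"
  by (rule isoI[where g = "Inv f \<bullet> Inv g"]) (use assms in auto)

lemma iso_epi:
  assumes "iso f" "g \<in> Arr C" "h \<in> Arr C" "Dom C g = Cod C f" "Dom C h = Cod C f" "g \<bullet> f = h \<bullet> f"
  shows "g = h"
proof -
  have *: "k = (k \<bullet> f) \<bullet> Inv f" if "k \<in> Arr C" "Dom C k = Cod C f" for k
    using that assms(1) by simp
  show ?thesis using *[of g] *[of h] assms by simp
qed

lemma iso_mono:
  assumes "iso f" "g \<in> Arr C" "h \<in> Arr C" "Cod C g = Dom C f" "Cod C h = Dom C f" "f \<bullet> g = f \<bullet> h"
  shows "g = h"
proof -
  have *: "k = Inv f \<bullet> f \<bullet> k" if "k \<in> Arr C" "Cod C k = Dom C f" for k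
    using that assms(1) by simp
  show ?thesis using *[of g] *[of h] assms by metis
qed

end


section \<open>Coherence\<close>

context symmetric_monoidal_category
begin

declare TensO_Obj [simp] UnitO_Obj [simp] TensA_Ident [simp]

lemma typ_TensA [simp]:
  assumes "f \<in> Arr C" "g \<in> Arr C"
  shows "f \<boxtimes> g \<in> Arr C" "Dom C (f \<boxtimes> g) = Dom C f \<otimes> Dom C g"
    "Cod C (f \<boxtimes> g) = Cod C f \<otimes> Cod C g"
  using TensA_Hom[of f "Dom C f" "Cod C f" g "Dom C g" "Cod C g"] assms by (auto simp: Hom_def)

lemma TensA_Comp':
  "f \<in> Arr C \<Longrightarrow> g \<in> Arr C \<Longrightarrow> f' \<in> Arr C \<Longrightarrow> g' \<in> Arr C \<Longrightarrow> Dom C f' = Cod C f \<Longrightarrow>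
    Dom C g' = Cod C g \<Longrightarrow> (f' \<boxtimes> g') \<bullet> (f \<boxtimes> g) = (f' \<bullet> f) \<boxtimes> (g' \<bullet> g)"
  using TensA_Comp[of f "Dom C f" "Cod C f" f' "Cod C f'" g "Dom C g" "Cod C g" g' "Cod C g'"]
  by (auto simp: Hom_def)

lemma TensA_Comp_left:
  "f \<in> Arr C \<Longrightarrow> g \<in> Arr C \<Longrightarrow> f' \<in> Arr C \<Longrightarrow> g' \<in> Arr C \<Longrightarrow> h \<in> Arr C \<Longrightarrow> Dom C f' = Cod C f \<Longrightarrow>
    Dom C g' = Cod C g \<Longrightarrow> Cod C h = Dom C f \<otimes> Dom C g \<Longrightarrow>
    (f' \<boxtimes> g') \<bullet> (f \<boxtimes> g) \<bullet> h = ((f' \<bullet> f) \<boxtimes> (g' \<bullet> g)) \<bullet> h"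
  using TensA_Comp'[of f g f' g'] by (metis Comp_assoc' typ_TensA)

lemma iso_TensA [simp]:
  assumes "iso f" "iso g"
  shows "iso (f \<boxtimes> g)"
  by (rule isoI[where g = "Inv f \<boxtimes> Inv g"]) (use assms in \<open>auto simp: TensA_Comp'\<close>)

lemma typ_structure [simp]:
  "X \<in> Obj C \<Longrightarrow> \<l> X \<in> Arr C" "X \<in> Obj C \<Longrightarrow> Dom C (\<l> X) = \<I> \<otimes> X" "X \<in> Obj C \<Longrightarrow> Cod C (\<l> X) = X"
  "X \<in> Obj C \<Longrightarrow> \<r> X \<in> Arr C" "X \<in> Obj C \<Longrightarrow> Dom C (\<r> X) = X \<otimes> \<I>" "X \<in> Obj C \<Longrightarrow> Cod C (\<r> X) = X"
  "X \<in> Obj C \<Longrightarrow> Y \<in> Obj C \<Longrightarrow> \<s> X Y \<in> Arr C"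
  "X \<in> Obj C \<Longrightarrow> Y \<in> Obj C \<Longrightarrow> Dom C (\<s> X Y) = X \<otimes> Y"
  "X \<in> Obj C \<Longrightarrow> Y \<in> Obj C \<Longrightarrow> Cod C (\<s> X Y) = Y \<otimes> X"
  "X \<in> Obj C \<Longrightarrow> Y \<in> Obj C \<Longrightarrow> Z \<in> Obj C \<Longrightarrow> \<a> X Y Z \<in> Arr C"
  "X \<in> Obj C \<Longrightarrow> Y \<in> Obj C \<Longrightarrow> Z \<in> Obj C \<Longrightarrow> Dom C (\<a> X Y Z) = (X \<otimes> Y) \<otimes> Z"
  "X \<in> Obj C \<Longrightarrow> Y \<in> Obj C \<Longrightarrow> Z \<in> Obj C \<Longrightarrow> Cod C (\<a> X Y Z) = X \<otimes> Y \<otimes> Z"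
  using LUnit_Hom RUnit_Hom Symm_Hom Assoc_Hom by (auto simp: Hom_def)

lemma iso_structure [simp]:
  "X \<in> Obj C \<Longrightarrow> iso (\<l> X)" "X \<in> Obj C \<Longrightarrow> iso (\<r> X)"
  "X \<in> Obj C \<Longrightarrow> Y \<in> Obj C \<Longrightarrow> Z \<in> Obj C \<Longrightarrow> iso (\<a> X Y Z)"
  using LUnit_iso RUnit_iso Assoc_iso by (auto simp: iso_def)

lemma iso_Symm [simp]: "X \<in> Obj C \<Longrightarrow> Y \<in> Obj C \<Longrightarrow> iso (\<s> X Y)"
  by (rule isoI[where g = "\<s> Y X"]) (auto simp: Symm_Symm)

lemma Symm_Symm_left:
  "X \<in> Obj C \<Longrightarrow> Y \<in> Obj C \<Longrightarrow> f \<in> Arr C \<Longrightarrow> Cod C f = X \<otimes> Y \<Longrightarrow> \<s> Y X \<bullet> \<s> X Y \<bullet> f = f"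
  by (metis Symm_Symm Comp_assoc' Ident_Comp' typ_structure(7-9))

lemma Assoc_nat:
  "f \<in> Arr C \<Longrightarrow> g \<in> Arr C \<Longrightarrow> h \<in> Arr C \<Longrightarrow> X = Cod C f \<Longrightarrow> Y = Cod C g \<Longrightarrow> Z = Cod C h \<Longrightarrow>
    \<a> X Y Z \<bullet> ((f \<boxtimes> g) \<boxtimes> h) = (f \<boxtimes> g \<boxtimes> h) \<bullet> \<a> (Dom C f) (Dom C g) (Dom C h)"
  using Assoc_natural[of f "Dom C f" "Cod C f" g "Dom C g" "Cod C g" h "Dom C h" "Cod C h"]
  by (auto simp: Hom_def)

lemma LUnit_nat:
  "f \<in> Arr C \<Longrightarrow> Y = Cod C f \<Longrightarrow> \<l> Y \<bullet> (\<one> \<I> \<boxtimes> f) = f \<bullet> \<l> (Dom C f)"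
  using LUnit_natural[of f "Dom C f" "Cod C f"] by (auto simp: Hom_def)

lemma RUnit_nat:
  "f \<in> Arr C \<Longrightarrow> Y = Cod C f \<Longrightarrow> \<r> Y \<bullet> (f \<boxtimes> \<one> \<I>) = f \<bullet> \<r> (Dom C f)"
  using RUnit_natural[of f "Dom C f" "Cod C f"] by (auto simp: Hom_def)

lemma Symm_nat:
  "f \<in> Arr C \<Longrightarrow> g \<in> Arr C \<Longrightarrow> X = Cod C f \<Longrightarrow> Y = Cod C g \<Longrightarrow>
    \<s> X Y \<bullet> (f \<boxtimes> g) = (g \<boxtimes> f) \<bullet> \<s> (Dom C f) (Dom C g)"
  using Symm_natural[of f "Dom C f" "Cod C f" g "Dom C g" "Cod C g"] by (auto simp: Hom_def)

text \<open>Naturality of the unitors makes \<open>\<I> \<otimes> _\<close> and \<open>_ \<otimes> \<I>\<close> faithful. In the three unit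
coherences that follow one may therefore tensor with \<open>\<I>\<close> first, where pentagon, triangle and hexagon apply.\<close>

lemma unit_TensA_inj:
  assumes "f \<in> Arr C" "g \<in> Arr C" "Dom C f = Dom C g" "Cod C f = Cod C g"
  shows "\<one> \<I> \<boxtimes> f = \<one> \<I> \<boxtimes> g \<Longrightarrow> f = g" "f \<boxtimes> \<one> \<I> = g \<boxtimes> \<one> \<I> \<Longrightarrow> f = g"
proof -
  assume "\<one> \<I> \<boxtimes> f = \<one> \<I> \<boxtimes> g"
  then have "f \<bullet> \<l> (Dom C f) = g \<bullet> \<l> (Dom C f)"
    using LUnit_nat[of f] LUnit_nat[of g] assms by metis
  then show "f = g" by (rule iso_epi[rotated -1]) (use assms in auto)
next
  assume "f \<boxtimes> \<one> \<I> = g \<boxtimes> \<one> \<I>"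
  then have "f \<bullet> \<r> (Dom C f) = g \<bullet> \<r> (Dom C f)"
    using RUnit_nat[of f] RUnit_nat[of g] assms by metis
  then show "f = g" by (rule iso_epi[rotated -1]) (use assms in auto)
qed

lemma LUnit_TensO:
  assumes [simp]: "X \<in> Obj C" "Y \<in> Obj C"
  shows "\<l> (X \<otimes> Y) \<bullet> \<a> \<I> X Y = \<l> X \<boxtimes> \<one> Y"
proof (rule unit_TensA_inj(1), simp_all)
  let ?p = "\<a> \<I> (\<I> \<otimes> X) Y \<bullet> (\<a> \<I> \<I> X \<boxtimes> \<one> Y)"
  have "(\<one> \<I> \<boxtimes> (\<l> (X \<otimes> Y) \<bullet> \<a> \<I> X Y)) \<bullet> ?p
      = (\<one> \<I> \<boxtimes> \<l> (X \<otimes> Y)) \<bullet> (\<one> \<I> \<boxtimes> \<a> \<I> X Y) \<bullet> ?p"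
    by (simp add: TensA_Comp_left)
  also have "\<dots> = (\<one> \<I> \<boxtimes> \<l> (X \<otimes> Y)) \<bullet> \<a> \<I> \<I> (X \<otimes> Y) \<bullet> \<a> (\<I> \<otimes> \<I>) X Y"
    by (simp add: pentagon)
  also have "\<dots> = (\<r> \<I> \<boxtimes> \<one> (X \<otimes> Y)) \<bullet> \<a> (\<I> \<otimes> \<I>) X Y"
    using triangle[of \<I> "X \<otimes> Y"] by (subst Comp_left) simp_all
  also have "\<dots> = \<a> \<I> X Y \<bullet> ((\<r> \<I> \<boxtimes> \<one> X) \<boxtimes> \<one> Y)"
    by (simp add: Assoc_nat)
  also have "\<dots> = \<a> \<I> X Y \<bullet> ((\<one> \<I> \<boxtimes> \<l> X) \<boxtimes> \<one> Y) \<bullet> (\<a> \<I> \<I> X \<boxtimes> \<one> Y)"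
    by (simp add: TensA_Comp' flip: triangle)
  also have "\<dots> = (\<one> \<I> \<boxtimes> (\<l> X \<boxtimes> \<one> Y)) \<bullet> ?p"
    by (subst Comp_left[OF Assoc_nat]) simp_all
  finally show "\<one> \<I> \<boxtimes> (\<l> (X \<otimes> Y) \<bullet> \<a> \<I> X Y) = \<one> \<I> \<boxtimes> (\<l> X \<boxtimes> \<one> Y)"
    by (rule iso_epi[rotated -1]) (auto intro!: iso_Comp)
qed

lemma LUnit_Symm:
  assumes [simp]: "X \<in> Obj C"
  shows "\<l> X \<bullet> \<s> X \<I> = \<r> X"
proof (rule unit_TensA_inj(2), simp_all)
  note h = hexagon[of X \<I> \<I>]
  have "\<s> X \<I> \<bullet> ((\<l> X \<bullet> \<s> X \<I>) \<boxtimes> \<one> \<I>) = \<s> X \<I> \<bullet> (\<l> X \<boxtimes> \<one> \<I>) \<bullet> (\<s> X \<I> \<boxtimes> \<one> \<I>)"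
    by (simp add: TensA_Comp')
  also have "\<dots> = \<s> X \<I> \<bullet> \<l> (X \<otimes> \<I>) \<bullet> \<a> \<I> X \<I> \<bullet> (\<s> X \<I> \<boxtimes> \<one> \<I>)"
    using Comp_left[OF LUnit_TensO[of X \<I>], of "\<s> X \<I> \<boxtimes> \<one> \<I>"] by simp
  also have "\<dots> = \<l> (\<I> \<otimes> X) \<bullet> (\<one> \<I> \<boxtimes> \<s> X \<I>) \<bullet> \<a> \<I> X \<I> \<bullet> (\<s> X \<I> \<boxtimes> \<one> \<I>)"
    using Comp_left[OF LUnit_nat[of "\<s> X \<I>" "\<I> \<otimes> X"], of "\<a> \<I> X \<I> \<bullet> (\<s> X \<I> \<boxtimes> \<one> \<I>)"] by simp
  also have "\<dots> = \<l> (\<I> \<otimes> X) \<bullet> \<a> \<I> \<I> X \<bullet> \<s> X (\<I> \<otimes> \<I>) \<bullet> \<a> X \<I> \<I>"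
    using h by simp
  also have "\<dots> = (\<l> \<I> \<boxtimes> \<one> X) \<bullet> \<s> X (\<I> \<otimes> \<I>) \<bullet> \<a> X \<I> \<I>"
    by (subst Comp_left[OF LUnit_TensO]) simp_all
  also have "\<dots> = \<s> X \<I> \<bullet> (\<one> X \<boxtimes> \<l> \<I>) \<bullet> \<a> X \<I> \<I>"
    using Comp_left[OF Symm_nat[of "\<one> X" "\<l> \<I>" X \<I>], of "\<a> X \<I> \<I>"] by simp
  also have "\<dots> = \<s> X \<I> \<bullet> (\<r> X \<boxtimes> \<one> \<I>)" by (simp add: triangle)
  finally show "(\<l> X \<bullet> \<s> X \<I>) \<boxtimes> \<one> \<I> = \<r> X \<boxtimes> \<one> \<I>"
    by (rule iso_mono[rotated -1]) auto
qed

lemma LUnit_eq_RUnit: "\<l> \<I> = \<r> \<I>"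
proof (rule unit_TensA_inj(2), simp_all)
  have "\<l> \<I> \<bullet> (\<one> \<I> \<boxtimes> \<l> \<I>) = \<l> \<I> \<bullet> \<l> (\<I> \<otimes> \<I>)"
    using LUnit_nat[of "\<l> \<I>"] by simp
  then have "\<one> \<I> \<boxtimes> \<l> \<I> = \<l> (\<I> \<otimes> \<I>)"
    by (rule iso_mono[rotated -1]) auto
  then show "\<l> \<I> \<boxtimes> \<one> \<I> = \<r> \<I> \<boxtimes> \<one> \<I>"
    using triangle[of \<I> \<I>] LUnit_TensO[of \<I> \<I>] by simp
qed

text \<open>The second hexagon follows from the first one because \<open>\<s> Z (X \<otimes> Y)\<close> inverts \<open>\<s> (X \<otimes> Y) Z\<close>.\<close>

lemma Symm_TensO:
  assumes [simp]: "X \<in> Obj C" "Y \<in> Obj C" "Z \<in> Obj C"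
  shows "\<s> (X \<otimes> Y) Z = \<a> Z X Y \<bullet> (\<s> X Z \<boxtimes> \<one> Y) \<bullet> Inv (\<a> X Z Y) \<bullet> (\<one> X \<boxtimes> \<s> Y Z) \<bullet> \<a> X Y Z"
    (is "_ = ?r")
proof (rule iso_epi[of "\<s> Z (X \<otimes> Y) \<bullet> \<a> Z X Y"])
  have "?r \<bullet> \<s> Z (X \<otimes> Y) \<bullet> \<a> Z X Y = \<a> Z X Y \<bullet> (\<s> X Z \<boxtimes> \<one> Y) \<bullet> Inv (\<a> X Z Y) \<bullet>
      (\<one> X \<boxtimes> \<s> Y Z) \<bullet> (\<a> X Y Z \<bullet> \<s> Z (X \<otimes> Y) \<bullet> \<a> Z X Y)"
    by simp
  also have "\<dots> = \<a> Z X Y \<bullet> (\<s> X Z \<boxtimes> \<one> Y) \<bullet> Inv (\<a> X Z Y) \<bullet>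
      (\<one> X \<boxtimes> \<s> Y Z) \<bullet> (\<one> X \<boxtimes> \<s> Z Y) \<bullet> \<a> X Z Y \<bullet> (\<s> Z X \<boxtimes> \<one> Y)"
    by (simp only: hexagon assms)
  also have "\<dots> = \<a> Z X Y" by (simp add: TensA_Comp_left TensA_Comp' Symm_Symm)
  finally show "\<s> (X \<otimes> Y) Z \<bullet> \<s> Z (X \<otimes> Y) \<bullet> \<a> Z X Y = ?r \<bullet> \<s> Z (X \<otimes> Y) \<bullet> \<a> Z X Y"
    by (simp add: Symm_Symm_left)
qed (auto intro!: iso_Comp)

text \<open>The exchange of the last two of three factors; it expresses both the commutation of an action with
itself and the passage of a variable over a tensor product.\<close>

definition RSwap :: "'o \<Rightarrow> 'o \<Rightarrow> 'o \<Rightarrow> 'm" where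
  "RSwap A B V = Inv (\<a> A V B) \<bullet> (\<one> A \<boxtimes> \<s> B V) \<bullet> \<a> A B V"

lemma typ_RSwap [simp]:
  assumes "A \<in> Obj C" "B \<in> Obj C" "V \<in> Obj C"
  shows "RSwap A B V \<in> Arr C" "Dom C (RSwap A B V) = (A \<otimes> B) \<otimes> V"
    "Cod C (RSwap A B V) = (A \<otimes> V) \<otimes> B"
  using assms by (simp_all add: RSwap_def)

lemma iso_RSwap [simp]: "A \<in> Obj C \<Longrightarrow> B \<in> Obj C \<Longrightarrow> V \<in> Obj C \<Longrightarrow> iso (RSwap A B V)"
  unfolding RSwap_def by (auto intro!: iso_Comp)

lemma RSwap_nat:
  assumes [simp]: "f \<in> Arr C" "g \<in> Arr C" "h \<in> Arr C"
    "A = Cod C f" "B = Cod C g" "V = Cod C h"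
  shows "RSwap A B V \<bullet> ((f \<boxtimes> g) \<boxtimes> h) = ((f \<boxtimes> h) \<boxtimes> g) \<bullet> RSwap (Dom C f) (Dom C g) (Dom C h)"
proof (rule iso_mono[of "\<a> A V B"])
  have "\<a> A V B \<bullet> RSwap A B V \<bullet> ((f \<boxtimes> g) \<boxtimes> h)
      = (\<one> A \<boxtimes> \<s> B V) \<bullet> \<a> A B V \<bullet> ((f \<boxtimes> g) \<boxtimes> h)" by (simp add: RSwap_def)
  also have "\<dots> = (f \<boxtimes> h \<boxtimes> g) \<bullet> (\<one> (Dom C f) \<boxtimes> \<s> (Dom C g) (Dom C h)) \<bullet>
      \<a> (Dom C f) (Dom C g) (Dom C h)"
    by (simp add: Assoc_nat TensA_Comp_left Symm_nat)
  also have "\<dots> = (f \<boxtimes> h \<boxtimes> g) \<bullet> \<a> (Dom C f) (Dom C h) (Dom C g) \<bullet>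
      RSwap (Dom C f) (Dom C g) (Dom C h)" by (simp add: RSwap_def)
  also have "\<dots> = \<a> A V B \<bullet> ((f \<boxtimes> h) \<boxtimes> g) \<bullet> RSwap (Dom C f) (Dom C g) (Dom C h)"
    by (subst Comp_left[OF Assoc_nat]) simp_all
  finally show "\<a> A V B \<bullet> RSwap A B V \<bullet> ((f \<boxtimes> g) \<boxtimes> h) =
    \<a> A V B \<bullet> ((f \<boxtimes> h) \<boxtimes> g) \<bullet> RSwap (Dom C f) (Dom C g) (Dom C h)" .
qed simp_all

lemma RSwap_second:
  assumes [simp]: "A \<in> Obj C" "B \<in> Obj C" "D \<in> Obj C" "V \<in> Obj C"
  shows "\<a> A (B \<otimes> V) D \<bullet> (\<a> A B V \<boxtimes> \<one> D) \<bullet> RSwap (A \<otimes> B) D V =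
    (\<one> A \<boxtimes> RSwap B D V) \<bullet> \<a> A (B \<otimes> D) V \<bullet> (\<a> A B D \<boxtimes> \<one> V)"
proof (rule iso_mono[of "\<one> A \<boxtimes> \<a> B V D"])
  have "(\<one> A \<boxtimes> \<a> B V D) \<bullet> \<a> A (B \<otimes> V) D \<bullet> (\<a> A B V \<boxtimes> \<one> D) \<bullet> RSwap (A \<otimes> B) D V
      = \<a> A B (V \<otimes> D) \<bullet> \<a> (A \<otimes> B) V D \<bullet> RSwap (A \<otimes> B) D V"
    using arg_cong[OF pentagon[of A B V D], of "\<lambda>f. f \<bullet> RSwap (A \<otimes> B) D V"] by simp
  also have "\<dots> = \<a> A B (V \<otimes> D) \<bullet> ((\<one> A \<boxtimes> \<one> B) \<boxtimes> \<s> D V) \<bullet> \<a> (A \<otimes> B) D V" by (simp add: RSwap_def)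
  also have "\<dots> = (\<one> A \<boxtimes> \<one> B \<boxtimes> \<s> D V) \<bullet> \<a> A B (D \<otimes> V) \<bullet> \<a> (A \<otimes> B) D V"
    by (subst Comp_left[OF Assoc_nat]) simp_all
  also have "\<dots> = (\<one> A \<boxtimes> \<one> B \<boxtimes> \<s> D V) \<bullet> (\<one> A \<boxtimes> \<a> B D V) \<bullet> \<a> A (B \<otimes> D) V \<bullet> (\<a> A B D \<boxtimes> \<one> V)"
    by (simp add: pentagon)
  also have "\<dots> = (\<one> A \<boxtimes> \<a> B V D) \<bullet> (\<one> A \<boxtimes> RSwap B D V) \<bullet> \<a> A (B \<otimes> D) V \<bullet> (\<a> A B D \<boxtimes> \<one> V)"
    by (simp add: TensA_Comp_left RSwap_def)
  finally show "(\<one> A \<boxtimes> \<a> B V D) \<bullet> \<a> A (B \<otimes> V) D \<bullet> (\<a> A B V \<boxtimes> \<one> D) \<bullet> RSwap (A \<otimes> B) D V =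
    (\<one> A \<boxtimes> \<a> B V D) \<bullet> (\<one> A \<boxtimes> RSwap B D V) \<bullet> \<a> A (B \<otimes> D) V \<bullet> (\<a> A B D \<boxtimes> \<one> V)" .
qed simp_all

lemma RSwap_Symm:
  assumes [simp]: "A \<in> Obj C" "B \<in> Obj C" "V \<in> Obj C"
  shows "\<s> (A \<otimes> V) B \<bullet> RSwap A B V = \<a> B A V \<bullet> (\<s> A B \<boxtimes> \<one> V)"
  by (simp add: RSwap_def Symm_TensO TensA_Comp_left TensA_Comp' Symm_Symm)

lemma RSwap_first:
  assumes [simp]: "A \<in> Obj C" "B \<in> Obj C" "D \<in> Obj C" "V \<in> Obj C"
  shows "\<a> (A \<otimes> V) B D \<bullet> (RSwap A B V \<boxtimes> \<one> D) \<bullet> RSwap (A \<otimes> B) D V =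
    RSwap A (B \<otimes> D) V \<bullet> (\<a> A B D \<boxtimes> \<one> V)"
proof (rule iso_mono[of "\<a> A V (B \<otimes> D)"])
  have "\<a> A V (B \<otimes> D) \<bullet> \<a> (A \<otimes> V) B D \<bullet> (RSwap A B V \<boxtimes> \<one> D) \<bullet> RSwap (A \<otimes> B) D V
    = (\<one> A \<boxtimes> \<a> V B D) \<bullet> \<a> A (V \<otimes> B) D \<bullet> (\<a> A V B \<boxtimes> \<one> D) \<bullet> (RSwap A B V \<boxtimes> \<one> D) \<bullet> RSwap (A \<otimes> B) D V"
    using arg_cong[OF pentagon[of A V B D], of "\<lambda>f. f \<bullet> (RSwap A B V \<boxtimes> \<one> D) \<bullet> RSwap (A \<otimes> B) D V"]
    by simp
  also have "\<dots> = (\<one> A \<boxtimes> \<a> V B D) \<bullet> \<a> A (V \<otimes> B) D \<bullet> ((\<one> A \<boxtimes> \<s> B V) \<boxtimes> \<one> D) \<bullet> (\<a> A B V \<boxtimes> \<one> D) \<bullet> RSwap (A \<otimes> B) D V"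
    by (simp add: TensA_Comp_left RSwap_def)
  also have "\<dots> = (\<one> A \<boxtimes> \<a> V B D) \<bullet> (\<one> A \<boxtimes> \<s> B V \<boxtimes> \<one> D) \<bullet> \<a> A (B \<otimes> V) D \<bullet> (\<a> A B V \<boxtimes> \<one> D) \<bullet> RSwap (A \<otimes> B) D V"
    by (subst Comp_left[OF Assoc_nat]) simp_all
  also have "\<dots> = (\<one> A \<boxtimes> (\<a> V B D \<bullet> (\<s> B V \<boxtimes> \<one> D) \<bullet> RSwap B D V)) \<bullet> \<a> A (B \<otimes> D) V \<bullet> (\<a> A B D \<boxtimes> \<one> V)"
    by (simp add: RSwap_second TensA_Comp_left)
  also have "\<a> V B D \<bullet> (\<s> B V \<boxtimes> \<one> D) \<bullet> RSwap B D V = \<s> (B \<otimes> D) V"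
    by (simp add: RSwap_def Symm_TensO)
  also have "(\<one> A \<boxtimes> \<s> (B \<otimes> D) V) \<bullet> \<a> A (B \<otimes> D) V \<bullet> (\<a> A B D \<boxtimes> \<one> V) =
    \<a> A V (B \<otimes> D) \<bullet> RSwap A (B \<otimes> D) V \<bullet> (\<a> A B D \<boxtimes> \<one> V)"
    by (simp add: RSwap_def)
  finally show "\<a> A V (B \<otimes> D) \<bullet> \<a> (A \<otimes> V) B D \<bullet> (RSwap A B V \<boxtimes> \<one> D) \<bullet> RSwap (A \<otimes> B) D V =
    \<a> A V (B \<otimes> D) \<bullet> RSwap A (B \<otimes> D) V \<bullet> (\<a> A B D \<boxtimes> \<one> V)" .
qed simp_all

end


section \<open>Generalised elements\<close>

text \<open>A context assigns an object to every set of variables, and a splitting \<open>CSplit \<Gamma> \<Delta>\<close>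
from the object of \<open>\<Gamma> \<union> \<Delta>\<close> to the tensor product of those of \<open>\<Gamma>\<close> and \<open>\<Delta>\<close>. The variables in \<open>CDup\<close> are those
that both \<open>\<Gamma>\<close> and \<open>\<Delta>\<close> may contain; \<open>CStar\<close> identifies the object of the empty set with the unit.
A generalised element carries its context and the set of variables on which it depends, so that pairing is
a total binary operation on elements.\<close>

record ('o, 'm) ctxt =
  CObj :: "nat set \<Rightarrow> 'o"
  CSplit :: "nat set \<Rightarrow> nat set \<Rightarrow> 'm"
  CDup :: "nat set"
  CStar :: "'m"

datatype ('o, 'm) el = El (base: "('o, 'm) ctxt") (supp: "nat set") (arrow: 'm)

context symmetric_monoidal_category
begin

text \<open>Coassociativity, cocommutativity and counitality of the splittings are exactly what makes the
structure maps act on pairs of elements in the evident way (\<open>app_Assoc\<close>, \<open>app_Symm\<close>, \<open>app_LUnit\<close>).\<close>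

definition ctxt_ok :: "('o, 'm) ctxt \<Rightarrow> bool" where
  "ctxt_ok K \<longleftrightarrow>
     (\<forall>\<Gamma>. CObj K \<Gamma> \<in> Obj C) \<and>
     (\<forall>\<Gamma> \<Delta>. \<Gamma> \<inter> \<Delta> \<subseteq> CDup K \<longrightarrow> CSplit K \<Gamma> \<Delta> \<in> hom (CObj K (\<Gamma> \<union> \<Delta>)) (CObj K \<Gamma> \<otimes> CObj K \<Delta>)) \<and>
     (\<forall>\<Gamma> \<Delta>. \<Gamma> \<inter> \<Delta> = {} \<longrightarrow> iso (CSplit K \<Gamma> \<Delta>)) \<and>
     (\<forall>\<Gamma> \<Delta> \<Theta>. \<Gamma> \<inter> \<Delta> \<subseteq> CDup K \<longrightarrow> \<Gamma> \<inter> \<Theta> \<subseteq> CDup K \<longrightarrow> \<Delta> \<inter> \<Theta> \<subseteq> CDup K \<longrightarrow>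
        \<a> (CObj K \<Gamma>) (CObj K \<Delta>) (CObj K \<Theta>) \<bullet> (CSplit K \<Gamma> \<Delta> \<boxtimes> \<one> (CObj K \<Theta>)) \<bullet> CSplit K (\<Gamma> \<union> \<Delta>) \<Theta>
          = (\<one> (CObj K \<Gamma>) \<boxtimes> CSplit K \<Delta> \<Theta>) \<bullet> CSplit K \<Gamma> (\<Delta> \<union> \<Theta>)) \<and>
     (\<forall>\<Gamma> \<Delta>. \<Gamma> \<inter> \<Delta> \<subseteq> CDup K \<longrightarrow> \<s> (CObj K \<Gamma>) (CObj K \<Delta>) \<bullet> CSplit K \<Gamma> \<Delta> = CSplit K \<Delta> \<Gamma>) \<and>
     CStar K \<in> hom (CObj K {}) \<I> \<and>
     (\<forall>\<Gamma>. \<l> (CObj K \<Gamma>) \<bullet> (CStar K \<boxtimes> \<one> (CObj K \<Gamma>)) \<bullet> CSplit K {} \<Gamma> = \<one> (CObj K \<Gamma>))"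

definition el :: "('o, 'm) el \<Rightarrow> bool" where
  "el t \<longleftrightarrow> ctxt_ok (base t) \<and> arrow t \<in> Arr C \<and> Dom C (arrow t) = CObj (base t) (supp t)"

definition ty :: "('o, 'm) el \<Rightarrow> 'o" where
  "ty t = Cod C (arrow t)"

definition app :: "'m \<Rightarrow> ('o, 'm) el \<Rightarrow> ('o, 'm) el" where
  "app f t = El (base t) (supp t) (f \<bullet> arrow t)"

definition pair :: "('o, 'm) el \<Rightarrow> ('o, 'm) el \<Rightarrow> ('o, 'm) el" (infixr "\<otimes>\<otimes>" 70) where
  "t \<otimes>\<otimes> s = El (base t) (supp t \<union> supp s)
     ((arrow t \<boxtimes> arrow s) \<bullet> CSplit (base t) (supp t) (supp s))"

definition star :: "('o, 'm) ctxt \<Rightarrow> ('o, 'm) el" where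
  "star K = El K {} (CStar K)"

lemma el_facts:
  assumes "el t"
  shows "ctxt_ok (base t)" "arrow t \<in> Arr C" "Dom C (arrow t) = CObj (base t) (supp t)"
    "Cod C (arrow t) = ty t"
  using assms by (auto simp: el_def ty_def)

lemma ty_Obj [simp]: "el t \<Longrightarrow> ty t \<in> Obj C"
  by (simp add: el_def ty_def)

lemma ctxt_facts:
  assumes "ctxt_ok K"
  shows "CObj K \<Gamma> \<in> Obj C"
    "\<Gamma> \<inter> \<Delta> \<subseteq> CDup K \<Longrightarrow> CSplit K \<Gamma> \<Delta> \<in> Arr C"
    "\<Gamma> \<inter> \<Delta> \<subseteq> CDup K \<Longrightarrow> Dom C (CSplit K \<Gamma> \<Delta>) = CObj K (\<Gamma> \<union> \<Delta>)"
    "\<Gamma> \<inter> \<Delta> \<subseteq> CDup K \<Longrightarrow> Cod C (CSplit K \<Gamma> \<Delta>) = CObj K \<Gamma> \<otimes> CObj K \<Delta>"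
    "CStar K \<in> Arr C" "Dom C (CStar K) = CObj K {}" "Cod C (CStar K) = \<I>"
  using assms by (simp_all add: ctxt_ok_def Hom_def)

lemma base_simps [simp]: "base (app f t) = base t" "base (t \<otimes>\<otimes> s) = base t" "base (star K) = K"
  and supp_simps [simp]: "supp (app f t) = supp t" "supp (t \<otimes>\<otimes> s) = supp t \<union> supp s" "supp (star K) = {}"
  by (simp_all add: app_def pair_def star_def)

lemma el_app [simp]: "el t \<Longrightarrow> f \<in> Arr C \<Longrightarrow> Dom C f = ty t \<Longrightarrow> el (app f t)"
  and ty_app [simp]: "el t \<Longrightarrow> f \<in> Arr C \<Longrightarrow> Dom C f = ty t \<Longrightarrow> ty (app f t) = Cod C f"
  by (auto simp: el_def ty_def app_def)

lemma el_pair [simp]: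
  "el t \<Longrightarrow> el s \<Longrightarrow> base t = base s \<Longrightarrow> supp t \<inter> supp s \<subseteq> CDup (base s) \<Longrightarrow> el (t \<otimes>\<otimes> s)"
  and ty_pair [simp]:
  "el t \<Longrightarrow> el s \<Longrightarrow> base t = base s \<Longrightarrow> supp t \<inter> supp s \<subseteq> CDup (base s) \<Longrightarrow> ty (t \<otimes>\<otimes> s) = ty t \<otimes> ty s"
  by (auto simp: el_def ty_def pair_def ctxt_facts)

lemma el_star [simp]: "ctxt_ok K \<Longrightarrow> el (star K)" "ctxt_ok K \<Longrightarrow> ty (star K) = \<I>"
  by (auto simp: el_def ty_def star_def ctxt_facts)

lemma ctxt_ok_base [simp]: "el t \<Longrightarrow> ctxt_ok (base t)"
  by (simp add: el_def)

lemma app_Ident [simp]: "el t \<Longrightarrow> X = ty t \<Longrightarrow> app (\<one> X) t = t"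
  by (simp add: app_def el_facts)

lemma app_Comp [simp]:
  "el t \<Longrightarrow> f \<in> Arr C \<Longrightarrow> g \<in> Arr C \<Longrightarrow> Dom C f = ty t \<Longrightarrow> Dom C g = Cod C f \<Longrightarrow>
    app (g \<bullet> f) t = app g (app f t)"
  by (simp add: app_def el_facts)

lemma app_TensA [simp]:
  "el t \<Longrightarrow> el s \<Longrightarrow> base t = base s \<Longrightarrow> supp t \<inter> supp s \<subseteq> CDup (base s) \<Longrightarrow>
    f \<in> Arr C \<Longrightarrow> g \<in> Arr C \<Longrightarrow> Dom C f = ty t \<Longrightarrow> Dom C g = ty s \<Longrightarrow>
    app (f \<boxtimes> g) (t \<otimes>\<otimes> s) = app f t \<otimes>\<otimes> app g s"
  by (simp add: app_def pair_def el_facts ctxt_facts TensA_Comp_left)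

lemma app_Symm [simp]:
  assumes [simp]: "el t" "el s" "base t = base s" "supp t \<inter> supp s \<subseteq> CDup (base s)"
    "X = ty t" "Y = ty s"
  shows "app (\<s> X Y) (t \<otimes>\<otimes> s) = s \<otimes>\<otimes> t"
proof -
  let ?K = "base s"
  have ok: "ctxt_ok ?K" by simp
  note [simp] = ctxt_facts[OF ok] el_facts[of t] el_facts[of s]
  have "\<s> X Y \<bullet> (arrow t \<boxtimes> arrow s) \<bullet> CSplit ?K (supp t) (supp s)
      = (arrow s \<boxtimes> arrow t) \<bullet> \<s> (CObj ?K (supp t)) (CObj ?K (supp s)) \<bullet> CSplit ?K (supp t) (supp s)"
    by (subst Comp_left[OF Symm_nat]) simp_all
  also have "\<dots> = (arrow s \<boxtimes> arrow t) \<bullet> CSplit ?K (supp s) (supp t)"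
    using ok by (simp add: ctxt_ok_def)
  finally show ?thesis by (simp add: app_def pair_def Un_commute)
qed

lemma app_Assoc [simp]:
  assumes [simp]: "el t" "el s" "el r" "base t = base r" "base s = base r"
    "supp t \<inter> supp s \<subseteq> CDup (base r)" "supp t \<inter> supp r \<subseteq> CDup (base r)" "supp s \<inter> supp r \<subseteq> CDup (base r)"
    "X = ty t" "Y = ty s" "Z = ty r"
  shows "app (\<a> X Y Z) ((t \<otimes>\<otimes> s) \<otimes>\<otimes> r) = t \<otimes>\<otimes> s \<otimes>\<otimes> r"
proof -
  let ?K = "base r" let ?t = "supp t" and ?s = "supp s" and ?r = "supp r"
  have ok: "ctxt_ok ?K" by simp
  have [simp]: "(?t \<union> ?s) \<inter> ?r \<subseteq> CDup ?K" "?t \<inter> (?s \<union> ?r) \<subseteq> CDup ?K"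
    using assms(6-8) by blast+
  note [simp] = ctxt_facts[OF ok] el_facts[of t] el_facts[of s] el_facts[of r]
  have "\<a> X Y Z \<bullet> (((arrow t \<boxtimes> arrow s) \<bullet> CSplit ?K ?t ?s) \<boxtimes> arrow r) \<bullet> CSplit ?K (?t \<union> ?s) ?r
      = \<a> X Y Z \<bullet> ((arrow t \<boxtimes> arrow s) \<boxtimes> arrow r) \<bullet> (CSplit ?K ?t ?s \<boxtimes> \<one> (CObj ?K ?r)) \<bullet> CSplit ?K (?t \<union> ?s) ?r"
    by (simp add: TensA_Comp_left)
  also have "\<dots> = (arrow t \<boxtimes> arrow s \<boxtimes> arrow r) \<bullet> \<a> (CObj ?K ?t) (CObj ?K ?s) (CObj ?K ?r) \<bullet>
      (CSplit ?K ?t ?s \<boxtimes> \<one> (CObj ?K ?r)) \<bullet> CSplit ?K (?t \<union> ?s) ?r"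
    by (subst Comp_left[OF Assoc_nat]) simp_all
  also have "\<dots> = (arrow t \<boxtimes> arrow s \<boxtimes> arrow r) \<bullet> (\<one> (CObj ?K ?t) \<boxtimes> CSplit ?K ?s ?r) \<bullet> CSplit ?K ?t (?s \<union> ?r)"
    using ok by (simp add: ctxt_ok_def)
  finally show ?thesis by (simp add: app_def pair_def TensA_Comp_left Un_assoc)
qed

lemma app_LUnit [simp]:
  assumes [simp]: "el t" "K = base t" "X = ty t"
  shows "app (\<l> X) (star K \<otimes>\<otimes> t) = t"
proof -
  let ?K = "base t" let ?t = "supp t"
  have ok: "ctxt_ok ?K" by simp
  note [simp] = ctxt_facts[OF ok] el_facts[of t]
  have "\<l> X \<bullet> (CStar ?K \<boxtimes> arrow t) \<bullet> CSplit ?K {} ?t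
      = (\<l> X \<bullet> (\<one> \<I> \<boxtimes> arrow t)) \<bullet> (CStar ?K \<boxtimes> \<one> (CObj ?K ?t)) \<bullet> CSplit ?K {} ?t"
    by (simp add: TensA_Comp_left)
  also have "\<dots> = arrow t \<bullet> \<l> (CObj ?K ?t) \<bullet> (CStar ?K \<boxtimes> \<one> (CObj ?K ?t)) \<bullet> CSplit ?K {} ?t"
    by (subst LUnit_nat) simp_all
  also have "\<dots> = arrow t" using ok by (simp add: ctxt_ok_def)
  finally show ?thesis by (simp add: app_def pair_def star_def)
qed

lemma app_iso_eq: "iso f \<Longrightarrow> el t \<Longrightarrow> Dom C f = ty t \<Longrightarrow> app f t = s \<Longrightarrow> app (Inv f) s = t"
  by (auto simp: app_def el_facts)

lemma app_RUnit [simp]: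
  assumes [simp]: "el t" "K = base t" "X = ty t"
  shows "app (\<r> X) (t \<otimes>\<otimes> star K) = t"
  by (simp flip: LUnit_Symm)

lemma app_Inv_structure [simp]:
  "el t \<Longrightarrow> X = ty t \<Longrightarrow> app (Inv (\<l> X)) t = star (base t) \<otimes>\<otimes> t"
  "el t \<Longrightarrow> X = ty t \<Longrightarrow> app (Inv (\<r> X)) t = t \<otimes>\<otimes> star (base t)"
  by (rule app_iso_eq; simp)+

lemma app_Inv_Assoc [simp]:
  "el t \<Longrightarrow> el s \<Longrightarrow> el r \<Longrightarrow> base t = base r \<Longrightarrow> base s = base r \<Longrightarrow>
    supp t \<inter> supp s \<subseteq> CDup (base r) \<Longrightarrow> supp t \<inter> supp r \<subseteq> CDup (base r) \<Longrightarrow>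
    supp s \<inter> supp r \<subseteq> CDup (base r) \<Longrightarrow> X = ty t \<Longrightarrow> Y = ty s \<Longrightarrow> Z = ty r \<Longrightarrow>
    app (Inv (\<a> X Y Z)) (t \<otimes>\<otimes> s \<otimes>\<otimes> r) = (t \<otimes>\<otimes> s) \<otimes>\<otimes> r"
  by (rule app_iso_eq) (auto simp: Int_Un_distrib Int_Un_distrib2)

lemma typ_MidSwap [simp]:
  assumes "W \<in> Obj C" "X \<in> Obj C" "Y \<in> Obj C" "Z \<in> Obj C"
  shows "MidSwap C W X Y Z \<in> Arr C" "Dom C (MidSwap C W X Y Z) = (W \<otimes> X) \<otimes> Y \<otimes> Z"
    "Cod C (MidSwap C W X Y Z) = (W \<otimes> Y) \<otimes> X \<otimes> Z"
  using assms by (simp_all add: MidSwap_def)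

lemma iso_MidSwap [simp]:
  "W \<in> Obj C \<Longrightarrow> X \<in> Obj C \<Longrightarrow> Y \<in> Obj C \<Longrightarrow> Z \<in> Obj C \<Longrightarrow> iso (MidSwap C W X Y Z)"
  unfolding MidSwap_def by (intro iso_Comp iso_TensA) auto

lemma app_MidSwap [simp]:
  assumes [simp]: "el t" "el s" "el r" "el q" "base t = base q" "base s = base q" "base r = base q"
    "supp t \<inter> supp s \<subseteq> CDup (base q)" "supp t \<inter> supp r \<subseteq> CDup (base q)" "supp t \<inter> supp q \<subseteq> CDup (base q)"
    "supp s \<inter> supp r \<subseteq> CDup (base q)" "supp s \<inter> supp q \<subseteq> CDup (base q)" "supp r \<inter> supp q \<subseteq> CDup (base q)"
    "W = ty t" "X = ty s" "Y = ty r" "Z = ty q"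
  shows "app (MidSwap C W X Y Z) ((t \<otimes>\<otimes> s) \<otimes>\<otimes> r \<otimes>\<otimes> q) = (t \<otimes>\<otimes> r) \<otimes>\<otimes> s \<otimes>\<otimes> q"
proof -
  have [simp]: "supp r \<inter> supp s \<subseteq> CDup (base q)"
    using assms(11) by blast
  show ?thesis by (simp add: MidSwap_def Int_Un_distrib Int_Un_distrib2)
qed

text \<open>An element that is invertible as an arrow plays the role of a variable: a map is determined by its
value at it.\<close>

definition generic :: "('o, 'm) el \<Rightarrow> bool" where
  "generic t \<longleftrightarrow> el t \<and> iso (arrow t)"

lemma generic_pair:
  assumes "generic t" "generic s" "base t = base s" "supp t \<inter> supp s = {}"
  shows "generic (t \<otimes>\<otimes> s)"
proof -
  have "iso ((arrow t \<boxtimes> arrow s) \<bullet> CSplit (base s) (supp t) (supp s))"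
    using assms by (intro iso_Comp) (auto simp: generic_def el_def ctxt_ok_def ctxt_facts)
  then show ?thesis using assms by (simp add: generic_def) (simp add: pair_def)
qed

lemma generic_ext:
  assumes "generic t" "f \<in> hom (ty t) Y" "g \<in> hom (ty t) Y" "app f t = app g t"
  shows "f = g"
  by (rule iso_epi[of "arrow t"]) (use assms in \<open>auto simp: generic_def Hom_def app_def el_facts\<close>)


subsection \<open>Contexts of distinct variables\<close>

text \<open>The variables below \<open>n\<close> are tensored from left to right, leaving out those outside \<open>\<Gamma>\<close>, and
\<open>lsplit\<close> unshuffles them by recursion on \<open>n\<close>. No variable can be duplicated here. These contexts serve to decide the
coherence laws of \<open>MidSwap\<close>, from which the contexts with duplicable variables are then built.\<close>

primrec ltens :: "(nat \<Rightarrow> 'o) \<Rightarrow> nat \<Rightarrow> nat set \<Rightarrow> 'o" where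
  "ltens \<tau> 0 \<Gamma> = \<I>"
| "ltens \<tau> (Suc n) \<Gamma> = (if n \<in> \<Gamma> then ltens \<tau> n \<Gamma> \<otimes> \<tau> n else ltens \<tau> n \<Gamma>)"

primrec lsplit :: "(nat \<Rightarrow> 'o) \<Rightarrow> nat \<Rightarrow> nat set \<Rightarrow> nat set \<Rightarrow> 'm" where
  "lsplit \<tau> 0 \<Gamma> \<Delta> = Inv (\<l> \<I>)"
| "lsplit \<tau> (Suc n) \<Gamma> \<Delta> =
    (if n \<in> \<Gamma> then RSwap (ltens \<tau> n \<Gamma>) (ltens \<tau> n \<Delta>) (\<tau> n) \<bullet> (lsplit \<tau> n \<Gamma> \<Delta> \<boxtimes> \<one> (\<tau> n))
     else if n \<in> \<Delta> then \<a> (ltens \<tau> n \<Gamma>) (ltens \<tau> n \<Delta>) (\<tau> n) \<bullet> (lsplit \<tau> n \<Gamma> \<Delta> \<boxtimes> \<one> (\<tau> n))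
     else lsplit \<tau> n \<Gamma> \<Delta>)"

definition lctxt :: "(nat \<Rightarrow> 'o) \<Rightarrow> nat \<Rightarrow> ('o, 'm) ctxt" where
  "lctxt \<tau> n = \<lparr>CObj = ltens \<tau> n, CSplit = lsplit \<tau> n, CDup = {}, CStar = \<one> \<I>\<rparr>"

definition lvar :: "(nat \<Rightarrow> 'o) \<Rightarrow> nat \<Rightarrow> nat \<Rightarrow> ('o, 'm) el" where
  "lvar \<tau> n i = El (lctxt \<tau> n) {i} (\<l> (\<tau> i))"

context
  fixes \<tau> :: "nat \<Rightarrow> 'o"
  assumes \<tau> [simp]: "\<And>i. \<tau> i \<in> Obj C"
begin

lemma ltens_Obj [simp]: "ltens \<tau> n \<Gamma> \<in> Obj C"
  by (induction n) auto

lemma lsplit_typ [simp]: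
  assumes "\<Gamma> \<inter> \<Delta> = {}"
  shows "lsplit \<tau> n \<Gamma> \<Delta> \<in> Arr C" "Dom C (lsplit \<tau> n \<Gamma> \<Delta>) = ltens \<tau> n (\<Gamma> \<union> \<Delta>)"
    "Cod C (lsplit \<tau> n \<Gamma> \<Delta>) = ltens \<tau> n \<Gamma> \<otimes> ltens \<tau> n \<Delta>"
  using assms by (induction n) auto

lemma lsplit_iso: "\<Gamma> \<inter> \<Delta> = {} \<Longrightarrow> iso (lsplit \<tau> n \<Gamma> \<Delta>)"
  by (induction n) (auto intro!: iso_Comp)

lemma ltens_empty [simp]: "ltens \<tau> n {} = \<I>"
  by (induction n) auto

lemma lsplit_unit: "\<l> (ltens \<tau> n \<Gamma>) \<bullet> lsplit \<tau> n {} \<Gamma> = \<one> (ltens \<tau> n \<Gamma>)"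
proof (induction n)
  case (Suc n)
  show ?case
  proof (cases "n \<in> \<Gamma>")
    case True
    have "\<l> (ltens \<tau> n \<Gamma> \<otimes> \<tau> n) \<bullet> \<a> \<I> (ltens \<tau> n \<Gamma>) (\<tau> n) \<bullet> (lsplit \<tau> n {} \<Gamma> \<boxtimes> \<one> (\<tau> n))
       = (\<l> (ltens \<tau> n \<Gamma>) \<boxtimes> \<one> (\<tau> n)) \<bullet> (lsplit \<tau> n {} \<Gamma> \<boxtimes> \<one> (\<tau> n))"
      by (subst Comp_left[OF LUnit_TensO]) simp_all
    then show ?thesis using True Suc by (simp add: TensA_Comp')
  qed (use Suc in simp)
qed simp

lemma lsplit_symm:
  "\<Gamma> \<inter> \<Delta> = {} \<Longrightarrow> \<s> (ltens \<tau> n \<Gamma>) (ltens \<tau> n \<Delta>) \<bullet> lsplit \<tau> n \<Gamma> \<Delta> = lsplit \<tau> n \<Delta> \<Gamma>"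
proof (induction n)
  case 0
  have "\<s> \<I> \<I> = \<one> (\<I> \<otimes> \<I>)"
    by (rule iso_mono[of "\<r> \<I>", rotated -1]) (use LUnit_Symm[of \<I>] in \<open>simp_all add: LUnit_eq_RUnit\<close>)
  then show ?case by simp
next
  case (Suc n)
  let ?\<Gamma> = "ltens \<tau> n \<Gamma>" and ?\<Delta> = "ltens \<tau> n \<Delta>"
  have dis: "\<Delta> \<inter> \<Gamma> = {}" using Suc.prems by blast
  note IH = Suc.IH[OF Suc.prems]
  have "\<s> ?\<Delta> ?\<Gamma> \<bullet> lsplit \<tau> n \<Delta> \<Gamma> = lsplit \<tau> n \<Gamma> \<Delta>"
    unfolding IH[symmetric] using Suc.prems by (simp add: Symm_Symm_left)
  note IH' = this
  consider "n \<in> \<Gamma>" "n \<notin> \<Delta>" | "n \<in> \<Delta>" "n \<notin> \<Gamma>" | "n \<notin> \<Gamma>" "n \<notin> \<Delta>" using Suc.prems by blast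
  then show ?case
  proof cases
    case 1
    have "\<s> (?\<Gamma> \<otimes> \<tau> n) ?\<Delta> \<bullet> RSwap ?\<Gamma> ?\<Delta> (\<tau> n) \<bullet> (lsplit \<tau> n \<Gamma> \<Delta> \<boxtimes> \<one> (\<tau> n))
        = \<a> ?\<Delta> ?\<Gamma> (\<tau> n) \<bullet> (\<s> ?\<Gamma> ?\<Delta> \<boxtimes> \<one> (\<tau> n)) \<bullet> (lsplit \<tau> n \<Gamma> \<Delta> \<boxtimes> \<one> (\<tau> n))"
      using Suc.prems by (subst Comp_left[OF RSwap_Symm]) simp_all
    then show ?thesis using 1 Suc.prems by (simp add: TensA_Comp' IH)
  next
    case 2
    have "\<a> ?\<Gamma> ?\<Delta> (\<tau> n) \<bullet> (lsplit \<tau> n \<Gamma> \<Delta> \<boxtimes> \<one> (\<tau> n))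
       = \<a> ?\<Gamma> ?\<Delta> (\<tau> n) \<bullet> (\<s> ?\<Delta> ?\<Gamma> \<boxtimes> \<one> (\<tau> n)) \<bullet> (lsplit \<tau> n \<Delta> \<Gamma> \<boxtimes> \<one> (\<tau> n))"
      using dis by (simp add: TensA_Comp' IH')
    also have "\<dots> = \<s> (?\<Delta> \<otimes> \<tau> n) ?\<Gamma> \<bullet> RSwap ?\<Delta> ?\<Gamma> (\<tau> n) \<bullet> (lsplit \<tau> n \<Delta> \<Gamma> \<boxtimes> \<one> (\<tau> n))"
      using dis by (subst Comp_left[OF RSwap_Symm]) simp_all
    finally show ?thesis using 2 dis by (simp add: Symm_Symm_left)
  next
    case 3
    then show ?thesis using IH by simp
  qed
qed

lemma lsplit_assoc:
  assumes [simp]: "\<Gamma> \<inter> \<Delta> = {}" "\<Gamma> \<inter> \<Theta> = {}" "\<Delta> \<inter> \<Theta> = {}"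
  shows "\<a> (ltens \<tau> n \<Gamma>) (ltens \<tau> n \<Delta>) (ltens \<tau> n \<Theta>) \<bullet>
      (lsplit \<tau> n \<Gamma> \<Delta> \<boxtimes> \<one> (ltens \<tau> n \<Theta>)) \<bullet> lsplit \<tau> n (\<Gamma> \<union> \<Delta>) \<Theta>
    = (\<one> (ltens \<tau> n \<Gamma>) \<boxtimes> lsplit \<tau> n \<Delta> \<Theta>) \<bullet> lsplit \<tau> n \<Gamma> (\<Delta> \<union> \<Theta>)"
proof (induction n)
  case 0
  have "(\<one> \<I> \<boxtimes> \<l> \<I>) \<bullet> \<a> \<I> \<I> \<I> \<bullet> (Inv (\<l> \<I>) \<boxtimes> \<one> \<I>) = (\<r> \<I> \<boxtimes> \<one> \<I>) \<bullet> (Inv (\<l> \<I>) \<boxtimes> \<one> \<I>)"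
    by (subst Comp_left[OF triangle]) simp_all
  also have "\<dots> = (\<one> \<I> \<boxtimes> \<l> \<I>) \<bullet> (\<one> \<I> \<boxtimes> Inv (\<l> \<I>))"
    by (simp add: TensA_Comp' flip: LUnit_eq_RUnit)
  finally have "\<a> \<I> \<I> \<I> \<bullet> (Inv (\<l> \<I>) \<boxtimes> \<one> \<I>) = \<one> \<I> \<boxtimes> Inv (\<l> \<I>)"
    by (rule iso_mono[rotated -1]) auto
  then show ?case using Comp_left[of "\<a> \<I> \<I> \<I>" "Inv (\<l> \<I>) \<boxtimes> \<one> \<I>" _ "Inv (\<l> \<I>)"] by simp
next
  case (Suc n)
  let ?G = "ltens \<tau> n \<Gamma>" and ?D = "ltens \<tau> n \<Delta>" and ?T = "ltens \<tau> n \<Theta>" and ?V = "\<tau> n"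
  have [simp]: "(\<Gamma> \<union> \<Delta>) \<inter> \<Theta> = {}" "\<Gamma> \<inter> (\<Delta> \<union> \<Theta>) = {}" using assms by blast+
  let ?cc = "(lsplit \<tau> n \<Gamma> \<Delta> \<boxtimes> \<one> ?T) \<bullet> lsplit \<tau> n (\<Gamma> \<union> \<Delta>) \<Theta>"
  have IH: "(\<one> ?G \<boxtimes> lsplit \<tau> n \<Delta> \<Theta>) \<bullet> lsplit \<tau> n \<Gamma> (\<Delta> \<union> \<Theta>) = \<a> ?G ?D ?T \<bullet> ?cc"
    using Suc.IH by simp
  consider "n \<in> \<Gamma>" "n \<notin> \<Delta>" "n \<notin> \<Theta>" | "n \<in> \<Delta>" "n \<notin> \<Gamma>" "n \<notin> \<Theta>"
    | "n \<in> \<Theta>" "n \<notin> \<Gamma>" "n \<notin> \<Delta>" | "n \<notin> \<Gamma>" "n \<notin> \<Delta>" "n \<notin> \<Theta>" using assms by blast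
  then show ?case
  proof cases
    case 1
    have "\<a> (?G \<otimes> ?V) ?D ?T \<bullet> ((RSwap ?G ?D ?V \<bullet> (lsplit \<tau> n \<Gamma> \<Delta> \<boxtimes> \<one> ?V)) \<boxtimes> \<one> ?T) \<bullet>
        RSwap (ltens \<tau> n (\<Gamma> \<union> \<Delta>)) ?T ?V \<bullet> (lsplit \<tau> n (\<Gamma> \<union> \<Delta>) \<Theta> \<boxtimes> \<one> ?V)
      = \<a> (?G \<otimes> ?V) ?D ?T \<bullet> (RSwap ?G ?D ?V \<boxtimes> \<one> ?T) \<bullet> ((lsplit \<tau> n \<Gamma> \<Delta> \<boxtimes> \<one> ?V) \<boxtimes> \<one> ?T) \<bullet>
        RSwap (ltens \<tau> n (\<Gamma> \<union> \<Delta>)) ?T ?V \<bullet> (lsplit \<tau> n (\<Gamma> \<union> \<Delta>) \<Theta> \<boxtimes> \<one> ?V)"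
      by (simp add: TensA_Comp_left)
    also have "\<dots> = \<a> (?G \<otimes> ?V) ?D ?T \<bullet> (RSwap ?G ?D ?V \<boxtimes> \<one> ?T) \<bullet> RSwap (?G \<otimes> ?D) ?T ?V \<bullet>
        ((lsplit \<tau> n \<Gamma> \<Delta> \<boxtimes> \<one> ?T) \<boxtimes> \<one> ?V) \<bullet> (lsplit \<tau> n (\<Gamma> \<union> \<Delta>) \<Theta> \<boxtimes> \<one> ?V)"
      using Comp_left[OF RSwap_nat[of "lsplit \<tau> n \<Gamma> \<Delta>" "\<one> ?T" "\<one> ?V" "?G \<otimes> ?D" ?T ?V],
          of "lsplit \<tau> n (\<Gamma> \<union> \<Delta>) \<Theta> \<boxtimes> \<one> ?V"]
      by simp
    also have "\<dots> = RSwap ?G (?D \<otimes> ?T) ?V \<bullet> (\<a> ?G ?D ?T \<boxtimes> \<one> ?V) \<bullet> (?cc \<boxtimes> \<one> ?V)"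
      using arg_cong[OF RSwap_first[of ?G ?D ?T ?V], of "\<lambda>f. f \<bullet> (?cc \<boxtimes> \<one> ?V)"]
      by (simp add: TensA_Comp')
    also have "\<dots> = RSwap ?G (?D \<otimes> ?T) ?V \<bullet> ((\<one> ?G \<boxtimes> lsplit \<tau> n \<Delta> \<Theta>) \<boxtimes> \<one> ?V) \<bullet> (lsplit \<tau> n \<Gamma> (\<Delta> \<union> \<Theta>) \<boxtimes> \<one> ?V)"
      by (simp add: TensA_Comp' IH)
    also have "\<dots> = ((\<one> ?G \<boxtimes> \<one> ?V) \<boxtimes> lsplit \<tau> n \<Delta> \<Theta>) \<bullet> RSwap ?G (ltens \<tau> n (\<Delta> \<union> \<Theta>)) ?V \<bullet> (lsplit \<tau> n \<Gamma> (\<Delta> \<union> \<Theta>) \<boxtimes> \<one> ?V)"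
      by (subst Comp_left[OF RSwap_nat]) simp_all
    finally show ?thesis using 1 by simp
  next
    case 2
    have "\<a> ?G (?D \<otimes> ?V) ?T \<bullet> ((\<a> ?G ?D ?V \<bullet> (lsplit \<tau> n \<Gamma> \<Delta> \<boxtimes> \<one> ?V)) \<boxtimes> \<one> ?T) \<bullet>
        RSwap (ltens \<tau> n (\<Gamma> \<union> \<Delta>)) ?T ?V \<bullet> (lsplit \<tau> n (\<Gamma> \<union> \<Delta>) \<Theta> \<boxtimes> \<one> ?V)
      = \<a> ?G (?D \<otimes> ?V) ?T \<bullet> (\<a> ?G ?D ?V \<boxtimes> \<one> ?T) \<bullet> ((lsplit \<tau> n \<Gamma> \<Delta> \<boxtimes> \<one> ?V) \<boxtimes> \<one> ?T) \<bullet>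
        RSwap (ltens \<tau> n (\<Gamma> \<union> \<Delta>)) ?T ?V \<bullet> (lsplit \<tau> n (\<Gamma> \<union> \<Delta>) \<Theta> \<boxtimes> \<one> ?V)"
      by (simp add: TensA_Comp_left)
    also have "\<dots> = \<a> ?G (?D \<otimes> ?V) ?T \<bullet> (\<a> ?G ?D ?V \<boxtimes> \<one> ?T) \<bullet> RSwap (?G \<otimes> ?D) ?T ?V \<bullet>
        ((lsplit \<tau> n \<Gamma> \<Delta> \<boxtimes> \<one> ?T) \<boxtimes> \<one> ?V) \<bullet> (lsplit \<tau> n (\<Gamma> \<union> \<Delta>) \<Theta> \<boxtimes> \<one> ?V)"
      using Comp_left[OF RSwap_nat[of "lsplit \<tau> n \<Gamma> \<Delta>" "\<one> ?T" "\<one> ?V" "?G \<otimes> ?D" ?T ?V],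
          of "lsplit \<tau> n (\<Gamma> \<union> \<Delta>) \<Theta> \<boxtimes> \<one> ?V"]
      by simp
    also have "\<dots> = (\<one> ?G \<boxtimes> RSwap ?D ?T ?V) \<bullet> \<a> ?G (?D \<otimes> ?T) ?V \<bullet> (\<a> ?G ?D ?T \<boxtimes> \<one> ?V) \<bullet> (?cc \<boxtimes> \<one> ?V)"
      using arg_cong[OF RSwap_second[of ?G ?D ?T ?V], of "\<lambda>f. f \<bullet> (?cc \<boxtimes> \<one> ?V)"]
      by (simp add: TensA_Comp')
    also have "\<dots> = (\<one> ?G \<boxtimes> RSwap ?D ?T ?V) \<bullet> \<a> ?G (?D \<otimes> ?T) ?V \<bullet> ((\<one> ?G \<boxtimes> lsplit \<tau> n \<Delta> \<Theta>) \<boxtimes> \<one> ?V) \<bullet> (lsplit \<tau> n \<Gamma> (\<Delta> \<union> \<Theta>) \<boxtimes> \<one> ?V)"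
      by (simp add: TensA_Comp' IH)
    also have "\<dots> = (\<one> ?G \<boxtimes> RSwap ?D ?T ?V) \<bullet> (\<one> ?G \<boxtimes> lsplit \<tau> n \<Delta> \<Theta> \<boxtimes> \<one> ?V) \<bullet> \<a> ?G (ltens \<tau> n (\<Delta> \<union> \<Theta>)) ?V \<bullet> (lsplit \<tau> n \<Gamma> (\<Delta> \<union> \<Theta>) \<boxtimes> \<one> ?V)"
      by (subst Comp_left[OF Assoc_nat]) simp_all
    finally show ?thesis using 2 by (simp add: TensA_Comp_left)
  next
    case 3
    have "\<a> ?G ?D (?T \<otimes> ?V) \<bullet> (lsplit \<tau> n \<Gamma> \<Delta> \<boxtimes> \<one> (?T \<otimes> ?V)) \<bullet>
        \<a> (ltens \<tau> n (\<Gamma> \<union> \<Delta>)) ?T ?V \<bullet> (lsplit \<tau> n (\<Gamma> \<union> \<Delta>) \<Theta> \<boxtimes> \<one> ?V)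
      = \<a> ?G ?D (?T \<otimes> ?V) \<bullet> \<a> (?G \<otimes> ?D) ?T ?V \<bullet>
        ((lsplit \<tau> n \<Gamma> \<Delta> \<boxtimes> \<one> ?T) \<boxtimes> \<one> ?V) \<bullet> (lsplit \<tau> n (\<Gamma> \<union> \<Delta>) \<Theta> \<boxtimes> \<one> ?V)"
      using Comp_left[OF Assoc_nat[of "lsplit \<tau> n \<Gamma> \<Delta>" "\<one> ?T" "\<one> ?V" "?G \<otimes> ?D" ?T ?V],
          of "lsplit \<tau> n (\<Gamma> \<union> \<Delta>) \<Theta> \<boxtimes> \<one> ?V"]
      by simp
    also have "\<dots> = (\<one> ?G \<boxtimes> \<a> ?D ?T ?V) \<bullet> \<a> ?G (?D \<otimes> ?T) ?V \<bullet> (\<a> ?G ?D ?T \<boxtimes> \<one> ?V) \<bullet> (?cc \<boxtimes> \<one> ?V)"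
      using arg_cong[OF pentagon[of ?G ?D ?T ?V], of "\<lambda>f. f \<bullet> (?cc \<boxtimes> \<one> ?V)"]
      by (simp add: TensA_Comp')
    also have "\<dots> = (\<one> ?G \<boxtimes> \<a> ?D ?T ?V) \<bullet> \<a> ?G (?D \<otimes> ?T) ?V \<bullet> ((\<one> ?G \<boxtimes> lsplit \<tau> n \<Delta> \<Theta>) \<boxtimes> \<one> ?V) \<bullet> (lsplit \<tau> n \<Gamma> (\<Delta> \<union> \<Theta>) \<boxtimes> \<one> ?V)"
      by (simp add: TensA_Comp' IH)
    also have "\<dots> = (\<one> ?G \<boxtimes> \<a> ?D ?T ?V) \<bullet> (\<one> ?G \<boxtimes> lsplit \<tau> n \<Delta> \<Theta> \<boxtimes> \<one> ?V) \<bullet> \<a> ?G (ltens \<tau> n (\<Delta> \<union> \<Theta>)) ?V \<bullet> (lsplit \<tau> n \<Gamma> (\<Delta> \<union> \<Theta>) \<boxtimes> \<one> ?V)"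
      by (subst Comp_left[OF Assoc_nat]) simp_all
    finally show ?thesis using 3 by (simp add: TensA_Comp_left)
  next
    case 4
    then show ?thesis using Suc.IH by simp
  qed
qed

lemma lctxt_ok: "ctxt_ok (lctxt \<tau> n)"
  unfolding ctxt_ok_def lctxt_def
  using lsplit_iso lsplit_assoc lsplit_symm lsplit_unit
  by (auto simp: Hom_def)

lemma ltens_single: "ltens \<tau> n {i} = (if i < n then \<I> \<otimes> \<tau> i else \<I>)"
  by (induction n) (auto simp: less_Suc_eq)

lemma lvar:
  assumes "i < n"
  shows "generic (lvar \<tau> n i)" "base (lvar \<tau> n i) = lctxt \<tau> n" "supp (lvar \<tau> n i) = {i}" "ty (lvar \<tau> n i) = \<tau> i"
  using assms by (simp_all add: generic_def el_def lvar_def ty_def lctxt_ok) (simp add: lctxt_def ltens_single)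

end

end


subsection \<open>Contexts with duplicable variables\<close>

context symmetric_monoidal_category
begin

lemma generic_app: "iso f \<Longrightarrow> generic t \<Longrightarrow> Dom C f = ty t \<Longrightarrow> generic (app f t)"
  unfolding generic_def by (simp, simp add: app_def el_facts iso_Comp)

lemma generic_star:
  assumes "generic t" "K = base t"
  shows "generic (star K \<otimes>\<otimes> t)" "generic (t \<otimes>\<otimes> star K)"
proof -
  have [simp]: "el t" using assms by (simp add: generic_def)
  show "generic (star K \<otimes>\<otimes> t)" "generic (t \<otimes>\<otimes> star K)"
    using generic_app[of "Inv (\<l> (ty t))" t] generic_app[of "Inv (\<r> (ty t))" t] assms by simp_all
qed

lemma distinct_vars:
  assumes "list_all (\<lambda>X. X \<in> Obj C) Xs"
  obtains K v where "CDup K = {}"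
    "\<And>i. i < length Xs \<Longrightarrow> el (v i) \<and> generic (v i) \<and> base (v i) = K \<and> supp (v i) = {i} \<and> ty (v i) = Xs ! i"
proof
  let ?\<tau> = "\<lambda>i. if i < length Xs then Xs ! i else \<I>"
  have \<tau>: "?\<tau> i \<in> Obj C" for i using assms by (auto simp: list_all_length)
  show "CDup (lctxt ?\<tau> (length Xs)) = {}" by (simp add: lctxt_def)
  show "el (lvar ?\<tau> (length Xs) i) \<and> generic (lvar ?\<tau> (length Xs) i) \<and> base (lvar ?\<tau> (length Xs) i) = lctxt ?\<tau> (length Xs) \<and>
      supp (lvar ?\<tau> (length Xs) i) = {i} \<and> ty (lvar ?\<tau> (length Xs) i) = Xs ! i"
    if "i < length Xs" for i
    using lvar[OF \<tau> that] that by (auto simp: generic_def)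
qed

text \<open>Naturality and coherence of \<open>MidSwap\<close> only say how distinct variables are permuted, so it suffices
to evaluate both sides at distinct variables.\<close>

lemma MidSwap_nat:
  assumes [simp]: "f \<in> Arr C" "g \<in> Arr C" "h \<in> Arr C" "k \<in> Arr C"
    "W = Cod C f" "X = Cod C g" "Y = Cod C h" "Z = Cod C k"
  shows "MidSwap C W X Y Z \<bullet> ((f \<boxtimes> g) \<boxtimes> h \<boxtimes> k) =
    ((f \<boxtimes> h) \<boxtimes> g \<boxtimes> k) \<bullet> MidSwap C (Dom C f) (Dom C g) (Dom C h) (Dom C k)"
proof -
  obtain K v where v: "CDup K = {}"
    "\<And>i. i < length [Dom C f, Dom C g, Dom C h, Dom C k] \<Longrightarrow> el (v i) \<and> generic (v i) \<and> base (v i) = K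
      \<and> supp (v i) = {i} \<and> ty (v i) = [Dom C f, Dom C g, Dom C h, Dom C k] ! i"
    by (rule distinct_vars[of "[Dom C f, Dom C g, Dom C h, Dom C k]"]) (simp, rule that, assumption, blast)
  note [simp] = v(1) v(2)[of 0, simplified] v(2)[of 1, simplified] v(2)[of 2, simplified] v(2)[of 3, simplified]
  show ?thesis
    by (rule generic_ext[of "(v 0 \<otimes>\<otimes> v 1) \<otimes>\<otimes> v 2 \<otimes>\<otimes> v 3"]) (simp_all add: Hom_def generic_pair)
qed

lemma MidSwap_assoc:
  assumes [simp]: "A \<in> Obj C" "A' \<in> Obj C" "B \<in> Obj C" "B' \<in> Obj C" "D \<in> Obj C" "D' \<in> Obj C"
  shows "\<a> (A \<otimes> A') (B \<otimes> B') (D \<otimes> D') \<bullet> (MidSwap C A B A' B' \<boxtimes> \<one> (D \<otimes> D')) \<bullet>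
      MidSwap C (A \<otimes> B) D (A' \<otimes> B') D' =
    (\<one> (A \<otimes> A') \<boxtimes> MidSwap C B D B' D') \<bullet> MidSwap C A (B \<otimes> D) A' (B' \<otimes> D') \<bullet>
      (\<a> A B D \<boxtimes> \<a> A' B' D')"
proof -
  obtain K v where v: "CDup K = {}"
    "\<And>i. i < length [A, B, D, A', B', D'] \<Longrightarrow> el (v i) \<and> generic (v i) \<and> base (v i) = K
      \<and> supp (v i) = {i} \<and> ty (v i) = [A, B, D, A', B', D'] ! i"
    by (rule distinct_vars[of "[A, B, D, A', B', D']"]) (simp, rule that, assumption, blast)
  note [simp] = v(1) v(2)[of 0, simplified] v(2)[of 1, simplified] v(2)[of 2, simplified]
    v(2)[of 3, simplified] v(2)[of 4, simplified] v(2)[of 5, simplified]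
  show ?thesis
    by (rule generic_ext[of "((v 0 \<otimes>\<otimes> v 1) \<otimes>\<otimes> v 2) \<otimes>\<otimes> (v 3 \<otimes>\<otimes> v 4) \<otimes>\<otimes> v 5"])
      (simp_all add: Hom_def generic_pair)
qed

lemma MidSwap_Symm:
  assumes [simp]: "A \<in> Obj C" "A' \<in> Obj C" "B \<in> Obj C" "B' \<in> Obj C"
  shows "\<s> (A \<otimes> A') (B \<otimes> B') \<bullet> MidSwap C A B A' B' = MidSwap C B A B' A' \<bullet> (\<s> A B \<boxtimes> \<s> A' B')"
proof -
  obtain K v where v: "CDup K = {}"
    "\<And>i. i < length [A, B, A', B'] \<Longrightarrow> el (v i) \<and> generic (v i) \<and> base (v i) = K
      \<and> supp (v i) = {i} \<and> ty (v i) = [A, B, A', B'] ! i"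
    by (rule distinct_vars[of "[A, B, A', B']"]) (simp, rule that, assumption, blast)
  note [simp] = v(1) v(2)[of 0, simplified] v(2)[of 1, simplified] v(2)[of 2, simplified]
    v(2)[of 3, simplified]
  show ?thesis
    by (rule generic_ext[of "(v 0 \<otimes>\<otimes> v 1) \<otimes>\<otimes> v 2 \<otimes>\<otimes> v 3"]) (simp_all add: Hom_def generic_pair)
qed

lemma MidSwap_unit:
  assumes [simp]: "A \<in> Obj C" "B \<in> Obj C"
  shows "\<l> (A \<otimes> B) \<bullet> (\<l> \<I> \<boxtimes> \<one> (A \<otimes> B)) \<bullet> MidSwap C \<I> A \<I> B = \<l> A \<boxtimes> \<l> B"
proof -
  obtain K v where v: "CDup K = {}"
    "\<And>i. i < length [A, B] \<Longrightarrow> el (v i) \<and> generic (v i) \<and> base (v i) = K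
      \<and> supp (v i) = {i} \<and> ty (v i) = [A, B] ! i"
    by (rule distinct_vars[of "[A, B]"]) (simp, rule that, assumption, blast)
  note [simp] = v(1) v(2)[of 0, simplified] v(2)[of 1, simplified]
  have ok [simp]: "ctxt_ok K" using ctxt_ok_base[of "v 0"] by simp
  show ?thesis
    by (rule generic_ext[of "(star K \<otimes>\<otimes> v 0) \<otimes>\<otimes> star K \<otimes>\<otimes> v 1"])
      (simp_all add: Hom_def generic_pair generic_star)
qed

lemma unit_coherence:
  assumes [simp]: "X \<in> Obj C" "Y \<in> Obj C"
  shows "\<a> \<I> X Y \<bullet> (Inv (\<l> X) \<boxtimes> \<one> Y) = Inv (\<l> (X \<otimes> Y))"
    "\<a> X \<I> Y \<bullet> (Inv (\<r> X) \<boxtimes> \<one> Y) = \<one> X \<boxtimes> Inv (\<l> Y)"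
    "\<a> X Y \<I> \<bullet> Inv (\<r> (X \<otimes> Y)) = \<one> X \<boxtimes> Inv (\<r> Y)"
proof -
  obtain K v where v: "CDup K = {}"
    "\<And>i. i < length [X, Y] \<Longrightarrow> el (v i) \<and> generic (v i) \<and> base (v i) = K
      \<and> supp (v i) = {i} \<and> ty (v i) = [X, Y] ! i"
    by (rule distinct_vars[of "[X, Y]"]) (simp, rule that, assumption, blast)
  note [simp] = v(1) v(2)[of 0, simplified] v(2)[of 1, simplified]
  have ok [simp]: "ctxt_ok K" using ctxt_ok_base[of "v 0"] by simp
  show "\<a> \<I> X Y \<bullet> (Inv (\<l> X) \<boxtimes> \<one> Y) = Inv (\<l> (X \<otimes> Y))"
    "\<a> X \<I> Y \<bullet> (Inv (\<r> X) \<boxtimes> \<one> Y) = \<one> X \<boxtimes> Inv (\<l> Y)"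
    "\<a> X Y \<I> \<bullet> Inv (\<r> (X \<otimes> Y)) = \<one> X \<boxtimes> Inv (\<r> Y)"
    by (rule generic_ext[of "v 0 \<otimes>\<otimes> v 1"]; simp add: Hom_def generic_pair)+
qed

lemma Inv_LUnit_nat:
  assumes [simp]: "f \<in> Arr C" "X = Dom C f"
  shows "(\<one> \<I> \<boxtimes> f) \<bullet> Inv (\<l> X) = Inv (\<l> (Cod C f)) \<bullet> f"
proof (rule iso_mono[of "\<l> (Cod C f)"])
  show "\<l> (Cod C f) \<bullet> (\<one> \<I> \<boxtimes> f) \<bullet> Inv (\<l> X) = \<l> (Cod C f) \<bullet> Inv (\<l> (Cod C f)) \<bullet> f"
    by (subst Comp_left[OF LUnit_nat]) simp_all
qed simp_all

lemma Inv_RUnit_nat: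
  assumes [simp]: "f \<in> Arr C" "X = Dom C f"
  shows "(f \<boxtimes> \<one> \<I>) \<bullet> Inv (\<r> X) = Inv (\<r> (Cod C f)) \<bullet> f"
proof (rule iso_mono[of "\<r> (Cod C f)"])
  show "\<r> (Cod C f) \<bullet> (f \<boxtimes> \<one> \<I>) \<bullet> Inv (\<r> X) = \<r> (Cod C f) \<bullet> Inv (\<r> (Cod C f)) \<bullet> f"
    by (subst Comp_left[OF RUnit_nat]) simp_all
qed simp_all

lemma Symm_Inv_unit:
  assumes [simp]: "X \<in> Obj C"
  shows "\<s> X \<I> \<bullet> Inv (\<r> X) = Inv (\<l> X)" "\<s> \<I> X \<bullet> Inv (\<l> X) = Inv (\<r> X)"
proof -
  show 1: "\<s> X \<I> \<bullet> Inv (\<r> X) = Inv (\<l> X)"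
    by (rule iso_mono[of "\<l> X"], simp_all) (subst Comp_left[OF LUnit_Symm]; simp)
  show "\<s> \<I> X \<bullet> Inv (\<l> X) = Inv (\<r> X)"
    unfolding 1[symmetric] by (simp add: Symm_Symm_left)
qed

end

lemma (in cocommutative_comonoid) comonoid_simps:
  "A \<in> Obj C" "e \<in> Arr C" "Dom C e = A" "Cod C e = \<I>" "d \<in> Arr C" "Dom C d = A" "Cod C d = A \<otimes> A"
  using carrier counit_Hom comult_Hom by (auto simp: Hom_def)

context symmetric_monoidal_category
begin

text \<open>One variable of type \<open>V\<close> that is present iff \<open>b\<close> holds. Its splitting is the comultiplication if both
sides need the variable and a unitor otherwise.\<close>

definition bobj :: "'o \<Rightarrow> bool \<Rightarrow> 'o" where
  "bobj V b = (if b then V else \<I>)"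

definition bsplit :: "'o \<Rightarrow> 'm \<Rightarrow> bool \<Rightarrow> bool \<Rightarrow> 'm" where
  "bsplit V d b c = (if b \<and> c then d else if b then Inv (\<r> V) else if c then Inv (\<l> V) else Inv (\<l> \<I>))"

definition bcounit :: "'m \<Rightarrow> bool \<Rightarrow> 'm" where
  "bcounit e b = (if b then e else \<one> \<I>)"

context
  fixes V :: 'o and e d :: 'm
  assumes V [simp]: "V \<in> Obj C"
begin

lemma bobj_simps [simp]: "bobj V b \<in> Obj C" "bobj V True = V" "bobj V False = \<I>"
  by (auto simp: bobj_def)

lemma bsplit_typ:
  assumes "b \<and> c \<Longrightarrow> cocommutative_comonoid C V e d"
  shows "bsplit V d b c \<in> Arr C" "Dom C (bsplit V d b c) = bobj V (b \<or> c)"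
    "Cod C (bsplit V d b c) = bobj V b \<otimes> bobj V c"
  using assms by (auto simp: bsplit_def cocommutative_comonoid.comonoid_simps)

lemma bsplit_iso: "\<not> (b \<and> c) \<Longrightarrow> iso (bsplit V d b c)"
  by (auto simp: bsplit_def)

lemma bsplit_symm:
  assumes "b \<and> c \<Longrightarrow> cocommutative_comonoid C V e d"
  shows "\<s> (bobj V b) (bobj V c) \<bullet> bsplit V d b c = bsplit V d c b"
  using assms Symm_Inv_unit[of \<I>]
  by (auto simp: bsplit_def cocommutative_comonoid.cocommute Symm_Inv_unit LUnit_eq_RUnit)

lemma bsplit_assoc:
  assumes "b \<and> c \<or> b \<and> t \<or> c \<and> t \<Longrightarrow> cocommutative_comonoid C V e d"
  shows "\<a> (bobj V b) (bobj V c) (bobj V t) \<bullet> (bsplit V d b c \<boxtimes> \<one> (bobj V t)) \<bullet> bsplit V d (b \<or> c) t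
    = (\<one> (bobj V b) \<boxtimes> bsplit V d c t) \<bullet> bsplit V d b (c \<or> t)"
proof -
  have d [simp]: "d \<in> Arr C" "Dom C d = V" "Cod C d = V \<otimes> V" if "b \<and> c \<or> b \<and> t \<or> c \<and> t"
    using assms that by (auto simp: cocommutative_comonoid.comonoid_simps)
  show ?thesis
    using assms
    by (cases b; cases c; cases t)
      (auto simp: bsplit_def cocommutative_comonoid.coassoc Inv_RUnit_nat Inv_LUnit_nat
        Comp_left[OF unit_coherence(1)] Comp_left[OF unit_coherence(2)] Comp_left[OF unit_coherence(3)]
        LUnit_eq_RUnit)
qed

lemma bcounit:
  assumes "b \<longrightarrow> c" "b \<Longrightarrow> cocommutative_comonoid C V e d"
  shows "\<l> (bobj V c) \<bullet> (bcounit e b \<boxtimes> \<one> (bobj V c)) \<bullet> bsplit V d b c = \<one> (bobj V c)"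
  using assms by (auto simp: bcounit_def bsplit_def cocommutative_comonoid.left_counit)

lemma bcounit_typ:
  assumes "b \<Longrightarrow> cocommutative_comonoid C V e d"
  shows "bcounit e b \<in> Arr C" "Dom C (bcounit e b) = bobj V b" "Cod C (bcounit e b) = \<I>"
  using assms by (auto simp: bcounit_def cocommutative_comonoid.comonoid_simps)

end

text \<open>An absent variable contributes a factor \<open>\<I>\<close> instead of being left out. In this way \<open>csplit\<close> is
uniformly a \<open>MidSwap\<close> after splittings of single variables, and its laws follow factor by factor.\<close>

primrec ctens :: "(nat \<Rightarrow> 'o) \<Rightarrow> nat \<Rightarrow> nat set \<Rightarrow> 'o" where
  "ctens \<tau> 0 \<Gamma> = \<I>"
| "ctens \<tau> (Suc n) \<Gamma> = ctens \<tau> n \<Gamma> \<otimes> bobj (\<tau> n) (n \<in> \<Gamma>)"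

primrec csplit :: "(nat \<Rightarrow> 'o) \<Rightarrow> (nat \<Rightarrow> 'm) \<Rightarrow> nat \<Rightarrow> nat set \<Rightarrow> nat set \<Rightarrow> 'm" where
  "csplit \<tau> d 0 \<Gamma> \<Delta> = Inv (\<l> \<I>)"
| "csplit \<tau> d (Suc n) \<Gamma> \<Delta> =
    MidSwap C (ctens \<tau> n \<Gamma>) (ctens \<tau> n \<Delta>) (bobj (\<tau> n) (n \<in> \<Gamma>)) (bobj (\<tau> n) (n \<in> \<Delta>)) \<bullet>
      (csplit \<tau> d n \<Gamma> \<Delta> \<boxtimes> bsplit (\<tau> n) (d n) (n \<in> \<Gamma>) (n \<in> \<Delta>))"

primrec ccounit :: "(nat \<Rightarrow> 'm) \<Rightarrow> nat \<Rightarrow> nat set \<Rightarrow> 'm" where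
  "ccounit e 0 \<Gamma> = \<one> \<I>"
| "ccounit e (Suc n) \<Gamma> = \<l> \<I> \<bullet> (ccounit e n \<Gamma> \<boxtimes> bcounit (e n) (n \<in> \<Gamma>))"

primrec cproj :: "(nat \<Rightarrow> 'o) \<Rightarrow> (nat \<Rightarrow> 'm) \<Rightarrow> nat \<Rightarrow> nat \<Rightarrow> 'm" where
  "cproj \<tau> e 0 i = \<one> \<I>"
| "cproj \<tau> e (Suc n) i =
    (if i = n then \<l> (\<tau> n) \<bullet> (ccounit e n {} \<boxtimes> \<one> (\<tau> n)) else \<r> (\<tau> i) \<bullet> (cproj \<tau> e n i \<boxtimes> \<one> \<I>))"

definition cctxt :: "(nat \<Rightarrow> 'o) \<Rightarrow> (nat \<Rightarrow> 'm) \<Rightarrow> (nat \<Rightarrow> 'm) \<Rightarrow> nat set \<Rightarrow> nat \<Rightarrow> ('o, 'm) ctxt" where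
  "cctxt \<tau> e d B n = \<lparr>CObj = ctens \<tau> n, CSplit = csplit \<tau> d n, CDup = B, CStar = ccounit e n {}\<rparr>"

definition cvar :: "(nat \<Rightarrow> 'o) \<Rightarrow> (nat \<Rightarrow> 'm) \<Rightarrow> (nat \<Rightarrow> 'm) \<Rightarrow> nat set \<Rightarrow> nat \<Rightarrow> nat \<Rightarrow> ('o, 'm) el" where
  "cvar \<tau> e d B n i = El (cctxt \<tau> e d B n) {i} (cproj \<tau> e n i)"

context
  fixes \<tau> :: "nat \<Rightarrow> 'o" and e d :: "nat \<Rightarrow> 'm" and B :: "nat set"
  assumes \<tau> [simp]: "\<And>i. \<tau> i \<in> Obj C"
    and B: "\<And>i. i \<in> B \<Longrightarrow> cocommutative_comonoid C (\<tau> i) (e i) (d i)"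
begin

lemma ctens_Obj [simp]: "ctens \<tau> n \<Gamma> \<in> Obj C"
  by (induction n) auto

lemma bsplit_typ' [simp]:
  assumes "\<Gamma> \<inter> \<Delta> \<subseteq> B"
  shows "bsplit (\<tau> n) (d n) (n \<in> \<Gamma>) (n \<in> \<Delta>) \<in> Arr C"
    "Dom C (bsplit (\<tau> n) (d n) (n \<in> \<Gamma>) (n \<in> \<Delta>)) = bobj (\<tau> n) (n \<in> \<Gamma> \<union> \<Delta>)"
    "Cod C (bsplit (\<tau> n) (d n) (n \<in> \<Gamma>) (n \<in> \<Delta>)) = bobj (\<tau> n) (n \<in> \<Gamma>) \<otimes> bobj (\<tau> n) (n \<in> \<Delta>)"
  using bsplit_typ[where V = "\<tau> n" and b = "n \<in> \<Gamma>" and c = "n \<in> \<Delta>" and e = "e n" and d = "d n"] assms B[of n]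
  by auto

lemma csplit_typ [simp]:
  assumes "\<Gamma> \<inter> \<Delta> \<subseteq> B"
  shows "csplit \<tau> d n \<Gamma> \<Delta> \<in> Arr C" "Dom C (csplit \<tau> d n \<Gamma> \<Delta>) = ctens \<tau> n (\<Gamma> \<union> \<Delta>)"
    "Cod C (csplit \<tau> d n \<Gamma> \<Delta>) = ctens \<tau> n \<Gamma> \<otimes> ctens \<tau> n \<Delta>"
  using assms by (induction n) simp_all

lemma csplit_iso: "\<Gamma> \<inter> \<Delta> = {} \<Longrightarrow> iso (csplit \<tau> d n \<Gamma> \<Delta>)"
proof (induction n)
  case (Suc n)
  then have "iso (bsplit (\<tau> n) (d n) (n \<in> \<Gamma>) (n \<in> \<Delta>))" by (intro bsplit_iso) auto
  with Suc show ?case by (auto intro!: iso_Comp)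
qed simp

lemma csplit_symm:
  "\<Gamma> \<inter> \<Delta> \<subseteq> B \<Longrightarrow> \<s> (ctens \<tau> n \<Gamma>) (ctens \<tau> n \<Delta>) \<bullet> csplit \<tau> d n \<Gamma> \<Delta> = csplit \<tau> d n \<Delta> \<Gamma>"
proof (induction n)
  case 0
  then show ?case using Symm_Inv_unit[of \<I>] by (simp add: LUnit_eq_RUnit)
next
  case (Suc n)
  note [simp] = Suc
  have [simp]: "\<Delta> \<inter> \<Gamma> \<subseteq> B" using Suc.prems by blast
  have bs: "\<s> (bobj (\<tau> n) (n \<in> \<Gamma>)) (bobj (\<tau> n) (n \<in> \<Delta>)) \<bullet> bsplit (\<tau> n) (d n) (n \<in> \<Gamma>) (n \<in> \<Delta>)
      = bsplit (\<tau> n) (d n) (n \<in> \<Delta>) (n \<in> \<Gamma>)"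
    by (rule bsplit_symm[where e = "e n", OF \<tau>]) (use Suc.prems B in blast)
  show ?case
    using Comp_left[OF MidSwap_Symm[of "ctens \<tau> n \<Gamma>" "bobj (\<tau> n) (n \<in> \<Gamma>)" "ctens \<tau> n \<Delta>" "bobj (\<tau> n) (n \<in> \<Delta>)"],
       of "csplit \<tau> d n \<Gamma> \<Delta> \<boxtimes> bsplit (\<tau> n) (d n) (n \<in> \<Gamma>) (n \<in> \<Delta>)"]
    by (simp add: TensA_Comp' bs)
qed

lemma csplit_assoc:
  assumes [simp]: "\<Gamma> \<inter> \<Delta> \<subseteq> B" "\<Gamma> \<inter> \<Theta> \<subseteq> B" "\<Delta> \<inter> \<Theta> \<subseteq> B"
  shows "\<a> (ctens \<tau> n \<Gamma>) (ctens \<tau> n \<Delta>) (ctens \<tau> n \<Theta>) \<bullet>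
      (csplit \<tau> d n \<Gamma> \<Delta> \<boxtimes> \<one> (ctens \<tau> n \<Theta>)) \<bullet> csplit \<tau> d n (\<Gamma> \<union> \<Delta>) \<Theta>
    = (\<one> (ctens \<tau> n \<Gamma>) \<boxtimes> csplit \<tau> d n \<Delta> \<Theta>) \<bullet> csplit \<tau> d n \<Gamma> (\<Delta> \<union> \<Theta>)"
proof (induction n)
  case 0
  then show ?case
    using Comp_left[OF unit_coherence(1)[of \<I> \<I>], of "Inv (\<l> \<I>)"] by (simp add: Inv_LUnit_nat)
next
  case (Suc n)
  have [simp]: "(\<Gamma> \<union> \<Delta>) \<inter> \<Theta> \<subseteq> B" "\<Gamma> \<inter> (\<Delta> \<union> \<Theta>) \<subseteq> B" using assms by blast+
  note [simp del] = Un_iff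
  let ?G = "ctens \<tau> n \<Gamma>" and ?D = "ctens \<tau> n \<Delta>" and ?T = "ctens \<tau> n \<Theta>"
  let ?g = "bobj (\<tau> n) (n \<in> \<Gamma>)" and ?d = "bobj (\<tau> n) (n \<in> \<Delta>)" and ?t = "bobj (\<tau> n) (n \<in> \<Theta>)"
  let ?b = "\<lambda>\<Gamma> \<Delta>. bsplit (\<tau> n) (d n) (n \<in> \<Gamma>) (n \<in> \<Delta>)"
  let ?c = "\<lambda>\<Gamma> \<Delta>. csplit \<tau> d n \<Gamma> \<Delta>"
  have bs: "\<a> ?g ?d ?t \<bullet> (?b \<Gamma> \<Delta> \<boxtimes> \<one> ?t) \<bullet> ?b (\<Gamma> \<union> \<Delta>) \<Theta> = (\<one> ?g \<boxtimes> ?b \<Delta> \<Theta>) \<bullet> ?b \<Gamma> (\<Delta> \<union> \<Theta>)"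
    by (simp only: Un_iff, rule bsplit_assoc[where e = "e n", OF \<tau>]) (use assms B in blast)
  have "\<a> (?G \<otimes> ?g) (?D \<otimes> ?d) (?T \<otimes> ?t) \<bullet>
      ((MidSwap C ?G ?D ?g ?d \<bullet> (?c \<Gamma> \<Delta> \<boxtimes> ?b \<Gamma> \<Delta>)) \<boxtimes> \<one> (?T \<otimes> ?t)) \<bullet>
      MidSwap C (ctens \<tau> n (\<Gamma> \<union> \<Delta>)) ?T (bobj (\<tau> n) (n \<in> \<Gamma> \<union> \<Delta>)) ?t \<bullet> (?c (\<Gamma> \<union> \<Delta>) \<Theta> \<boxtimes> ?b (\<Gamma> \<union> \<Delta>) \<Theta>)
    = \<a> (?G \<otimes> ?g) (?D \<otimes> ?d) (?T \<otimes> ?t) \<bullet> (MidSwap C ?G ?D ?g ?d \<boxtimes> \<one> (?T \<otimes> ?t)) \<bullet>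
      ((?c \<Gamma> \<Delta> \<boxtimes> ?b \<Gamma> \<Delta>) \<boxtimes> \<one> ?T \<boxtimes> \<one> ?t) \<bullet>
      MidSwap C (ctens \<tau> n (\<Gamma> \<union> \<Delta>)) ?T (bobj (\<tau> n) (n \<in> \<Gamma> \<union> \<Delta>)) ?t \<bullet> (?c (\<Gamma> \<union> \<Delta>) \<Theta> \<boxtimes> ?b (\<Gamma> \<union> \<Delta>) \<Theta>)"
    by (simp add: TensA_Comp_left)
  also have "\<dots> = (\<a> (?G \<otimes> ?g) (?D \<otimes> ?d) (?T \<otimes> ?t) \<bullet> (MidSwap C ?G ?D ?g ?d \<boxtimes> \<one> (?T \<otimes> ?t)) \<bullet>
      MidSwap C (?G \<otimes> ?D) ?T (?g \<otimes> ?d) ?t) \<bullet>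
      (((?c \<Gamma> \<Delta> \<boxtimes> \<one> ?T) \<bullet> ?c (\<Gamma> \<union> \<Delta>) \<Theta>) \<boxtimes> ((?b \<Gamma> \<Delta> \<boxtimes> \<one> ?t) \<bullet> ?b (\<Gamma> \<union> \<Delta>) \<Theta>))"
    using Comp_left[OF MidSwap_nat[of "?c \<Gamma> \<Delta>" "\<one> ?T" "?b \<Gamma> \<Delta>" "\<one> ?t" "?G \<otimes> ?D" ?T "?g \<otimes> ?d" ?t],
        of "?c (\<Gamma> \<union> \<Delta>) \<Theta> \<boxtimes> ?b (\<Gamma> \<union> \<Delta>) \<Theta>"]
    by (simp add: TensA_Comp' del: TensA_Ident)
  also have "\<dots> = (\<one> (?G \<otimes> ?g) \<boxtimes> MidSwap C ?D ?T ?d ?t) \<bullet> MidSwap C ?G (?D \<otimes> ?T) ?g (?d \<otimes> ?t) \<bullet>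
      ((\<one> ?G \<boxtimes> ?c \<Delta> \<Theta>) \<boxtimes> (\<one> ?g \<boxtimes> ?b \<Delta> \<Theta>)) \<bullet> (?c \<Gamma> (\<Delta> \<union> \<Theta>) \<boxtimes> ?b \<Gamma> (\<Delta> \<union> \<Theta>))"
    using Suc.IH bs by (subst MidSwap_assoc) (simp_all add: TensA_Comp')
  also have "\<dots> = (\<one> (?G \<otimes> ?g) \<boxtimes> MidSwap C ?D ?T ?d ?t) \<bullet> ((\<one> ?G \<boxtimes> \<one> ?g) \<boxtimes> ?c \<Delta> \<Theta> \<boxtimes> ?b \<Delta> \<Theta>) \<bullet>
      MidSwap C ?G (ctens \<tau> n (\<Delta> \<union> \<Theta>)) ?g (bobj (\<tau> n) (n \<in> \<Delta> \<union> \<Theta>)) \<bullet> (?c \<Gamma> (\<Delta> \<union> \<Theta>) \<boxtimes> ?b \<Gamma> (\<Delta> \<union> \<Theta>))"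
    by (subst Comp_left[OF MidSwap_nat]) simp_all
  finally show ?case by (simp add: TensA_Comp_left)
qed

lemma bcounit_typ' [simp]:
  assumes "\<Gamma> \<subseteq> B"
  shows "bcounit (e n) (n \<in> \<Gamma>) \<in> Arr C" "Dom C (bcounit (e n) (n \<in> \<Gamma>)) = bobj (\<tau> n) (n \<in> \<Gamma>)"
    "Cod C (bcounit (e n) (n \<in> \<Gamma>)) = \<I>"
  using bcounit_typ[where V = "\<tau> n" and b = "n \<in> \<Gamma>" and e = "e n" and d = "d n"] assms B[of n] by auto

lemma ccounit_typ [simp]:
  assumes "\<Gamma> \<subseteq> B"
  shows "ccounit e n \<Gamma> \<in> Arr C" "Dom C (ccounit e n \<Gamma>) = ctens \<tau> n \<Gamma>" "Cod C (ccounit e n \<Gamma>) = \<I>"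
  using assms by (induction n) simp_all

lemma ccounit:
  assumes [simp]: "\<Gamma> \<subseteq> B" and "\<Gamma> \<subseteq> \<Delta>"
  shows "\<l> (ctens \<tau> n \<Delta>) \<bullet> (ccounit e n \<Gamma> \<boxtimes> \<one> (ctens \<tau> n \<Delta>)) \<bullet> csplit \<tau> d n \<Gamma> \<Delta> = \<one> (ctens \<tau> n \<Delta>)"
proof (induction n)
  case 0
  then show ?case by simp
next
  case (Suc n)
  have [simp]: "\<Gamma> \<inter> \<Delta> \<subseteq> B" "\<Gamma> \<union> \<Delta> = \<Delta>" "n \<in> \<Gamma> \<or> n \<in> \<Delta> \<longleftrightarrow> n \<in> \<Delta>"
    using assms by blast+
  let ?D = "ctens \<tau> n \<Delta>" and ?d = "bobj (\<tau> n) (n \<in> \<Delta>)" and ?G = "ctens \<tau> n \<Gamma>" and ?g = "bobj (\<tau> n) (n \<in> \<Gamma>)"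
  let ?k = "ccounit e n \<Gamma>" and ?b = "bcounit (e n) (n \<in> \<Gamma>)"
  have bc: "\<l> ?d \<bullet> (?b \<boxtimes> \<one> ?d) \<bullet> bsplit (\<tau> n) (d n) (n \<in> \<Gamma>) (n \<in> \<Delta>) = \<one> ?d"
    by (rule bcounit[OF \<tau>]) (use assms B in blast)+
  have "\<l> (?D \<otimes> ?d) \<bullet> ((\<l> \<I> \<bullet> (?k \<boxtimes> ?b)) \<boxtimes> \<one> (?D \<otimes> ?d)) \<bullet> MidSwap C ?G ?D ?g ?d
    = \<l> (?D \<otimes> ?d) \<bullet> (\<l> \<I> \<boxtimes> \<one> (?D \<otimes> ?d)) \<bullet> ((?k \<boxtimes> ?b) \<boxtimes> \<one> ?D \<boxtimes> \<one> ?d) \<bullet> MidSwap C ?G ?D ?g ?d"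
    by (simp add: TensA_Comp_left)
  also have "\<dots> = \<l> (?D \<otimes> ?d) \<bullet> (\<l> \<I> \<boxtimes> \<one> (?D \<otimes> ?d)) \<bullet> MidSwap C \<I> ?D \<I> ?d \<bullet> ((?k \<boxtimes> \<one> ?D) \<boxtimes> ?b \<boxtimes> \<one> ?d)"
    by (subst MidSwap_nat) (simp_all del: TensA_Ident)
  also have "\<dots> = (\<l> ?D \<bullet> (?k \<boxtimes> \<one> ?D)) \<boxtimes> (\<l> ?d \<bullet> (?b \<boxtimes> \<one> ?d))"
    using arg_cong[OF MidSwap_unit[of ?D ?d], of "\<lambda>f. f \<bullet> ((?k \<boxtimes> \<one> ?D) \<boxtimes> ?b \<boxtimes> \<one> ?d)"]
    by (simp add: TensA_Comp')
  finally have "(\<l> (?D \<otimes> ?d) \<bullet> ((\<l> \<I> \<bullet> (?k \<boxtimes> ?b)) \<boxtimes> \<one> (?D \<otimes> ?d)) \<bullet> MidSwap C ?G ?D ?g ?d) \<bullet>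
      (csplit \<tau> d n \<Gamma> \<Delta> \<boxtimes> bsplit (\<tau> n) (d n) (n \<in> \<Gamma>) (n \<in> \<Delta>)) =
      ((\<l> ?D \<bullet> (?k \<boxtimes> \<one> ?D)) \<boxtimes> (\<l> ?d \<bullet> (?b \<boxtimes> \<one> ?d))) \<bullet>
      (csplit \<tau> d n \<Gamma> \<Delta> \<boxtimes> bsplit (\<tau> n) (d n) (n \<in> \<Gamma>) (n \<in> \<Delta>))" by simp
  then show ?case using Suc.IH bc by (simp add: TensA_Comp')
qed

lemma cctxt_ok: "ctxt_ok (cctxt \<tau> e d B n)"
  unfolding ctxt_ok_def cctxt_def
  using csplit_iso csplit_assoc csplit_symm ccounit[of "{}"]
  by (auto simp: Hom_def)

lemma ctens_single: "n \<le> i \<Longrightarrow> ctens \<tau> n {i} = ctens \<tau> n {}"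
  by (induction n) auto

lemma csplit_single: "n \<le> i \<Longrightarrow> csplit \<tau> d n {i} {i} = csplit \<tau> d n {} {}"
  by (induction n) (auto simp: ctens_single)

lemma ccounit_single: "n \<le> i \<Longrightarrow> ccounit e n {i} = ccounit e n {}"
  by (induction n) auto

lemma ccounit_iso: "iso (ccounit e n {})"
  by (induction n) (auto intro!: iso_Comp simp: bcounit_def)

lemma cproj_typ:
  "i < n \<Longrightarrow> iso (cproj \<tau> e n i) \<and> Dom C (cproj \<tau> e n i) = ctens \<tau> n {i} \<and> Cod C (cproj \<tau> e n i) = \<tau> i"
  by (induction n) (auto simp: less_Suc_eq ctens_single ccounit_iso intro!: iso_Comp)

lemma cproj_comult_last:
  assumes "i \<in> B"
  shows "d i \<bullet> cproj \<tau> e (Suc i) i =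
    (cproj \<tau> e (Suc i) i \<boxtimes> cproj \<tau> e (Suc i) i) \<bullet> csplit \<tau> d (Suc i) {i} {i}"
proof -
  note [simp] = cocommutative_comonoid.comonoid_simps[OF B[OF \<open>i \<in> B\<close>]]
  let ?V = "\<tau> i"
  have b: "bsplit V D True True = D" for V D by (simp add: bsplit_def)
  let ?k = "ccounit e i {}" let ?E = "ctens \<tau> i {}" let ?c = "csplit \<tau> d i {} {}"
  have s [simp]: "ctens \<tau> i {i} = ?E" "csplit \<tau> d i {i} {i} = ?c" by (simp_all add: ctens_single csplit_single)
  have "(\<l> \<I> \<bullet> (?k \<boxtimes> ?k) \<bullet> ?c) = (\<l> \<I> \<bullet> (\<one> \<I> \<boxtimes> ?k)) \<bullet> (?k \<boxtimes> \<one> ?E) \<bullet> ?c"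
    by (simp add: TensA_Comp_left)
  also have "\<dots> = ?k \<bullet> \<l> ?E \<bullet> (?k \<boxtimes> \<one> ?E) \<bullet> ?c" by (subst LUnit_nat) simp_all
  also have "\<dots> = ?k" using ccounit[of "{}" "{}" i] by simp
  finally have kc: "\<l> \<I> \<bullet> (?k \<boxtimes> ?k) \<bullet> ?c = ?k" .
  have "((\<l> ?V \<bullet> (?k \<boxtimes> \<one> ?V)) \<boxtimes> (\<l> ?V \<bullet> (?k \<boxtimes> \<one> ?V))) \<bullet> MidSwap C ?E ?E ?V ?V \<bullet> (?c \<boxtimes> d i)
    = (\<l> ?V \<boxtimes> \<l> ?V) \<bullet> ((?k \<boxtimes> \<one> ?V) \<boxtimes> (?k \<boxtimes> \<one> ?V)) \<bullet> MidSwap C ?E ?E ?V ?V \<bullet> (?c \<boxtimes> d i)"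
    by (simp add: TensA_Comp_left)
  also have "\<dots> = (\<l> ?V \<boxtimes> \<l> ?V) \<bullet> MidSwap C \<I> \<I> ?V ?V \<bullet> ((?k \<boxtimes> ?k) \<boxtimes> (\<one> ?V \<boxtimes> \<one> ?V)) \<bullet> (?c \<boxtimes> d i)"
    by (subst Comp_left[OF MidSwap_nat]) (simp_all del: TensA_Ident)
  also have "\<dots> = \<l> (?V \<otimes> ?V) \<bullet> (\<l> \<I> \<boxtimes> \<one> (?V \<otimes> ?V)) \<bullet> (((?k \<boxtimes> ?k) \<bullet> ?c) \<boxtimes> d i)"
  proof -
    have "(\<l> ?V \<boxtimes> \<l> ?V) \<bullet> MidSwap C \<I> \<I> ?V ?V = \<l> (?V \<otimes> ?V) \<bullet> (\<l> \<I> \<boxtimes> \<one> (?V \<otimes> ?V))"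
    proof -
      obtain K v where v: "CDup K = {}"
        "\<And>j. j < length [\<I>, \<I>, ?V, ?V] \<Longrightarrow> el (v j) \<and> generic (v j) \<and> base (v j) = K
          \<and> supp (v j) = {j} \<and> ty (v j) = [\<I>, \<I>, ?V, ?V] ! j"
        by (rule distinct_vars[of "[\<I>, \<I>, ?V, ?V]"]) (simp, rule that, assumption, blast)
      note [simp] = v(1) v(2)[of 2, simplified] v(2)[of 3, simplified]
      have ok [simp]: "ctxt_ok K" using ctxt_ok_base[of "v 2"] by simp
      have "generic (app (Inv (\<l> \<I>) \<boxtimes> \<one> (?V \<otimes> ?V)) (star K \<otimes>\<otimes> v 2 \<otimes>\<otimes> v 3))"
        by (rule generic_app) (simp_all add: generic_star generic_pair)
      then have "generic ((star K \<otimes>\<otimes> star K) \<otimes>\<otimes> v 2 \<otimes>\<otimes> v 3)" by simp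
      then show ?thesis
        by (rule generic_ext) (simp_all add: Hom_def)
    qed
    from arg_cong[OF this, of "\<lambda>f. f \<bullet> ((?k \<boxtimes> ?k) \<boxtimes> (\<one> ?V \<boxtimes> \<one> ?V)) \<bullet> (?c \<boxtimes> d i)"]
    show ?thesis by (simp add: TensA_Comp')
  qed
  also have "\<dots> = \<l> (?V \<otimes> ?V) \<bullet> (\<one> \<I> \<boxtimes> d i) \<bullet> (?k \<boxtimes> \<one> ?V)"
    by (simp add: TensA_Comp' kc)
  also have "\<dots> = d i \<bullet> \<l> ?V \<bullet> (?k \<boxtimes> \<one> ?V)"
    by (subst Comp_left[OF LUnit_nat]) simp_all
  finally show ?thesis by (simp add: b)
qed

lemma cproj_comult:
  assumes "i \<in> B" "i < n"
  shows "d i \<bullet> cproj \<tau> e n i = (cproj \<tau> e n i \<boxtimes> cproj \<tau> e n i) \<bullet> csplit \<tau> d n {i} {i}"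
  using \<open>i < n\<close>
proof (induction n)
  case (Suc n)
  note [simp] = cocommutative_comonoid.comonoid_simps[OF B[OF \<open>i \<in> B\<close>]]
  note [simp] = \<open>i \<in> B\<close>
  let ?c = "csplit \<tau> d n {i} {i}" and ?V = "\<tau> i" and ?T = "ctens \<tau> n {i}"
  have b: "bsplit V D False False = Inv (\<l> \<I>)" for V D by (simp add: bsplit_def)
  show ?case
  proof (cases "i = n")
    case True
    then show ?thesis using cproj_comult_last[OF \<open>i \<in> B\<close>] by simp
  next
    case False
    then have "i < n" using Suc by simp
    note IH = Suc.IH[OF this] let ?v = "cproj \<tau> e n i"
    have [simp]: "?v \<in> Arr C" "Dom C ?v = ?T" "Cod C ?v = ?V" using cproj_typ[OF \<open>i < n\<close>] by auto
    have "((\<r> ?V \<bullet> (?v \<boxtimes> \<one> \<I>)) \<boxtimes> (\<r> ?V \<bullet> (?v \<boxtimes> \<one> \<I>))) \<bullet> MidSwap C ?T ?T \<I> \<I> \<bullet> (?c \<boxtimes> Inv (\<l> \<I>))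
      = (\<r> ?V \<boxtimes> \<r> ?V) \<bullet> ((?v \<boxtimes> \<one> \<I>) \<boxtimes> (?v \<boxtimes> \<one> \<I>)) \<bullet> MidSwap C ?T ?T \<I> \<I> \<bullet> (?c \<boxtimes> Inv (\<l> \<I>))"
      by (simp add: TensA_Comp_left)
    also have "\<dots> = (\<r> ?V \<boxtimes> \<r> ?V) \<bullet> MidSwap C ?V ?V \<I> \<I> \<bullet> ((?v \<boxtimes> ?v) \<boxtimes> (\<one> \<I> \<boxtimes> \<one> \<I>)) \<bullet> (?c \<boxtimes> Inv (\<l> \<I>))"
      by (subst Comp_left[OF MidSwap_nat]) (simp_all del: TensA_Ident)
    also have "\<dots> = ((\<r> ?V \<boxtimes> \<r> ?V) \<bullet> MidSwap C ?V ?V \<I> \<I> \<bullet> (\<one> (?V \<otimes> ?V) \<boxtimes> Inv (\<l> \<I>))) \<bullet> ((d i \<bullet> ?v) \<boxtimes> \<one> \<I>)"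
      by (simp add: TensA_Comp' IH)
    also have "(\<r> ?V \<boxtimes> \<r> ?V) \<bullet> MidSwap C ?V ?V \<I> \<I> \<bullet> (\<one> (?V \<otimes> ?V) \<boxtimes> Inv (\<l> \<I>)) = \<r> (?V \<otimes> ?V)"
    proof -
      obtain K v where v: "CDup K = {}"
        "\<And>j. j < length [?V, ?V] \<Longrightarrow> el (v j) \<and> generic (v j) \<and> base (v j) = K
          \<and> supp (v j) = {j} \<and> ty (v j) = [?V, ?V] ! j"
        by (rule distinct_vars[of "[?V, ?V]"]) (simp, rule that, assumption, blast)
      note [simp] = v(1) v(2)[of 0, simplified] v(2)[of 1, simplified]
      have ok [simp]: "ctxt_ok K" using ctxt_ok_base[of "v 0"] by simp
      have "generic ((v 0 \<otimes>\<otimes> v 1) \<otimes>\<otimes> star K)" by (simp add: generic_star generic_pair)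
      then show ?thesis by (rule generic_ext) (simp_all add: Hom_def)
    qed
    also have "\<r> (?V \<otimes> ?V) \<bullet> ((d i \<bullet> ?v) \<boxtimes> \<one> \<I>) = d i \<bullet> \<r> ?V \<bullet> (?v \<boxtimes> \<one> \<I>)"
      by (simp add: RUnit_nat)
    finally show ?thesis using False by (simp add: b)
  qed
qed simp

lemma cproj_counit:
  assumes "i \<in> B" "i < n"
  shows "e i \<bullet> cproj \<tau> e n i = ccounit e n {i}"
  using \<open>i < n\<close>
proof (induction n)
  case (Suc n)
  note [simp] = cocommutative_comonoid.comonoid_simps[OF B[OF \<open>i \<in> B\<close>]]
  show ?case
  proof (cases "i = n")
    case True
    have "\<l> \<I> \<bullet> (ccounit e n {} \<boxtimes> e i) = (\<l> \<I> \<bullet> (\<one> \<I> \<boxtimes> e i)) \<bullet> (ccounit e n {} \<boxtimes> \<one> (\<tau> i))"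
      by (simp add: TensA_Comp')
    also have "\<dots> = e i \<bullet> \<l> (\<tau> i) \<bullet> (ccounit e n {} \<boxtimes> \<one> (\<tau> i))"
      by (subst LUnit_nat) simp_all
    finally show ?thesis using True by (simp add: bcounit_def ccounit_single)
  next
    case False
    then have "i < n" using Suc by simp
    have [simp]: "cproj \<tau> e n i \<in> Arr C" "Dom C (cproj \<tau> e n i) = ctens \<tau> n {i}" "Cod C (cproj \<tau> e n i) = \<tau> i"
      using cproj_typ[OF \<open>i < n\<close>] by auto
    have "e i \<bullet> \<r> (\<tau> i) \<bullet> (cproj \<tau> e n i \<boxtimes> \<one> \<I>) = \<r> \<I> \<bullet> ((e i \<bullet> cproj \<tau> e n i) \<boxtimes> \<one> \<I>)"
      by (simp add: RUnit_nat)
    then show ?thesis using False Suc.IH[OF \<open>i < n\<close>] by (simp add: bcounit_def LUnit_eq_RUnit)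
  qed
qed simp

end

text \<open>Weakening: applying the counit \<open>e\<close> to \<open>p\<close> is invisible next to an element that still
contains the variables of \<open>p\<close>.\<close>

definition weak :: "('o, 'm) el \<Rightarrow> 'm \<Rightarrow> bool" where
  "weak p e \<longleftrightarrow> el p \<and> supp p \<subseteq> CDup (base p) \<and> e \<in> hom (ty p) \<I> \<and>
    (\<forall>t. el t \<longrightarrow> base t = base p \<longrightarrow> supp p \<subseteq> supp t \<longrightarrow> app (\<l> (ty t)) (app e p \<otimes>\<otimes> t) = t)"

text \<open>The clause on comonoids is conditional so that the same extensionality lemmas serve for
duplicable and for linear variables; for the latter \<open>e\<close> and \<open>d\<close> are arbitrary.\<close>

definition var :: "('o, 'm) ctxt \<Rightarrow> nat \<Rightarrow> 'o \<Rightarrow> 'm \<Rightarrow> 'm \<Rightarrow> ('o, 'm) el \<Rightarrow> bool" where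
  "var K i X e d t \<longleftrightarrow> el t \<and> base t = K \<and> supp t = {i} \<and> ty t = X \<and>
    (cocommutative_comonoid C X e d \<longrightarrow> i \<in> CDup K \<and> weak t e \<and> app d t = t \<otimes>\<otimes> t)"

lemma dup_vars:
  assumes "list_all (\<lambda>(X, e, d). X \<in> Obj C) Xs"
  shows "\<exists>K v. ctxt_ok K \<and> (\<forall>i < length Xs.
    generic (v i) \<and> var K i (fst (Xs ! i)) (fst (snd (Xs ! i))) (snd (snd (Xs ! i))) (v i))"
proof -
  define \<tau> where "\<tau> = (\<lambda>i. if i < length Xs then fst (Xs ! i) else \<I>)"
  let ?e = "\<lambda>i. fst (snd (Xs ! i))" and ?d = "\<lambda>i. snd (snd (Xs ! i))"
  let ?\<tau> = \<tau>
  define B where "B = {i. cocommutative_comonoid C (\<tau> i) (?e i) (?d i)}"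
  let ?B = B
  let ?K = "cctxt ?\<tau> ?e ?d ?B (length Xs)" and ?v = "cvar ?\<tau> ?e ?d ?B (length Xs)"
  have \<tau>: "?\<tau> i \<in> Obj C" for i using assms by (auto simp: list_all_length split_def \<tau>_def)
  have B: "\<And>i. i \<in> ?B \<Longrightarrow> cocommutative_comonoid C (?\<tau> i) (?e i) (?d i)" by (simp add: B_def)
  have ok: "ctxt_ok ?K" using cctxt_ok[OF \<tau> B] .
  have "generic (?v i) \<and> var ?K i (fst (Xs ! i)) (?e i) (?d i) (?v i)" if i: "i < length Xs" for i
  proof -
  have \<tau>i: "\<tau> i = fst (Xs ! i)" using i by (simp add: \<tau>_def)
  note [simp] = cproj_typ[OF \<tau> B i]
  have g: "generic (?v i)" using ok
    by (simp add: generic_def el_def cvar_def) (simp add: cctxt_def)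
  have el: "el (?v i)" using g by (simp add: generic_def)
  have t: "ty (?v i) = fst (Xs ! i)" using \<tau>i by (simp add: cvar_def ty_def)
  have "i \<in> CDup ?K \<and> weak (?v i) (?e i) \<and> app (?d i) (?v i) = ?v i \<otimes>\<otimes> ?v i"
    if co: "cocommutative_comonoid C (fst (Xs ! i)) (?e i) (?d i)"
  proof (intro conjI)
    have iB: "i \<in> ?B" using \<tau>i co by (simp add: B_def)
    show "i \<in> CDup ?K" using iB by (simp add: cctxt_def)
    show "app (?d i) (?v i) = ?v i \<otimes>\<otimes> ?v i"
      using cproj_comult[OF \<tau> B iB i] by (simp add: app_def pair_def cvar_def) (simp add: cctxt_def)
    show "weak (?v i) (?e i)"
      unfolding weak_def
    proof (intro conjI allI impI)
      show "supp (?v i) \<subseteq> CDup (base (?v i))" using iB by (simp add: cctxt_def cvar_def)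
      show "?e i \<in> hom (ty (?v i)) \<I>" using co t by (simp add: cocommutative_comonoid.counit_Hom)
      fix s assume s: "el s" "base s = base (?v i)" "supp (?v i) \<subseteq> supp s"
      let ?T = "ctens ?\<tau> (length Xs)" and ?w = "ccounit ?e (length Xs) {i}"
      let ?c = "csplit ?\<tau> ?d (length Xs) {i} (supp s)"
      have si: "i \<in> supp s" using s by (simp add: cvar_def)
      then have u: "insert i (supp s) = supp s" by blast
      have a: "arrow s \<in> Arr C" "Dom C (arrow s) = ?T (supp s)" "Cod C (arrow s) = ty s"
        using s by (simp_all add: el_facts) (simp add: cvar_def cctxt_def)
      have iB': "{i} \<subseteq> ?B" "{i} \<inter> supp s \<subseteq> ?B" using iB by auto
      note w = ccounit_typ[OF \<tau> B iB'(1), where n = "length Xs"]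
      note c = csplit_typ[OF \<tau> B iB'(2), where n = "length Xs"]
      have [simp]: "?T (supp s) \<in> Obj C" using a(1,2) by (metis Obj_Dom)
      have "\<l> (ty s) \<bullet> (?w \<boxtimes> arrow s) \<bullet> ?c
          = (\<l> (ty s) \<bullet> (\<one> \<I> \<boxtimes> arrow s)) \<bullet> (?w \<boxtimes> \<one> (?T (supp s))) \<bullet> ?c"
        using a w c s u by (simp add: TensA_Comp_left)
      also have "\<dots> = arrow s \<bullet> \<l> (?T (supp s)) \<bullet> (?w \<boxtimes> \<one> (?T (supp s))) \<bullet> ?c"
        using a w c s u by (subst LUnit_nat) simp_all
      also have "\<dots> = arrow s" using a si by (subst ccounit[OF \<tau> B iB'(1)]) simp_all
      finally have "\<l> (ty s) \<bullet> (?w \<boxtimes> arrow s) \<bullet> ?c = arrow s" .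
      moreover have "app (?e i) (?v i) = El ?K {i} ?w"
        using cproj_counit[OF \<tau> B iB i] by (simp add: app_def cvar_def)
      moreover have "base s = ?K" using s by (simp add: cvar_def)
      ultimately show "app (\<l> (ty s)) (app (?e i) (?v i) \<otimes>\<otimes> s) = s"
        using u by (cases s) (simp add: app_def pair_def, simp add: cctxt_def)
    qed (fact el)
  qed
  then show ?thesis using g el t by (simp add: var_def) (simp add: cvar_def)
  qed
  then show ?thesis using ok by blast
qed

end


subsection \<open>Extensionality\<close>

context symmetric_monoidal_category
begin

text \<open>Two maps agree if they agree on a term \<open>t\<close> built from distinct variables, where every variable
whose type is a comonoid may be duplicated and discarded.\<close>

lemma ext_vars:
  assumes "list_all (\<lambda>(X, e, d). X \<in> Obj C) Xs"
    and "\<And>K v. ctxt_ok K \<Longrightarrow> (\<And>i. i < length Xs \<Longrightarrow>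
      generic (v i) \<and> var K i (fst (Xs ! i)) (fst (snd (Xs ! i))) (snd (snd (Xs ! i))) (v i)) \<Longrightarrow>
      generic (t v) \<and> f \<in> hom (ty (t v)) Y \<and> g \<in> hom (ty (t v)) Y \<and> app f (t v) = app g (t v)"
  shows "f = g"
proof -
  obtain K v where "ctxt_ok K" "\<forall>i < length Xs.
    generic (v i) \<and> var K i (fst (Xs ! i)) (fst (snd (Xs ! i))) (snd (snd (Xs ! i))) (v i)"
    using dup_vars[OF assms(1)] by blast
  then show ?thesis using assms(2)[of K v] generic_ext by blast
qed

lemma varD: "var K i X e d t \<Longrightarrow> el t \<and> base t = K \<and> supp t = {i} \<and> ty t = X"
  by (simp add: var_def)

lemma ext1:
  assumes "f \<in> hom X Z" "g \<in> hom X Z" "X \<in> Obj C"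
    and "\<And>K x. ctxt_ok K \<Longrightarrow> var K 0 X e d x \<Longrightarrow> app f x = app g x"
  shows "f = g"
proof (rule ext_vars[of "[(X, e, d)]" "\<lambda>v. v 0"])
  fix K v assume K: "ctxt_ok K" and v: "\<And>i. i < length [(X, e, d)] \<Longrightarrow> generic (v i) \<and>
    var K i (fst ([(X, e, d)] ! i)) (fst (snd ([(X, e, d)] ! i))) (snd (snd ([(X, e, d)] ! i))) (v i)"
  note v = v[of 0, simplified]
  note [simp] = v varD[OF v[THEN conjunct2]]
  show "generic (v 0) \<and> f \<in> hom (ty (v 0)) Z \<and> g \<in> hom (ty (v 0)) Z \<and> app f (v 0) = app g (v 0)"
    using assms K by simp
qed (use assms in simp)

lemma ext2:
  assumes "f \<in> hom (X \<otimes> Y) Z" "g \<in> hom (X \<otimes> Y) Z" "X \<in> Obj C" "Y \<in> Obj C"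
    and "\<And>K x y. ctxt_ok K \<Longrightarrow> var K 0 X e d x \<Longrightarrow> var K 1 Y e' d' y \<Longrightarrow> app f (x \<otimes>\<otimes> y) = app g (x \<otimes>\<otimes> y)"
  shows "f = g"
proof (rule ext_vars[of "[(X, e, d), (Y, e', d')]" "\<lambda>v. v 0 \<otimes>\<otimes> v 1"])
  fix K v assume K: "ctxt_ok K" and v: "\<And>i. i < length [(X, e, d), (Y, e', d')] \<Longrightarrow> generic (v i) \<and>
    var K i (fst ([(X, e, d), (Y, e', d')] ! i)) (fst (snd ([(X, e, d), (Y, e', d')] ! i)))
      (snd (snd ([(X, e, d), (Y, e', d')] ! i))) (v i)"
  note v = v[of 0, simplified] v[of 1, simplified]
  note [simp] = v v[THEN conjunct2, THEN varD]
  show "generic (v 0 \<otimes>\<otimes> v 1) \<and> f \<in> hom (ty (v 0 \<otimes>\<otimes> v 1)) Z \<and> g \<in> hom (ty (v 0 \<otimes>\<otimes> v 1)) Z \<and>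
      app f (v 0 \<otimes>\<otimes> v 1) = app g (v 0 \<otimes>\<otimes> v 1)"
    using assms K by (simp add: generic_pair)
qed (use assms in simp)

lemma ext3:
  assumes "f \<in> hom ((X \<otimes> Y) \<otimes> W) Z" "g \<in> hom ((X \<otimes> Y) \<otimes> W) Z" "X \<in> Obj C" "Y \<in> Obj C" "W \<in> Obj C"
    and "\<And>K x y w. ctxt_ok K \<Longrightarrow> var K 0 X e d x \<Longrightarrow> var K 1 Y e' d' y \<Longrightarrow> var K 2 W e'' d'' w \<Longrightarrow>
      app f ((x \<otimes>\<otimes> y) \<otimes>\<otimes> w) = app g ((x \<otimes>\<otimes> y) \<otimes>\<otimes> w)"
  shows "f = g"
proof (rule ext_vars[of "[(X, e, d), (Y, e', d'), (W, e'', d'')]" "\<lambda>v. (v 0 \<otimes>\<otimes> v 1) \<otimes>\<otimes> v 2"])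
  fix K v assume K: "ctxt_ok K" and v: "\<And>i. i < length [(X, e, d), (Y, e', d'), (W, e'', d'')] \<Longrightarrow> generic (v i) \<and>
    var K i (fst ([(X, e, d), (Y, e', d'), (W, e'', d'')] ! i)) (fst (snd ([(X, e, d), (Y, e', d'), (W, e'', d'')] ! i)))
      (snd (snd ([(X, e, d), (Y, e', d'), (W, e'', d'')] ! i))) (v i)"
  note v = v[of 0, simplified] v[of 1, simplified] v[of 2, simplified]
  note [simp] = v v[THEN conjunct2, THEN varD]
  let ?t = "(v 0 \<otimes>\<otimes> v 1) \<otimes>\<otimes> v 2"
  show "generic ?t \<and> f \<in> hom (ty ?t) Z \<and> g \<in> hom (ty ?t) Z \<and> app f ?t = app g ?t"
    using assms K by (simp add: generic_pair)
qed (use assms in simp)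

lemma ext4:
  assumes "f \<in> hom (((X \<otimes> Y) \<otimes> W) \<otimes> V) Z" "g \<in> hom (((X \<otimes> Y) \<otimes> W) \<otimes> V) Z"
    "X \<in> Obj C" "Y \<in> Obj C" "W \<in> Obj C" "V \<in> Obj C"
    and "\<And>K x y w z. ctxt_ok K \<Longrightarrow> var K 0 X e d x \<Longrightarrow> var K 1 Y e' d' y \<Longrightarrow> var K 2 W e'' d'' w \<Longrightarrow>
      var K 3 V e3 d3 z \<Longrightarrow> app f (((x \<otimes>\<otimes> y) \<otimes>\<otimes> w) \<otimes>\<otimes> z) = app g (((x \<otimes>\<otimes> y) \<otimes>\<otimes> w) \<otimes>\<otimes> z)"
  shows "f = g"
proof (rule ext_vars[of "[(X, e, d), (Y, e', d'), (W, e'', d''), (V, e3, d3)]" "\<lambda>v. ((v 0 \<otimes>\<otimes> v 1) \<otimes>\<otimes> v 2) \<otimes>\<otimes> v 3"])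
  let ?Xs = "[(X, e, d), (Y, e', d'), (W, e'', d''), (V, e3, d3)]"
  fix K v assume K: "ctxt_ok K" and v: "\<And>i. i < length ?Xs \<Longrightarrow> generic (v i) \<and>
    var K i (fst (?Xs ! i)) (fst (snd (?Xs ! i))) (snd (snd (?Xs ! i))) (v i)"
  note v = v[of 0, simplified] v[of 1, simplified] v[of 2, simplified] v[of 3, simplified]
  note [simp] = v v[THEN conjunct2, THEN varD]
  let ?t = "((v 0 \<otimes>\<otimes> v 1) \<otimes>\<otimes> v 2) \<otimes>\<otimes> v 3"
  show "generic ?t \<and> f \<in> hom (ty ?t) Z \<and> g \<in> hom (ty ?t) Z \<and> app f ?t = app g ?t"
    using assms K by (simp add: generic_pair)
qed (use assms in simp)

lemma app_eq:
  "g \<bullet> f = h \<Longrightarrow> el t \<Longrightarrow> f \<in> Arr C \<Longrightarrow> g \<in> Arr C \<Longrightarrow> Dom C f = ty t \<Longrightarrow> Dom C g = Cod C f \<Longrightarrow>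
    app g (app f t) = app h t"
  using app_Comp by metis

lemma weak_LUnit [simp]:
  "weak p e \<Longrightarrow> el t \<Longrightarrow> base t = base p \<Longrightarrow> supp p \<subseteq> supp t \<Longrightarrow> X = ty t \<Longrightarrow>
    app (\<l> X) (app e p \<otimes>\<otimes> t) = t"
  by (simp add: weak_def)

lemma weakD: "weak p e \<Longrightarrow> el p \<and> supp p \<subseteq> CDup (base p) \<and> e \<in> Arr C \<and> Dom C e = ty p \<and> Cod C e = \<I>"
  by (simp add: weak_def Hom_def)

lemma weak_RUnit [simp]:
  assumes w: "weak p e" and [simp]: "el t" "base t = base p" and s: "supp p \<subseteq> supp t" "X = ty t"
  shows "app (\<r> X) (t \<otimes>\<otimes> app e p) = t"
proof -
  note [simp] = weakD[OF w]
  have [simp]: "supp t \<inter> supp p \<subseteq> CDup (base p)" "supp p \<inter> supp t \<subseteq> CDup (base p)"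
    using weakD[OF w] by blast+
  have "app (\<r> X) (t \<otimes>\<otimes> app e p) = app (\<l> X) (app e p \<otimes>\<otimes> t)"
    using s by (simp flip: LUnit_Symm)
  then show ?thesis using w s by simp
qed

lemma LUnit_twice:
  assumes [simp]: "X \<in> Obj C"
  shows "\<l> X \<bullet> (\<l> \<I> \<boxtimes> \<one> X) = \<l> X \<bullet> (\<one> \<I> \<boxtimes> \<l> X) \<bullet> \<a> \<I> \<I> X"
  by (simp add: triangle LUnit_eq_RUnit)

lemma weak_twice [simp]:
  assumes w: "weak p e" "weak q e'" and [simp]: "el t" "base t = base p" "base q = base p"
    and s: "supp p \<subseteq> supp t" "supp q \<subseteq> supp t" "X = ty t"
  shows "app (\<r> X) (t \<otimes>\<otimes> app (\<l> \<I>) (app e p \<otimes>\<otimes> app e' q)) = t"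
proof -
  note [simp] = weakD[OF w(1)] weakD[OF w(2)]
  have sub: "supp p \<subseteq> CDup (base p)" "supp q \<subseteq> CDup (base p)"
    using weakD[OF w(1)] weakD[OF w(2)] by auto
  then have [simp]: "supp t \<inter> supp p \<subseteq> CDup (base p)" "supp p \<inter> supp t \<subseteq> CDup (base p)"
    "supp t \<inter> supp q \<subseteq> CDup (base p)" "supp q \<inter> supp t \<subseteq> CDup (base p)" "supp p \<inter> supp q \<subseteq> CDup (base p)"
    "(supp p \<union> supp q) \<inter> supp t \<subseteq> CDup (base p)"
    "supp t \<inter> (supp p \<union> supp q) \<subseteq> CDup (base p)"
    "supp p \<inter> (supp q \<union> supp t) \<subseteq> CDup (base p)" by blast+
  have "app (\<l> X) (app (\<l> \<I>) (app e p \<otimes>\<otimes> app e' q) \<otimes>\<otimes> t) =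
     app (\<l> X \<bullet> (\<l> \<I> \<boxtimes> \<one> X)) ((app e p \<otimes>\<otimes> app e' q) \<otimes>\<otimes> t)"
    using s by simp
  also have "\<dots> = t" using w s by (subst LUnit_twice) simp_all
  finally have 1: "app (\<l> X) (app (\<l> \<I>) (app e p \<otimes>\<otimes> app e' q) \<otimes>\<otimes> t) = t" .
  have "app (\<r> X) (t \<otimes>\<otimes> app (\<l> \<I>) (app e p \<otimes>\<otimes> app e' q)) =
      app (\<l> X) (app (\<l> \<I>) (app e p \<otimes>\<otimes> app e' q) \<otimes>\<otimes> t)"
    using s by (simp flip: LUnit_Symm)
  then show ?thesis using 1 by simp
qed

end


subsection \<open>Linear combinations of elements\<close>

definition (in linear_symmetric_monoidal_category) plus :: "('o, 'm) el \<Rightarrow> ('o, 'm) el \<Rightarrow> ('o, 'm) el" (infixl "\<oplus>\<oplus>" 65) where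
  "t \<oplus>\<oplus> s = El (base t) (supp t) (arrow t \<oplus> arrow s)"

definition (in linear_symmetric_monoidal_category) zero :: "('o, 'm) ctxt \<Rightarrow> nat set \<Rightarrow> 'o \<Rightarrow> ('o, 'm) el" where
  "zero K \<Gamma> X = El K \<Gamma> (\<zero> (CObj K \<Gamma>) X)"

context linear_symmetric_monoidal_category
begin

lemma typ_Add [simp]:
  assumes "f \<in> Arr C" "g \<in> Arr C" "Dom C f = Dom C g" "Cod C f = Cod C g"
  shows "f \<oplus> g \<in> Arr C" "Dom C (f \<oplus> g) = Dom C g" "Cod C (f \<oplus> g) = Cod C g"
  using Add_Hom[of f "Dom C g" "Cod C g" g] assms by (auto simp: Hom_def)

lemma typ_Zero [simp]:
  assumes "X \<in> Obj C" "Y \<in> Obj C"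
  shows "\<zero> X Y \<in> Arr C" "Dom C (\<zero> X Y) = X" "Cod C (\<zero> X Y) = Y"
  using Zero_Hom[OF assms] by (auto simp: Hom_def)

lemma Comp_Add':
  assumes "f \<in> Arr C" "g \<in> Arr C" "Dom C f = Dom C g" "Cod C f = Cod C g" "h \<in> Arr C"
  shows "Dom C h = Cod C f \<Longrightarrow> h \<bullet> (f \<oplus> g) = (h \<bullet> f) \<oplus> (h \<bullet> g)"
    "Dom C f = Cod C h \<Longrightarrow> (f \<oplus> g) \<bullet> h = (f \<bullet> h) \<oplus> (g \<bullet> h)"
    "(f \<oplus> g) \<boxtimes> h = (f \<boxtimes> h) \<oplus> (g \<boxtimes> h)" "h \<boxtimes> (f \<oplus> g) = (h \<boxtimes> f) \<oplus> (h \<boxtimes> g)"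
  using assms by (auto intro!: Comp_Add Add_Comp Add_TensA TensA_Add simp: Hom_def)

lemma Comp_Zero' [simp]:
  assumes "h \<in> Arr C" "X \<in> Obj C" "Y \<in> Obj C"
  shows "Dom C h = Y \<Longrightarrow> h \<bullet> \<zero> X Y = \<zero> X (Cod C h)"
    "X = Cod C h \<Longrightarrow> \<zero> X Y \<bullet> h = \<zero> (Dom C h) Y"
    "\<zero> X Y \<boxtimes> h = \<zero> (X \<otimes> Dom C h) (Y \<otimes> Cod C h)" "h \<boxtimes> \<zero> X Y = \<zero> (Dom C h \<otimes> X) (Cod C h \<otimes> Y)"
  using assms by (auto intro!: Comp_Zero Zero_Comp Zero_TensA TensA_Zero simp: Hom_def)

lemma Zero_Add' [simp]:
  assumes "f \<in> Arr C"
  shows "X = Dom C f \<Longrightarrow> Y = Cod C f \<Longrightarrow> \<zero> X Y \<oplus> f = f" "X = Dom C f \<Longrightarrow> Y = Cod C f \<Longrightarrow> f \<oplus> \<zero> X Y = f"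
proof -
  show 1: "X = Dom C f \<Longrightarrow> Y = Cod C f \<Longrightarrow> \<zero> X Y \<oplus> f = f"
    using assms by (simp add: Zero_Add Hom_def)
  show "X = Dom C f \<Longrightarrow> Y = Cod C f \<Longrightarrow> f \<oplus> \<zero> X Y = f"
    using 1 assms Add_commute[of f X Y "\<zero> X Y"] by (simp add: Hom_def)
qed

lemma plus_simps [simp]: "base (t \<oplus>\<oplus> s) = base t" "supp (t \<oplus>\<oplus> s) = supp t" "base (zero K \<Gamma> X) = K" "supp (zero K \<Gamma> X) = \<Gamma>"
  by (simp_all add: plus_def zero_def)

lemma el_plus [simp]:
  assumes "el t" "el s" "base t = base s" "supp t = supp s" "ty t = ty s"
  shows "el (t \<oplus>\<oplus> s)" "ty (t \<oplus>\<oplus> s) = ty s"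
  using assms by (auto simp: el_def plus_def ty_def)

lemma el_zero [simp]:
  assumes "ctxt_ok K" "X \<in> Obj C"
  shows "el (zero K \<Gamma> X)" "ty (zero K \<Gamma> X) = X"
  using assms by (auto simp: el_def zero_def ty_def ctxt_facts)

lemma app_Add [simp]:
  "el t \<Longrightarrow> f \<in> Arr C \<Longrightarrow> g \<in> Arr C \<Longrightarrow> Dom C f = ty t \<Longrightarrow> Dom C g = ty t \<Longrightarrow> Cod C f = Cod C g \<Longrightarrow>
    app (f \<oplus> g) t = app f t \<oplus>\<oplus> app g t"
  by (simp add: app_def plus_def el_facts Comp_Add')

lemma app_plus [simp]:
  "el t \<Longrightarrow> el s \<Longrightarrow> base t = base s \<Longrightarrow> supp t = supp s \<Longrightarrow> ty t = ty s \<Longrightarrow> f \<in> Arr C \<Longrightarrow> Dom C f = ty t \<Longrightarrow>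
    app f (t \<oplus>\<oplus> s) = app f t \<oplus>\<oplus> app f s"
  by (simp add: app_def plus_def el_facts Comp_Add')

lemma pair_plus [simp]:
  assumes "el t" "el s" "base t = base s" "supp t = supp s" "ty t = ty s"
    "el r" "base r = base s"
  shows "supp r \<inter> supp s \<subseteq> CDup (base s) \<Longrightarrow> r \<otimes>\<otimes> (t \<oplus>\<oplus> s) = r \<otimes>\<otimes> t \<oplus>\<oplus> r \<otimes>\<otimes> s"
    "supp s \<inter> supp r \<subseteq> CDup (base s) \<Longrightarrow> (t \<oplus>\<oplus> s) \<otimes>\<otimes> r = t \<otimes>\<otimes> r \<oplus>\<oplus> s \<otimes>\<otimes> r"
  using assms by (simp_all add: pair_def plus_def el_facts ctxt_facts Comp_Add')

lemma app_Zero [simp]: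
  "el t \<Longrightarrow> X = ty t \<Longrightarrow> Y \<in> Obj C \<Longrightarrow> app (\<zero> X Y) t = zero (base t) (supp t) Y"
  by (simp add: app_def zero_def el_facts)

lemma app_zero [simp]:
  "ctxt_ok K \<Longrightarrow> f \<in> Arr C \<Longrightarrow> Dom C f = X \<Longrightarrow> app f (zero K \<Gamma> X) = zero K \<Gamma> (Cod C f)"
  by (auto simp: app_def zero_def ctxt_facts)

lemma pair_zero [simp]:
  assumes "el t" "base t = K" "X \<in> Obj C"
  shows "supp t \<inter> \<Gamma> \<subseteq> CDup K \<Longrightarrow> t \<otimes>\<otimes> zero K \<Gamma> X = zero K (supp t \<union> \<Gamma>) (ty t \<otimes> X)"
    "\<Gamma> \<inter> supp t \<subseteq> CDup K \<Longrightarrow> zero K \<Gamma> X \<otimes>\<otimes> t = zero K (\<Gamma> \<union> supp t) (X \<otimes> ty t)"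
  using assms by (auto simp: pair_def zero_def el_facts ctxt_facts)

lemma plus_zero [simp]:
  "el t \<Longrightarrow> K = base t \<Longrightarrow> \<Gamma> = supp t \<Longrightarrow> X = ty t \<Longrightarrow> zero K \<Gamma> X \<oplus>\<oplus> t = t"
  "el t \<Longrightarrow> K = base t \<Longrightarrow> \<Gamma> = supp t \<Longrightarrow> X = ty t \<Longrightarrow> t \<oplus>\<oplus> zero K \<Gamma> X = t"
  by (simp_all add: plus_def zero_def el_facts)

lemma plus_commute:
  "el t \<Longrightarrow> el s \<Longrightarrow> base t = base s \<Longrightarrow> supp t = supp s \<Longrightarrow> ty t = ty s \<Longrightarrow> t \<oplus>\<oplus> s = s \<oplus>\<oplus> t"
  using Add_commute[of "arrow t" "CObj (base s) (supp s)" "ty s" "arrow s"]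
  by (simp add: plus_def el_facts Hom_def)

lemma plus_assoc:
  "el t \<Longrightarrow> el s \<Longrightarrow> el r \<Longrightarrow> base t = base r \<Longrightarrow> supp t = supp r \<Longrightarrow> ty t = ty r \<Longrightarrow>
    base s = base r \<Longrightarrow> supp s = supp r \<Longrightarrow> ty s = ty r \<Longrightarrow> (t \<oplus>\<oplus> s) \<oplus>\<oplus> r = t \<oplus>\<oplus> (s \<oplus>\<oplus> r)"
  using Add_assoc[of "arrow t" "CObj (base r) (supp r)" "ty r" "arrow s" "arrow r"]
  by (simp add: plus_def el_facts Hom_def)

lemma plus_left_commute:
  assumes "el t" "el s" "el r" "base t = base r" "supp t = supp r" "ty t = ty r"
    "base s = base r" "supp s = supp r" "ty s = ty r"
  shows "t \<oplus>\<oplus> (s \<oplus>\<oplus> r) = s \<oplus>\<oplus> (t \<oplus>\<oplus> r)"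
  using plus_assoc[of t s r] plus_assoc[of s t r] plus_commute[of t s] assms by simp

lemmas plus_ac = plus_assoc plus_commute plus_left_commute

end


section \<open>Differential comonoids\<close>

context symmetric_monoidal_category
begin

lemma app_RSwap [simp]:
  assumes [simp]: "el t" "el s" "el r" "base t = base r" "base s = base r"
    "supp t \<inter> supp s \<subseteq> CDup (base r)" "supp t \<inter> supp r \<subseteq> CDup (base r)" "supp s \<inter> supp r \<subseteq> CDup (base r)"
    "X = ty t" "Y = ty s" "Z = ty r"
  shows "app (RSwap X Y Z) ((t \<otimes>\<otimes> s) \<otimes>\<otimes> r) = (t \<otimes>\<otimes> r) \<otimes>\<otimes> s"
proof -
  have [simp]: "supp r \<inter> supp s \<subseteq> CDup (base r)" "(supp t \<union> supp s) \<inter> supp r \<subseteq> CDup (base r)"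
    "supp t \<inter> (supp s \<union> supp r) \<subseteq> CDup (base r)"
    using assms(6-8) by blast+
  show ?thesis by (simp add: RSwap_def)
qed

lemma weak_pair [simp]:
  assumes w: "weak p e" and [simp]: "el t" "el s" "base t = base p" "base s = base p"
    and ts: "supp t \<inter> supp s \<subseteq> CDup (base p)" and s: "supp p \<subseteq> supp s" and X: "X = ty t"
  shows "app (\<r> X) (t \<otimes>\<otimes> app e p) \<otimes>\<otimes> s = t \<otimes>\<otimes> s" "app (\<l> X) (app e p \<otimes>\<otimes> t) \<otimes>\<otimes> s = t \<otimes>\<otimes> s"
    "s \<otimes>\<otimes> app (\<l> X) (app e p \<otimes>\<otimes> t) = s \<otimes>\<otimes> t" "s \<otimes>\<otimes> app (\<r> X) (t \<otimes>\<otimes> app e p) = s \<otimes>\<otimes> t"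
proof -
  note [simp] = weakD[OF w] ts s
  have [simp]: "supp t \<inter> supp p \<subseteq> CDup (base p)" "supp p \<inter> supp t \<subseteq> CDup (base p)" "supp p \<inter> supp s \<subseteq> CDup (base p)"
    "supp s \<inter> supp p \<subseteq> CDup (base p)" "supp s \<inter> supp t \<subseteq> CDup (base p)"
    "(supp t \<union> supp p) \<inter> supp s \<subseteq> CDup (base p)" "supp s \<inter> (supp p \<union> supp t) \<subseteq> CDup (base p)"
    "supp t \<inter> (supp p \<union> supp s) \<subseteq> CDup (base p)" "(supp s \<union> supp p) \<inter> supp t \<subseteq> CDup (base p)"
    using weakD[OF w] ts by blast+
  have rl: "app (\<l> X) (app e p \<otimes>\<otimes> t) = app (\<r> X) (t \<otimes>\<otimes> app e p)"
    using X by (simp flip: LUnit_Symm)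
  have "app (\<r> (ty t) \<boxtimes> \<one> (ty s)) ((t \<otimes>\<otimes> app e p) \<otimes>\<otimes> s) = t \<otimes>\<otimes> s"
    using w by (subst triangle[symmetric]) simp_all
  then show 1: "app (\<r> X) (t \<otimes>\<otimes> app e p) \<otimes>\<otimes> s = t \<otimes>\<otimes> s" using X by simp
  then show "app (\<l> X) (app e p \<otimes>\<otimes> t) \<otimes>\<otimes> s = t \<otimes>\<otimes> s" by (simp only: rl)
  have "app (\<one> (ty s) \<boxtimes> \<l> (ty t)) (app (\<a> (ty s) \<I> (ty t)) ((s \<otimes>\<otimes> app e p) \<otimes>\<otimes> t)) = app (\<r> (ty s) \<boxtimes> \<one> (ty t)) ((s \<otimes>\<otimes> app e p) \<otimes>\<otimes> t)"
    by (rule app_eq[OF triangle]) (simp_all add: Int_Un_distrib2)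
  also have "app (\<r> (ty s) \<boxtimes> \<one> (ty t)) ((s \<otimes>\<otimes> app e p) \<otimes>\<otimes> t) = app (\<r> (ty s)) (s \<otimes>\<otimes> app e p) \<otimes>\<otimes> t"
    by (simp add: Int_Un_distrib2 del: weak_RUnit)
  also have "\<dots> = s \<otimes>\<otimes> t" using w by simp
  finally show 2: "s \<otimes>\<otimes> app (\<l> X) (app e p \<otimes>\<otimes> t) = s \<otimes>\<otimes> t" using X by simp
  then show "s \<otimes>\<otimes> app (\<r> X) (t \<otimes>\<otimes> app e p) = s \<otimes>\<otimes> t" by (simp only: rl)
qed

lemma commuting_action_RSwap:
  "commuting_action C X A \<alpha> \<longleftrightarrow> A \<in> Obj C \<and> \<alpha> \<in> hom (A \<otimes> X) A \<and>
    \<alpha> \<bullet> (\<alpha> \<boxtimes> \<one> X) \<bullet> RSwap A X X = \<alpha> \<bullet> (\<alpha> \<boxtimes> \<one> X)"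
  by (simp add: commuting_action_def RSwap_def)

lemma commuting_app:
  assumes \<alpha>: "commuting_action C X A \<alpha>" and X: "X \<in> Obj C"
    and [simp]: "el t" "el x" "el y" "base t = base y" "base x = base y"
    "supp t \<inter> supp x \<subseteq> CDup (base y)" "supp t \<inter> supp y \<subseteq> CDup (base y)" "supp x \<inter> supp y \<subseteq> CDup (base y)"
    "ty t = A" "ty x = X" "ty y = X"
  shows "app \<alpha> (app \<alpha> (t \<otimes>\<otimes> x) \<otimes>\<otimes> y) = app \<alpha> (app \<alpha> (t \<otimes>\<otimes> y) \<otimes>\<otimes> x)"
proof -
  have [simp]: "A \<in> Obj C" "\<alpha> \<in> Arr C" "Dom C \<alpha> = A \<otimes> X" "Cod C \<alpha> = A" "X \<in> Obj C"
    and eq: "\<alpha> \<bullet> (\<alpha> \<boxtimes> \<one> X) \<bullet> RSwap A X X = \<alpha> \<bullet> (\<alpha> \<boxtimes> \<one> X)"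
    using \<alpha> X by (auto simp: commuting_action_RSwap Hom_def)
  have [simp]: "supp y \<inter> supp x \<subseteq> CDup (base y)" "(supp t \<union> supp x) \<inter> supp y \<subseteq> CDup (base y)"
    "(supp t \<union> supp y) \<inter> supp x \<subseteq> CDup (base y)"
    using assms(8-10) by blast+
  have "app \<alpha> (app \<alpha> (t \<otimes>\<otimes> y) \<otimes>\<otimes> x) = app (\<alpha> \<bullet> (\<alpha> \<boxtimes> \<one> X) \<bullet> RSwap A X X) ((t \<otimes>\<otimes> x) \<otimes>\<otimes> y)" by simp
  also have "\<dots> = app \<alpha> (app \<alpha> (t \<otimes>\<otimes> x) \<otimes>\<otimes> y)" unfolding eq by simp
  finally show ?thesis by simp
qed

end

lemma (in symmetric_monoidal_category) ext0:
  assumes "f \<in> hom \<I> Z" "g \<in> hom \<I> Z" "\<And>K. ctxt_ok K \<Longrightarrow> app f (star K) = app g (star K)"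
  shows "f = g"
proof -
  let ?K = "lctxt (\<lambda>_. \<I>) 0"
  have K: "ctxt_ok ?K" by (rule lctxt_ok) simp
  have "generic (star ?K)" using K by (simp add: generic_def) (simp add: star_def lctxt_def)
  then show ?thesis using assms K by (intro generic_ext[of "star ?K" f Z g]) auto
qed

context linear_symmetric_monoidal_category
begin

text \<open>The Leibniz rule \<open>(a \<otimes> b) \<cdot> x = a \<otimes> (b \<cdot> x) + (a \<cdot> x) \<otimes> b\<close>.\<close>

definition tens_act :: "'o \<Rightarrow> 'm \<Rightarrow> 'o \<Rightarrow> 'm \<Rightarrow> 'o \<Rightarrow> 'm" where
  "tens_act A \<alpha> B \<beta> X = (\<one> A \<boxtimes> \<beta>) \<bullet> \<a> A B X \<oplus> (\<alpha> \<boxtimes> \<one> B) \<bullet> RSwap A B X"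

lemma commuting_actionD:
  assumes "commuting_action C X A \<alpha>"
  shows "A \<in> Obj C" "\<alpha> \<in> Arr C" "Dom C \<alpha> = A \<otimes> X" "Cod C \<alpha> = A"
  using assms by (auto simp: commuting_action_def Hom_def)

lemma tens_act_typ:
  assumes "A \<in> Obj C" "\<alpha> \<in> Arr C" "Dom C \<alpha> = A \<otimes> X" "Cod C \<alpha> = A"
    "B \<in> Obj C" "\<beta> \<in> Arr C" "Dom C \<beta> = B \<otimes> X" "Cod C \<beta> = B" "X \<in> Obj C"
  shows "tens_act A \<alpha> B \<beta> X \<in> Arr C" "Dom C (tens_act A \<alpha> B \<beta> X) = (A \<otimes> B) \<otimes> X"
    "Cod C (tens_act A \<alpha> B \<beta> X) = A \<otimes> B"
  using assms by (auto simp: tens_act_def)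

lemma tens_act_commuting:
  assumes \<alpha>: "commuting_action C X A \<alpha>" and \<beta>: "commuting_action C X B \<beta>" and X [simp]: "X \<in> Obj C"
  shows "commuting_action C X (A \<otimes> B) (tens_act A \<alpha> B \<beta> X)"
proof -
  note [simp] = commuting_actionD[OF \<alpha>] commuting_actionD[OF \<beta>]
  let ?t = "tens_act A \<alpha> B \<beta> X"
  have [simp]: "?t \<in> Arr C" "Dom C ?t = (A \<otimes> B) \<otimes> X" "Cod C ?t = A \<otimes> B"
    by (simp_all add: tens_act_typ)
  have "?t \<bullet> (?t \<boxtimes> \<one> X) \<bullet> RSwap (A \<otimes> B) X X = ?t \<bullet> (?t \<boxtimes> \<one> X)"
  proof (rule ext4)
    fix K a b x y
    assume v: "var K 0 A (\<one> \<I>) (\<one> \<I>) a" "var K 1 B (\<one> \<I>) (\<one> \<I>) b" "var K 2 X (\<one> \<I>) (\<one> \<I>) x"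
      "var K 3 X (\<one> \<I>) (\<one> \<I>) y"
    note [simp] = varD[OF v(1)] varD[OF v(2)] varD[OF v(3)] varD[OF v(4)]
    show "app (?t \<bullet> (?t \<boxtimes> \<one> X) \<bullet> RSwap (A \<otimes> B) X X) (((a \<otimes>\<otimes> b) \<otimes>\<otimes> x) \<otimes>\<otimes> y) =
        app (?t \<bullet> (?t \<boxtimes> \<one> X)) (((a \<otimes>\<otimes> b) \<otimes>\<otimes> x) \<otimes>\<otimes> y)"
      by (simp add: tens_act_def insert_commute commuting_app[OF \<alpha> X] commuting_app[OF \<beta> X] plus_ac)
  qed (simp_all add: Hom_def)
  then show ?thesis by (simp add: commuting_action_RSwap Hom_def)
qed

end

text \<open>The structure that a monoidal differential modality puts on the single object \<open>!X\<close>: carrier \<open>!X\<close>,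
base \<open>X\<close>, the comonoid structure, the differential \<open>!X \<otimes> X \<rightarrow> !X\<close>, the linear part \<open>!X \<rightarrow> X\<close>, and the
group-like element \<open>!x \<circ> m\<^sub>I\<close> of \<open>!X\<close> for every point \<open>x : \<I> \<rightarrow> X\<close>.\<close>

record ('o, 'm) dcom =
  Car :: 'o
  Bas :: 'o
  Cou :: 'm
  Cmu :: 'm
  Dif :: 'm
  Lin :: 'm
  Pnt :: "'m \<Rightarrow> 'm"

text \<open>The rules that involve one object only. The interchange rule says that \<open>Dif\<close> is a commuting action,
and the constant and product rules that counit and comultiplication are action maps for the zero action and for the
Leibniz action.\<close>

locale diff_comonoid = linear_symmetric_monoidal_category C
  for C :: "('o, 'm, 'k::{comm_semiring_0,comm_monoid_mult}, 'z) linsmcat_scheme" (structure) +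
  fixes R :: "('o, 'm) dcom"
  assumes base: "Bas R \<in> Obj C"
    and comonoid: "cocommutative_comonoid C (Car R) (Cou R) (Cmu R)"
    and commuting: "commuting_action C (Bas R) (Car R) (Dif R)"
    and const_zero: "Cou R \<bullet> Dif R = \<zero> (Car R \<otimes> Bas R) \<I>"
    and product: "Cmu R \<bullet> Dif R =
        tens_act (Car R) (Dif R) (Car R) (Dif R) (Bas R) \<bullet> (Cmu R \<boxtimes> \<one> (Bas R))"
    and Lin_Hom: "Lin R \<in> hom (Car R) (Bas R)"
    and linear: "Lin R \<bullet> Dif R = \<l> (Bas R) \<bullet> (Cou R \<boxtimes> \<one> (Bas R))"
    and Pnt_Hom: "x \<in> hom \<I> (Bas R) \<Longrightarrow> Pnt R x \<in> hom \<I> (Car R)"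
    and Cou_Pnt: "x \<in> hom \<I> (Bas R) \<Longrightarrow> Cou R \<bullet> Pnt R x = \<one> \<I>"
    and Cmu_Pnt: "x \<in> hom \<I> (Bas R) \<Longrightarrow> Cmu R \<bullet> Pnt R x = (Pnt R x \<boxtimes> Pnt R x) \<bullet> Inv (\<l> \<I>)"
    and Lin_Pnt: "x \<in> hom \<I> (Bas R) \<Longrightarrow> Lin R \<bullet> Pnt R x = x"
begin

lemma dtyp [simp]: "Bas R \<in> Obj C" "Car R \<in> Obj C"
  "Cou R \<in> Arr C" "Dom C (Cou R) = Car R" "Cod C (Cou R) = \<I>"
  "Cmu R \<in> Arr C" "Dom C (Cmu R) = Car R" "Cod C (Cmu R) = Car R \<otimes> Car R"
  "Dif R \<in> Arr C" "Dom C (Dif R) = Car R \<otimes> Bas R" "Cod C (Dif R) = Car R"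
  "Lin R \<in> Arr C" "Dom C (Lin R) = Car R" "Cod C (Lin R) = Bas R"
  using base cocommutative_comonoid.comonoid_simps[OF comonoid] commuting Lin_Hom
  by (auto simp: commuting_action_def Hom_def)

lemma Pnt_typ [simp]:
  "x \<in> Arr C \<Longrightarrow> Dom C x = \<I> \<Longrightarrow> Cod C x = Bas R \<Longrightarrow> Pnt R x \<in> Arr C"
  "x \<in> Arr C \<Longrightarrow> Dom C x = \<I> \<Longrightarrow> Cod C x = Bas R \<Longrightarrow> Dom C (Pnt R x) = \<I>"
  "x \<in> Arr C \<Longrightarrow> Dom C x = \<I> \<Longrightarrow> Cod C x = Bas R \<Longrightarrow> Cod C (Pnt R x) = Car R"
  using Pnt_Hom[of x] by (auto simp: Hom_def)

declare comonoid [simp]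

lemma app_const_zero [simp]:
  "el t \<Longrightarrow> ty t = Car R \<otimes> Bas R \<Longrightarrow> app (Cou R) (app (Dif R) t) = zero (base t) (supp t) \<I>"
  using app_eq[OF const_zero, of t] by simp

lemma app_product [simp]:
  assumes [simp]: "el t" "el x" "ty t = Car R" "ty x = Bas R" "base t = base x" "supp t \<inter> supp x \<subseteq> CDup (base x)"
  shows "app (Cmu R) (app (Dif R) (t \<otimes>\<otimes> x)) =
    app (\<one> (Car R) \<boxtimes> Dif R) (app (\<a> (Car R) (Car R) (Bas R)) (app (Cmu R) t \<otimes>\<otimes> x)) \<oplus>\<oplus>
    app (Dif R \<boxtimes> \<one> (Car R)) (app (RSwap (Car R) (Car R) (Bas R)) (app (Cmu R) t \<otimes>\<otimes> x))"
  using app_eq[OF product, of "t \<otimes>\<otimes> x"] by (simp add: tens_act_typ) (simp add: tens_act_def del: TensA_Ident)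

lemma app_linear [simp]:
  assumes [simp]: "el t" "el x" "ty t = Car R" "ty x = Bas R" "base t = base x" "supp t \<inter> supp x \<subseteq> CDup (base x)"
  shows "app (Lin R) (app (Dif R) (t \<otimes>\<otimes> x)) = app (\<l> (Bas R)) (app (Cou R) t \<otimes>\<otimes> x)"
  using app_eq[OF linear, of "t \<otimes>\<otimes> x"] by simp

lemma app_Pnt [simp]:
  assumes "el t" "ty t = \<I>" "x \<in> Arr C" "Dom C x = \<I>" "Cod C x = Bas R"
  shows "app (Cou R) (app (Pnt R x) t) = t"
    "app (Cmu R) (app (Pnt R x) t) = app (Pnt R x \<boxtimes> Pnt R x) (app (Inv (\<l> \<I>)) t)"
    "app (Lin R) (app (Pnt R x) t) = app x t"
  using app_eq[OF Cou_Pnt, of x t] app_eq[OF Cmu_Pnt, of x t] app_eq[OF Lin_Pnt, of x t] assms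
  by (simp_all add: Hom_def)

end

context linear_symmetric_monoidal_category
begin

text \<open>In Sweedler notation \<open>ext_along R f b\<close> is \<open>p \<otimes> x \<mapsto> f(p\<^sub>1) \<otimes> b(p\<^sub>2 \<otimes> x)\<close>. Hence \<open>ode\<close> is the
linear differential equation \<open>f(p \<cdot> x) = \<alpha>(f(p\<^sub>1), g(p\<^sub>2 \<cdot> x))\<close> for \<open>f\<close>, and \<open>ode_act\<close> is the action
\<open>(a \<otimes> p) \<cdot> x = a \<otimes> (p \<cdot> x) + \<alpha>(a, g(p\<^sub>1 \<cdot> x)) \<otimes> p\<^sub>2\<close> on \<open>A \<otimes> Car R\<close>.\<close>

definition ext_along :: "('o, 'm) dcom \<Rightarrow> 'm \<Rightarrow> 'm \<Rightarrow> 'm" where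
  "ext_along R f b = (f \<boxtimes> b) \<bullet> \<a> (Car R) (Car R) (Bas R) \<bullet> (Cmu R \<boxtimes> \<one> (Bas R))"

definition ode :: "('o, 'm) dcom \<Rightarrow> 'm \<Rightarrow> 'm \<Rightarrow> 'm \<Rightarrow> bool" where
  "ode R \<alpha> g f \<longleftrightarrow> f \<bullet> Dif R = \<alpha> \<bullet> ext_along R f (g \<bullet> Dif R)"

definition ode_act :: "('o, 'm) dcom \<Rightarrow> 'o \<Rightarrow> 'm \<Rightarrow> 'm \<Rightarrow> 'm" where
  "ode_act R A \<alpha> g =
    (\<one> A \<boxtimes> Dif R) \<bullet> \<a> A (Car R) (Bas R) \<oplus>
    (\<alpha> \<boxtimes> \<one> (Car R)) \<bullet> Inv (\<a> A (Cod C g) (Car R)) \<bullet> (\<one> A \<boxtimes> ((g \<bullet> Dif R) \<boxtimes> \<one> (Car R))) \<bullet>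
      (\<one> A \<boxtimes> RSwap (Car R) (Car R) (Bas R)) \<bullet> \<a> A (Car R \<otimes> Car R) (Bas R) \<bullet>
      ((\<one> A \<boxtimes> Cmu R) \<boxtimes> \<one> (Bas R))"

end

context diff_comonoid
begin

lemma typ_ode_act [simp]:
  assumes "\<alpha> \<in> Arr C" "Dom C \<alpha> = A \<otimes> Y" "Cod C \<alpha> = A" "A \<in> Obj C" "g \<in> Arr C" "Dom C g = Car R" "Cod C g = Y"
  shows "ode_act R A \<alpha> g \<in> Arr C" "Dom C (ode_act R A \<alpha> g) = (A \<otimes> Car R) \<otimes> Bas R"
    "Cod C (ode_act R A \<alpha> g) = A \<otimes> Car R"
  using assms by (auto simp: ode_act_def)

text \<open>In the double action, the terms in which \<open>\<alpha>\<close> is applied twice are symmetric because \<open>\<alpha>\<close> commutes, the one with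
\<open>g(p \<cdot> x \<cdot> y)\<close> because \<open>Dif R\<close> commutes, and the mixed terms are exchanged with each other.\<close>

lemma ode_act_commuting:
  assumes \<alpha>: "commuting_action C Y A \<alpha>" and g: "g \<in> hom (Car R) Y" and Y [simp]: "Y \<in> Obj C"
  shows "commuting_action C (Bas R) (A \<otimes> Car R) (ode_act R A \<alpha> g)"
proof -
  have [simp]: "A \<in> Obj C" "\<alpha> \<in> Arr C" "Dom C \<alpha> = A \<otimes> Y" "Cod C \<alpha> = A"
    "g \<in> Arr C" "Dom C g = Car R" "Cod C g = Y"
    using \<alpha> g by (auto simp: commuting_action_RSwap Hom_def)
  let ?\<beta> = "ode_act R A \<alpha> g"
  have "?\<beta> \<bullet> (?\<beta> \<boxtimes> \<one> (Bas R)) \<bullet> RSwap (A \<otimes> Car R) (Bas R) (Bas R) = ?\<beta> \<bullet> (?\<beta> \<boxtimes> \<one> (Bas R))"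
  proof (rule ext4[where e' = "Cou R" and d' = "Cmu R"])
    fix K a p x y
    assume v: "var K 0 A e d a" "var K 1 (Car R) (Cou R) (Cmu R) p" "var K 2 (Bas R) e'' d'' x"
      "var K 3 (Bas R) e3 d3 y"
    show "app (?\<beta> \<bullet> (?\<beta> \<boxtimes> \<one> (Bas R)) \<bullet> RSwap (A \<otimes> Car R) (Bas R) (Bas R)) (((a \<otimes>\<otimes> p) \<otimes>\<otimes> x) \<otimes>\<otimes> y) =
      app (?\<beta> \<bullet> (?\<beta> \<boxtimes> \<one> (Bas R))) (((a \<otimes>\<otimes> p) \<otimes>\<otimes> x) \<otimes>\<otimes> y)"
      using v
      by (simp add: var_def ode_act_def insert_commute commuting_app[OF commuting base]
          commuting_app[OF \<alpha> Y] plus_ac)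
  qed (simp_all add: Hom_def)
  then show ?thesis by (simp add: commuting_action_RSwap Hom_def)
qed

end


subsection \<open>Free actions and linear differential equations\<close>

context linear_symmetric_monoidal_category
begin

definition act_hom :: "'o \<Rightarrow> 'o \<Rightarrow> 'm \<Rightarrow> 'o \<Rightarrow> 'm \<Rightarrow> 'm \<Rightarrow> bool" where
  "act_hom X Q D A \<alpha> f \<longleftrightarrow> f \<in> hom Q A \<and> f \<bullet> D = \<alpha> \<bullet> (f \<boxtimes> \<one> X)"

text \<open>The parameter object \<open>W\<close> is what allows free actions of two objects to be combined
into a free action of their biproduct, by extending along one factor at a time.\<close>

definition free_action :: "'o \<Rightarrow> 'o \<Rightarrow> 'm \<Rightarrow> ('m \<Rightarrow> 'm) \<Rightarrow> bool" where
  "free_action X Q D pt \<longleftrightarrow> X \<in> Obj C \<and> commuting_action C X Q D \<and> (\<forall>x \<in> hom \<I> X. pt x \<in> hom \<I> Q) \<and>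
    (\<forall>W A \<alpha> a. W \<in> Obj C \<longrightarrow> commuting_action C X A \<alpha> \<longrightarrow> (\<forall>x \<in> hom \<I> X. a x \<in> hom W A) \<longrightarrow>
      (\<exists>!F. act_hom X (W \<otimes> Q) ((\<one> W \<boxtimes> D) \<bullet> \<a> W Q X) A \<alpha> F \<and>
        (\<forall>x \<in> hom \<I> X. F \<bullet> (\<one> W \<boxtimes> pt x) \<bullet> Inv (\<r> W) = a x)))"

lemma free_actionD:
  assumes "free_action X Q D pt" "W \<in> Obj C" "commuting_action C X A \<alpha>" "\<And>x. x \<in> hom \<I> X \<Longrightarrow> a x \<in> hom W A"
  shows "\<exists>!F. act_hom X (W \<otimes> Q) ((\<one> W \<boxtimes> D) \<bullet> \<a> W Q X) A \<alpha> F \<and>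
        (\<forall>x \<in> hom \<I> X. F \<bullet> (\<one> W \<boxtimes> pt x) \<bullet> Inv (\<r> W) = a x)"
proof -
  have "\<forall>x \<in> hom \<I> X. a x \<in> hom W A" using assms(4) by blast
  then show ?thesis using assms(1-3) unfolding free_action_def by (elim conjE allE impE) assumption+
qed

lemma free_action_unparametrised:
  assumes free: "free_action X Q D pt" and \<alpha>: "commuting_action C X A \<alpha>"
  shows "(\<And>x. x \<in> hom \<I> X \<Longrightarrow> a x \<in> hom \<I> A) \<Longrightarrow>
      \<exists>f. act_hom X Q D A \<alpha> f \<and> (\<forall>x \<in> hom \<I> X. f \<bullet> pt x = a x)"
    and "act_hom X Q D A \<alpha> f \<Longrightarrow> act_hom X Q D A \<alpha> g \<Longrightarrow>
      (\<And>x. x \<in> hom \<I> X \<Longrightarrow> f \<bullet> pt x = g \<bullet> pt x) \<Longrightarrow> f = g"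
proof -
  have [simp]: "X \<in> Obj C" and D: "commuting_action C X Q D" and pt: "\<And>x. x \<in> hom \<I> X \<Longrightarrow> pt x \<in> hom \<I> Q"
    using free by (auto simp: free_action_def)
  note [simp] = commuting_actionD[OF \<alpha>] commuting_actionD[OF D]
  let ?D = "(\<one> \<I> \<boxtimes> D) \<bullet> \<a> \<I> Q X"
  have D_unit: "\<l> Q \<bullet> ?D = D \<bullet> (\<l> Q \<boxtimes> \<one> X)"
    by (subst Comp_left[OF LUnit_nat]) (simp_all add: LUnit_TensO)
  have *: "act_hom X (\<I> \<otimes> Q) ?D A \<alpha> (f \<bullet> \<l> Q) \<longleftrightarrow> act_hom X Q D A \<alpha> f" if [simp]: "f \<in> Arr C" "Dom C f = Q" "Cod C f = A" for f
  proof -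
    have "(f \<bullet> \<l> Q) \<bullet> ?D = (f \<bullet> D) \<bullet> (\<l> Q \<boxtimes> \<one> X)" using D_unit by simp
    moreover have "\<alpha> \<bullet> ((f \<bullet> \<l> Q) \<boxtimes> \<one> X) = (\<alpha> \<bullet> (f \<boxtimes> \<one> X)) \<bullet> (\<l> Q \<boxtimes> \<one> X)"
      by (simp add: TensA_Comp')
    moreover have "(f \<bullet> D) \<bullet> (\<l> Q \<boxtimes> \<one> X) = (\<alpha> \<bullet> (f \<boxtimes> \<one> X)) \<bullet> (\<l> Q \<boxtimes> \<one> X) \<longleftrightarrow> f \<bullet> D = \<alpha> \<bullet> (f \<boxtimes> \<one> X)"
      using iso_epi[of "\<l> Q \<boxtimes> \<one> X" "f \<bullet> D" "\<alpha> \<bullet> (f \<boxtimes> \<one> X)"] by (auto simp del: Comp_assoc')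
    ultimately show ?thesis by (simp add: act_hom_def Hom_def)
  qed
  have p: "(f \<bullet> \<l> Q) \<bullet> (\<one> \<I> \<boxtimes> pt x) \<bullet> Inv (\<r> \<I>) = f \<bullet> pt x"
    if "x \<in> hom \<I> X" and [simp]: "f \<in> Arr C" "Dom C f = Q" for f x
  proof -
    have [simp]: "pt x \<in> Arr C" "Dom C (pt x) = \<I>" "Cod C (pt x) = Q"
      using pt[OF that(1)] by (auto simp: Hom_def)
    have "(f \<bullet> \<l> Q) \<bullet> (\<one> \<I> \<boxtimes> pt x) \<bullet> Inv (\<r> \<I>) = f \<bullet> (\<l> Q \<bullet> (\<one> \<I> \<boxtimes> pt x)) \<bullet> Inv (\<r> \<I>)" by simp
    also have "\<dots> = f \<bullet> pt x" by (subst LUnit_nat) (simp_all add: LUnit_eq_RUnit)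
    finally show ?thesis .
  qed
  have univ: "\<exists>!F. act_hom X (\<I> \<otimes> Q) ?D A \<alpha> F \<and> (\<forall>x \<in> hom \<I> X. F \<bullet> (\<one> \<I> \<boxtimes> pt x) \<bullet> Inv (\<r> \<I>) = a x)"
    if "\<And>x. x \<in> hom \<I> X \<Longrightarrow> a x \<in> hom \<I> A" for a
    by (rule free_actionD[OF free UnitO_Obj \<alpha> that])
  show "\<exists>f. act_hom X Q D A \<alpha> f \<and> (\<forall>x \<in> hom \<I> X. f \<bullet> pt x = a x)"
    if a: "\<And>x. x \<in> hom \<I> X \<Longrightarrow> a x \<in> hom \<I> A"
  proof -
    obtain F where F: "act_hom X (\<I> \<otimes> Q) ?D A \<alpha> F" "\<And>x. x \<in> hom \<I> X \<Longrightarrow> F \<bullet> (\<one> \<I> \<boxtimes> pt x) \<bullet> Inv (\<r> \<I>) = a x"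
      using univ[of a, OF a] by blast
    have [simp]: "F \<in> Arr C" "Dom C F = \<I> \<otimes> Q" "Cod C F = A" using F(1) by (auto simp: act_hom_def Hom_def)
    let ?f = "F \<bullet> Inv (\<l> Q)"
    have Fl: "?f \<bullet> \<l> Q = F" by simp
    have "act_hom X Q D A \<alpha> ?f" using *[of ?f] F(1) unfolding Fl by simp
    moreover have "?f \<bullet> pt x = a x" if x: "x \<in> hom \<I> X" for x
      using p[OF x, of ?f] F(2)[OF x] unfolding Fl by simp
    ultimately show ?thesis by blast
  qed
  show "f = g" if f: "act_hom X Q D A \<alpha> f" "act_hom X Q D A \<alpha> g" "\<And>x. x \<in> hom \<I> X \<Longrightarrow> f \<bullet> pt x = g \<bullet> pt x"
  proof -
    have [simp]: "f \<in> Arr C" "Dom C f = Q" "Cod C f = A" "g \<in> Arr C" "Dom C g = Q" "Cod C g = A"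
      using f by (auto simp: act_hom_def Hom_def)
    have "\<And>x. x \<in> hom \<I> X \<Longrightarrow> f \<bullet> pt x \<in> hom \<I> A" using pt by (auto simp: Hom_def)
    note u = univ[of "\<lambda>x. f \<bullet> pt x", OF this]
    have "act_hom X (\<I> \<otimes> Q) ?D A \<alpha> (f \<bullet> \<l> Q)" "act_hom X (\<I> \<otimes> Q) ?D A \<alpha> (g \<bullet> \<l> Q)"
      using f *[of f] *[of g] by simp_all
    moreover have "\<forall>x \<in> hom \<I> X. (f \<bullet> \<l> Q) \<bullet> (\<one> \<I> \<boxtimes> pt x) \<bullet> Inv (\<r> \<I>) = f \<bullet> pt x"
      using p[of _ f] by (simp del: Comp_assoc')
    moreover have "\<forall>x \<in> hom \<I> X. (g \<bullet> \<l> Q) \<bullet> (\<one> \<I> \<boxtimes> pt x) \<bullet> Inv (\<r> \<I>) = f \<bullet> pt x"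
      using p[of _ g] f(3) by (simp del: Comp_assoc')
    ultimately have "f \<bullet> \<l> Q = g \<bullet> \<l> Q" using u by blast
    then show ?thesis by (rule iso_epi[rotated -1]) auto
  qed
qed

end

locale free_diff_comonoid = diff_comonoid +
  assumes free: "free_action (Bas R) (Car R) (Dif R) (Pnt R)"
begin

text \<open>\<open>f\<close> solves the equation iff \<open>p \<mapsto> f(p\<^sub>1) \<otimes> p\<^sub>2\<close> is an action map for \<open>ode_act\<close>; the counit recovers \<open>f\<close>
from that map.\<close>

lemma ode_unique:
  assumes \<alpha>: "commuting_action C Y A \<alpha>" and Y [simp]: "Y \<in> Obj C" and g: "g \<in> hom (Car R) Y"
    and f: "f \<in> hom (Car R) A" "ode R \<alpha> g f" "f' \<in> hom (Car R) A" "ode R \<alpha> g f'"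
    and pt: "\<And>x. x \<in> hom \<I> (Bas R) \<Longrightarrow> f \<bullet> Pnt R x = f' \<bullet> Pnt R x"
  shows "f = f'"
proof -
  note [simp] = commuting_actionD[OF \<alpha>]
  let ?Q = "Car R" and ?X = "Bas R" let ?\<beta> = "ode_act R A \<alpha> g"
  have g' [simp]: "g \<in> Arr C" "Dom C g = ?Q" "Cod C g = Y" using g by (auto simp: Hom_def)
  have act: "act_hom ?X ?Q (Dif R) (A \<otimes> ?Q) ?\<beta> ((f \<boxtimes> \<one> ?Q) \<bullet> Cmu R)"
    if "f \<in> hom ?Q A" "ode R \<alpha> g f" for f
  proof -
    have [simp]: "f \<in> Arr C" "Dom C f = ?Q" "Cod C f = A" using that by (auto simp: Hom_def)
    have eq: "f \<bullet> Dif R = \<alpha> \<bullet> (f \<boxtimes> (g \<bullet> Dif R)) \<bullet> \<a> ?Q ?Q ?X \<bullet> (Cmu R \<boxtimes> \<one> ?X)"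
      using that by (simp add: ode_def ext_along_def)
    have "((f \<boxtimes> \<one> ?Q) \<bullet> Cmu R) \<bullet> Dif R = ?\<beta> \<bullet> (((f \<boxtimes> \<one> ?Q) \<bullet> Cmu R) \<boxtimes> \<one> ?X)"
    proof (rule ext2[where e = "Cou R" and d = "Cmu R"])
      fix K p x assume v: "var K 0 ?Q (Cou R) (Cmu R) p" "var K 1 ?X e' d' x"
      show "app (((f \<boxtimes> \<one> ?Q) \<bullet> Cmu R) \<bullet> Dif R) (p \<otimes>\<otimes> x) =
          app (?\<beta> \<bullet> (((f \<boxtimes> \<one> ?Q) \<bullet> Cmu R) \<boxtimes> \<one> ?X)) (p \<otimes>\<otimes> x)"
        using v app_eq[OF eq, of "p \<otimes>\<otimes> x"]
        by (simp add: var_def ode_act_def insert_commute plus_ac)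
    qed (simp_all add: Hom_def)
    then show ?thesis by (simp add: act_hom_def Hom_def)
  qed
  have [simp]: "f \<in> Arr C" "Dom C f = ?Q" "Cod C f = A" "f' \<in> Arr C" "Dom C f' = ?Q" "Cod C f' = A"
    using f by (auto simp: Hom_def)
  have p: "((f \<boxtimes> \<one> ?Q) \<bullet> Cmu R) \<bullet> Pnt R x = ((f' \<boxtimes> \<one> ?Q) \<bullet> Cmu R) \<bullet> Pnt R x" if "x \<in> hom \<I> ?X" for x
    using that pt[OF that] by (simp add: Cmu_Pnt TensA_Comp_left Hom_def)
  have "(f \<boxtimes> \<one> ?Q) \<bullet> Cmu R = (f' \<boxtimes> \<one> ?Q) \<bullet> Cmu R"
    by (rule free_action_unparametrised(2)[OF free ode_act_commuting[OF \<alpha> g Y] act act p]) (use f in auto)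
  note eq = this
  have recover: "k = \<r> A \<bullet> (\<one> A \<boxtimes> Cou R) \<bullet> (k \<boxtimes> \<one> ?Q) \<bullet> Cmu R" if [simp]: "k \<in> Arr C" "Dom C k = ?Q" "Cod C k = A" for k
  proof (rule ext1[where X = ?Q and e = "Cou R" and d = "Cmu R"])
    fix K p assume "var K 0 ?Q (Cou R) (Cmu R) p"
    then show "app k p = app (\<r> A \<bullet> (\<one> A \<boxtimes> Cou R) \<bullet> (k \<boxtimes> \<one> ?Q) \<bullet> Cmu R) p"
      by (simp add: var_def)
  qed (simp_all add: Hom_def)
  have "f = \<r> A \<bullet> (\<one> A \<boxtimes> Cou R) \<bullet> (f \<boxtimes> \<one> ?Q) \<bullet> Cmu R" by (rule recover) simp_all
  also have "\<dots> = f'" unfolding eq by (rule recover[symmetric]) simp_all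
  finally show ?thesis .
qed

text \<open>Conversely, let \<open>h\<close> be the action map into \<open>A \<otimes> Car R\<close> with value \<open>a x \<otimes> x\<close> at the point \<open>x\<close>. It has the form
\<open>p \<mapsto> f(p\<^sub>1) \<otimes> p\<^sub>2\<close>: both \<open>(h \<otimes> 1) \<circ> \<Delta>\<close> and \<open>(1 \<otimes> \<Delta>) \<circ> h\<close> are action maps into \<open>A \<otimes> Car R \<otimes> Car R\<close> with the
same values at the points, so they agree.\<close>

lemma ode_exists:
  assumes \<alpha>: "commuting_action C Y A \<alpha>" and Y [simp]: "Y \<in> Obj C" and g: "g \<in> hom (Car R) Y"
    and a: "\<And>x. x \<in> hom \<I> (Bas R) \<Longrightarrow> a x \<in> hom \<I> A"
  shows "\<exists>f. f \<in> hom (Car R) A \<and> ode R \<alpha> g f \<and> (\<forall>x \<in> hom \<I> (Bas R). f \<bullet> Pnt R x = a x)"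
proof -
  note [simp] = commuting_actionD[OF \<alpha>]
  let ?Q = "Car R" and ?X = "Bas R" let ?\<beta> = "ode_act R A \<alpha> g"
  have g' [simp]: "g \<in> Arr C" "Dom C g = ?Q" "Cod C g = Y" using g by (auto simp: Hom_def)
  have \<beta>: "commuting_action C ?X (A \<otimes> ?Q) ?\<beta>" by (rule ode_act_commuting[OF \<alpha> g Y])
  have [simp]: "a x \<in> Arr C" "Dom C (a x) = \<I>" "Cod C (a x) = A"
    if "x \<in> Arr C" "Dom C x = \<I>" "Cod C x = ?X" for x
    using a[of x] that by (auto simp: Hom_def)
  obtain h where h: "act_hom ?X ?Q (Dif R) (A \<otimes> ?Q) ?\<beta> h"
      "\<And>x. x \<in> hom \<I> ?X \<Longrightarrow> h \<bullet> Pnt R x = (a x \<boxtimes> Pnt R x) \<bullet> Inv (\<l> \<I>)"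
  proof -
    have "\<And>x. x \<in> hom \<I> ?X \<Longrightarrow> (a x \<boxtimes> Pnt R x) \<bullet> Inv (\<l> \<I>) \<in> hom \<I> (A \<otimes> ?Q)"
      by (simp add: Hom_def)
    from free_action_unparametrised(1)[OF free \<beta>, where a = "\<lambda>x. (a x \<boxtimes> Pnt R x) \<bullet> Inv (\<l> \<I>)", OF this] show thesis using that by blast
  qed
  have [simp]: "h \<in> Arr C" "Dom C h = ?Q" "Cod C h = A \<otimes> ?Q" and hD: "h \<bullet> Dif R = ?\<beta> \<bullet> (h \<boxtimes> \<one> ?X)"
    using h by (auto simp: act_hom_def Hom_def)
  let ?f = "\<r> A \<bullet> (\<one> A \<boxtimes> Cou R) \<bullet> h"
  let ?\<gamma> = "tens_act (A \<otimes> ?Q) ?\<beta> ?Q (Dif R) ?X"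
  have \<gamma>: "commuting_action C ?X ((A \<otimes> ?Q) \<otimes> ?Q) ?\<gamma>" by (rule tens_act_commuting[OF \<beta> commuting]) simp
  note [simp] = commuting_actionD[OF \<gamma>]
  \<comment> \<open>Hence \<open>h\<close> is \<open>p \<mapsto> f(p\<^sub>1) \<otimes> p\<^sub>2\<close> with \<open>f\<close> the first component of \<open>h\<close>.\<close>
  have "(h \<boxtimes> \<one> ?Q) \<bullet> Cmu R = Inv (\<a> A ?Q ?Q) \<bullet> (\<one> A \<boxtimes> Cmu R) \<bullet> h"
  proof (rule free_action_unparametrised(2)[OF free \<gamma>])
    have "((h \<boxtimes> \<one> ?Q) \<bullet> Cmu R) \<bullet> Dif R = ?\<gamma> \<bullet> (((h \<boxtimes> \<one> ?Q) \<bullet> Cmu R) \<boxtimes> \<one> ?X)"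
    proof (rule ext2[where e = "Cou R" and d = "Cmu R"])
      fix K p x assume v: "var K 0 ?Q (Cou R) (Cmu R) p" "var K 1 ?X e' d' x"
      show "app (((h \<boxtimes> \<one> ?Q) \<bullet> Cmu R) \<bullet> Dif R) (p \<otimes>\<otimes> x) =
          app (?\<gamma> \<bullet> (((h \<boxtimes> \<one> ?Q) \<bullet> Cmu R) \<boxtimes> \<one> ?X)) (p \<otimes>\<otimes> x)"
        using v app_eq[OF hD, of "p \<otimes>\<otimes> x"]
        by (simp add: var_def tens_act_def insert_commute)
    qed (simp_all add: Hom_def)
    then show "act_hom ?X ?Q (Dif R) ((A \<otimes> ?Q) \<otimes> ?Q) ?\<gamma> ((h \<boxtimes> \<one> ?Q) \<bullet> Cmu R)"
      by (simp add: act_hom_def Hom_def)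
    have "Inv (\<a> A ?Q ?Q) \<bullet> (\<one> A \<boxtimes> Cmu R) \<bullet> ?\<beta> = ?\<gamma> \<bullet> ((Inv (\<a> A ?Q ?Q) \<bullet> (\<one> A \<boxtimes> Cmu R)) \<boxtimes> \<one> ?X)"
    proof (rule ext3[where e' = "Cou R" and d' = "Cmu R"])
      fix K p b x assume v: "var K 0 A e d b" "var K 1 ?Q (Cou R) (Cmu R) p" "var K 2 ?X e'' d'' x"
      show "app (Inv (\<a> A ?Q ?Q) \<bullet> (\<one> A \<boxtimes> Cmu R) \<bullet> ?\<beta>) ((b \<otimes>\<otimes> p) \<otimes>\<otimes> x) =
          app (?\<gamma> \<bullet> ((Inv (\<a> A ?Q ?Q) \<bullet> (\<one> A \<boxtimes> Cmu R)) \<boxtimes> \<one> ?X)) ((b \<otimes>\<otimes> p) \<otimes>\<otimes> x)"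
        using v by (simp add: var_def tens_act_def ode_act_def insert_commute plus_ac)
    qed (simp_all add: Hom_def)
    then have "(Inv (\<a> A ?Q ?Q) \<bullet> (\<one> A \<boxtimes> Cmu R) \<bullet> h) \<bullet> Dif R
        = ?\<gamma> \<bullet> ((Inv (\<a> A ?Q ?Q) \<bullet> (\<one> A \<boxtimes> Cmu R)) \<boxtimes> \<one> ?X) \<bullet> (h \<boxtimes> \<one> ?X)"
      using hD Comp_assoc'[of "h \<boxtimes> \<one> ?X" "?\<beta>" "Inv (\<a> A ?Q ?Q) \<bullet> (\<one> A \<boxtimes> Cmu R)"] by simp
    then show "act_hom ?X ?Q (Dif R) ((A \<otimes> ?Q) \<otimes> ?Q) ?\<gamma> (Inv (\<a> A ?Q ?Q) \<bullet> (\<one> A \<boxtimes> Cmu R) \<bullet> h)"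
      by (simp add: act_hom_def Hom_def TensA_Comp')
    show "((h \<boxtimes> \<one> ?Q) \<bullet> Cmu R) \<bullet> Pnt R x = (Inv (\<a> A ?Q ?Q) \<bullet> (\<one> A \<boxtimes> Cmu R) \<bullet> h) \<bullet> Pnt R x"
      if x: "x \<in> hom \<I> ?X" for x
    proof (rule ext0)
      fix K assume [simp]: "ctxt_ok K"
      have [simp]: "x \<in> Arr C" "Dom C x = \<I>" "Cod C x = ?X" using x by (auto simp: Hom_def)
      show "app (((h \<boxtimes> \<one> ?Q) \<bullet> Cmu R) \<bullet> Pnt R x) (star K) =
        app ((Inv (\<a> A ?Q ?Q) \<bullet> (\<one> A \<boxtimes> Cmu R) \<bullet> h) \<bullet> Pnt R x) (star K)"
        using app_eq[OF h(2)[OF x]] by simp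
    qed (use x in \<open>simp_all add: Hom_def\<close>)
  qed
  note hh = this
  have "h = ((\<r> A \<bullet> (\<one> A \<boxtimes> Cou R)) \<boxtimes> \<one> ?Q) \<bullet> Inv (\<a> A ?Q ?Q) \<bullet> (\<one> A \<boxtimes> Cmu R) \<bullet> h"
  proof -
    have "((\<r> A \<bullet> (\<one> A \<boxtimes> Cou R)) \<boxtimes> \<one> ?Q) \<bullet> Inv (\<a> A ?Q ?Q) \<bullet> (\<one> A \<boxtimes> Cmu R) = \<one> (A \<otimes> ?Q)"
    proof (rule ext2[where e' = "Cou R" and d' = "Cmu R"])
      fix K b p assume v: "var K 0 A e d b" "var K 1 ?Q (Cou R) (Cmu R) p"
      show "app (((\<r> A \<bullet> (\<one> A \<boxtimes> Cou R)) \<boxtimes> \<one> ?Q) \<bullet> Inv (\<a> A ?Q ?Q) \<bullet> (\<one> A \<boxtimes> Cmu R)) (b \<otimes>\<otimes> p) =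
          app (\<one> (A \<otimes> ?Q)) (b \<otimes>\<otimes> p)"
        using v by (simp add: var_def)
    qed (simp_all add: Hom_def)
    from arg_cong[OF this, of "\<lambda>f. f \<bullet> h"] show ?thesis by simp
  qed
  also have "\<dots> = ((\<r> A \<bullet> (\<one> A \<boxtimes> Cou R)) \<boxtimes> \<one> ?Q) \<bullet> (h \<boxtimes> \<one> ?Q) \<bullet> Cmu R"
    by (simp add: hh)
  finally have hf: "h = (?f \<boxtimes> \<one> ?Q) \<bullet> Cmu R" by (simp add: TensA_Comp_left)
  have "\<r> A \<bullet> (\<one> A \<boxtimes> Cou R) \<bullet> ?\<beta> = \<alpha> \<bullet> (\<one> A \<boxtimes> (g \<bullet> Dif R)) \<bullet> \<a> A ?Q ?X"
  proof (rule ext3[where e' = "Cou R" and d' = "Cmu R"])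
    fix K p b x assume v: "var K 0 A e d b" "var K 1 ?Q (Cou R) (Cmu R) p" "var K 2 ?X e'' d'' x"
    show "app (\<r> A \<bullet> (\<one> A \<boxtimes> Cou R) \<bullet> ?\<beta>) ((b \<otimes>\<otimes> p) \<otimes>\<otimes> x) = app (\<alpha> \<bullet> (\<one> A \<boxtimes> (g \<bullet> Dif R)) \<bullet> \<a> A ?Q ?X) ((b \<otimes>\<otimes> p) \<otimes>\<otimes> x)"
      using v by (simp add: var_def ode_act_def insert_commute)
  qed (simp_all add: Hom_def)
  from arg_cong[OF this, of "\<lambda>f. f \<bullet> (h \<boxtimes> \<one> ?X)"]
  have "?f \<bullet> Dif R = \<alpha> \<bullet> (\<one> A \<boxtimes> (g \<bullet> Dif R)) \<bullet> \<a> A ?Q ?X \<bullet> (h \<boxtimes> \<one> ?X)"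
    by (simp add: hD)
  also have "\<dots> = \<alpha> \<bullet> (\<one> A \<boxtimes> (g \<bullet> Dif R)) \<bullet> \<a> A ?Q ?X \<bullet> ((?f \<boxtimes> \<one> ?Q) \<boxtimes> \<one> ?X) \<bullet> (Cmu R \<boxtimes> \<one> ?X)"
    by (subst (1) hf) (simp add: TensA_Comp')
  also have "\<dots> = \<alpha> \<bullet> (\<one> A \<boxtimes> (g \<bullet> Dif R)) \<bullet> (?f \<boxtimes> \<one> ?Q \<boxtimes> \<one> ?X) \<bullet> \<a> ?Q ?Q ?X \<bullet> (Cmu R \<boxtimes> \<one> ?X)"
    by (subst Comp_left[OF Assoc_nat]) (simp_all del: TensA_Ident)
  finally have "ode R \<alpha> g ?f"
    by (simp add: ode_def ext_along_def TensA_Comp_left)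
  moreover have "?f \<bullet> Pnt R x = a x" if x: "x \<in> hom \<I> ?X" for x
  proof (rule ext0)
    fix K assume [simp]: "ctxt_ok K"
    have [simp]: "x \<in> Arr C" "Dom C x = \<I>" "Cod C x = ?X" using x by (auto simp: Hom_def)
    show "app (?f \<bullet> Pnt R x) (star K) = app (a x) (star K)"
      using app_eq[OF h(2)[OF x]] by simp
  qed (use x in \<open>simp_all add: Hom_def\<close>)
  moreover have "?f \<in> hom ?Q A" by (simp add: Hom_def)
  ultimately show ?thesis by blast
qed

end


subsection \<open>The comonoid structure of a free action\<close>

context symmetric_monoidal_category
begin

text \<open>Elements of type \<open>\<I>\<close> act as scalars. The counit of a variable produces scalars, and if they cannot
be cancelled by weakening they have to be moved to a common place.\<close>

lemma scalar_app:
  assumes [simp]: "el s" "el t" "base s = base t" "supp s \<inter> supp t \<subseteq> CDup (base t)" "ty s = \<I>" "X = ty t"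
    "f \<in> Arr C" "Dom C f = ty t"
  shows "app f (app (\<l> X) (s \<otimes>\<otimes> t)) = app (\<l> (Cod C f)) (s \<otimes>\<otimes> app f t)"
proof -
  have "app (f \<bullet> \<l> (ty t)) (s \<otimes>\<otimes> t) = app (\<l> (Cod C f) \<bullet> (\<one> \<I> \<boxtimes> f)) (s \<otimes>\<otimes> t)"
    by (subst LUnit_nat) simp_all
  then show ?thesis by simp
qed

lemma scalar_pair:
  assumes [simp]: "el s" "el t" "el r" "base s = base r" "base t = base r" "ty s = \<I>" "X = ty t"
    "supp s \<inter> supp t \<subseteq> CDup (base r)" "supp s \<inter> supp r \<subseteq> CDup (base r)" "supp t \<inter> supp r \<subseteq> CDup (base r)"
  shows "app (\<l> X) (s \<otimes>\<otimes> t) \<otimes>\<otimes> r = app (\<l> (ty t \<otimes> ty r)) (s \<otimes>\<otimes> t \<otimes>\<otimes> r)"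
proof -
  have [simp]: "(supp s \<union> supp t) \<inter> supp r \<subseteq> CDup (base r)" "supp s \<inter> (supp t \<union> supp r) \<subseteq> CDup (base r)"
    using assms(8-10) by blast+
  have "app (\<l> (ty t) \<boxtimes> \<one> (ty r)) ((s \<otimes>\<otimes> t) \<otimes>\<otimes> r) = app (\<l> (ty t \<otimes> ty r)) (s \<otimes>\<otimes> t \<otimes>\<otimes> r)"
    by (subst LUnit_TensO[symmetric]) simp_all
  then show ?thesis by simp
qed

end

context linear_symmetric_monoidal_category
begin

lemma act_homD:
  assumes "act_hom X Q D A \<alpha> f"
  shows "f \<in> Arr C" "Dom C f = Q" "Cod C f = A" "f \<bullet> D = \<alpha> \<bullet> (f \<boxtimes> \<one> X)"
  using assms by (auto simp: act_hom_def Hom_def)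

lemma act_hom_id: "commuting_action C X A \<alpha> \<Longrightarrow> X \<in> Obj C \<Longrightarrow> act_hom X A \<alpha> A \<alpha> (\<one> A)"
  by (auto simp: act_hom_def commuting_action_def Hom_def)

lemma act_hom_comp:
  assumes f: "act_hom X A \<alpha> B \<beta> f" and g: "act_hom X B \<beta> D \<gamma> g"
    and X [simp]: "X \<in> Obj C" and \<alpha>: "commuting_action C X A \<alpha>" and \<beta>: "commuting_action C X B \<beta>" and \<gamma>: "commuting_action C X D \<gamma>"
  shows "act_hom X A \<alpha> D \<gamma> (g \<bullet> f)"
proof -
  note [simp] = commuting_actionD[OF \<alpha>] commuting_actionD[OF \<beta>] commuting_actionD[OF \<gamma>]
    act_homD(1-3)[OF f] act_homD(1-3)[OF g]
  have "(g \<bullet> f) \<bullet> \<alpha> = (g \<bullet> \<beta>) \<bullet> (f \<boxtimes> \<one> X)" by (simp add: act_homD(4)[OF f])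
  also have "\<dots> = \<gamma> \<bullet> ((g \<bullet> f) \<boxtimes> \<one> X)" by (simp add: act_homD(4)[OF g] TensA_Comp')
  finally show ?thesis by (simp add: act_hom_def Hom_def)
qed

lemma act_hom_TensA:
  assumes f: "act_hom X A \<alpha> A' \<alpha>' f" and g: "act_hom X B \<beta> B' \<beta>' g" and X [simp]: "X \<in> Obj C"
    and "commuting_action C X A \<alpha>" "commuting_action C X B \<beta>"
      "commuting_action C X A' \<alpha>'" "commuting_action C X B' \<beta>'"
  shows "act_hom X (A \<otimes> B) (tens_act A \<alpha> B \<beta> X) (A' \<otimes> B') (tens_act A' \<alpha>' B' \<beta>' X) (f \<boxtimes> g)"
proof -
  note [simp] = assms(4-7)[THEN commuting_actionD(1)] assms(4-7)[THEN commuting_actionD(2)]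
    assms(4-7)[THEN commuting_actionD(3)] assms(4-7)[THEN commuting_actionD(4)]
    act_homD(1-3)[OF f] act_homD(1-3)[OF g]
  have "(f \<boxtimes> g) \<bullet> tens_act A \<alpha> B \<beta> X = tens_act A' \<alpha>' B' \<beta>' X \<bullet> ((f \<boxtimes> g) \<boxtimes> \<one> X)"
  proof (rule ext3)
    fix K a b x assume v: "var K 0 A e d a" "var K 1 B e' d' b" "var K 2 X e'' d'' x"
    note [simp] = varD[OF v(1)] varD[OF v(2)] varD[OF v(3)]
    show "app ((f \<boxtimes> g) \<bullet> tens_act A \<alpha> B \<beta> X) ((a \<otimes>\<otimes> b) \<otimes>\<otimes> x) =
      app (tens_act A' \<alpha>' B' \<beta>' X \<bullet> ((f \<boxtimes> g) \<boxtimes> \<one> X)) ((a \<otimes>\<otimes> b) \<otimes>\<otimes> x)"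
      using app_eq[OF act_homD(4)[OF f]] app_eq[OF act_homD(4)[OF g]]
      by (simp add: tens_act_def insert_commute)
  qed (simp_all add: Hom_def tens_act_typ)
  then show ?thesis by (simp add: act_hom_def Hom_def tens_act_typ)
qed

lemma act_hom_Assoc:
  assumes "commuting_action C X A \<alpha>" "commuting_action C X B \<beta>" "commuting_action C X D \<gamma>" and X [simp]: "X \<in> Obj C"
  shows "act_hom X ((A \<otimes> B) \<otimes> D) (tens_act (A \<otimes> B) (tens_act A \<alpha> B \<beta> X) D \<gamma> X)
     (A \<otimes> B \<otimes> D) (tens_act A \<alpha> (B \<otimes> D) (tens_act B \<beta> D \<gamma> X) X) (\<a> A B D)"
proof -
  note [simp] = commuting_actionD[OF assms(1)] commuting_actionD[OF assms(2)] commuting_actionD[OF assms(3)]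
  have "\<a> A B D \<bullet> tens_act (A \<otimes> B) (tens_act A \<alpha> B \<beta> X) D \<gamma> X =
    tens_act A \<alpha> (B \<otimes> D) (tens_act B \<beta> D \<gamma> X) X \<bullet> (\<a> A B D \<boxtimes> \<one> X)"
  proof (rule ext4)
    fix K a b c x assume v: "var K 0 A e d a" "var K 1 B e' d' b" "var K 2 D e'' d'' c" "var K 3 X e3 d3 x"
    note [simp] = varD[OF v(1)] varD[OF v(2)] varD[OF v(3)] varD[OF v(4)]
    show "app (\<a> A B D \<bullet> tens_act (A \<otimes> B) (tens_act A \<alpha> B \<beta> X) D \<gamma> X) (((a \<otimes>\<otimes> b) \<otimes>\<otimes> c) \<otimes>\<otimes> x) =
      app (tens_act A \<alpha> (B \<otimes> D) (tens_act B \<beta> D \<gamma> X) X \<bullet> (\<a> A B D \<boxtimes> \<one> X)) (((a \<otimes>\<otimes> b) \<otimes>\<otimes> c) \<otimes>\<otimes> x)"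
      by (simp add: tens_act_def insert_commute plus_ac)
  qed (simp_all add: Hom_def tens_act_typ)
  then show ?thesis by (simp add: act_hom_def Hom_def tens_act_typ)
qed

lemma act_hom_Symm:
  assumes "commuting_action C X A \<alpha>" "commuting_action C X B \<beta>" and X [simp]: "X \<in> Obj C"
  shows "act_hom X (A \<otimes> B) (tens_act A \<alpha> B \<beta> X) (B \<otimes> A) (tens_act B \<beta> A \<alpha> X) (\<s> A B)"
proof -
  note [simp] = commuting_actionD[OF assms(1)] commuting_actionD[OF assms(2)]
  have "\<s> A B \<bullet> tens_act A \<alpha> B \<beta> X = tens_act B \<beta> A \<alpha> X \<bullet> (\<s> A B \<boxtimes> \<one> X)"
  proof (rule ext3)
    fix K a b x assume v: "var K 0 A e d a" "var K 1 B e' d' b" "var K 2 X e'' d'' x"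
    note [simp] = varD[OF v(1)] varD[OF v(2)] varD[OF v(3)]
    show "app (\<s> A B \<bullet> tens_act A \<alpha> B \<beta> X) ((a \<otimes>\<otimes> b) \<otimes>\<otimes> x) =
      app (tens_act B \<beta> A \<alpha> X \<bullet> (\<s> A B \<boxtimes> \<one> X)) ((a \<otimes>\<otimes> b) \<otimes>\<otimes> x)"
      by (simp add: tens_act_def insert_commute plus_ac)
  qed (simp_all add: Hom_def tens_act_typ)
  then show ?thesis by (simp add: act_hom_def Hom_def tens_act_typ)
qed

lemma zero_action: "A \<in> Obj C \<Longrightarrow> X \<in> Obj C \<Longrightarrow> commuting_action C X A (\<zero> (A \<otimes> X) A)"
  by (simp add: commuting_action_RSwap Hom_def)

lemma counit_act_hom:
  assumes "act_hom X Q D \<I> (\<zero> (\<I> \<otimes> X) \<I>) e" and D: "commuting_action C X Q D" and X [simp]: "X \<in> Obj C"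
  shows "act_hom X (Q \<otimes> Q) (tens_act Q D Q D X) Q D (\<l> Q \<bullet> (e \<boxtimes> \<one> Q))"
proof -
  note [simp] = commuting_actionD[OF D] act_homD(1-3)[OF assms(1)]
  have eD: "e \<bullet> D = \<zero> (Q \<otimes> X) \<I>" using act_homD(4)[OF assms(1)] by simp
  have "(\<l> Q \<bullet> (e \<boxtimes> \<one> Q)) \<bullet> tens_act Q D Q D X = D \<bullet> ((\<l> Q \<bullet> (e \<boxtimes> \<one> Q)) \<boxtimes> \<one> X)"
  proof (rule ext3)
    fix K a b x assume v: "var K 0 Q e1 d a" "var K 1 Q e' d' b" "var K 2 X e'' d'' x"
    note [simp] = varD[OF v(1)] varD[OF v(2)] varD[OF v(3)]
    show "app ((\<l> Q \<bullet> (e \<boxtimes> \<one> Q)) \<bullet> tens_act Q D Q D X) ((a \<otimes>\<otimes> b) \<otimes>\<otimes> x) =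
      app (D \<bullet> ((\<l> Q \<bullet> (e \<boxtimes> \<one> Q)) \<boxtimes> \<one> X)) ((a \<otimes>\<otimes> b) \<otimes>\<otimes> x)"
      using app_eq[OF eD]
      by (simp add: tens_act_def insert_commute scalar_pair scalar_app)
  qed (simp_all add: Hom_def tens_act_typ)
  then show ?thesis by (simp add: act_hom_def Hom_def tens_act_typ)
qed

text \<open>Every comonoid law is an equation between two action maps out of the free action that have the same
values at the points.\<close>

lemma free_action_comonoid:
  assumes free: "free_action X Q D pt"
    and e: "act_hom X Q D \<I> (\<zero> (\<I> \<otimes> X) \<I>) e" "\<And>x. x \<in> hom \<I> X \<Longrightarrow> e \<bullet> pt x = \<one> \<I>"
    and d: "act_hom X Q D (Q \<otimes> Q) (tens_act Q D Q D X) d" "\<And>x. x \<in> hom \<I> X \<Longrightarrow> d \<bullet> pt x = (pt x \<boxtimes> pt x) \<bullet> Inv (\<l> \<I>)"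
  shows "cocommutative_comonoid C Q e d"
proof -
  have X [simp]: "X \<in> Obj C" and D: "commuting_action C X Q D" and pt: "\<And>x. x \<in> hom \<I> X \<Longrightarrow> pt x \<in> hom \<I> Q"
    using free by (auto simp: free_action_def)
  note unique = free_action_unparametrised(2)[OF free]
  note DD = tens_act_commuting[OF D D X]
  note zero = zero_action[OF UnitO_Obj X]
  note [simp] = commuting_actionD[OF D] act_homD(1-3)[OF e(1)] act_homD(1-3)[OF d(1)] commuting_actionD[OF DD]
  have p [simp]: "pt x \<in> Arr C" "Dom C (pt x) = \<I>" "Cod C (pt x) = Q" if "x \<in> Arr C" "Dom C x = \<I>" "Cod C x = X" for x
    using pt[of x] that by (auto simp: Hom_def)
  have 1: "(\<l> Q \<bullet> (e \<boxtimes> \<one> Q)) \<bullet> d = \<one> Q"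
  proof (rule unique[OF D act_hom_comp[OF d(1) counit_act_hom[OF e(1) D X] X D DD D] act_hom_id[OF D X]])
    fix x assume x: "x \<in> hom \<I> X"
    then have [simp]: "x \<in> Arr C" "Dom C x = \<I>" "Cod C x = X" by (auto simp: Hom_def)
    show "((\<l> Q \<bullet> (e \<boxtimes> \<one> Q)) \<bullet> d) \<bullet> pt x = \<one> Q \<bullet> pt x"
      by (rule ext0[where Z = Q]) (simp_all add: Hom_def app_eq[OF d(2)[OF x]] app_eq[OF e(2)[OF x]])
  qed
  have 2: "\<s> Q Q \<bullet> d = d"
  proof (rule unique[OF DD act_hom_comp[OF d(1) act_hom_Symm[OF D D X] X D DD DD] d(1)])
    fix x assume x: "x \<in> hom \<I> X"
    then have [simp]: "x \<in> Arr C" "Dom C x = \<I>" "Cod C x = X" by (auto simp: Hom_def)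
    show "(\<s> Q Q \<bullet> d) \<bullet> pt x = d \<bullet> pt x"
      by (rule ext0[where Z = "Q \<otimes> Q"]) (simp_all add: Hom_def app_eq[OF d(2)[OF x]])
  qed
  have 3: "\<a> Q Q Q \<bullet> ((d \<boxtimes> \<one> Q) \<bullet> d) = (\<one> Q \<boxtimes> d) \<bullet> d"
  proof (rule unique)
    note DDD = tens_act_commuting[OF D DD X] tens_act_commuting[OF DD D X]
    show "act_hom X Q D (Q \<otimes> Q \<otimes> Q) (tens_act Q D (Q \<otimes> Q) (tens_act Q D Q D X) X) (\<a> Q Q Q \<bullet> ((d \<boxtimes> \<one> Q) \<bullet> d))"
      by (rule act_hom_comp[OF act_hom_comp[OF d(1) act_hom_TensA[OF d(1) act_hom_id[OF D X]]] act_hom_Assoc])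
        (simp_all add: D DD DDD)
    show "act_hom X Q D (Q \<otimes> Q \<otimes> Q) (tens_act Q D (Q \<otimes> Q) (tens_act Q D Q D X) X) ((\<one> Q \<boxtimes> d) \<bullet> d)"
      by (rule act_hom_comp[OF d(1) act_hom_TensA[OF act_hom_id[OF D X] d(1)]])
        (simp_all add: D DD DDD)
    show "commuting_action C X (Q \<otimes> Q \<otimes> Q) (tens_act Q D (Q \<otimes> Q) (tens_act Q D Q D X) X)" by (rule DDD)
    fix x assume x: "x \<in> hom \<I> X"
    then have [simp]: "x \<in> Arr C" "Dom C x = \<I>" "Cod C x = X" by (auto simp: Hom_def)
    show "(\<a> Q Q Q \<bullet> ((d \<boxtimes> \<one> Q) \<bullet> d)) \<bullet> pt x = ((\<one> Q \<boxtimes> d) \<bullet> d) \<bullet> pt x"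
      by (rule ext0[where Z = "Q \<otimes> Q \<otimes> Q"]) (simp_all add: Hom_def app_eq[OF d(2)[OF x]])
  qed
  have "\<r> Q \<bullet> (\<one> Q \<boxtimes> e) \<bullet> d = \<l> Q \<bullet> \<s> Q \<I> \<bullet> (\<one> Q \<boxtimes> e) \<bullet> d"
    by (subst Comp_left[OF LUnit_Symm]) simp_all
  also have "\<dots> = \<l> Q \<bullet> (e \<boxtimes> \<one> Q) \<bullet> \<s> Q Q \<bullet> d"
    by (subst Comp_left[OF Symm_nat]) simp_all
  finally have 4: "\<r> Q \<bullet> (\<one> Q \<boxtimes> e) \<bullet> d = \<one> Q" using 1 2 by simp
  show ?thesis
    by (unfold_locales) (use 1 2 3 4 in \<open>simp_all add: Hom_def\<close>)
qed

lemma biproductD: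
  assumes "is_biproduct C X Y B p q i j" "X \<in> Obj C" "Y \<in> Obj C"
  shows "B \<in> Obj C" "p \<in> Arr C" "Dom C p = B" "Cod C p = X" "q \<in> Arr C" "Dom C q = B" "Cod C q = Y"
    "i \<in> Arr C" "Dom C i = X" "Cod C i = B" "j \<in> Arr C" "Dom C j = Y" "Cod C j = B"
    "p \<bullet> i = \<one> X" "q \<bullet> j = \<one> Y" "p \<bullet> j = \<zero> Y X" "q \<bullet> i = \<zero> X Y" "(i \<bullet> p) \<oplus> (j \<bullet> q) = \<one> B"
    "f \<in> Arr C \<Longrightarrow> Cod C f = X \<Longrightarrow> p \<bullet> i \<bullet> f = f" "f \<in> Arr C \<Longrightarrow> Cod C f = Y \<Longrightarrow> q \<bullet> j \<bullet> f = f"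
    "f \<in> Arr C \<Longrightarrow> Cod C f = Y \<Longrightarrow> p \<bullet> j \<bullet> f = \<zero> (Dom C f) X"
    "f \<in> Arr C \<Longrightarrow> Cod C f = X \<Longrightarrow> q \<bullet> i \<bullet> f = \<zero> (Dom C f) Y"
proof -
  show 1: "B \<in> Obj C" "p \<in> Arr C" "Dom C p = B" "Cod C p = X" "q \<in> Arr C" "Dom C q = B" "Cod C q = Y"
    "i \<in> Arr C" "Dom C i = X" "Cod C i = B" "j \<in> Arr C" "Dom C j = Y" "Cod C j = B"
    and 2: "p \<bullet> i = \<one> X" "q \<bullet> j = \<one> Y" "p \<bullet> j = \<zero> Y X" "q \<bullet> i = \<zero> X Y" "(i \<bullet> p) \<oplus> (j \<bullet> q) = \<one> B"
    using assms(1) by (auto simp: is_biproduct_def Hom_def)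
  note [simp] = 1 assms(2,3)
  show "f \<in> Arr C \<Longrightarrow> Cod C f = X \<Longrightarrow> p \<bullet> i \<bullet> f = f" "f \<in> Arr C \<Longrightarrow> Cod C f = Y \<Longrightarrow> q \<bullet> j \<bullet> f = f"
    "f \<in> Arr C \<Longrightarrow> Cod C f = Y \<Longrightarrow> p \<bullet> j \<bullet> f = \<zero> (Dom C f) X"
    "f \<in> Arr C \<Longrightarrow> Cod C f = X \<Longrightarrow> q \<bullet> i \<bullet> f = \<zero> (Dom C f) Y"
    using Comp_left[OF 2(1), of f] Comp_left[OF 2(2), of f] Comp_left[OF 2(3), of f] Comp_left[OF 2(4), of f]
    by simp_all
qed

text \<open>Counit and comultiplication come from freeness for the zero action on \<open>\<I>\<close> and the Leibniz action.
For the linear part consider the action \<open>(y, t) \<cdot> x = (t x, 0)\<close> on the biproduct of \<open>X\<close> and \<open>\<I>\<close>: the action map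
with value \<open>(x, 1)\<close> at the point \<open>x\<close> has the counit as its second component, hence its first
component satisfies the linear rule.\<close>

lemma free_action_diff_comonoid:
  assumes free: "free_action X Q D pt" and bip: "has_finite_biproducts C"
  shows "\<exists>e d \<epsilon>. free_diff_comonoid C \<lparr>Car = Q, Bas = X, Cou = e, Cmu = d, Dif = D, Lin = \<epsilon>, Pnt = pt\<rparr>"
proof -
  have X [simp]: "X \<in> Obj C" and D: "commuting_action C X Q D" and pt: "\<And>x. x \<in> hom \<I> X \<Longrightarrow> pt x \<in> hom \<I> Q"
    using free by (auto simp: free_action_def)
  note unique = free_action_unparametrised(2)[OF free]
  note DD = tens_act_commuting[OF D D X]
  note zero = zero_action[OF UnitO_Obj X]
  have p [simp]: "pt x \<in> Arr C" "Dom C (pt x) = \<I>" "Cod C (pt x) = Q" if "x \<in> Arr C" "Dom C x = \<I>" "Cod C x = X" for x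
    using pt[of x] that by (auto simp: Hom_def)
  obtain e where e: "act_hom X Q D \<I> (\<zero> (\<I> \<otimes> X) \<I>) e" "\<And>x. x \<in> hom \<I> X \<Longrightarrow> e \<bullet> pt x = \<one> \<I>"
    using free_action_unparametrised(1)[OF free zero, of "\<lambda>_. \<one> \<I>"] by (auto simp: Hom_def)
  have "\<And>x. x \<in> hom \<I> X \<Longrightarrow> (pt x \<boxtimes> pt x) \<bullet> Inv (\<l> \<I>) \<in> hom \<I> (Q \<otimes> Q)" by (simp add: Hom_def)
  then obtain d where d: "act_hom X Q D (Q \<otimes> Q) (tens_act Q D Q D X) d"
      "\<And>x. x \<in> hom \<I> X \<Longrightarrow> d \<bullet> pt x = (pt x \<boxtimes> pt x) \<bullet> Inv (\<l> \<I>)"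
    using free_action_unparametrised(1)[OF free DD, of "\<lambda>x. (pt x \<boxtimes> pt x) \<bullet> Inv (\<l> \<I>)"] by blast
  note [simp] = commuting_actionD[OF D] act_homD(1-3)[OF e(1)] act_homD(1-3)[OF d(1)]
  obtain B p q i j where B: "is_biproduct C X \<I> B p q i j"
    using bip X UnitO_Obj unfolding has_finite_biproducts_def by blast
  note [simp] = biproductD[OF B X UnitO_Obj]
  \<comment> \<open>The action is nilpotent: acting twice gives zero, so it commutes.\<close>
  let ?\<gamma> = "i \<bullet> \<l> X \<bullet> (q \<boxtimes> \<one> X)"
  have "?\<gamma> \<bullet> (?\<gamma> \<boxtimes> \<one> X) = \<zero> ((B \<otimes> X) \<otimes> X) B"
    by (simp add: TensA_Comp')
  moreover have "?\<gamma> \<bullet> (?\<gamma> \<boxtimes> \<one> X) \<bullet> RSwap B X X = (?\<gamma> \<bullet> (?\<gamma> \<boxtimes> \<one> X)) \<bullet> RSwap B X X"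
    by simp
  ultimately have \<gamma>: "commuting_action C X B ?\<gamma>" by (simp add: commuting_action_RSwap Hom_def)
  have "\<And>x. x \<in> hom \<I> X \<Longrightarrow> (i \<bullet> x) \<oplus> j \<in> hom \<I> B" by (simp add: Hom_def)
  then obtain k where k: "act_hom X Q D B ?\<gamma> k" "\<And>x. x \<in> hom \<I> X \<Longrightarrow> k \<bullet> pt x = (i \<bullet> x) \<oplus> j"
    using free_action_unparametrised(1)[OF free \<gamma>, of "\<lambda>x. (i \<bullet> x) \<oplus> j"] by blast
  note [simp] = act_homD(1-3)[OF k(1)]
  have kD: "k \<bullet> D = i \<bullet> \<l> X \<bullet> (q \<boxtimes> \<one> X) \<bullet> (k \<boxtimes> \<one> X)" using act_homD(4)[OF k(1)] by simp
  have qk: "q \<bullet> k = e"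
  proof (rule unique[OF zero _ e(1)])
    show "act_hom X Q D \<I> (\<zero> (\<I> \<otimes> X) \<I>) (q \<bullet> k)" by (simp add: act_hom_def Hom_def kD)
    show "(q \<bullet> k) \<bullet> pt x = e \<bullet> pt x" if x: "x \<in> hom \<I> X" for x
      using x by (simp add: k(2)[OF x] e(2)[OF x] Comp_Add' Hom_def)
  qed
  have "(p \<bullet> k) \<bullet> D = \<l> X \<bullet> (e \<boxtimes> \<one> X)"
    by (simp add: kD TensA_Comp' qk)
  moreover have "(p \<bullet> k) \<bullet> pt x = x" if x: "x \<in> hom \<I> X" for x
    using x by (simp add: k(2)[OF x] Comp_Add' Hom_def)
  moreover have "e \<bullet> D = \<zero> (Q \<otimes> X) \<I>" using act_homD(4)[OF e(1)] by simp
  moreover note act_homD(4)[OF d(1)] free_action_comonoid[OF free e d]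
  ultimately have "free_diff_comonoid C \<lparr>Car = Q, Bas = X, Cou = e, Cmu = d, Dif = D, Lin = p \<bullet> k, Pnt = pt\<rparr>"
    by (intro free_diff_comonoid.intro diff_comonoid.intro diff_comonoid_axioms.intro
        free_diff_comonoid_axioms.intro linear_symmetric_monoidal_category_axioms)
      (use D pt e d free in \<open>simp_all add: Hom_def\<close>)
  then show ?thesis by blast
qed

end


subsection \<open>Smooth maps\<close>

context linear_symmetric_monoidal_category
begin

text \<open>With \<open>ode\<close> for the differential of \<open>R'\<close>, the equation is the chain rule: the derivative of \<open>h\<close> at \<open>p\<close> in the
direction \<open>x\<close> is the derivative at \<open>h(p\<^sub>1)\<close> in the direction of the derivative at \<open>p\<^sub>2\<close> of the linear part of \<open>h\<close>.\<close>

definition smooth :: "('o, 'm) dcom \<Rightarrow> ('o, 'm) dcom \<Rightarrow> 'm \<Rightarrow> bool" where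
  "smooth R R' h \<longleftrightarrow> h \<in> hom (Car R) (Car R') \<and> Cou R' \<bullet> h = Cou R \<and> Cmu R' \<bullet> h = (h \<boxtimes> h) \<bullet> Cmu R \<and>
    ode R (Dif R') (Lin R' \<bullet> h) h \<and> (\<forall>x \<in> hom \<I> (Bas R). h \<bullet> Pnt R x = Pnt R' (Lin R' \<bullet> h \<bullet> Pnt R x))"

lemma smoothD:
  assumes "smooth R R' h"
  shows "h \<in> Arr C" "Dom C h = Car R" "Cod C h = Car R'" "Cou R' \<bullet> h = Cou R" "Cmu R' \<bullet> h = (h \<boxtimes> h) \<bullet> Cmu R"
    "ode R (Dif R') (Lin R' \<bullet> h) h"
    "x \<in> hom \<I> (Bas R) \<Longrightarrow> h \<bullet> Pnt R x = Pnt R' (Lin R' \<bullet> h \<bullet> Pnt R x)"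
  using assms by (auto simp: smooth_def Hom_def)

lemma smooth_id:
  assumes "diff_comonoid C R"
  shows "smooth R R (\<one> (Car R))"
proof -
  interpret R: diff_comonoid C R by fact
  let ?Q = "Car R" and ?X = "Bas R"
  have "\<one> ?Q \<bullet> Dif R = Dif R \<bullet> (\<one> ?Q \<boxtimes> (\<l> ?X \<bullet> (Cou R \<boxtimes> \<one> ?X))) \<bullet> \<a> ?Q ?Q ?X \<bullet> (Cmu R \<boxtimes> \<one> ?X)"
  proof (rule ext2[where e = "Cou R" and d = "Cmu R"])
    fix K p x assume v: "var K 0 ?Q (Cou R) (Cmu R) p" "var K 1 ?X e d x"
    then show "app (\<one> ?Q \<bullet> Dif R) (p \<otimes>\<otimes> x) =
        app (Dif R \<bullet> (\<one> ?Q \<boxtimes> (\<l> ?X \<bullet> (Cou R \<boxtimes> \<one> ?X))) \<bullet> \<a> ?Q ?Q ?X \<bullet> (Cmu R \<boxtimes> \<one> ?X)) (p \<otimes>\<otimes> x)"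
      by (simp add: var_def)
  qed (simp_all add: Hom_def)
  then show ?thesis
    by (auto simp: smooth_def ode_def ext_along_def Hom_def R.linear R.Lin_Pnt)
qed

lemma smooth_comp:
  assumes "diff_comonoid C R" "diff_comonoid C R'" "diff_comonoid C R''"
    and h: "smooth R R' h" and k: "smooth R' R'' k"
  shows "smooth R R'' (k \<bullet> h)"
proof -
  interpret R: diff_comonoid C R by fact
  interpret R': diff_comonoid C R' by fact
  interpret R'': diff_comonoid C R'' by fact
  note [simp] = smoothD(1-3)[OF h] smoothD(1-3)[OF k]
  define g where "g = Lin R' \<bullet> h"
  define g' where "g' = Lin R'' \<bullet> k"
  have [simp]: "g \<in> Arr C" "Dom C g = Car R" "Cod C g = Bas R'" "g' \<in> Arr C" "Dom C g' = Car R'" "Cod C g' = Bas R''"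
    by (simp_all add: g_def g'_def)
  have 1: "h \<bullet> Dif R = Dif R' \<bullet> ext_along R h (g \<bullet> Dif R)" "k \<bullet> Dif R' = Dif R'' \<bullet> ext_along R' k (g' \<bullet> Dif R')"
    using smoothD(6)[OF h] smoothD(6)[OF k] by (simp_all add: ode_def g_def g'_def)
  note 1 = this[unfolded ext_along_def]
  have "(k \<bullet> h) \<bullet> Dif R = Dif R'' \<bullet> ((k \<bullet> h) \<boxtimes> ((g' \<bullet> h) \<bullet> Dif R)) \<bullet> \<a> (Car R) (Car R) (Bas R) \<bullet> (Cmu R \<boxtimes> \<one> (Bas R))"
  proof (rule ext2[where e = "Cou R" and d = "Cmu R"])
    fix K p x assume v: "var K 0 (Car R) (Cou R) (Cmu R) p" "var K 1 (Bas R) e d x"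
    then show "app ((k \<bullet> h) \<bullet> Dif R) (p \<otimes>\<otimes> x) =
        app (Dif R'' \<bullet> ((k \<bullet> h) \<boxtimes> ((g' \<bullet> h) \<bullet> Dif R)) \<bullet> \<a> (Car R) (Car R) (Bas R) \<bullet> (Cmu R \<boxtimes> \<one> (Bas R))) (p \<otimes>\<otimes> x)"
      using app_eq[OF 1(1)] app_eq[OF 1(2)] app_eq[OF smoothD(5)[OF h]] by (simp add: var_def)
  qed (simp_all add: Hom_def)
  then have "ode R (Dif R'') (Lin R'' \<bullet> k \<bullet> h) (k \<bullet> h)"
    by (simp add: ode_def ext_along_def g'_def)
  moreover have "Cou R'' \<bullet> k \<bullet> h = Cou R" using Comp_left[OF smoothD(4)[OF k], of h] smoothD(4)[OF h] by simp
  moreover have "Cmu R'' \<bullet> k \<bullet> h = ((k \<bullet> h) \<boxtimes> (k \<bullet> h)) \<bullet> Cmu R"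
    using Comp_left[OF smoothD(5)[OF k], of h] smoothD(5)[OF h] by (simp add: TensA_Comp_left)
  moreover have "(k \<bullet> h) \<bullet> Pnt R x = Pnt R'' (Lin R'' \<bullet> (k \<bullet> h) \<bullet> Pnt R x)" if x: "x \<in> hom \<I> (Bas R)" for x
  proof -
    have [simp]: "Pnt R x \<in> Arr C" "Dom C (Pnt R x) = \<I>" "Cod C (Pnt R x) = Car R"
      using R.Pnt_Hom[OF x] by (auto simp: Hom_def)
    let ?y = "Lin R' \<bullet> h \<bullet> Pnt R x"
    have y: "?y \<in> hom \<I> (Bas R')" by (simp add: Hom_def)
    have [simp]: "Pnt R' ?y \<in> Arr C" "Dom C (Pnt R' ?y) = \<I>" "Cod C (Pnt R' ?y) = Car R'"
      using R'.Pnt_Hom[OF y] by (auto simp: Hom_def)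
    show ?thesis using smoothD(7)[OF h x] smoothD(7)[OF k y] by simp
  qed
  ultimately show ?thesis by (simp add: smooth_def Hom_def)
qed

text \<open>Two smooth maps with the same linear part solve the same linear differential equation, and the
condition on points gives them the same initial values.\<close>

lemma smooth_unique:
  assumes "free_diff_comonoid C R" "diff_comonoid C R'" and h: "smooth R R' h" and k: "smooth R R' k"
    and eq: "Lin R' \<bullet> h = Lin R' \<bullet> k"
  shows "h = k"
proof -
  interpret R: free_diff_comonoid C R by fact
  interpret R': diff_comonoid C R' by fact
  note [simp] = smoothD(1-3)[OF h] smoothD(1-3)[OF k]
  show ?thesis
  proof (rule R.ode_unique[OF R'.commuting])
    show "h \<bullet> Pnt R x = k \<bullet> Pnt R x" if x: "x \<in> hom \<I> (Bas R)" for x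
    proof -
      have [simp]: "Pnt R x \<in> Arr C" "Dom C (Pnt R x) = \<I>" "Cod C (Pnt R x) = Car R"
        using R.Pnt_Hom[OF x] by (auto simp: Hom_def)
      have "Lin R' \<bullet> h \<bullet> Pnt R x = Lin R' \<bullet> k \<bullet> Pnt R x"
        using Comp_left[OF eq, of "Pnt R x"] by simp
      then show ?thesis using smoothD(7)[OF h x] smoothD(7)[OF k x] by simp
    qed
    show "ode R (Dif R') (Lin R' \<bullet> k) h" "ode R (Dif R') (Lin R' \<bullet> k) k"
      using smoothD(6)[OF h] smoothD(6)[OF k] eq by simp_all
  qed (simp_all add: Hom_def)
qed

text \<open>Here \<open>f\<close> is not an action map, but \<open>(f, 1)\<close> is one into the biproduct of \<open>Y\<close> and \<open>Car R\<close> with the action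
\<open>(y, p) \<cdot> x = (f(p \<cdot> x), p \<cdot> x)\<close>, and so is \<open>(f', 1)\<close> since \<open>f\<close> and \<open>f'\<close> have the same derivative.\<close>

lemma quadrature_unique:
  assumes free: "free_diff_comonoid C R" and bip: "has_finite_biproducts C"
    and f: "f \<in> hom (Car R) Y" "f' \<in> hom (Car R) Y" and D: "f \<bullet> Dif R = f' \<bullet> Dif R"
    and pt: "\<And>x. x \<in> hom \<I> (Bas R) \<Longrightarrow> f \<bullet> Pnt R x = f' \<bullet> Pnt R x"
  shows "f = f'"
proof -
  interpret R: free_diff_comonoid C R by fact
  let ?Q = "Car R" and ?X = "Bas R"
  have [simp]: "f \<in> Arr C" "Dom C f = ?Q" "Cod C f = Y" "f' \<in> Arr C" "Dom C f' = ?Q" "Cod C f' = Y"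
    using f by (auto simp: Hom_def)
  then have Y [simp]: "Y \<in> Obj C" using Obj_Cod by metis
  obtain B p q i j where B: "is_biproduct C Y ?Q B p q i j"
    using bip Y R.dtyp(2) unfolding has_finite_biproducts_def by blast
  note [simp] = biproductD[OF B Y R.dtyp(2)]
  let ?k = "(i \<bullet> f \<bullet> Dif R) \<oplus> (j \<bullet> Dif R)"
  let ?\<gamma> = "?k \<bullet> (q \<boxtimes> \<one> ?X)"
  have q\<gamma>: "q \<bullet> ?\<gamma> = Dif R \<bullet> (q \<boxtimes> \<one> ?X)" by (simp add: Comp_Add')
  have DD: "Dif R \<bullet> (Dif R \<boxtimes> \<one> ?X) \<bullet> RSwap ?Q ?X ?X = Dif R \<bullet> (Dif R \<boxtimes> \<one> ?X)"
    using R.commuting by (simp add: commuting_action_RSwap)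
  have kDD: "?k \<bullet> (Dif R \<boxtimes> \<one> ?X) \<bullet> RSwap ?Q ?X ?X = ?k \<bullet> (Dif R \<boxtimes> \<one> ?X)"
    using DD by (simp add: Comp_Add')
  have *: "?\<gamma> \<bullet> (?\<gamma> \<boxtimes> \<one> ?X) = ?k \<bullet> (Dif R \<boxtimes> \<one> ?X) \<bullet> ((q \<boxtimes> \<one> ?X) \<boxtimes> \<one> ?X)"
  proof -
    have "?\<gamma> \<bullet> (?\<gamma> \<boxtimes> \<one> ?X) = ?k \<bullet> ((q \<bullet> ?\<gamma>) \<boxtimes> \<one> ?X)" by (simp add: TensA_Comp')
    also have "\<dots> = ?k \<bullet> (Dif R \<boxtimes> \<one> ?X) \<bullet> ((q \<boxtimes> \<one> ?X) \<boxtimes> \<one> ?X)" unfolding q\<gamma> by (simp add: TensA_Comp')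
    finally show ?thesis .
  qed
  have "?\<gamma> \<bullet> (?\<gamma> \<boxtimes> \<one> ?X) \<bullet> RSwap B ?X ?X = (?\<gamma> \<bullet> (?\<gamma> \<boxtimes> \<one> ?X)) \<bullet> RSwap B ?X ?X" by simp
  also have "\<dots> = ?k \<bullet> (Dif R \<boxtimes> \<one> ?X) \<bullet> RSwap ?Q ?X ?X \<bullet> ((q \<boxtimes> \<one> ?X) \<boxtimes> \<one> ?X)"
    unfolding * by (simp add: RSwap_nat)
  also have "\<dots> = (?k \<bullet> (Dif R \<boxtimes> \<one> ?X) \<bullet> RSwap ?Q ?X ?X) \<bullet> ((q \<boxtimes> \<one> ?X) \<boxtimes> \<one> ?X)" by simp
  also have "\<dots> = ?\<gamma> \<bullet> (?\<gamma> \<boxtimes> \<one> ?X)" unfolding kDD * by simp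
  finally have \<gamma>: "commuting_action C ?X B ?\<gamma>" by (simp add: commuting_action_RSwap Hom_def)
  have act: "act_hom ?X ?Q (Dif R) B ?\<gamma> ((i \<bullet> h) \<oplus> j)" if [simp]: "h \<in> Arr C" "Dom C h = ?Q" "Cod C h = Y"
    and h: "h \<bullet> Dif R = f \<bullet> Dif R" for h
  proof -
    have "q \<bullet> ((i \<bullet> h) \<oplus> j) = \<one> ?Q" by (simp add: Comp_Add')
    then have "?\<gamma> \<bullet> (((i \<bullet> h) \<oplus> j) \<boxtimes> \<one> ?X) = ?k" by (simp add: TensA_Comp')
    then show ?thesis by (simp add: act_hom_def Hom_def Comp_Add' h)
  qed
  have "(i \<bullet> f) \<oplus> j = (i \<bullet> f') \<oplus> j"
  proof (rule free_action_unparametrised(2)[OF R.free \<gamma> act act])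
    fix x assume x: "x \<in> hom \<I> ?X"
    then have [simp]: "Pnt R x \<in> Arr C" "Dom C (Pnt R x) = \<I>" "Cod C (Pnt R x) = ?Q"
      using R.Pnt_Hom[OF x] by (auto simp: Hom_def)
    show "((i \<bullet> f) \<oplus> j) \<bullet> Pnt R x = ((i \<bullet> f') \<oplus> j) \<bullet> Pnt R x"
      using pt[OF x] by (simp add: Comp_Add')
  qed (simp_all add: D)
  then have "p \<bullet> ((i \<bullet> f) \<oplus> j) = p \<bullet> ((i \<bullet> f') \<oplus> j)" by simp
  then show ?thesis by (simp add: Comp_Add')
qed

text \<open>Take the solution \<open>h\<close> of the differential equation given by \<open>g\<close>. It is compatible with the counit and the
comultiplication because both sides solve one equation with the same initial values, and its
linear part is \<open>g\<close> because both have the same derivative.\<close>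

lemma smooth_lift:
  assumes free: "free_diff_comonoid C R" and R': "diff_comonoid C R'" and bip: "has_finite_biproducts C"
    and g: "g \<in> hom (Car R) (Bas R')"
  shows "\<exists>h. smooth R R' h \<and> Lin R' \<bullet> h = g"
proof -
  interpret R: free_diff_comonoid C R by fact
  interpret R': diff_comonoid C R' by fact
  let ?Q = "Car R" and ?X = "Bas R" and ?Q' = "Car R'" and ?X' = "Bas R'"
  have [simp]: "g \<in> Arr C" "Dom C g = ?Q" "Cod C g = ?X'" using g by (auto simp: Hom_def)
  have gp: "g \<bullet> Pnt R x \<in> hom \<I> ?X'" if "x \<in> hom \<I> ?X" for x
    using R.Pnt_Hom[OF that] by (auto simp: Hom_def)
  obtain h where h: "h \<in> hom ?Q ?Q'" "ode R (Dif R') g h" and hp: "\<And>x. x \<in> hom \<I> ?X \<Longrightarrow> h \<bullet> Pnt R x = Pnt R' (g \<bullet> Pnt R x)"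
    using R.ode_exists[OF R'.commuting R'.base g, of "\<lambda>x. Pnt R' (g \<bullet> Pnt R x)"] R'.Pnt_Hom[OF gp] by blast
  have [simp]: "h \<in> Arr C" "Dom C h = ?Q" "Cod C h = ?Q'" using h by (auto simp: Hom_def)
  have hD: "h \<bullet> Dif R = Dif R' \<bullet> (h \<boxtimes> (g \<bullet> Dif R)) \<bullet> \<a> ?Q ?Q ?X \<bullet> (Cmu R \<boxtimes> \<one> ?X)"
    using h by (simp add: ode_def ext_along_def)
  have P [simp]: "Pnt R x \<in> Arr C" "Dom C (Pnt R x) = \<I>" "Cod C (Pnt R x) = ?Q"
      "Pnt R' (g \<bullet> Pnt R x) \<in> Arr C" "Dom C (Pnt R' (g \<bullet> Pnt R x)) = \<I>" "Cod C (Pnt R' (g \<bullet> Pnt R x)) = ?Q'"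
    if "x \<in> hom \<I> ?X" for x
    using R.Pnt_Hom[OF that] R'.Pnt_Hom[OF gp[OF that]] by (auto simp: Hom_def)
  have 1: "Cou R' \<bullet> h = Cou R"
  proof (rule free_action_unparametrised(2)[OF R.free zero_action[OF UnitO_Obj R.base]])
    have "(Cou R' \<bullet> h) \<bullet> Dif R = (Cou R' \<bullet> Dif R') \<bullet> (h \<boxtimes> (g \<bullet> Dif R)) \<bullet> \<a> ?Q ?Q ?X \<bullet> (Cmu R \<boxtimes> \<one> ?X)"
      by (simp add: hD)
    then show "act_hom ?X ?Q (Dif R) \<I> (\<zero> (\<I> \<otimes> ?X) \<I>) (Cou R' \<bullet> h)"
      unfolding R'.const_zero by (simp add: act_hom_def Hom_def)
    show "act_hom ?X ?Q (Dif R) \<I> (\<zero> (\<I> \<otimes> ?X) \<I>) (Cou R)"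
      by (simp add: act_hom_def Hom_def R.const_zero)
    show "(Cou R' \<bullet> h) \<bullet> Pnt R x = Cou R \<bullet> Pnt R x" if x: "x \<in> hom \<I> ?X" for x
      using x by (simp add: hp[OF x] R.Cou_Pnt[OF x] R'.Cou_Pnt[OF gp[OF x]])
  qed
  note tens = tens_act_commuting[OF R'.commuting R'.commuting R'.base]
  note [simp] = commuting_actionD[OF tens]
  have 2: "Cmu R' \<bullet> h = (h \<boxtimes> h) \<bullet> Cmu R"
  proof (rule R.ode_unique[OF tens R'.base g])
    have "(Cmu R' \<bullet> h) \<bullet> Dif R = (Cmu R' \<bullet> Dif R') \<bullet> (h \<boxtimes> (g \<bullet> Dif R)) \<bullet> \<a> ?Q ?Q ?X \<bullet> (Cmu R \<boxtimes> \<one> ?X)"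
      by (simp add: hD)
    then show "ode R (tens_act ?Q' (Dif R') ?Q' (Dif R') ?X') g (Cmu R' \<bullet> h)"
      unfolding R'.product by (simp add: ode_def ext_along_def TensA_Comp_left)
    have "((h \<boxtimes> h) \<bullet> Cmu R) \<bullet> Dif R = tens_act ?Q' (Dif R') ?Q' (Dif R') ?X' \<bullet>
        (((h \<boxtimes> h) \<bullet> Cmu R) \<boxtimes> (g \<bullet> Dif R)) \<bullet> \<a> ?Q ?Q ?X \<bullet> (Cmu R \<boxtimes> \<one> ?X)"
    proof (rule ext2[where e = "Cou R" and d = "Cmu R"])
      fix K p x assume v: "var K 0 ?Q (Cou R) (Cmu R) p" "var K 1 ?X e' d' x"
      then show "app (((h \<boxtimes> h) \<bullet> Cmu R) \<bullet> Dif R) (p \<otimes>\<otimes> x) = app (tens_act ?Q' (Dif R') ?Q' (Dif R') ?X' \<bullet>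
          (((h \<boxtimes> h) \<bullet> Cmu R) \<boxtimes> (g \<bullet> Dif R)) \<bullet> \<a> ?Q ?Q ?X \<bullet> (Cmu R \<boxtimes> \<one> ?X)) (p \<otimes>\<otimes> x)"
        using app_eq[OF hD, of "p \<otimes>\<otimes> x"] by (simp add: var_def insert_commute) (simp add: tens_act_def insert_commute)
    qed (simp_all add: Hom_def)
    then show "ode R (tens_act ?Q' (Dif R') ?Q' (Dif R') ?X') g ((h \<boxtimes> h) \<bullet> Cmu R)"
      by (simp add: ode_def ext_along_def)
    show "(Cmu R' \<bullet> h) \<bullet> Pnt R x = ((h \<boxtimes> h) \<bullet> Cmu R) \<bullet> Pnt R x" if x: "x \<in> hom \<I> ?X" for x
      using x by (simp add: hp[OF x] R.Cmu_Pnt[OF x] R'.Cmu_Pnt[OF gp[OF x]] TensA_Comp_left)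
  qed (simp_all add: Hom_def)
  have 3: "Lin R' \<bullet> h = g"
  proof (rule quadrature_unique[OF free bip])
    have "(Lin R' \<bullet> h) \<bullet> Dif R = (Lin R' \<bullet> Dif R') \<bullet> (h \<boxtimes> (g \<bullet> Dif R)) \<bullet> \<a> ?Q ?Q ?X \<bullet> (Cmu R \<boxtimes> \<one> ?X)"
      by (simp add: hD)
    also have "\<dots> = \<l> ?X' \<bullet> (Cou R \<boxtimes> (g \<bullet> Dif R)) \<bullet> \<a> ?Q ?Q ?X \<bullet> (Cmu R \<boxtimes> \<one> ?X)"
      unfolding R'.linear by (simp add: TensA_Comp_left 1)
    also have "\<dots> = g \<bullet> Dif R"
    proof (rule ext2[where e = "Cou R" and d = "Cmu R"])
      fix K p x assume v: "var K 0 ?Q (Cou R) (Cmu R) p" "var K 1 ?X e' d' x"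
      then show "app (\<l> ?X' \<bullet> (Cou R \<boxtimes> (g \<bullet> Dif R)) \<bullet> \<a> ?Q ?Q ?X \<bullet> (Cmu R \<boxtimes> \<one> ?X)) (p \<otimes>\<otimes> x) = app (g \<bullet> Dif R) (p \<otimes>\<otimes> x)"
        by (simp add: var_def)
    qed (simp_all add: Hom_def)
    finally show "(Lin R' \<bullet> h) \<bullet> Dif R = g \<bullet> Dif R" .
    show "(Lin R' \<bullet> h) \<bullet> Pnt R x = g \<bullet> Pnt R x" if x: "x \<in> hom \<I> ?X" for x
      using x by (simp add: hp[OF x] R'.Lin_Pnt[OF gp[OF x]])
  qed (simp_all add: Hom_def)
  have "h \<bullet> Pnt R x = Pnt R' (Lin R' \<bullet> h \<bullet> Pnt R x)" if x: "x \<in> hom \<I> ?X" for x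
    using hp[OF x] Comp_left[OF 3, of "Pnt R x"] x by simp
  then have "smooth R R' h" unfolding smooth_def 3 using h 1 2 by blast
  then show ?thesis using 3 by blast
qed

end


section \<open>Tensor products of differential comonoids\<close>

context symmetric_monoidal_category
begin

lemma scalar_right:
  assumes [simp]: "el s" "el t" "base s = base t" "supp t \<inter> supp s \<subseteq> CDup (base t)" "ty s = \<I>" "X = ty t"
  shows "app (\<r> X) (t \<otimes>\<otimes> s) = app (\<l> X) (s \<otimes>\<otimes> t)"
  by (simp flip: LUnit_Symm)

lemma scalar_pair_right:
  assumes [simp]: "el s" "el t" "el r" "base s = base r" "base t = base r" "ty s = \<I>" "X = ty t"
    "supp s \<inter> supp t \<subseteq> CDup (base r)" "supp s \<inter> supp r \<subseteq> CDup (base r)" "supp r \<inter> supp t \<subseteq> CDup (base r)"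
  shows "r \<otimes>\<otimes> app (\<l> X) (s \<otimes>\<otimes> t) = app (\<l> (ty r \<otimes> ty t)) (s \<otimes>\<otimes> r \<otimes>\<otimes> t)"
proof -
  have [simp]: "supp r \<inter> (supp s \<union> supp t) \<subseteq> CDup (base r)" "supp r \<inter> supp s \<subseteq> CDup (base r)" "supp t \<inter> supp r \<subseteq> CDup (base r)"
    "(supp s \<union> supp t) \<inter> supp r \<subseteq> CDup (base r)" "supp s \<inter> (supp r \<union> supp t) \<subseteq> CDup (base r)"
    "supp s \<inter> (supp t \<union> supp r) \<subseteq> CDup (base r)"
    using assms(8-10) by blast+
  have "r \<otimes>\<otimes> app (\<l> X) (s \<otimes>\<otimes> t) = app (\<s> (ty t) (ty r)) (app (\<l> X) (s \<otimes>\<otimes> t) \<otimes>\<otimes> r)" by simp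
  also have "\<dots> = app (\<s> (ty t) (ty r)) (app (\<l> (ty t \<otimes> ty r)) (s \<otimes>\<otimes> t \<otimes>\<otimes> r))"
    by (simp add: scalar_pair)
  also have "\<dots> = app (\<l> (ty r \<otimes> ty t)) (s \<otimes>\<otimes> r \<otimes>\<otimes> t)"
    by (simp add: scalar_app)
  finally show ?thesis .
qed

lemma scalar_assoc:
  assumes [simp]: "el s" "el s'" "el t" "base s = base t" "base s' = base t" "ty s = \<I>" "ty s' = \<I>" "X = ty t"
    "supp s \<inter> supp s' \<subseteq> CDup (base t)" "supp s \<inter> supp t \<subseteq> CDup (base t)" "supp s' \<inter> supp t \<subseteq> CDup (base t)"
  shows "app (\<l> X) (app (\<l> \<I>) (s \<otimes>\<otimes> s') \<otimes>\<otimes> t) = app (\<l> X) (s \<otimes>\<otimes> app (\<l> X) (s' \<otimes>\<otimes> t))"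
proof -
  have [simp]: "(supp s \<union> supp s') \<inter> supp t \<subseteq> CDup (base t)" "supp s \<inter> (supp s' \<union> supp t) \<subseteq> CDup (base t)"
    using assms(9-11) by blast+
  have "app (\<l> X) (app (\<l> \<I>) (s \<otimes>\<otimes> s') \<otimes>\<otimes> t) = app (\<l> X \<bullet> (\<l> \<I> \<boxtimes> \<one> X)) ((s \<otimes>\<otimes> s') \<otimes>\<otimes> t)"
    by simp
  then show ?thesis unfolding LUnit_twice[OF ty_Obj[OF assms(3)], folded assms(8)] by simp
qed

lemma scalar_swap:
  assumes [simp]: "el s" "el t" "base s = base t" "supp s \<inter> supp t \<subseteq> CDup (base t)" "ty s = \<I>" "ty t = \<I>"
  shows "app (\<l> \<I>) (s \<otimes>\<otimes> t) = app (\<l> \<I>) (t \<otimes>\<otimes> s)"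
proof -
  have [simp]: "supp t \<inter> supp s \<subseteq> CDup (base t)" using assms(4) by blast
  have "app (\<l> \<I>) (s \<otimes>\<otimes> t) = app (\<r> \<I>) (s \<otimes>\<otimes> t)" by (simp only: LUnit_eq_RUnit)
  also have "\<dots> = app (\<l> \<I>) (t \<otimes>\<otimes> s)" by (rule scalar_right) simp_all
  finally show ?thesis .
qed

lemma scalar_commute:
  assumes [simp]: "el s" "el s'" "el t" "base s = base t" "base s' = base t" "ty s = \<I>" "ty s' = \<I>" "X = ty t"
    "supp s \<inter> supp s' \<subseteq> CDup (base t)" "supp s \<inter> supp t \<subseteq> CDup (base t)" "supp s' \<inter> supp t \<subseteq> CDup (base t)"
  shows "app (\<l> X) (s \<otimes>\<otimes> app (\<l> X) (s' \<otimes>\<otimes> t)) = app (\<l> X) (s' \<otimes>\<otimes> app (\<l> X) (s \<otimes>\<otimes> t))"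
proof -
  have [simp]: "supp s' \<inter> supp s \<subseteq> CDup (base t)" using assms(9) by blast
  have "app (\<l> X) (s \<otimes>\<otimes> app (\<l> X) (s' \<otimes>\<otimes> t)) = app (\<l> X) (app (\<l> \<I>) (s \<otimes>\<otimes> s') \<otimes>\<otimes> t)"
    by (rule scalar_assoc[symmetric]) simp_all
  also have "\<dots> = app (\<l> X) (app (\<l> \<I>) (s' \<otimes>\<otimes> s) \<otimes>\<otimes> t)" by (subst scalar_swap) simp_all
  also have "\<dots> = app (\<l> X) (s' \<otimes>\<otimes> app (\<l> X) (s \<otimes>\<otimes> t))" by (rule scalar_assoc) simp_all
  finally show ?thesis .
qed

lemma tensor_comonoid:
  assumes "cocommutative_comonoid C A e d" "cocommutative_comonoid C A' e' d'"
  shows "cocommutative_comonoid C (A \<otimes> A') (\<l> \<I> \<bullet> (e \<boxtimes> e')) (MidSwap C A A A' A' \<bullet> (d \<boxtimes> d'))"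
proof -
  note [simp] = assms cocommutative_comonoid.comonoid_simps[OF assms(1)] cocommutative_comonoid.comonoid_simps[OF assms(2)]
  let ?e = "\<l> \<I> \<bullet> (e \<boxtimes> e')" and ?d = "MidSwap C A A A' A' \<bullet> (d \<boxtimes> d')" and ?A = "A \<otimes> A'"
  have "\<l> ?A \<bullet> (?e \<boxtimes> \<one> ?A) \<bullet> ?d = \<one> ?A"
  proof (rule ext2[where e = e and d = d and e' = e' and d' = d'])
    fix K a b assume "var K 0 A e d a" "var K 1 A' e' d' b"
    then show "app (\<l> ?A \<bullet> (?e \<boxtimes> \<one> ?A) \<bullet> ?d) (a \<otimes>\<otimes> b) = app (\<one> ?A) (a \<otimes>\<otimes> b)"
      by (simp add: var_def)
  qed (simp_all add: Hom_def)
  moreover have "\<r> ?A \<bullet> (\<one> ?A \<boxtimes> ?e) \<bullet> ?d = \<one> ?A"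
  proof (rule ext2[where e = e and d = d and e' = e' and d' = d'])
    fix K a b assume "var K 0 A e d a" "var K 1 A' e' d' b"
    then show "app (\<r> ?A \<bullet> (\<one> ?A \<boxtimes> ?e) \<bullet> ?d) (a \<otimes>\<otimes> b) = app (\<one> ?A) (a \<otimes>\<otimes> b)"
      by (simp add: var_def)
  qed (simp_all add: Hom_def)
  moreover have "\<a> ?A ?A ?A \<bullet> (?d \<boxtimes> \<one> ?A) \<bullet> ?d = (\<one> ?A \<boxtimes> ?d) \<bullet> ?d"
  proof (rule ext2[where e = e and d = d and e' = e' and d' = d'])
    fix K a b assume "var K 0 A e d a" "var K 1 A' e' d' b"
    then show "app (\<a> ?A ?A ?A \<bullet> (?d \<boxtimes> \<one> ?A) \<bullet> ?d) (a \<otimes>\<otimes> b) = app ((\<one> ?A \<boxtimes> ?d) \<bullet> ?d) (a \<otimes>\<otimes> b)"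
      by (simp add: var_def)
  qed (simp_all add: Hom_def)
  moreover have "\<s> ?A ?A \<bullet> ?d = ?d"
  proof (rule ext2[where e = e and d = d and e' = e' and d' = d'])
    fix K a b assume "var K 0 A e d a" "var K 1 A' e' d' b"
    then show "app (\<s> ?A ?A \<bullet> ?d) (a \<otimes>\<otimes> b) = app ?d (a \<otimes>\<otimes> b)"
      by (simp add: var_def)
  qed (simp_all add: Hom_def)
  ultimately show ?thesis
    by (intro cocommutative_comonoid.intro cocommutative_comonoid_axioms.intro symmetric_monoidal_category_axioms)
      (simp_all add: Hom_def)
qed

end

context linear_symmetric_monoidal_category
begin

text \<open>The base is a biproduct of the two bases, with projections \<open>p\<close>, \<open>q\<close> and injections \<open>i\<close>, \<open>j\<close>; the differential
is the sum of the two partial derivatives.\<close>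

definition tens_dcom :: "('o, 'm) dcom \<Rightarrow> ('o, 'm) dcom \<Rightarrow> 'o \<Rightarrow> 'm \<Rightarrow> 'm \<Rightarrow> 'm \<Rightarrow> 'm \<Rightarrow> ('o, 'm) dcom" where
  "tens_dcom R R' B p q i j =
    \<lparr>Car = Car R \<otimes> Car R', Bas = B, Cou = \<l> \<I> \<bullet> (Cou R \<boxtimes> Cou R'),
     Cmu = MidSwap C (Car R) (Car R) (Car R') (Car R') \<bullet> (Cmu R \<boxtimes> Cmu R'),
     Dif = (Dif R \<boxtimes> \<one> (Car R')) \<bullet> RSwap (Car R) (Car R') (Bas R) \<bullet> (\<one> (Car R \<otimes> Car R') \<boxtimes> p) \<oplus>
       (\<one> (Car R) \<boxtimes> Dif R') \<bullet> \<a> (Car R) (Car R') (Bas R') \<bullet> (\<one> (Car R \<otimes> Car R') \<boxtimes> q),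
     Lin = i \<bullet> \<r> (Bas R) \<bullet> (Lin R \<boxtimes> Cou R') \<oplus> j \<bullet> \<l> (Bas R') \<bullet> (Cou R \<boxtimes> Lin R'),
     Pnt = (\<lambda>z. (Pnt R (p \<bullet> z) \<boxtimes> Pnt R' (q \<bullet> z)) \<bullet> Inv (\<l> \<I>))\<rparr>"

lemma tens_dcom_simps [simp]:
  "Car (tens_dcom R R' B p q i j) = Car R \<otimes> Car R'" "Bas (tens_dcom R R' B p q i j) = B"
  "Cou (tens_dcom R R' B p q i j) = \<l> \<I> \<bullet> (Cou R \<boxtimes> Cou R')"
  "Cmu (tens_dcom R R' B p q i j) = MidSwap C (Car R) (Car R) (Car R') (Car R') \<bullet> (Cmu R \<boxtimes> Cmu R')"
  "Pnt (tens_dcom R R' B p q i j) = (\<lambda>z. (Pnt R (p \<bullet> z) \<boxtimes> Pnt R' (q \<bullet> z)) \<bullet> Inv (\<l> \<I>))"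
  by (simp_all add: tens_dcom_def)

definition unit_dcom :: "'o \<Rightarrow> ('o, 'm) dcom" where
  "unit_dcom Z = \<lparr>Car = \<I>, Bas = Z, Cou = \<one> \<I>, Cmu = Inv (\<l> \<I>), Dif = \<zero> (\<I> \<otimes> Z) \<I>, Lin = \<zero> \<I> Z, Pnt = (\<lambda>_. \<one> \<I>)\<rparr>"

lemma unit_dcom_simps [simp]:
  "Car (unit_dcom Z) = \<I>" "Bas (unit_dcom Z) = Z" "Cou (unit_dcom Z) = \<one> \<I>" "Cmu (unit_dcom Z) = Inv (\<l> \<I>)"
  "Dif (unit_dcom Z) = \<zero> (\<I> \<otimes> Z) \<I>" "Lin (unit_dcom Z) = \<zero> \<I> Z" "Pnt (unit_dcom Z) = (\<lambda>_. \<one> \<I>)"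
  by (simp_all add: unit_dcom_def)

end

locale dcom_pair = linear_symmetric_monoidal_category C + R: diff_comonoid C R + R': diff_comonoid C R'
  for C :: "('o, 'm, 'k::{comm_semiring_0,comm_monoid_mult}, 'z) linsmcat_scheme" (structure)
    and R R' :: "('o, 'm) dcom" +
  fixes B p q i j
  assumes bip: "is_biproduct C (Bas R) (Bas R') B p q i j"
begin

abbreviation T :: "('o, 'm) dcom" where "T \<equiv> tens_dcom R R' B p q i j"

lemmas bip_simps [simp] = biproductD[OF bip R.base R'.base]

lemma app_bip [simp]:
  "el t \<Longrightarrow> ty t = Bas R \<Longrightarrow> app p (app i t) = t" "el t \<Longrightarrow> ty t = Bas R' \<Longrightarrow> app q (app j t) = t"
  "el t \<Longrightarrow> ty t = Bas R' \<Longrightarrow> app p (app j t) = zero (base t) (supp t) (Bas R)"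
  "el t \<Longrightarrow> ty t = Bas R \<Longrightarrow> app q (app i t) = zero (base t) (supp t) (Bas R')"
  "el t \<Longrightarrow> ty t = B \<Longrightarrow> app i (app p t) \<oplus>\<oplus> app j (app q t) = t"
proof -
  show "app p (app i t) = t" if "el t" "ty t = Bas R"
    using app_eq[OF bip_simps(14), of t] that by simp
  show "app q (app j t) = t" if "el t" "ty t = Bas R'"
    using app_eq[OF bip_simps(15), of t] that by simp
  show "app p (app j t) = zero (base t) (supp t) (Bas R)" if "el t" "ty t = Bas R'"
    using app_eq[OF bip_simps(16), of t] that by simp
  show "app q (app i t) = zero (base t) (supp t) (Bas R')" if "el t" "ty t = Bas R"
    using app_eq[OF bip_simps(17), of t] that by simp
  show "app i (app p t) \<oplus>\<oplus> app j (app q t) = t" if "el t" "ty t = B"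
  proof -
    have "app ((i \<bullet> p) \<oplus> (j \<bullet> q)) t = t" unfolding bip_simps(18) using that by simp
    then show ?thesis using that by (simp del: bip_simps(18))
  qed
qed

lemma Dif_typ [simp]: "Dif T \<in> Arr C" "Dom C (Dif T) = (Car R \<otimes> Car R') \<otimes> B" "Cod C (Dif T) = Car R \<otimes> Car R'"
  and Lin_typ [simp]: "Lin T \<in> Arr C" "Dom C (Lin T) = Car R \<otimes> Car R'" "Cod C (Lin T) = B"
  by (simp_all add: tens_dcom_def)

lemma app_Dif [simp]:
  "el a \<Longrightarrow> el b \<Longrightarrow> el z \<Longrightarrow> base a = base z \<Longrightarrow> base b = base z \<Longrightarrow> ty a = Car R \<Longrightarrow> ty b = Car R' \<Longrightarrow> ty z = B \<Longrightarrow>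
    supp a \<inter> supp b \<subseteq> CDup (base z) \<Longrightarrow> supp a \<inter> supp z \<subseteq> CDup (base z) \<Longrightarrow> supp b \<inter> supp z \<subseteq> CDup (base z) \<Longrightarrow>
    app (Dif T) ((a \<otimes>\<otimes> b) \<otimes>\<otimes> z) =
      app (Dif R) (a \<otimes>\<otimes> app p z) \<otimes>\<otimes> b \<oplus>\<oplus> a \<otimes>\<otimes> app (Dif R') (b \<otimes>\<otimes> app q z)"
  by (simp add: tens_dcom_def Int_Un_distrib Int_Un_distrib2 Un_ac Int_commute)

lemma app_Lin [simp]:
  "el a \<Longrightarrow> el b \<Longrightarrow> base a = base b \<Longrightarrow> ty a = Car R \<Longrightarrow> ty b = Car R' \<Longrightarrow> supp a \<inter> supp b \<subseteq> CDup (base b) \<Longrightarrow>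
    app (Lin T) (a \<otimes>\<otimes> b) = app i (app (\<r> (Bas R)) (app (Lin R) a \<otimes>\<otimes> app (Cou R') b)) \<oplus>\<oplus>
      app j (app (\<l> (Bas R')) (app (Cou R) a \<otimes>\<otimes> app (Lin R') b))"
  by (simp add: tens_dcom_def)

lemma tens_diff_comonoid: "diff_comonoid C T"
proof -
  let ?Q = "Car R" and ?Q' = "Car R'" and ?P = "Car R \<otimes> Car R'"
  have [simp]: "B \<in> Obj C" by simp
  have "Dif T \<bullet> (Dif T \<boxtimes> \<one> B) \<bullet> RSwap ?P B B = Dif T \<bullet> (Dif T \<boxtimes> \<one> B)"
  proof (rule ext4)
    fix K a b x y
    assume [simp]: "ctxt_ok K" and v: "var K 0 ?Q (\<one> \<I>) (\<one> \<I>) a" "var K 1 ?Q' (\<one> \<I>) (\<one> \<I>) b" "var K 2 B (\<one> \<I>) (\<one> \<I>) x"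
      "var K 3 B (\<one> \<I>) (\<one> \<I>) y"
    note [simp] = varD[OF v(1)] varD[OF v(2)] varD[OF v(3)] varD[OF v(4)]
    show "app (Dif T \<bullet> (Dif T \<boxtimes> \<one> B) \<bullet> RSwap ?P B B) (((a \<otimes>\<otimes> b) \<otimes>\<otimes> x) \<otimes>\<otimes> y) =
      app (Dif T \<bullet> (Dif T \<boxtimes> \<one> B)) (((a \<otimes>\<otimes> b) \<otimes>\<otimes> x) \<otimes>\<otimes> y)"
      by (simp add: insert_commute commuting_app[OF R.commuting R.base] commuting_app[OF R'.commuting R'.base] plus_ac)
  qed (simp_all add: Hom_def)
  then have 1: "commuting_action C B ?P (Dif T)" by (simp add: commuting_action_RSwap Hom_def)
  have 2: "Cou T \<bullet> Dif T = \<zero> (?P \<otimes> B) \<I>"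
  proof (rule ext3)
    fix K a b x
    assume [simp]: "ctxt_ok K" and v: "var K 0 ?Q (\<one> \<I>) (\<one> \<I>) a" "var K 1 ?Q' (\<one> \<I>) (\<one> \<I>) b" "var K 2 B (\<one> \<I>) (\<one> \<I>) x"
    note [simp] = varD[OF v(1)] varD[OF v(2)] varD[OF v(3)]
    show "app (Cou T \<bullet> Dif T) ((a \<otimes>\<otimes> b) \<otimes>\<otimes> x) = app (\<zero> (?P \<otimes> B) \<I>) ((a \<otimes>\<otimes> b) \<otimes>\<otimes> x)"
      by (simp add: insert_commute)
  qed (simp_all add: Hom_def)
  have 3: "Cmu T \<bullet> Dif T = tens_act ?P (Dif T) ?P (Dif T) B \<bullet> (Cmu T \<boxtimes> \<one> B)"
  proof (rule ext3[where e = "Cou R" and d = "Cmu R" and e' = "Cou R'" and d' = "Cmu R'"])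
    fix K a b x
    assume [simp]: "ctxt_ok K" and v: "var K 0 ?Q (Cou R) (Cmu R) a" "var K 1 ?Q' (Cou R') (Cmu R') b" "var K 2 B e'' d'' x"
    then show "app (Cmu T \<bullet> Dif T) ((a \<otimes>\<otimes> b) \<otimes>\<otimes> x) =
        app (tens_act ?P (Dif T) ?P (Dif T) B \<bullet> (Cmu T \<boxtimes> \<one> B)) ((a \<otimes>\<otimes> b) \<otimes>\<otimes> x)"
      by (simp add: var_def tens_act_def insert_commute plus_ac)
  qed (simp_all add: Hom_def tens_act_typ)
  have 4: "Lin T \<bullet> Dif T = \<l> B \<bullet> (Cou T \<boxtimes> \<one> B)"
  proof (rule ext3[where e = "Cou R" and d = "Cmu R" and e' = "Cou R'" and d' = "Cmu R'"])
    fix K a b x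
    assume [simp]: "ctxt_ok K" and v: "var K 0 ?Q (Cou R) (Cmu R) a" "var K 1 ?Q' (Cou R') (Cmu R') b" "var K 2 B e'' d'' x"
    then have [simp]: "el x" "ty x = B" by (simp_all add: var_def)
    have "app (\<l> B \<bullet> (Cou T \<boxtimes> \<one> B)) ((a \<otimes>\<otimes> b) \<otimes>\<otimes> x) =
        app (\<l> B \<bullet> (Cou T \<boxtimes> \<one> B)) ((a \<otimes>\<otimes> b) \<otimes>\<otimes> (app i (app p x) \<oplus>\<oplus> app j (app q x)))"
      by simp
    also have "\<dots> = app (Lin T \<bullet> Dif T) ((a \<otimes>\<otimes> b) \<otimes>\<otimes> x)"
      using v by (simp add: var_def insert_commute scalar_right scalar_app scalar_assoc del: app_bip(5))
        (simp add: insert_commute scalar_commute)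
    finally show "app (Lin T \<bullet> Dif T) ((a \<otimes>\<otimes> b) \<otimes>\<otimes> x) = app (\<l> B \<bullet> (Cou T \<boxtimes> \<one> B)) ((a \<otimes>\<otimes> b) \<otimes>\<otimes> x)" ..
  qed (simp_all add: Hom_def)
  have 5: "Cou T \<bullet> Pnt T z = \<one> \<I>" "Cmu T \<bullet> Pnt T z = (Pnt T z \<boxtimes> Pnt T z) \<bullet> Inv (\<l> \<I>)" "Lin T \<bullet> Pnt T z = z"
      "Pnt T z \<in> hom \<I> ?P"
    if z: "z \<in> hom \<I> B" for z
  proof -
    have [simp]: "z \<in> Arr C" "Dom C z = \<I>" "Cod C z = B" using z by (auto simp: Hom_def)
    show "Pnt T z \<in> hom \<I> ?P" by (simp add: Hom_def)
    show "Cou T \<bullet> Pnt T z = \<one> \<I>" by (rule ext0[where Z = \<I>]) (simp_all add: Hom_def)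
    show "Cmu T \<bullet> Pnt T z = (Pnt T z \<boxtimes> Pnt T z) \<bullet> Inv (\<l> \<I>)"
      by (rule ext0[where Z = "?P \<otimes> ?P"]) (simp_all add: Hom_def)
    show "Lin T \<bullet> Pnt T z = z" by (rule ext0[where Z = B]) (simp_all add: Hom_def)
  qed
  show ?thesis
    by (intro diff_comonoid.intro diff_comonoid_axioms.intro linear_symmetric_monoidal_category_axioms)
      (use 1 2 3 4 5 tensor_comonoid[OF R.comonoid R'.comonoid] in \<open>simp_all add: Hom_def\<close>)
qed

end


section \<open>Smoothness of the structure maps\<close>

context linear_symmetric_monoidal_category
begin

text \<open>If the linear part of \<open>h\<close> is \<open>\<psi> \<circ> Lin R\<close>, then \<open>g(p\<^sub>2 \<cdot> x) = e(p\<^sub>2) \<psi>(x)\<close> by the linear rule, and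
the chain rule reduces to \<open>h(p \<cdot> x) = h(p) \<cdot> \<psi>(x)\<close>. All structure maps of the monoidal category and of
comonoids are of this kind.\<close>

lemma smooth_linear:
  assumes "diff_comonoid C R" "diff_comonoid C R'"
    and h: "h \<in> hom (Car R) (Car R')" and \<psi>: "\<psi> \<in> hom (Bas R) (Bas R')"
    and hom: "Cou R' \<bullet> h = Cou R" "Cmu R' \<bullet> h = (h \<boxtimes> h) \<bullet> Cmu R"
    and D: "h \<bullet> Dif R = Dif R' \<bullet> (h \<boxtimes> \<psi>)" and L: "Lin R' \<bullet> h = \<psi> \<bullet> Lin R"
    and pt: "\<And>x. x \<in> hom \<I> (Bas R) \<Longrightarrow> h \<bullet> Pnt R x = Pnt R' (\<psi> \<bullet> x)"
  shows "smooth R R' h"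
proof -
  interpret R: diff_comonoid C R by fact
  interpret R': diff_comonoid C R' by fact
  have [simp]: "h \<in> Arr C" "Dom C h = Car R" "Cod C h = Car R'" "\<psi> \<in> Arr C" "Dom C \<psi> = Bas R" "Cod C \<psi> = Bas R'"
    using h \<psi> by (auto simp: Hom_def)
  have "h \<bullet> Dif R = Dif R' \<bullet> (h \<boxtimes> ((\<psi> \<bullet> Lin R) \<bullet> Dif R)) \<bullet> \<a> (Car R) (Car R) (Bas R) \<bullet> (Cmu R \<boxtimes> \<one> (Bas R))"
    unfolding D
  proof (rule ext2[where e = "Cou R" and d = "Cmu R"])
    fix K p x assume v: "var K 0 (Car R) (Cou R) (Cmu R) p" "var K 1 (Bas R) e' d' x"
    then show "app (Dif R' \<bullet> (h \<boxtimes> \<psi>)) (p \<otimes>\<otimes> x) =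
      app (Dif R' \<bullet> (h \<boxtimes> ((\<psi> \<bullet> Lin R) \<bullet> Dif R)) \<bullet> \<a> (Car R) (Car R) (Bas R) \<bullet> (Cmu R \<boxtimes> \<one> (Bas R))) (p \<otimes>\<otimes> x)"
      by (simp add: var_def scalar_app)
  qed (simp_all add: Hom_def)
  then have "ode R (Dif R') (Lin R' \<bullet> h) h" by (simp add: ode_def ext_along_def L)
  moreover have "h \<bullet> Pnt R x = Pnt R' (Lin R' \<bullet> h \<bullet> Pnt R x)" if x: "x \<in> hom \<I> (Bas R)" for x
  proof -
    have [simp]: "Pnt R x \<in> Arr C" "Dom C (Pnt R x) = \<I>" "Cod C (Pnt R x) = Car R"
      using R.Pnt_Hom[OF x] by (auto simp: Hom_def)
    show ?thesis using pt[OF x] Comp_left[OF L, of "Pnt R x"] R.Lin_Pnt[OF x] by simp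
  qed
  ultimately show ?thesis using h hom by (simp add: smooth_def)
qed

lemma terminalD: "terminal_object C Z \<Longrightarrow> f \<in> hom Y Z \<Longrightarrow> g \<in> hom Y Z \<Longrightarrow> f = g"
  unfolding terminal_object_def Hom_def using Obj_Dom by blast

lemma unit_comonoid_cocommutative: "cocommutative_comonoid C \<I> (\<one> \<I>) (Inv (\<l> \<I>))"
proof -
  have "\<a> \<I> \<I> \<I> \<bullet> (Inv (\<l> \<I>) \<boxtimes> \<one> \<I>) \<bullet> Inv (\<l> \<I>) = (\<one> \<I> \<boxtimes> Inv (\<l> \<I>)) \<bullet> Inv (\<l> \<I>)"
    using Comp_left[OF unit_coherence(1)[of \<I> \<I>], of "Inv (\<l> \<I>)"] Inv_LUnit_nat[of "Inv (\<l> \<I>)" \<I>] by simp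
  moreover have "\<s> \<I> \<I> \<bullet> Inv (\<l> \<I>) = Inv (\<l> \<I>)"
    using Symm_Inv_unit(1)[of \<I>] by (simp add: LUnit_eq_RUnit)
  moreover have "\<r> \<I> \<bullet> Inv (\<l> \<I>) = \<one> \<I>" by (simp add: LUnit_eq_RUnit)
  ultimately show ?thesis
    by (intro cocommutative_comonoid.intro cocommutative_comonoid_axioms.intro symmetric_monoidal_category_axioms)
      (simp_all add: Hom_def)
qed

text \<open>An action of a zero object is zero and its only point is zero, so the unit is free.\<close>

lemma unit_free_diff_comonoid:
  assumes Z: "terminal_object C Z"
  shows "free_diff_comonoid C (unit_dcom Z)"
proof -
  have Zo [simp]: "Z \<in> Obj C" using Z by (simp add: terminal_object_def)
  have one: "\<one> Z = \<zero> Z Z" by (rule terminalD[OF Z]) (simp_all add: Hom_def)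
  have co: "commuting_action C Z \<I> (\<zero> (\<I> \<otimes> Z) \<I>)" by (rule zero_action) simp_all
  have free: "free_action Z \<I> (\<zero> (\<I> \<otimes> Z) \<I>) (\<lambda>_. \<one> \<I>)"
    unfolding free_action_def
  proof (intro conjI allI impI ballI)
    fix W A \<alpha> a assume W [simp]: "W \<in> Obj C" and \<alpha>: "commuting_action C Z A \<alpha>" and a: "\<forall>x \<in> hom \<I> Z. a x \<in> hom W A"
    note [simp] = commuting_actionD[OF \<alpha>]
    have z: "\<zero> \<I> Z \<in> hom \<I> Z" by (simp add: Hom_def)
    then have [simp]: "a (\<zero> \<I> Z) \<in> Arr C" "Dom C (a (\<zero> \<I> Z)) = W" "Cod C (a (\<zero> \<I> Z)) = A" using a by (auto simp: Hom_def)
    have x: "x = \<zero> \<I> Z" if "x \<in> hom \<I> Z" for x using terminalD[OF Z that z] .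
    show "\<exists>!F. act_hom Z (W \<otimes> \<I>) ((\<one> W \<boxtimes> \<zero> (\<I> \<otimes> Z) \<I>) \<bullet> \<a> W \<I> Z) A \<alpha> F \<and>
        (\<forall>x \<in> hom \<I> Z. F \<bullet> (\<one> W \<boxtimes> \<one> \<I>) \<bullet> Inv (\<r> W) = a x)"
    proof (rule ex1I)
      let ?F = "a (\<zero> \<I> Z) \<bullet> \<r> W"
      have "?F \<bullet> (\<one> W \<boxtimes> \<one> \<I>) \<bullet> Inv (\<r> W) = a x" if "x \<in> hom \<I> Z" for x
        unfolding x[OF that] by simp
      moreover have "act_hom Z (W \<otimes> \<I>) ((\<one> W \<boxtimes> \<zero> (\<I> \<otimes> Z) \<I>) \<bullet> \<a> W \<I> Z) A \<alpha> ?F"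
        by (simp add: act_hom_def Hom_def one)
      ultimately show "act_hom Z (W \<otimes> \<I>) ((\<one> W \<boxtimes> \<zero> (\<I> \<otimes> Z) \<I>) \<bullet> \<a> W \<I> Z) A \<alpha> ?F \<and>
        (\<forall>x \<in> hom \<I> Z. ?F \<bullet> (\<one> W \<boxtimes> \<one> \<I>) \<bullet> Inv (\<r> W) = a x)" by blast
      fix F assume F: "act_hom Z (W \<otimes> \<I>) ((\<one> W \<boxtimes> \<zero> (\<I> \<otimes> Z) \<I>) \<bullet> \<a> W \<I> Z) A \<alpha> F \<and>
        (\<forall>x \<in> hom \<I> Z. F \<bullet> (\<one> W \<boxtimes> \<one> \<I>) \<bullet> Inv (\<r> W) = a x)"
      then have [simp]: "F \<in> Arr C" "Dom C F = W \<otimes> \<I>" "Cod C F = A" by (auto simp: act_hom_def Hom_def)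
      have "F \<bullet> Inv (\<r> W) = a (\<zero> \<I> Z)" using F z by simp
      then have "(F \<bullet> Inv (\<r> W)) \<bullet> \<r> W = ?F" by simp
      then show "F = ?F" by simp
    qed
  qed (simp_all add: co Hom_def)
  have lin: "\<zero> (\<I> \<otimes> Z) Z = \<l> Z" by (rule terminalD[OF Z]) (simp_all add: Hom_def)
  have pt: "\<zero> \<I> Z = x" if "x \<in> hom \<I> Z" for x by (rule terminalD[OF Z _ that]) (simp add: Hom_def)
  show ?thesis
    by (intro free_diff_comonoid.intro diff_comonoid.intro diff_comonoid_axioms.intro
        free_diff_comonoid_axioms.intro linear_symmetric_monoidal_category_axioms)
      (use co free lin pt unit_comonoid_cocommutative in \<open>simp_all add: Hom_def tens_act_def\<close>)
qed

lemma smooth_counit: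
  assumes R: "diff_comonoid C R" and Z: "terminal_object C Z"
  shows "smooth R (unit_dcom Z) (Cou R)"
proof -
  interpret R: diff_comonoid C R by fact
  interpret U: free_diff_comonoid C "unit_dcom Z" by (rule unit_free_diff_comonoid[OF Z])
  have Zo [simp]: "Z \<in> Obj C" using Z by (simp add: terminal_object_def)
  have "Inv (\<l> \<I>) \<bullet> Cou R = (Cou R \<boxtimes> Cou R) \<bullet> Cmu R"
  proof (rule ext1[where e = "Cou R" and d = "Cmu R"])
    fix K p assume v: "var K 0 (Car R) (Cou R) (Cmu R) p"
    then have w: "weak p (Cou R)" and [simp]: "el p" "ty p = Car R" "0 \<in> CDup (base p)" "supp p = {0}" "app (Cmu R) p = p \<otimes>\<otimes> p" by (simp_all add: var_def)
    have "app (\<l> \<I>) (app (Cou R) p \<otimes>\<otimes> app (Cou R) p) = app (Cou R) p"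
      by (rule weak_LUnit[OF w]) simp_all
    then have "app (Inv (\<l> \<I>)) (app (Cou R) p) = app (Cou R) p \<otimes>\<otimes> app (Cou R) p"
      by (rule app_iso_eq[rotated -1]) simp_all
    then show "app (Inv (\<l> \<I>) \<bullet> Cou R) p = app ((Cou R \<boxtimes> Cou R) \<bullet> Cmu R) p" by simp
  qed (simp_all add: Hom_def)
  then show ?thesis
    by (intro smooth_linear[where \<psi> = "\<zero> (Bas R) Z"])
      (simp_all add: R U.diff_comonoid_axioms Hom_def R.const_zero R.Cou_Pnt)
qed

text \<open>The linear part of the comultiplication is the diagonal of the base.\<close>

lemma smooth_comult:
  assumes R: "diff_comonoid C R" and B: "is_biproduct C (Bas R) (Bas R) B p q i j"
  shows "smooth R (tens_dcom R R B p q i j) (Cmu R)"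
proof -
  interpret dcom_pair C R R B p q i j
    by (intro dcom_pair.intro dcom_pair_axioms.intro linear_symmetric_monoidal_category_axioms R B)
  let ?Q = "Car R" and ?\<psi> = "i \<oplus> j"
  have 1: "Cou T \<bullet> Cmu R = Cou R"
  proof (rule ext1[where e = "Cou R" and d = "Cmu R"])
    fix K a assume v: "var K 0 (Car R) (Cou R) (Cmu R) a"
    then show "app (Cou T \<bullet> Cmu R) a = app (Cou R) a" by (simp add: var_def)
  qed (simp_all add: Hom_def)
  have 2: "Cmu T \<bullet> Cmu R = (Cmu R \<boxtimes> Cmu R) \<bullet> Cmu R"
  proof (rule ext1[where e = "Cou R" and d = "Cmu R"])
    fix K a assume v: "var K 0 (Car R) (Cou R) (Cmu R) a"
    then show "app (Cmu T \<bullet> Cmu R) a = app ((Cmu R \<boxtimes> Cmu R) \<bullet> Cmu R) a" by (simp add: var_def)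
  qed (simp_all add: Hom_def)
  have 3: "Cmu R \<bullet> Dif R = Dif T \<bullet> (Cmu R \<boxtimes> ?\<psi>)"
  proof (rule ext2[where e = "Cou R" and d = "Cmu R"])
    fix K a x assume [simp]: "ctxt_ok K" and v: "var K 0 (Car R) (Cou R) (Cmu R) a" "var K 1 (Bas R) e' d' x"
    then show "app (Cmu R \<bullet> Dif R) (a \<otimes>\<otimes> x) = app (Dif T \<bullet> (Cmu R \<boxtimes> ?\<psi>)) (a \<otimes>\<otimes> x)"
      by (simp add: var_def insert_commute plus_ac)
  qed (simp_all add: Hom_def)
  have 4: "Lin T \<bullet> Cmu R = ?\<psi> \<bullet> Lin R"
  proof (rule ext1[where e = "Cou R" and d = "Cmu R"])
    fix K a assume v: "var K 0 (Car R) (Cou R) (Cmu R) a"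
    then show "app (Lin T \<bullet> Cmu R) a = app (?\<psi> \<bullet> Lin R) a" by (simp add: var_def)
  qed (simp_all add: Hom_def)
  have 5: "Cmu R \<bullet> Pnt R x = Pnt T (?\<psi> \<bullet> x)" if "x \<in> hom \<I> (Bas R)" for x
    using that by (simp add: R.Cmu_Pnt Comp_Add' Hom_def)
  show ?thesis
    by (rule smooth_linear[OF R tens_diff_comonoid, where \<psi> = ?\<psi>]) (use 1 2 3 4 5 in \<open>simp_all add: Hom_def\<close>)
qed

lemma smooth_Symm:
  assumes R: "diff_comonoid C R" and R': "diff_comonoid C R'"
    and B: "is_biproduct C (Bas R) (Bas R') B p q i j" and B': "is_biproduct C (Bas R') (Bas R) B' p' q' i' j'"
  shows "smooth (tens_dcom R R' B p q i j) (tens_dcom R' R B' p' q' i' j') (\<s> (Car R) (Car R'))"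
proof -
  interpret dcom_pair C R R' B p q i j
    by (intro dcom_pair.intro dcom_pair_axioms.intro linear_symmetric_monoidal_category_axioms R R' B)
  interpret S: dcom_pair C R' R B' p' q' i' j'
    by (intro dcom_pair.intro dcom_pair_axioms.intro linear_symmetric_monoidal_category_axioms R R' B')
  let ?Q = "Car R" and ?Q' = "Car R'" and ?\<psi> = "(i' \<bullet> q) \<oplus> (j' \<bullet> p)" and ?h = "\<s> (Car R) (Car R')"
  have 1: "Cou S.T \<bullet> ?h = Cou T"
  proof (rule ext2[where e = "Cou R" and d = "Cmu R" and e' = "Cou R'" and d' = "Cmu R'"])
    fix K a b assume v: "var K 0 (Car R) (Cou R) (Cmu R) a" "var K 1 (Car R') (Cou R') (Cmu R') b"
    then have [simp]: "el a" "el b" "base a = K" "base b = K" "supp a = {0}" "supp b = {1}" "ty a = Car R" "ty b = Car R'" by (simp_all add: var_def)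
    show "app (Cou S.T \<bullet> ?h) (a \<otimes>\<otimes> b) = app (Cou T) (a \<otimes>\<otimes> b)"
      by (simp add: scalar_swap)
  qed (simp_all add: Hom_def)
  have 2: "Cmu S.T \<bullet> ?h = (?h \<boxtimes> ?h) \<bullet> Cmu T"
  proof (rule ext2[where e = "Cou R" and d = "Cmu R" and e' = "Cou R'" and d' = "Cmu R'"])
    fix K a b assume v: "var K 0 (Car R) (Cou R) (Cmu R) a" "var K 1 (Car R') (Cou R') (Cmu R') b"
    then show "app (Cmu S.T \<bullet> ?h) (a \<otimes>\<otimes> b) = app ((?h \<boxtimes> ?h) \<bullet> Cmu T) (a \<otimes>\<otimes> b)" by (simp add: var_def)
  qed (simp_all add: Hom_def)
  have 3: "?h \<bullet> Dif T = Dif S.T \<bullet> (?h \<boxtimes> ?\<psi>)"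
  proof (rule ext3[where e = "Cou R" and d = "Cmu R" and e' = "Cou R'" and d' = "Cmu R'"])
    fix K a b x assume [simp]: "ctxt_ok K" and v: "var K 0 (Car R) (Cou R) (Cmu R) a" "var K 1 (Car R') (Cou R') (Cmu R') b" "var K 2 B e'' d'' x"
    then show "app (?h \<bullet> Dif T) ((a \<otimes>\<otimes> b) \<otimes>\<otimes> x) = app (Dif S.T \<bullet> (?h \<boxtimes> ?\<psi>)) ((a \<otimes>\<otimes> b) \<otimes>\<otimes> x)"
      by (simp add: var_def insert_commute plus_ac)
  qed (simp_all add: Hom_def)
  have 4: "Lin S.T \<bullet> ?h = ?\<psi> \<bullet> Lin T"
  proof (rule ext2[where e = "Cou R" and d = "Cmu R" and e' = "Cou R'" and d' = "Cmu R'"])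
    fix K a b assume [simp]: "ctxt_ok K" and v: "var K 0 (Car R) (Cou R) (Cmu R) a" "var K 1 (Car R') (Cou R') (Cmu R') b"
    then show "app (Lin S.T \<bullet> ?h) (a \<otimes>\<otimes> b) = app (?\<psi> \<bullet> Lin T) (a \<otimes>\<otimes> b)"
      by (simp add: var_def insert_commute scalar_right scalar_app plus_ac)
  qed (simp_all add: Hom_def)
  have 5: "?h \<bullet> Pnt T x = Pnt S.T (?\<psi> \<bullet> x)" if "x \<in> hom \<I> B" for x
  proof (rule ext0[where Z = "?Q' \<otimes> ?Q"])
    show "app (?h \<bullet> Pnt T x) (star K) = app (Pnt S.T (?\<psi> \<bullet> x)) (star K)" if [simp]: "ctxt_ok K" for K
      using \<open>x \<in> hom \<I> B\<close> by (simp add: Comp_Add' Hom_def)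
  qed (use that in \<open>simp_all add: Comp_Add' Hom_def\<close>)
  show ?thesis
    by (rule smooth_linear[OF tens_diff_comonoid S.tens_diff_comonoid, where \<psi> = ?\<psi>])
      (use 1 2 3 4 5 in \<open>simp_all add: Hom_def\<close>)
qed

lemma smooth_LUnit:
  assumes R: "diff_comonoid C R" and Z: "terminal_object C Z" and B: "is_biproduct C Z (Bas R) B p q i j"
  shows "smooth (tens_dcom (unit_dcom Z) R B p q i j) R (\<l> (Car R))"
proof -
  interpret R: diff_comonoid C R by fact
  interpret U: free_diff_comonoid C "unit_dcom Z" by (rule unit_free_diff_comonoid[OF Z])
  have Zo [simp]: "Z \<in> Obj C" using Z by (simp add: terminal_object_def)
  let ?Q = "Car R"
  note [simp del] = app_LUnit app_RUnit
    interpret dcom_pair C "unit_dcom Z" R B p q i j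
      by (intro dcom_pair.intro dcom_pair_axioms.intro linear_symmetric_monoidal_category_axioms R U.diff_comonoid_axioms)
        (simp add: B)
    have 2: "Cmu R \<bullet> \<l> ?Q = (\<l> ?Q \<boxtimes> \<l> ?Q) \<bullet> Cmu T"
    proof (rule ext2[where e = "\<one> \<I>" and d = "Inv (\<l> \<I>)" and e' = "Cou R" and d' = "Cmu R"])
      fix K a b assume v: "var K 0 \<I> (\<one> \<I>) (Inv (\<l> \<I>)) a" "var K 1 (Car R) (Cou R) (Cmu R) b"
      then have [simp]: "el a" "el b" "base a = K" "base b = K" "supp a = {0}" "supp b = {1}" "ty a = \<I>" "ty b = Car R"
        "0 \<in> CDup K" "Suc 0 \<in> CDup K" and w: "weak a (\<one> \<I>)" and d: "app (Inv (\<l> \<I>)) a = a \<otimes>\<otimes> a" "app (Cmu R) b = b \<otimes>\<otimes> b"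
        using unit_comonoid_cocommutative by (simp_all add: var_def)
      have "app (Cmu R \<bullet> \<l> ?Q) (a \<otimes>\<otimes> b) = app (\<l> (?Q \<otimes> ?Q)) (a \<otimes>\<otimes> b \<otimes>\<otimes> b)"
        by (simp add: scalar_app d)
      moreover have "app ((\<l> ?Q \<boxtimes> \<l> ?Q) \<bullet> Cmu T) (a \<otimes>\<otimes> b) = app (\<l> ?Q) (a \<otimes>\<otimes> b) \<otimes>\<otimes> app (\<l> ?Q) (a \<otimes>\<otimes> b)"
        using d by (simp del: app_Inv_structure)
      moreover have "\<dots> = app (\<l> (?Q \<otimes> ?Q)) (a \<otimes>\<otimes> b \<otimes>\<otimes> app (\<l> ?Q) (a \<otimes>\<otimes> b))"
        by (simp add: scalar_pair)
      moreover have "b \<otimes>\<otimes> app (\<l> ?Q) (a \<otimes>\<otimes> b) = app (\<l> (?Q \<otimes> ?Q)) (a \<otimes>\<otimes> b \<otimes>\<otimes> b)"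
        by (simp add: scalar_pair_right)
      moreover have "app (\<l> (?Q \<otimes> ?Q)) (a \<otimes>\<otimes> app (\<l> (?Q \<otimes> ?Q)) (a \<otimes>\<otimes> b \<otimes>\<otimes> b)) = app (\<l> (?Q \<otimes> ?Q)) (a \<otimes>\<otimes> b \<otimes>\<otimes> b)"
        using weak_LUnit[OF w, of "app (\<l> (?Q \<otimes> ?Q)) (a \<otimes>\<otimes> b \<otimes>\<otimes> b)" "?Q \<otimes> ?Q"] by simp
      ultimately show "app (Cmu R \<bullet> \<l> ?Q) (a \<otimes>\<otimes> b) = app ((\<l> ?Q \<boxtimes> \<l> ?Q) \<bullet> Cmu T) (a \<otimes>\<otimes> b)" by simp
    qed (simp_all add: Hom_def)
    have 1: "Cou R \<bullet> \<l> ?Q = Cou T" by (simp add: LUnit_nat)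
    have 3: "\<l> ?Q \<bullet> Dif T = Dif R \<bullet> (\<l> ?Q \<boxtimes> q)"
    proof (rule ext3[where e = "Cou R" and d = "Cmu R" and e' = "Cou R" and d' = "Cmu R"])
      fix K a b x assume [simp]: "ctxt_ok K" and v: "var K 0 \<I> (Cou R) (Cmu R) a" "var K 1 (Car R) (Cou R) (Cmu R) b" "var K 2 B e'' d'' x"
      note [simp] = varD[OF v(1)] varD[OF v(2)] varD[OF v(3)]
      show "app (\<l> ?Q \<bullet> Dif T) ((a \<otimes>\<otimes> b) \<otimes>\<otimes> x) = app (Dif R \<bullet> (\<l> ?Q \<boxtimes> q)) ((a \<otimes>\<otimes> b) \<otimes>\<otimes> x)"
        by (simp add: insert_commute scalar_pair scalar_app)
    qed (simp_all add: Hom_def)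
    have 4: "Lin R \<bullet> \<l> ?Q = q \<bullet> Lin T"
      by (simp add: tens_dcom_def Comp_Add' LUnit_nat)
    have 5: "\<l> ?Q \<bullet> Pnt T x = Pnt R (q \<bullet> x)" if "x \<in> hom \<I> B" for x
    proof -
      have [simp]: "x \<in> Arr C" "Dom C x = \<I>" "Cod C x = B" using that by (auto simp: Hom_def)
      have "\<l> ?Q \<bullet> (\<one> \<I> \<boxtimes> Pnt R (q \<bullet> x)) \<bullet> Inv (\<l> \<I>) = Pnt R (q \<bullet> x)"
        by (subst Comp_left[OF LUnit_nat]) simp_all
      then show ?thesis by simp
    qed
    show ?thesis
      by (rule smooth_linear[OF tens_diff_comonoid R, where \<psi> = q]) (use 1 2 3 4 5 in \<open>simp_all add: Hom_def\<close>)
qed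

lemma smooth_RUnit:
  assumes R: "diff_comonoid C R" and Z: "terminal_object C Z" and B: "is_biproduct C (Bas R) Z B p q i j"
  shows "smooth (tens_dcom R (unit_dcom Z) B p q i j) R (\<r> (Car R))"
proof -
  interpret R: diff_comonoid C R by fact
  interpret U: free_diff_comonoid C "unit_dcom Z" by (rule unit_free_diff_comonoid[OF Z])
  let ?Q = "Car R"
    have B': "is_biproduct C Z (Bas R) B q p j i"
      using B Add_commute[of "i \<bullet> p" B B "j \<bullet> q"] Comp_Hom unfolding is_biproduct_def by metis
    interpret dcom_pair C R "unit_dcom Z" B p q i j
      by (intro dcom_pair.intro dcom_pair_axioms.intro linear_symmetric_monoidal_category_axioms R U.diff_comonoid_axioms)
        (simp add: B)
    interpret S: dcom_pair C "unit_dcom Z" R B q p j i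
      by (intro dcom_pair.intro dcom_pair_axioms.intro linear_symmetric_monoidal_category_axioms R U.diff_comonoid_axioms)
        (simp add: B')
    have "smooth T R (\<l> ?Q \<bullet> \<s> ?Q \<I>)"
      using smooth_Symm[OF R U.diff_comonoid_axioms, of B p q i j B q p j i] B B'
      by (intro smooth_comp[OF tens_diff_comonoid S.tens_diff_comonoid R _ smooth_LUnit[OF R Z B']]) simp_all
    then show ?thesis by (simp add: LUnit_Symm)
qed

lemma smooth_Assoc:
  assumes R: "diff_comonoid C R1" "diff_comonoid C R2" "diff_comonoid C R3"
    and B12: "is_biproduct C (Bas R1) (Bas R2) B12 p12 q12 i12 j12" and B: "is_biproduct C B12 (Bas R3) B p q i j"
    and B23: "is_biproduct C (Bas R2) (Bas R3) B23 p23 q23 i23 j23" and B': "is_biproduct C (Bas R1) B23 B' p' q' i' j'"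
  shows "smooth (tens_dcom (tens_dcom R1 R2 B12 p12 q12 i12 j12) R3 B p q i j)
     (tens_dcom R1 (tens_dcom R2 R3 B23 p23 q23 i23 j23) B' p' q' i' j') (\<a> (Car R1) (Car R2) (Car R3))"
proof -
  interpret L: dcom_pair C R1 R2 B12 p12 q12 i12 j12
    by (intro dcom_pair.intro dcom_pair_axioms.intro linear_symmetric_monoidal_category_axioms R B12)
  interpret M: dcom_pair C R2 R3 B23 p23 q23 i23 j23
    by (intro dcom_pair.intro dcom_pair_axioms.intro linear_symmetric_monoidal_category_axioms R B23)
  interpret LL: dcom_pair C L.T R3 B p q i j
    by (intro dcom_pair.intro dcom_pair_axioms.intro linear_symmetric_monoidal_category_axioms R L.tens_diff_comonoid)
      (simp add: B)
  interpret MM: dcom_pair C R1 M.T B' p' q' i' j'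
    by (intro dcom_pair.intro dcom_pair_axioms.intro linear_symmetric_monoidal_category_axioms R M.tens_diff_comonoid)
      (simp add: B')
  let ?h = "\<a> (Car R1) (Car R2) (Car R3)"
  let ?\<psi> = "(i' \<bullet> p12 \<bullet> p) \<oplus> (j' \<bullet> ((i23 \<bullet> q12 \<bullet> p) \<oplus> (j23 \<bullet> q)))"
  have 1: "Cou MM.T \<bullet> ?h = Cou LL.T"
  proof (rule ext3[where e = "Cou R1" and d = "Cmu R1" and e' = "Cou R2" and d' = "Cmu R2" and e'' = "Cou R3" and d'' = "Cmu R3"])
    fix K a b c assume [simp]: "ctxt_ok K" and v: "var K 0 (Car R1) (Cou R1) (Cmu R1) a" "var K 1 (Car R2) (Cou R2) (Cmu R2) b"
      "var K 2 (Car R3) (Cou R3) (Cmu R3) c"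
    note [simp] = varD[OF v(1)] varD[OF v(2)] varD[OF v(3)]
    show "app (Cou MM.T \<bullet> ?h) ((a \<otimes>\<otimes> b) \<otimes>\<otimes> c) = app (Cou LL.T) ((a \<otimes>\<otimes> b) \<otimes>\<otimes> c)"
      by (simp add: scalar_assoc)
  qed (simp_all add: Hom_def)
  have 2: "Cmu MM.T \<bullet> ?h = (?h \<boxtimes> ?h) \<bullet> Cmu LL.T"
  proof (rule ext3[where e = "Cou R1" and d = "Cmu R1" and e' = "Cou R2" and d' = "Cmu R2" and e'' = "Cou R3" and d'' = "Cmu R3"])
    fix K a b c assume [simp]: "ctxt_ok K" and v: "var K 0 (Car R1) (Cou R1) (Cmu R1) a" "var K 1 (Car R2) (Cou R2) (Cmu R2) b"
      "var K 2 (Car R3) (Cou R3) (Cmu R3) c"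
    show "app (Cmu MM.T \<bullet> ?h) ((a \<otimes>\<otimes> b) \<otimes>\<otimes> c) = app ((?h \<boxtimes> ?h) \<bullet> Cmu LL.T) ((a \<otimes>\<otimes> b) \<otimes>\<otimes> c)"
      using v by (simp add: var_def)
  qed (simp_all add: Hom_def)
  have 3: "?h \<bullet> Dif LL.T = Dif MM.T \<bullet> (?h \<boxtimes> ?\<psi>)"
  proof (rule ext4)
    fix K a b c x assume [simp]: "ctxt_ok K" and v: "var K 0 (Car R1) (Cou R1) (Cmu R1) a" "var K 1 (Car R2) (Cou R2) (Cmu R2) b"
      "var K 2 (Car R3) (Cou R3) (Cmu R3) c" "var K 3 B (Cou R1) (Cmu R1) x"
    note [simp] = varD[OF v(1)] varD[OF v(2)] varD[OF v(3)] varD[OF v(4)]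
    show "app (?h \<bullet> Dif LL.T) (((a \<otimes>\<otimes> b) \<otimes>\<otimes> c) \<otimes>\<otimes> x) = app (Dif MM.T \<bullet> (?h \<boxtimes> ?\<psi>)) (((a \<otimes>\<otimes> b) \<otimes>\<otimes> c) \<otimes>\<otimes> x)"
      by (simp add: insert_commute plus_ac)
  qed (simp_all add: Hom_def)
  have 4: "Lin MM.T \<bullet> ?h = ?\<psi> \<bullet> Lin LL.T"
  proof (rule ext3[where e = "Cou R1" and d = "Cmu R1" and e' = "Cou R2" and d' = "Cmu R2" and e'' = "Cou R3" and d'' = "Cmu R3"])
    fix K a b c assume [simp]: "ctxt_ok K" and v: "var K 0 (Car R1) (Cou R1) (Cmu R1) a" "var K 1 (Car R2) (Cou R2) (Cmu R2) b"
      "var K 2 (Car R3) (Cou R3) (Cmu R3) c"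
    note [simp] = varD[OF v(1)] varD[OF v(2)] varD[OF v(3)]
    show "app (Lin MM.T \<bullet> ?h) ((a \<otimes>\<otimes> b) \<otimes>\<otimes> c) = app (?\<psi> \<bullet> Lin LL.T) ((a \<otimes>\<otimes> b) \<otimes>\<otimes> c)"
      by (simp add: insert_commute scalar_right scalar_app scalar_assoc)
       (simp add: insert_commute scalar_commute scalar_app plus_ac)
  qed (simp_all add: Hom_def)
  have 5: "?h \<bullet> Pnt LL.T x = Pnt MM.T (?\<psi> \<bullet> x)" if "x \<in> hom \<I> B" for x
  proof (rule ext0[where Z = "Car R1 \<otimes> Car R2 \<otimes> Car R3"])
    show "app (?h \<bullet> Pnt LL.T x) (star K) = app (Pnt MM.T (?\<psi> \<bullet> x)) (star K)" if [simp]: "ctxt_ok K" for K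
      using \<open>x \<in> hom \<I> B\<close> by (simp add: Comp_Add' Hom_def)
  qed (use that in \<open>simp_all add: Comp_Add' Hom_def\<close>)
  show ?thesis
    by (rule smooth_linear[OF LL.tens_diff_comonoid MM.tens_diff_comonoid, where \<psi> = ?\<psi>])
      (use 1 2 3 4 5 in \<open>simp_all add: Hom_def\<close>)
qed

end

context linear_symmetric_monoidal_category
begin

text \<open>The derivative in a direction of the biproduct has two terms, and in each of them only one of the
two chain rules is used; the counit discards the copy of the other variable.\<close>

lemma smooth_TensA:
  assumes R: "diff_comonoid C R" "diff_comonoid C R'" "diff_comonoid C S" "diff_comonoid C S'"
    and B: "is_biproduct C (Bas R) (Bas R') B p q i j" and E: "is_biproduct C (Bas S) (Bas S') E p' q' i' j'"
    and h: "smooth R S h" and k: "smooth R' S' k"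
  shows "smooth (tens_dcom R R' B p q i j) (tens_dcom S S' E p' q' i' j') (h \<boxtimes> k)"
proof -
  interpret R: dcom_pair C R R' B p q i j
    by (intro dcom_pair.intro dcom_pair_axioms.intro linear_symmetric_monoidal_category_axioms R B)
  interpret S: dcom_pair C S S' E p' q' i' j'
    by (intro dcom_pair.intro dcom_pair_axioms.intro linear_symmetric_monoidal_category_axioms R E)
  note [simp] = smoothD(1-3)[OF h] smoothD(1-3)[OF k]
  define f where "f = Lin S \<bullet> h"
  define g where "g = Lin S' \<bullet> k"
  have [simp]: "f \<in> Arr C" "Dom C f = Car R" "Cod C f = Bas S" "g \<in> Arr C" "Dom C g = Car R'" "Cod C g = Bas S'"
    by (simp_all add: f_def g_def)
  have hD: "h \<bullet> Dif R = Dif S \<bullet> (h \<boxtimes> (f \<bullet> Dif R)) \<bullet> \<a> (Car R) (Car R) (Bas R) \<bullet> (Cmu R \<boxtimes> \<one> (Bas R))"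
    and kD: "k \<bullet> Dif R' = Dif S' \<bullet> (k \<boxtimes> (g \<bullet> Dif R')) \<bullet> \<a> (Car R') (Car R') (Bas R') \<bullet> (Cmu R' \<boxtimes> \<one> (Bas R'))"
    using smoothD(6)[OF h] smoothD(6)[OF k] by (simp_all add: ode_def f_def g_def ext_along_def)
  let ?f = "i' \<bullet> \<r> (Bas S) \<bullet> (f \<boxtimes> Cou R') \<oplus> j' \<bullet> \<l> (Bas S') \<bullet> (Cou R \<boxtimes> g)"
  have L: "Lin S.T \<bullet> (h \<boxtimes> k) = ?f"
    using smoothD(4)[OF h] smoothD(4)[OF k] by (simp add: tens_dcom_def Comp_Add' TensA_Comp' f_def g_def)
  have "(h \<boxtimes> k) \<bullet> Dif R.T = Dif S.T \<bullet> ((h \<boxtimes> k) \<boxtimes> (?f \<bullet> Dif R.T)) \<bullet>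
      \<a> (Car R \<otimes> Car R') (Car R \<otimes> Car R') B \<bullet> (Cmu R.T \<boxtimes> \<one> B)"
  proof (rule ext3[where e = "Cou R" and d = "Cmu R" and e' = "Cou R'" and d' = "Cmu R'"])
    fix K a b x assume [simp]: "ctxt_ok K" and v: "var K 0 (Car R) (Cou R) (Cmu R) a" "var K 1 (Car R') (Cou R') (Cmu R') b" "var K 2 B e'' d'' x"
    show "app ((h \<boxtimes> k) \<bullet> Dif R.T) ((a \<otimes>\<otimes> b) \<otimes>\<otimes> x) = app (Dif S.T \<bullet> ((h \<boxtimes> k) \<boxtimes> (?f \<bullet> Dif R.T)) \<bullet>
      \<a> (Car R \<otimes> Car R') (Car R \<otimes> Car R') B \<bullet> (Cmu R.T \<boxtimes> \<one> B)) ((a \<otimes>\<otimes> b) \<otimes>\<otimes> x)"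
      using v app_eq[OF hD] app_eq[OF kD]
      by (simp add: var_def insert_commute scalar_right scalar_pair_right scalar_app)
  qed (simp_all add: Hom_def)
  then have "ode R.T (Dif S.T) (Lin S.T \<bullet> (h \<boxtimes> k)) (h \<boxtimes> k)"
    unfolding L by (simp add: ode_def ext_along_def)
  moreover have "Cou S.T \<bullet> (h \<boxtimes> k) = Cou R.T"
    using smoothD(4)[OF h] smoothD(4)[OF k] by (simp add: TensA_Comp')
  moreover have "Cmu S.T \<bullet> (h \<boxtimes> k) = ((h \<boxtimes> k) \<boxtimes> (h \<boxtimes> k)) \<bullet> Cmu R.T"
    using smoothD(5)[OF h] smoothD(5)[OF k]
    by (simp add: TensA_Comp') (simp add: TensA_Comp'[symmetric] Comp_left[OF MidSwap_nat])
  moreover have "(h \<boxtimes> k) \<bullet> Pnt R.T x = Pnt S.T (Lin S.T \<bullet> (h \<boxtimes> k) \<bullet> Pnt R.T x)" if x: "x \<in> hom \<I> B" for x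
  proof -
    have [simp]: "x \<in> Arr C" "Dom C x = \<I>" "Cod C x = B" using x by (auto simp: Hom_def)
    have px: "p \<bullet> x \<in> hom \<I> (Bas R)" "q \<bullet> x \<in> hom \<I> (Bas R')" by (simp_all add: Hom_def)
    have hP: "h \<bullet> Pnt R (p \<bullet> x) = Pnt S (f \<bullet> Pnt R (p \<bullet> x))" "k \<bullet> Pnt R' (q \<bullet> x) = Pnt S' (g \<bullet> Pnt R' (q \<bullet> x))"
      using smoothD(7)[OF h px(1)] smoothD(7)[OF k px(2)] by (simp_all add: f_def g_def)
    have LP: "?f \<bullet> Pnt R.T x = (i' \<bullet> f \<bullet> Pnt R (p \<bullet> x)) \<oplus> (j' \<bullet> g \<bullet> Pnt R' (q \<bullet> x))"
      by (rule ext0[where Z = E]) (simp_all add: Hom_def)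
    have "Lin S.T \<bullet> (h \<boxtimes> k) \<bullet> Pnt R.T x = ?f \<bullet> Pnt R.T x" using Comp_left[OF L, of "Pnt R.T x"] by simp
    then show ?thesis unfolding LP by (simp add: Comp_Add' TensA_Comp_left hP)
  qed
  ultimately show ?thesis by (simp add: smooth_def Hom_def)
qed

end

context dcom_pair
begin

text \<open>An action of a biproduct amounts to actions of the two summands that commute with each other. A map out of
\<open>W \<otimes> Car R \<otimes> Car R'\<close> is found by currying: for each point of \<open>Bas R'\<close> extend along \<open>Car R\<close>
with parameter \<open>W\<close>, and then extend the resulting family along \<open>Car R'\<close> with parameter \<open>W \<otimes> Car R\<close>.\<close>

lemma tens_free:
  assumes free: "free_action (Bas R) (Car R) (Dif R) (Pnt R)" "free_action (Bas R') (Car R') (Dif R') (Pnt R')"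
  shows "free_diff_comonoid C T"
proof -
  let ?X = "Bas R" and ?X' = "Bas R'" and ?Q = "Car R" and ?Q' = "Car R'"
  interpret T: diff_comonoid C T by (rule tens_diff_comonoid)
  have [simp]: "B \<in> Obj C" by simp
  have "free_action B (?Q \<otimes> ?Q') (Dif T) (Pnt T)"
    unfolding free_action_def
  proof (intro conjI allI impI ballI)
    show "commuting_action C B (?Q \<otimes> ?Q') (Dif T)" using T.commuting by simp
    show "Pnt T x \<in> hom \<I> (?Q \<otimes> ?Q')" if "x \<in> hom \<I> B" for x using T.Pnt_Hom[of x] that by simp
    fix W A \<alpha> a
    assume W [simp]: "W \<in> Obj C" and \<alpha>: "commuting_action C B A \<alpha>" and a: "\<forall>x \<in> hom \<I> B. a x \<in> hom W A"
    note [simp] = commuting_actionD[OF \<alpha>]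
    have a' [simp]: "a x \<in> Arr C" "Dom C (a x) = W" "Cod C (a x) = A" if "x \<in> Arr C" "Dom C x = \<I>" "Cod C x = B" for x
      using a that by (auto simp: Hom_def)
    let ?\<alpha> = "\<alpha> \<bullet> (\<one> A \<boxtimes> i)" and ?\<alpha>' = "\<alpha> \<bullet> (\<one> A \<boxtimes> j)"
    have com: "commuting_action C Y A (\<alpha> \<bullet> (\<one> A \<boxtimes> k))" if [simp]: "k \<in> Arr C" "Dom C k = Y" "Cod C k = B" for k Y
    proof -
      have [simp]: "Y \<in> Obj C" using Obj_Dom[OF that(1)] by simp
      have "(\<alpha> \<bullet> (\<one> A \<boxtimes> k)) \<bullet> ((\<alpha> \<bullet> (\<one> A \<boxtimes> k)) \<boxtimes> \<one> Y) \<bullet> RSwap A Y Y = (\<alpha> \<bullet> (\<one> A \<boxtimes> k)) \<bullet> ((\<alpha> \<bullet> (\<one> A \<boxtimes> k)) \<boxtimes> \<one> Y)"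
      proof (rule ext3[where X = A and Y = Y and W = Y])
        fix K b x y assume [simp]: "ctxt_ok K" and v: "var K 0 A (\<one> \<I>) (\<one> \<I>) b" "var K 1 Y (\<one> \<I>) (\<one> \<I>) x" "var K 2 Y (\<one> \<I>) (\<one> \<I>) y"
        note [simp] = varD[OF v(1)] varD[OF v(2)] varD[OF v(3)]
        show "app ((\<alpha> \<bullet> (\<one> A \<boxtimes> k)) \<bullet> ((\<alpha> \<bullet> (\<one> A \<boxtimes> k)) \<boxtimes> \<one> Y) \<bullet> RSwap A Y Y) ((b \<otimes>\<otimes> x) \<otimes>\<otimes> y) =
            app ((\<alpha> \<bullet> (\<one> A \<boxtimes> k)) \<bullet> ((\<alpha> \<bullet> (\<one> A \<boxtimes> k)) \<boxtimes> \<one> Y)) ((b \<otimes>\<otimes> x) \<otimes>\<otimes> y)"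
          by (simp add: commuting_app[OF \<alpha>])
      qed (simp_all add: Hom_def)
      then show ?thesis by (simp add: commuting_action_RSwap Hom_def)
    qed
    have \<alpha>1: "commuting_action C ?X A ?\<alpha>" and \<alpha>2: "commuting_action C ?X' A ?\<alpha>'" by (rule com; simp)+
    \<comment> \<open>\<open>F y\<close> is the extension along \<open>Car R\<close> for a fixed point \<open>y\<close> of \<open>Bas R'\<close>.\<close>
    let ?act = "\<lambda>V Y Q D. (\<one> V \<boxtimes> D) \<bullet> \<a> V Q Y"
    have "\<exists>!F. act_hom ?X (W \<otimes> ?Q) (?act W ?X ?Q (Dif R)) A ?\<alpha> F \<and>
        (\<forall>x \<in> hom \<I> ?X. F \<bullet> (\<one> W \<boxtimes> Pnt R x) \<bullet> Inv (\<r> W) = a ((i \<bullet> x) \<oplus> (j \<bullet> y)))" if "y \<in> hom \<I> ?X'" for y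
      using that by (intro free_actionD[OF free(1) W \<alpha>1]) (simp add: Hom_def)
    then obtain F where F: "\<And>y. y \<in> hom \<I> ?X' \<Longrightarrow> act_hom ?X (W \<otimes> ?Q) (?act W ?X ?Q (Dif R)) A ?\<alpha> (F y)"
      "\<And>x y. y \<in> hom \<I> ?X' \<Longrightarrow> x \<in> hom \<I> ?X \<Longrightarrow> F y \<bullet> (\<one> W \<boxtimes> Pnt R x) \<bullet> Inv (\<r> W) = a ((i \<bullet> x) \<oplus> (j \<bullet> y))"
      by metis
    have F_typ [simp]: "F y \<in> Arr C" "Dom C (F y) = W \<otimes> ?Q" "Cod C (F y) = A" if "y \<in> Arr C" "Dom C y = \<I>" "Cod C y = ?X'" for y
      using act_homD(1-3)[OF F(1)[of y]] that by (auto simp: Hom_def)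
    have "\<exists>!G. act_hom ?X' ((W \<otimes> ?Q) \<otimes> ?Q') (?act (W \<otimes> ?Q) ?X' ?Q' (Dif R')) A ?\<alpha>' G \<and>
        (\<forall>y \<in> hom \<I> ?X'. G \<bullet> (\<one> (W \<otimes> ?Q) \<boxtimes> Pnt R' y) \<bullet> Inv (\<r> (W \<otimes> ?Q)) = F y)"
      by (intro free_actionD[OF free(2) _ \<alpha>2]) (simp_all add: Hom_def)
    then obtain G where G: "act_hom ?X' ((W \<otimes> ?Q) \<otimes> ?Q') (?act (W \<otimes> ?Q) ?X' ?Q' (Dif R')) A ?\<alpha>' G"
      and Gp: "\<And>y. y \<in> hom \<I> ?X' \<Longrightarrow> G \<bullet> (\<one> (W \<otimes> ?Q) \<boxtimes> Pnt R' y) \<bullet> Inv (\<r> (W \<otimes> ?Q)) = F y" by blast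
    note [simp] = act_homD(1-3)[OF G]
    note GD = act_homD(4)[OF G]
    \<comment> \<open>\<open>G\<close> is also an action map for the first factor, since it is one at every point of the second.\<close>
    let ?V = "(W \<otimes> ?Q) \<otimes> ?X"
    let ?U1 = "G \<bullet> (((\<one> W \<boxtimes> Dif R) \<bullet> \<a> W ?Q ?X) \<boxtimes> \<one> ?Q')" and ?U2 = "?\<alpha> \<bullet> (G \<boxtimes> \<one> ?X) \<bullet> RSwap (W \<otimes> ?Q) ?X ?Q'"
    have uniq': "f = g" if "act_hom ?X' (V \<otimes> ?Q') (?act V ?X' ?Q' (Dif R')) A ?\<alpha>' f"
      "act_hom ?X' (V \<otimes> ?Q') (?act V ?X' ?Q' (Dif R')) A ?\<alpha>' g"
      "\<And>y. y \<in> hom \<I> ?X' \<Longrightarrow> f \<bullet> (\<one> V \<boxtimes> Pnt R' y) \<bullet> Inv (\<r> V) = g \<bullet> (\<one> V \<boxtimes> Pnt R' y) \<bullet> Inv (\<r> V)"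
      and [simp]: "V \<in> Obj C" for f g V
    proof -
      note [simp] = act_homD(1-3)[OF that(1)]
      have *: "\<And>y. y \<in> hom \<I> ?X' \<Longrightarrow> f \<bullet> (\<one> V \<boxtimes> Pnt R' y) \<bullet> Inv (\<r> V) \<in> hom V A" by (simp add: Hom_def)
      show ?thesis
        using free_actionD[OF free(2) that(4) \<alpha>2, of "\<lambda>y. f \<bullet> (\<one> V \<boxtimes> Pnt R' y) \<bullet> Inv (\<r> V)", OF *] that by metis
    qed
    have uniq: "f = g" if "act_hom ?X (W \<otimes> ?Q) (?act W ?X ?Q (Dif R)) A ?\<alpha> f"
      "act_hom ?X (W \<otimes> ?Q) (?act W ?X ?Q (Dif R)) A ?\<alpha> g"
      "\<And>y. y \<in> hom \<I> ?X \<Longrightarrow> f \<bullet> (\<one> W \<boxtimes> Pnt R y) \<bullet> Inv (\<r> W) = g \<bullet> (\<one> W \<boxtimes> Pnt R y) \<bullet> Inv (\<r> W)" for f g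
    proof -
      note [simp] = act_homD(1-3)[OF that(1)]
      have *: "\<And>y. y \<in> hom \<I> ?X \<Longrightarrow> f \<bullet> (\<one> W \<boxtimes> Pnt R y) \<bullet> Inv (\<r> W) \<in> hom W A" by (simp add: Hom_def)
      show ?thesis
        using free_actionD[OF free(1) W \<alpha>1, of "\<lambda>y. f \<bullet> (\<one> W \<boxtimes> Pnt R y) \<bullet> Inv (\<r> W)", OF *] that by metis
    qed
    have G1: "?U1 = ?U2"
    proof (rule uniq'[where V = ?V])
      have "?U1 \<bullet> ?act ?V ?X' ?Q' (Dif R') = ?\<alpha>' \<bullet> (?U1 \<boxtimes> \<one> ?X')"
      proof (rule ext_vars[of "[(W, \<one> \<I>, \<one> \<I>), (?Q, \<one> \<I>, \<one> \<I>), (?X, \<one> \<I>, \<one> \<I>), (?Q', \<one> \<I>, \<one> \<I>), (?X', \<one> \<I>, \<one> \<I>)]"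
          "\<lambda>v. (((v 0 \<otimes>\<otimes> v 1) \<otimes>\<otimes> v 2) \<otimes>\<otimes> v 3) \<otimes>\<otimes> v 4"])
        let ?Xs = "[(W, \<one> \<I>, \<one> \<I>), (?Q, \<one> \<I>, \<one> \<I>), (?X, \<one> \<I>, \<one> \<I>), (?Q', \<one> \<I>, \<one> \<I>), (?X', \<one> \<I>, \<one> \<I>)]"
        fix K v assume [simp]: "ctxt_ok K" and v: "\<And>i. i < length ?Xs \<Longrightarrow> generic (v i) \<and>
          var K i (fst (?Xs ! i)) (fst (snd (?Xs ! i))) (snd (snd (?Xs ! i))) (v i)"
        note v = v[of 0, simplified] v[of 1, simplified] v[of 2, simplified] v[of 3, simplified] v[of 4, simplified]
        note [simp] = v[THEN conjunct1] v[THEN conjunct2, THEN varD]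
        let ?t = "(((v 0 \<otimes>\<otimes> v 1) \<otimes>\<otimes> v 2) \<otimes>\<otimes> v 3) \<otimes>\<otimes> v 4"
        have "app (?U1 \<bullet> ?act ?V ?X' ?Q' (Dif R')) ?t = app (?\<alpha>' \<bullet> (?U1 \<boxtimes> \<one> ?X')) ?t"
          using app_eq[OF GD, of "(app ((\<one> W \<boxtimes> Dif R) \<bullet> \<a> W ?Q ?X) ((v 0 \<otimes>\<otimes> v 1) \<otimes>\<otimes> v 2) \<otimes>\<otimes> v 3) \<otimes>\<otimes> v 4"] by simp
        then show "generic ?t \<and> ?U1 \<bullet> ?act ?V ?X' ?Q' (Dif R') \<in> hom (ty ?t) A \<and> ?\<alpha>' \<bullet> (?U1 \<boxtimes> \<one> ?X') \<in> hom (ty ?t) A \<and>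
            app (?U1 \<bullet> ?act ?V ?X' ?Q' (Dif R')) ?t = app (?\<alpha>' \<bullet> (?U1 \<boxtimes> \<one> ?X')) ?t"
          by (simp add: generic_pair Hom_def del: app_Comp)
      qed simp
      then show "act_hom ?X' (?V \<otimes> ?Q') (?act ?V ?X' ?Q' (Dif R')) A ?\<alpha>' ?U1" by (simp add: act_hom_def Hom_def)
      have "?U2 \<bullet> ?act ?V ?X' ?Q' (Dif R') = ?\<alpha>' \<bullet> (?U2 \<boxtimes> \<one> ?X')"
      proof (rule ext_vars[of "[(W, \<one> \<I>, \<one> \<I>), (?Q, \<one> \<I>, \<one> \<I>), (?X, \<one> \<I>, \<one> \<I>), (?Q', \<one> \<I>, \<one> \<I>), (?X', \<one> \<I>, \<one> \<I>)]"
          "\<lambda>v. (((v 0 \<otimes>\<otimes> v 1) \<otimes>\<otimes> v 2) \<otimes>\<otimes> v 3) \<otimes>\<otimes> v 4"])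
        let ?Xs = "[(W, \<one> \<I>, \<one> \<I>), (?Q, \<one> \<I>, \<one> \<I>), (?X, \<one> \<I>, \<one> \<I>), (?Q', \<one> \<I>, \<one> \<I>), (?X', \<one> \<I>, \<one> \<I>)]"
        fix K v assume [simp]: "ctxt_ok K" and v: "\<And>i. i < length ?Xs \<Longrightarrow> generic (v i) \<and>
          var K i (fst (?Xs ! i)) (fst (snd (?Xs ! i))) (snd (snd (?Xs ! i))) (v i)"
        note v = v[of 0, simplified] v[of 1, simplified] v[of 2, simplified] v[of 3, simplified] v[of 4, simplified]
        note [simp] = v[THEN conjunct1] v[THEN conjunct2, THEN varD]
        let ?t = "(((v 0 \<otimes>\<otimes> v 1) \<otimes>\<otimes> v 2) \<otimes>\<otimes> v 3) \<otimes>\<otimes> v 4"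
        have "app (?U2 \<bullet> ?act ?V ?X' ?Q' (Dif R')) ?t = app (?\<alpha>' \<bullet> (?U2 \<boxtimes> \<one> ?X')) ?t"
          using app_eq[OF GD, of "((v 0 \<otimes>\<otimes> v 1) \<otimes>\<otimes> v 3) \<otimes>\<otimes> v 4"]
          by (simp add: commuting_app[OF \<alpha>] insert_commute)
        then show "generic ?t \<and> ?U2 \<bullet> ?act ?V ?X' ?Q' (Dif R') \<in> hom (ty ?t) A \<and> ?\<alpha>' \<bullet> (?U2 \<boxtimes> \<one> ?X') \<in> hom (ty ?t) A \<and>
            app (?U2 \<bullet> ?act ?V ?X' ?Q' (Dif R')) ?t = app (?\<alpha>' \<bullet> (?U2 \<boxtimes> \<one> ?X')) ?t"
          by (simp add: generic_pair Hom_def del: app_Comp)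
      qed simp
      then show "act_hom ?X' (?V \<otimes> ?Q') (?act ?V ?X' ?Q' (Dif R')) A ?\<alpha>' ?U2" by (simp add: act_hom_def Hom_def)
      fix y assume y: "y \<in> hom \<I> ?X'"
      then have [simp]: "y \<in> Arr C" "Dom C y = \<I>" "Cod C y = ?X'" by (auto simp: Hom_def)
      show "?U1 \<bullet> (\<one> ?V \<boxtimes> Pnt R' y) \<bullet> Inv (\<r> ?V) = ?U2 \<bullet> (\<one> ?V \<boxtimes> Pnt R' y) \<bullet> Inv (\<r> ?V)"
      proof (rule ext3[where X = W and Y = ?Q and W = ?X])
        fix K w b x assume [simp]: "ctxt_ok K" and v: "var K 0 W (\<one> \<I>) (\<one> \<I>) w" "var K 1 ?Q (\<one> \<I>) (\<one> \<I>) b" "var K 2 ?X (\<one> \<I>) (\<one> \<I>) x"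
        note [simp] = varD[OF v(1)] varD[OF v(2)] varD[OF v(3)]
        show "app (?U1 \<bullet> (\<one> ?V \<boxtimes> Pnt R' y) \<bullet> Inv (\<r> ?V)) ((w \<otimes>\<otimes> b) \<otimes>\<otimes> x) =
            app (?U2 \<bullet> (\<one> ?V \<boxtimes> Pnt R' y) \<bullet> Inv (\<r> ?V)) ((w \<otimes>\<otimes> b) \<otimes>\<otimes> x)"
          using app_eq[OF Gp[OF y], of "w \<otimes>\<otimes> b"] app_eq[OF Gp[OF y], of "w \<otimes>\<otimes> app (Dif R) (b \<otimes>\<otimes> x)"]
            app_eq[OF act_homD(4)[OF F(1)[OF y]], of "(w \<otimes>\<otimes> b) \<otimes>\<otimes> x"]
          by simp
      qed (simp_all add: Hom_def)
    qed simp
    let ?H = "G \<bullet> Inv (\<a> W ?Q ?Q')"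
    have "?H \<bullet> ?act W B (?Q \<otimes> ?Q') (Dif T) = \<alpha> \<bullet> (?H \<boxtimes> \<one> B)"
    proof (rule ext_vars[of "[(W, \<one> \<I>, \<one> \<I>), (?Q, \<one> \<I>, \<one> \<I>), (?Q', \<one> \<I>, \<one> \<I>), (B, \<one> \<I>, \<one> \<I>)]"
        "\<lambda>v. (v 0 \<otimes>\<otimes> v 1 \<otimes>\<otimes> v 2) \<otimes>\<otimes> v 3"])
      let ?Xs = "[(W, \<one> \<I>, \<one> \<I>), (?Q, \<one> \<I>, \<one> \<I>), (?Q', \<one> \<I>, \<one> \<I>), (B, \<one> \<I>, \<one> \<I>)]"
      fix K v assume [simp]: "ctxt_ok K" and v: "\<And>i. i < length ?Xs \<Longrightarrow> generic (v i) \<and>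
        var K i (fst (?Xs ! i)) (fst (snd (?Xs ! i))) (snd (snd (?Xs ! i))) (v i)"
      note v = v[of 0, simplified] v[of 1, simplified] v[of 2, simplified] v[of 3, simplified]
      note [simp] = v[THEN conjunct1] v[THEN conjunct2, THEN varD]
      let ?t = "(v 0 \<otimes>\<otimes> v 1 \<otimes>\<otimes> v 2) \<otimes>\<otimes> v 3"
      have "app (\<alpha> \<bullet> (?H \<boxtimes> \<one> B)) ?t = app (\<alpha> \<bullet> (?H \<boxtimes> \<one> B)) ((v 0 \<otimes>\<otimes> v 1 \<otimes>\<otimes> v 2) \<otimes>\<otimes> (app i (app p (v 3)) \<oplus>\<oplus> app j (app q (v 3))))"
        by simp
      also have "\<dots> = app (?H \<bullet> ?act W B (?Q \<otimes> ?Q') (Dif T)) ?t"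
        using app_eq[OF GD, of "((v 0 \<otimes>\<otimes> v 1) \<otimes>\<otimes> v 2) \<otimes>\<otimes> app q (v 3)"] app_eq[OF G1, of "((v 0 \<otimes>\<otimes> v 1) \<otimes>\<otimes> app p (v 3)) \<otimes>\<otimes> v 2"]
          arg_cong[OF G1, of "\<lambda>f. app f (((v 0 \<otimes>\<otimes> v 1) \<otimes>\<otimes> app p (v 3)) \<otimes>\<otimes> v 2)"]
        by (simp add: insert_commute del: app_bip(5))
      finally show "generic ?t \<and> ?H \<bullet> ?act W B (?Q \<otimes> ?Q') (Dif T) \<in> hom (ty ?t) A \<and> \<alpha> \<bullet> (?H \<boxtimes> \<one> B) \<in> hom (ty ?t) A \<and>
          app (?H \<bullet> ?act W B (?Q \<otimes> ?Q') (Dif T)) ?t = app (\<alpha> \<bullet> (?H \<boxtimes> \<one> B)) ?t"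
        by (simp add: generic_pair Hom_def del: app_Comp)
    qed simp
    then have H: "act_hom B (W \<otimes> ?Q \<otimes> ?Q') (?act W B (?Q \<otimes> ?Q') (Dif T)) A \<alpha> ?H" by (simp add: act_hom_def Hom_def)
    have Hp: "?H \<bullet> (\<one> W \<boxtimes> Pnt T z) \<bullet> Inv (\<r> W) = a z" if z: "z \<in> hom \<I> B" for z
    proof (rule ext1[where X = W])
      have [simp]: "z \<in> Arr C" "Dom C z = \<I>" "Cod C z = B" using z by (auto simp: Hom_def)
      have pz: "p \<bullet> z \<in> hom \<I> ?X" "q \<bullet> z \<in> hom \<I> ?X'" by (simp_all add: Hom_def)
      have zz: "(i \<bullet> p \<bullet> z) \<oplus> (j \<bullet> q \<bullet> z) = z"
        using arg_cong[OF bip_simps(18), of "\<lambda>f. f \<bullet> z"] by (simp add: Comp_Add' del: bip_simps(18))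
      fix K w assume [simp]: "ctxt_ok K" and v: "var K 0 W (\<one> \<I>) (\<one> \<I>) w"
      note [simp] = varD[OF v]
      show "app (?H \<bullet> (\<one> W \<boxtimes> Pnt T z) \<bullet> Inv (\<r> W)) w = app (a z) w"
        using app_eq[OF Gp[OF pz(2)], of "w \<otimes>\<otimes> app (Pnt R (p \<bullet> z)) (star K)"] app_eq[OF F(2)[OF pz(2) pz(1)], of w] zz
        by simp
    qed (use z in \<open>simp_all add: Hom_def\<close>)
    show "\<exists>!F. act_hom B (W \<otimes> ?Q \<otimes> ?Q') (?act W B (?Q \<otimes> ?Q') (Dif T)) A \<alpha> F \<and>
        (\<forall>x \<in> hom \<I> B. F \<bullet> (\<one> W \<boxtimes> Pnt T x) \<bullet> Inv (\<r> W) = a x)"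
    proof (rule ex1I)
      show "act_hom B (W \<otimes> ?Q \<otimes> ?Q') (?act W B (?Q \<otimes> ?Q') (Dif T)) A \<alpha> ?H \<and>
        (\<forall>x \<in> hom \<I> B. ?H \<bullet> (\<one> W \<boxtimes> Pnt T x) \<bullet> Inv (\<r> W) = a x)" using H Hp by blast
      fix H' assume "act_hom B (W \<otimes> ?Q \<otimes> ?Q') (?act W B (?Q \<otimes> ?Q') (Dif T)) A \<alpha> H' \<and>
        (\<forall>x \<in> hom \<I> B. H' \<bullet> (\<one> W \<boxtimes> Pnt T x) \<bullet> Inv (\<r> W) = a x)"
      then have H': "act_hom B (W \<otimes> ?Q \<otimes> ?Q') (?act W B (?Q \<otimes> ?Q') (Dif T)) A \<alpha> H'"
        and H'p: "\<And>x. x \<in> hom \<I> B \<Longrightarrow> H' \<bullet> (\<one> W \<boxtimes> Pnt T x) \<bullet> Inv (\<r> W) = a x" by auto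
      note [simp] = act_homD(1-3)[OF H']
      note H'D = act_homD(4)[OF H']
      let ?G = "H' \<bullet> \<a> W ?Q ?Q'"
      have "?G = G"
      proof (rule uniq'[where V = "W \<otimes> ?Q"])
        show "act_hom ?X' ((W \<otimes> ?Q) \<otimes> ?Q') (?act (W \<otimes> ?Q) ?X' ?Q' (Dif R')) A ?\<alpha>' G" by (rule G)
        have "?G \<bullet> ?act (W \<otimes> ?Q) ?X' ?Q' (Dif R') = ?\<alpha>' \<bullet> (?G \<boxtimes> \<one> ?X')"
        proof (rule ext4)
          fix K w b c x assume [simp]: "ctxt_ok K" and v: "var K 0 W (\<one> \<I>) (\<one> \<I>) w" "var K 1 ?Q (\<one> \<I>) (\<one> \<I>) b" "var K 2 ?Q' (\<one> \<I>) (\<one> \<I>) c"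
            "var K 3 ?X' (\<one> \<I>) (\<one> \<I>) x"
          note [simp] = varD[OF v(1)] varD[OF v(2)] varD[OF v(3)] varD[OF v(4)]
          show "app (?G \<bullet> ?act (W \<otimes> ?Q) ?X' ?Q' (Dif R')) (((w \<otimes>\<otimes> b) \<otimes>\<otimes> c) \<otimes>\<otimes> x) = app (?\<alpha>' \<bullet> (?G \<boxtimes> \<one> ?X')) (((w \<otimes>\<otimes> b) \<otimes>\<otimes> c) \<otimes>\<otimes> x)"
            using app_eq[OF H'D, of "(w \<otimes>\<otimes> b \<otimes>\<otimes> c) \<otimes>\<otimes> app j x"] by (simp add: insert_commute)
        qed (simp_all add: Hom_def)
        then show "act_hom ?X' ((W \<otimes> ?Q) \<otimes> ?Q') (?act (W \<otimes> ?Q) ?X' ?Q' (Dif R')) A ?\<alpha>' ?G" by (simp add: act_hom_def Hom_def)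
        fix y assume y: "y \<in> hom \<I> ?X'"
        then have [simp]: "y \<in> Arr C" "Dom C y = \<I>" "Cod C y = ?X'" by (auto simp: Hom_def)
        let ?k = "?G \<bullet> (\<one> (W \<otimes> ?Q) \<boxtimes> Pnt R' y) \<bullet> Inv (\<r> (W \<otimes> ?Q))"
        have "?k = F y"
        proof (rule uniq[OF _ F(1)[OF y]])
          have "?k \<bullet> ?act W ?X ?Q (Dif R) = ?\<alpha> \<bullet> (?k \<boxtimes> \<one> ?X)"
          proof (rule ext3)
            fix K w b x assume [simp]: "ctxt_ok K" and v: "var K 0 W (\<one> \<I>) (\<one> \<I>) w" "var K 1 ?Q (\<one> \<I>) (\<one> \<I>) b" "var K 2 ?X (\<one> \<I>) (\<one> \<I>) x"
            note [simp] = varD[OF v(1)] varD[OF v(2)] varD[OF v(3)]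
            show "app (?k \<bullet> ?act W ?X ?Q (Dif R)) ((w \<otimes>\<otimes> b) \<otimes>\<otimes> x) = app (?\<alpha> \<bullet> (?k \<boxtimes> \<one> ?X)) ((w \<otimes>\<otimes> b) \<otimes>\<otimes> x)"
              using app_eq[OF H'D, of "(w \<otimes>\<otimes> b \<otimes>\<otimes> app (Pnt R' y) (star K)) \<otimes>\<otimes> app i x"] by (simp add: insert_commute)
          qed (simp_all add: Hom_def)
          then show "act_hom ?X (W \<otimes> ?Q) (?act W ?X ?Q (Dif R)) A ?\<alpha> ?k" by (simp add: act_hom_def Hom_def)
          fix x assume x: "x \<in> hom \<I> ?X"
          then have [simp]: "x \<in> Arr C" "Dom C x = \<I>" "Cod C x = ?X" by (auto simp: Hom_def)
          have xy: "(i \<bullet> x) \<oplus> (j \<bullet> y) \<in> hom \<I> B" by (simp add: Hom_def)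
          have "?k \<bullet> (\<one> W \<boxtimes> Pnt R x) \<bullet> Inv (\<r> W) = a ((i \<bullet> x) \<oplus> (j \<bullet> y))"
          proof (rule ext1[where X = W])
            fix K w assume [simp]: "ctxt_ok K" and v: "var K 0 W (\<one> \<I>) (\<one> \<I>) w"
            note [simp] = varD[OF v]
            show "app (?k \<bullet> (\<one> W \<boxtimes> Pnt R x) \<bullet> Inv (\<r> W)) w = app (a ((i \<bullet> x) \<oplus> (j \<bullet> y))) w"
              using app_eq[OF H'p[OF xy], of w] by (simp add: Comp_Add')
          qed (simp_all add: Hom_def)
          then show "?k \<bullet> (\<one> W \<boxtimes> Pnt R x) \<bullet> Inv (\<r> W) = F y \<bullet> (\<one> W \<boxtimes> Pnt R x) \<bullet> Inv (\<r> W)"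
            using F(2)[OF y x] by simp
        qed
        then show "?k = G \<bullet> (\<one> (W \<otimes> ?Q) \<boxtimes> Pnt R' y) \<bullet> Inv (\<r> (W \<otimes> ?Q))" using Gp[OF y] by simp
      qed simp
      then have "?G \<bullet> Inv (\<a> W ?Q ?Q') = ?H" by simp
      then show "H' = ?H" by simp
    qed
  qed simp
  then show ?thesis
    by (intro free_diff_comonoid.intro tens_diff_comonoid free_diff_comonoid_axioms.intro) simp
qed

end


section \<open>The modality of a family of free differential comonoids\<close>

context linear_symmetric_monoidal_category
begin

text \<open>The converse of \<open>smooth_linear\<close>, for the same reason.\<close>

lemma smooth_linear_conv:
  assumes "diff_comonoid C R" "diff_comonoid C R'" and h: "smooth R R' h" and \<psi>: "\<psi> \<in> hom (Bas R) (Bas R')"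
    and L: "Lin R' \<bullet> h = \<psi> \<bullet> Lin R"
  shows "h \<bullet> Dif R = Dif R' \<bullet> (h \<boxtimes> \<psi>)"
proof -
  interpret R: diff_comonoid C R by fact
  interpret R': diff_comonoid C R' by fact
  note [simp] = smoothD(1-3)[OF h]
  have [simp]: "\<psi> \<in> Arr C" "Dom C \<psi> = Bas R" "Cod C \<psi> = Bas R'" using \<psi> by (auto simp: Hom_def)
  have "h \<bullet> Dif R = Dif R' \<bullet> (h \<boxtimes> ((\<psi> \<bullet> Lin R) \<bullet> Dif R)) \<bullet> \<a> (Car R) (Car R) (Bas R) \<bullet> (Cmu R \<boxtimes> \<one> (Bas R))"
    using smoothD(6)[OF h] by (simp add: ode_def ext_along_def L)
  also have "\<dots> = Dif R' \<bullet> (h \<boxtimes> \<psi>)"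
  proof (rule ext2[where e = "Cou R" and d = "Cmu R"])
    fix K p x assume v: "var K 0 (Car R) (Cou R) (Cmu R) p" "var K 1 (Bas R) e' d' x"
    then show "app (Dif R' \<bullet> (h \<boxtimes> ((\<psi> \<bullet> Lin R) \<bullet> Dif R)) \<bullet> \<a> (Car R) (Car R) (Bas R) \<bullet> (Cmu R \<boxtimes> \<one> (Bas R))) (p \<otimes>\<otimes> x) =
      app (Dif R' \<bullet> (h \<boxtimes> \<psi>)) (p \<otimes>\<otimes> x)"
      by (simp add: var_def scalar_app)
  qed (simp_all add: Hom_def)
  finally show ?thesis .
qed

end

locale bip_linear = linear_symmetric_monoidal_category C
  for C :: "('o, 'm, 'k::{comm_semiring_0,comm_monoid_mult}, 'z) linsmcat_scheme" (structure) +
  assumes bip: "has_finite_biproducts C"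
begin

definition zero_obj :: 'o where
  "zero_obj = (SOME Z. terminal_object C Z)"

lemma zero_obj: "terminal_object C zero_obj"
  unfolding zero_obj_def using bip by (intro someI_ex[of "terminal_object C"]) (auto simp: has_finite_biproducts_def)

definition chosen_biproduct :: "'o \<Rightarrow> 'o \<Rightarrow> 'o \<times> 'm \<times> 'm \<times> 'm \<times> 'm" where
  "chosen_biproduct X Y = (SOME (B, p, q, i, j). is_biproduct C X Y B p q i j)"

definition tens :: "('o, 'm) dcom \<Rightarrow> ('o, 'm) dcom \<Rightarrow> ('o, 'm) dcom" (infixr "\<otimes>\<^sub>d" 70) where
  "R \<otimes>\<^sub>d R' = (case chosen_biproduct (Bas R) (Bas R') of (B, p, q, i, j) \<Rightarrow> tens_dcom R R' B p q i j)"

abbreviation unit :: "('o, 'm) dcom" where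
  "unit \<equiv> unit_dcom zero_obj"

lemma tens_obtain:
  assumes "diff_comonoid C R" "diff_comonoid C R'"
  obtains B p q i j where "is_biproduct C (Bas R) (Bas R') B p q i j" "R \<otimes>\<^sub>d R' = tens_dcom R R' B p q i j"
proof -
  have "Bas R \<in> Obj C" "Bas R' \<in> Obj C" using assms by (simp_all add: diff_comonoid.base)
  then have "\<exists>x. (\<lambda>(B, p, q, i, j). is_biproduct C (Bas R) (Bas R') B p q i j) x"
    using bip unfolding has_finite_biproducts_def by blast
  then have *: "(\<lambda>(B, p, q, i, j). is_biproduct C (Bas R) (Bas R') B p q i j) (chosen_biproduct (Bas R) (Bas R'))"
    unfolding chosen_biproduct_def by (rule someI_ex)
  obtain B p q i j where c: "chosen_biproduct (Bas R) (Bas R') = (B, p, q, i, j)" by (metis prod.exhaust)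
  show thesis using * by (intro that[of B p q i j]) (simp_all add: tens_def c)
qed

lemma dcom_pairI:
  "diff_comonoid C R \<Longrightarrow> diff_comonoid C R' \<Longrightarrow> is_biproduct C (Bas R) (Bas R') B p q i j \<Longrightarrow> dcom_pair C R R' B p q i j"
  by (intro dcom_pair.intro dcom_pair_axioms.intro linear_symmetric_monoidal_category_axioms)

lemma tens_is_diff_comonoid:
  assumes d: "diff_comonoid C R" "diff_comonoid C R'"
  shows "diff_comonoid C (R \<otimes>\<^sub>d R')"
proof -
  obtain B p q i j where B: "is_biproduct C (Bas R) (Bas R') B p q i j" and e: "R \<otimes>\<^sub>d R' = tens_dcom R R' B p q i j"
    using tens_obtain[OF d] .
  show ?thesis unfolding e by (rule dcom_pair.tens_diff_comonoid[OF dcom_pairI[OF d B]])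
qed

lemma tens_is_free:
  assumes "free_diff_comonoid C R" "free_diff_comonoid C R'"
  shows "free_diff_comonoid C (R \<otimes>\<^sub>d R')"
proof -
  have d: "diff_comonoid C R" "diff_comonoid C R'" using assms by (simp_all add: free_diff_comonoid_def)
  obtain B p q i j where B: "is_biproduct C (Bas R) (Bas R') B p q i j" and e: "R \<otimes>\<^sub>d R' = tens_dcom R R' B p q i j"
    using tens_obtain[OF d] .
  show ?thesis unfolding e
    by (rule dcom_pair.tens_free[OF dcom_pairI[OF d B]]) (simp_all add: assms free_diff_comonoid.free)
qed

lemma tens_simps [simp]:
  "Car (R \<otimes>\<^sub>d R') = Car R \<otimes> Car R'" "Cou (R \<otimes>\<^sub>d R') = \<l> \<I> \<bullet> (Cou R \<boxtimes> Cou R')"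
  "Cmu (R \<otimes>\<^sub>d R') = MidSwap C (Car R) (Car R) (Car R') (Car R') \<bullet> (Cmu R \<boxtimes> Cmu R')"
  by (simp_all add: tens_def split_def)

lemma unit_is_free: "free_diff_comonoid C unit"
  by (rule unit_free_diff_comonoid[OF zero_obj])

lemma unit_is_diff_comonoid: "diff_comonoid C unit"
  using unit_is_free by (simp add: free_diff_comonoid_def)

lemma tens_smooth:
  assumes "diff_comonoid C R" "diff_comonoid C R'" "diff_comonoid C S" "diff_comonoid C S'"
    "smooth R S h" "smooth R' S' k"
  shows "smooth (R \<otimes>\<^sub>d R') (S \<otimes>\<^sub>d S') (h \<boxtimes> k)"
proof -
  obtain B p q i j where B: "is_biproduct C (Bas R) (Bas R') B p q i j" and e: "R \<otimes>\<^sub>d R' = tens_dcom R R' B p q i j"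
    using tens_obtain[OF assms(1,2)] .
  obtain E p' q' i' j' where E: "is_biproduct C (Bas S) (Bas S') E p' q' i' j'" and e': "S \<otimes>\<^sub>d S' = tens_dcom S S' E p' q' i' j'"
    using tens_obtain[OF assms(3,4)] .
  show ?thesis unfolding e e' by (rule smooth_TensA) (use assms B E in auto)
qed

lemma comult_smooth: "diff_comonoid C R \<Longrightarrow> smooth R (R \<otimes>\<^sub>d R) (Cmu R)"
  using tens_obtain[of R R] smooth_comult[of R] by metis

lemma counit_smooth: "diff_comonoid C R \<Longrightarrow> smooth R unit (Cou R)"
  by (rule smooth_counit[OF _ zero_obj])

lemma Symm_smooth:
  assumes "diff_comonoid C R" "diff_comonoid C R'"
  shows "smooth (R \<otimes>\<^sub>d R') (R' \<otimes>\<^sub>d R) (\<s> (Car R) (Car R'))"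
proof -
  obtain B p q i j where B: "is_biproduct C (Bas R) (Bas R') B p q i j" and e: "R \<otimes>\<^sub>d R' = tens_dcom R R' B p q i j"
    using tens_obtain[OF assms(1,2)] .
  obtain E p' q' i' j' where E: "is_biproduct C (Bas R') (Bas R) E p' q' i' j'" and e': "R' \<otimes>\<^sub>d R = tens_dcom R' R E p' q' i' j'"
    using tens_obtain[OF assms(2,1)] .
  show ?thesis unfolding e e' by (rule smooth_Symm) (use assms B E in auto)
qed

lemma LUnit_smooth:
  assumes "diff_comonoid C R"
  shows "smooth (unit \<otimes>\<^sub>d R) R (\<l> (Car R))"
proof -
  obtain B p q i j where B: "is_biproduct C (Bas unit) (Bas R) B p q i j" and e: "unit \<otimes>\<^sub>d R = tens_dcom unit R B p q i j"
    using tens_obtain[OF unit_is_diff_comonoid assms] .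
  show ?thesis unfolding e by (rule smooth_LUnit[OF assms zero_obj]) (use B in simp)
qed

lemma RUnit_smooth:
  assumes "diff_comonoid C R"
  shows "smooth (R \<otimes>\<^sub>d unit) R (\<r> (Car R))"
proof -
  obtain B p q i j where B: "is_biproduct C (Bas R) (Bas unit) B p q i j" and e: "R \<otimes>\<^sub>d unit = tens_dcom R unit B p q i j"
    using tens_obtain[OF assms unit_is_diff_comonoid] .
  show ?thesis unfolding e by (rule smooth_RUnit[OF assms zero_obj]) (use B in simp)
qed

lemma Assoc_smooth:
  assumes R: "diff_comonoid C R1" "diff_comonoid C R2" "diff_comonoid C R3"
  shows "smooth ((R1 \<otimes>\<^sub>d R2) \<otimes>\<^sub>d R3) (R1 \<otimes>\<^sub>d R2 \<otimes>\<^sub>d R3) (\<a> (Car R1) (Car R2) (Car R3))"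
proof -
  obtain B12 p12 q12 i12 j12 where 1: "is_biproduct C (Bas R1) (Bas R2) B12 p12 q12 i12 j12" "R1 \<otimes>\<^sub>d R2 = tens_dcom R1 R2 B12 p12 q12 i12 j12"
    using tens_obtain[OF R(1,2)] .
  obtain B23 p23 q23 i23 j23 where 2: "is_biproduct C (Bas R2) (Bas R3) B23 p23 q23 i23 j23" "R2 \<otimes>\<^sub>d R3 = tens_dcom R2 R3 B23 p23 q23 i23 j23"
    using tens_obtain[OF R(2,3)] .
  obtain B p q i j where 3: "is_biproduct C (Bas (R1 \<otimes>\<^sub>d R2)) (Bas R3) B p q i j" "(R1 \<otimes>\<^sub>d R2) \<otimes>\<^sub>d R3 = tens_dcom (R1 \<otimes>\<^sub>d R2) R3 B p q i j"
    using tens_obtain[OF tens_is_diff_comonoid[OF R(1,2)] R(3)] .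
  obtain B' p' q' i' j' where 4: "is_biproduct C (Bas R1) (Bas (R2 \<otimes>\<^sub>d R3)) B' p' q' i' j'" "R1 \<otimes>\<^sub>d R2 \<otimes>\<^sub>d R3 = tens_dcom R1 (R2 \<otimes>\<^sub>d R3) B' p' q' i' j'"
    using tens_obtain[OF R(1) tens_is_diff_comonoid[OF R(2,3)]] .
  show ?thesis unfolding 1(2) 2(2) 3(2)[unfolded 1(2)] 4(2)[unfolded 2(2)]
    by (rule smooth_Assoc) (use R 1 2 3(1)[unfolded 1(2)] 4(1)[unfolded 2(2)] in simp_all)
qed

definition lift :: "('o, 'm) dcom \<Rightarrow> ('o, 'm) dcom \<Rightarrow> 'm \<Rightarrow> 'm" where
  "lift R R' g = (SOME h. smooth R R' h \<and> Lin R' \<bullet> h = g)"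

lemma lift:
  assumes "free_diff_comonoid C R" "diff_comonoid C R'" "g \<in> hom (Car R) (Bas R')"
  shows "smooth R R' (lift R R' g)" "Lin R' \<bullet> lift R R' g = g"
proof -
  have "smooth R R' (lift R R' g) \<and> Lin R' \<bullet> lift R R' g = g"
    unfolding lift_def by (rule someI_ex) (rule smooth_lift[OF assms(1,2) bip assms(3)])
  then show "smooth R R' (lift R R' g)" "Lin R' \<bullet> lift R R' g = g" by auto
qed

end

locale free_family = bip_linear C
  for C :: "('o, 'm, 'k::{comm_semiring_0,comm_monoid_mult}, 'z) linsmcat_scheme" (structure) +
  fixes R :: "'o \<Rightarrow> ('o, 'm) dcom"
  assumes R_free: "X \<in> Obj C \<Longrightarrow> free_diff_comonoid C (R X)"
    and Bas_R: "X \<in> Obj C \<Longrightarrow> Bas (R X) = X"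
begin

text \<open>The linear parts are dictated by naturality of \<open>\<epsilon>\<close>, by \<open>\<epsilon> \<circ> \<delta> = 1\<close>, and by monoidality of \<open>\<epsilon>\<close>.\<close>

definition P :: "('o, 'm) modality" where
  "P = \<lparr>Bang = (\<lambda>X. Car (R X)),
    BangA = (\<lambda>f. lift (R (Dom C f)) (R (Cod C f)) (f \<bullet> Lin (R (Dom C f)))),
    eps = (\<lambda>X. Lin (R X)),
    del = (\<lambda>X. lift (R X) (R (Car (R X))) (\<one> (Car (R X)))),
    cou = (\<lambda>X. Cou (R X)), com = (\<lambda>X. Cmu (R X)),
    munit = lift unit (R \<I>) (\<one> \<I>),
    mtens = (\<lambda>X Y. lift (R X \<otimes>\<^sub>d R Y) (R (X \<otimes> Y)) (Lin (R X) \<boxtimes> Lin (R Y))),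
    der = (\<lambda>X. Dif (R X))\<rparr>"

lemma P_simps [simp]: "Bang P X = Car (R X)" "eps P X = Lin (R X)" "cou P X = Cou (R X)" "com P X = Cmu (R X)"
  "der P X = Dif (R X)"
  by (simp_all add: P_def)

lemma R_diff_comonoid: "X \<in> Obj C \<Longrightarrow> diff_comonoid C (R X)"
  using R_free by (simp add: free_diff_comonoid_def)

lemma R_typ [simp]:
  assumes "X \<in> Obj C"
  shows "Bas (R X) = X" "Car (R X) \<in> Obj C" "Lin (R X) \<in> Arr C" "Dom C (Lin (R X)) = Car (R X)" "Cod C (Lin (R X)) = X"
    "Cou (R X) \<in> Arr C" "Dom C (Cou (R X)) = Car (R X)" "Cod C (Cou (R X)) = \<I>"
    "Cmu (R X) \<in> Arr C" "Dom C (Cmu (R X)) = Car (R X)" "Cod C (Cmu (R X)) = Car (R X) \<otimes> Car (R X)"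
    "Dif (R X) \<in> Arr C" "Dom C (Dif (R X)) = Car (R X) \<otimes> X" "Cod C (Dif (R X)) = Car (R X)"
  using diff_comonoid.dtyp[OF R_diff_comonoid[OF assms]] Bas_R[OF assms] by auto

lemma BangA:
  assumes "f \<in> Arr C"
  shows "smooth (R (Dom C f)) (R (Cod C f)) (BangA P f)" "Lin (R (Cod C f)) \<bullet> BangA P f = f \<bullet> Lin (R (Dom C f))"
  using assms by (auto simp: P_def Hom_def intro!: lift R_free R_diff_comonoid)

lemma BangA_Hom [simp]: "f \<in> Arr C \<Longrightarrow> BangA P f \<in> Arr C" "f \<in> Arr C \<Longrightarrow> Dom C (BangA P f) = Car (R (Dom C f))"
  "f \<in> Arr C \<Longrightarrow> Cod C (BangA P f) = Car (R (Cod C f))"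
  using smoothD(1-3)[OF BangA(1)] by auto

lemma del:
  assumes "X \<in> Obj C"
  shows "smooth (R X) (R (Car (R X))) (del P X)" "Lin (R (Car (R X))) \<bullet> del P X = \<one> (Car (R X))"
  using assms by (auto simp: P_def Hom_def intro!: lift R_free R_diff_comonoid)

lemma munit: "smooth unit (R \<I>) (munit P)" "Lin (R \<I>) \<bullet> munit P = \<one> \<I>"
  by (auto simp: P_def Hom_def intro!: lift R_free R_diff_comonoid unit_is_free)

lemma mtens:
  assumes "X \<in> Obj C" "Y \<in> Obj C"
  shows "smooth (R X \<otimes>\<^sub>d R Y) (R (X \<otimes> Y)) (mtens P X Y)" "Lin (R (X \<otimes> Y)) \<bullet> mtens P X Y = Lin (R X) \<boxtimes> Lin (R Y)"
  using assms by (auto simp: P_def Hom_def intro!: lift R_free R_diff_comonoid tens_is_free)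

lemma structure_typ [simp]:
  "X \<in> Obj C \<Longrightarrow> del P X \<in> Arr C" "X \<in> Obj C \<Longrightarrow> Dom C (del P X) = Car (R X)"
  "X \<in> Obj C \<Longrightarrow> Cod C (del P X) = Car (R (Car (R X)))"
  "munit P \<in> Arr C" "Dom C (munit P) = \<I>" "Cod C (munit P) = Car (R \<I>)"
  "X \<in> Obj C \<Longrightarrow> Y \<in> Obj C \<Longrightarrow> mtens P X Y \<in> Arr C"
  "X \<in> Obj C \<Longrightarrow> Y \<in> Obj C \<Longrightarrow> Dom C (mtens P X Y) = Car (R X) \<otimes> Car (R Y)"
  "X \<in> Obj C \<Longrightarrow> Y \<in> Obj C \<Longrightarrow> Cod C (mtens P X Y) = Car (R (X \<otimes> Y))"
  using smoothD(1-3)[OF del(1)[of X]] smoothD(1-3)[OF munit(1)] smoothD(1-3)[OF mtens(1)[of X Y]] by auto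

lemma Lin_left:
  "f \<in> Arr C \<Longrightarrow> k \<in> Arr C \<Longrightarrow> Y = Cod C f \<Longrightarrow> Cod C k = Car (R (Dom C f)) \<Longrightarrow>
    Lin (R Y) \<bullet> BangA P f \<bullet> k = f \<bullet> Lin (R (Dom C f)) \<bullet> k"
  "X \<in> Obj C \<Longrightarrow> k \<in> Arr C \<Longrightarrow> Cod C k = Car (R X) \<Longrightarrow> Lin (R (Car (R X))) \<bullet> del P X \<bullet> k = k"
  "k \<in> Arr C \<Longrightarrow> Cod C k = \<I> \<Longrightarrow> Lin (R \<I>) \<bullet> munit P \<bullet> k = k"
  "X \<in> Obj C \<Longrightarrow> Y \<in> Obj C \<Longrightarrow> k \<in> Arr C \<Longrightarrow> Cod C k = Car (R X) \<otimes> Car (R Y) \<Longrightarrow>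
    Lin (R (X \<otimes> Y)) \<bullet> mtens P X Y \<bullet> k = (Lin (R X) \<boxtimes> Lin (R Y)) \<bullet> k"
  using Comp_left[OF BangA(2)[of f], of k] Comp_left[OF del(2), of X k] Comp_left[OF munit(2), of k]
    Comp_left[OF mtens(2), of X Y k] by simp_all

lemma Lin_BangA: "f \<in> Arr C \<Longrightarrow> Y = Cod C f \<Longrightarrow> Lin (R Y) \<bullet> BangA P f = f \<bullet> Lin (R (Dom C f))"
  using BangA(2) by simp

lemmas Lin_simps = Lin_left Lin_BangA del(2) munit(2) mtens(2)

lemma BangA_smooth: "f \<in> Arr C \<Longrightarrow> Dom C f = X \<Longrightarrow> Cod C f = Y \<Longrightarrow> smooth (R X) (R Y) (BangA P f)"
  using BangA(1) by blast

text \<open>In the remaining axioms both sides are smooth maps out of a free object, so it is enough to compare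
their linear parts.\<close>

lemma P_comonad: "comonad C P"
proof (intro comonad.intro comonad_axioms.intro category_axioms)
  have id: "BangA P (\<one> X) = \<one> (Car (R X))" if [simp]: "X \<in> Obj C" for X
    by (rule smooth_unique[OF R_free R_diff_comonoid BangA_smooth smooth_id[OF R_diff_comonoid]]) (simp_all add: Lin_simps)
  have comp: "BangA P (g \<bullet> f) = BangA P g \<bullet> BangA P f" if "f \<in> hom X Y" "g \<in> hom Y Z" for f g X Y Z
  proof -
    have [simp]: "f \<in> Arr C" "Dom C f = X" "Cod C f = Y" "g \<in> Arr C" "Dom C g = Y" "Cod C g = Z"
      using that by (auto simp: Hom_def)
    have [simp]: "X \<in> Obj C" "Y \<in> Obj C" "Z \<in> Obj C" using Obj_Dom[of f] Obj_Cod[of f] Obj_Cod[of g] by auto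
    show ?thesis
      by (rule smooth_unique[OF R_free[of X] R_diff_comonoid[of Z] BangA_smooth smooth_comp[OF R_diff_comonoid[of X] R_diff_comonoid[of Y] R_diff_comonoid[of Z] BangA_smooth BangA_smooth]])
        (simp_all add: Lin_simps)
  qed
  show "is_functor C C (Bang P) (BangA P)"
    using id comp unfolding is_functor_def by (auto simp: Hom_def)
  show "eps P X \<in> hom (Bang P X) X" if "X \<in> Obj C" for X using that by (simp add: Hom_def)
  show "eps P Y \<bullet> BangA P f = f \<bullet> eps P X" if "f \<in> hom X Y" for f X Y
    using that BangA(2)[of f] by (auto simp: Hom_def)
  show "del P X \<in> hom (Bang P X) (Bang P (Bang P X))" if "X \<in> Obj C" for X using that by (simp add: Hom_def)
  show "del P Y \<bullet> BangA P f = BangA P (BangA P f) \<bullet> del P X" if "f \<in> hom X Y" for f X Y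
  proof -
    have [simp]: "f \<in> Arr C" "Dom C f = X" "Cod C f = Y" using that by (auto simp: Hom_def)
    have [simp]: "X \<in> Obj C" "Y \<in> Obj C" using Obj_Dom[of f] Obj_Cod[of f] by auto
    show ?thesis
      by (rule smooth_unique[OF R_free[of X] R_diff_comonoid[of "Car (R Y)"] smooth_comp[OF R_diff_comonoid[of X] R_diff_comonoid[of Y] _ BangA_smooth del(1)]
            smooth_comp[OF R_diff_comonoid[of X] R_diff_comonoid[of "Car (R X)"] _ del(1) BangA_smooth]])
        (simp_all add: Lin_simps R_diff_comonoid)
  qed
  show "eps P (Bang P X) \<bullet> del P X = \<one> (Bang P X)" if "X \<in> Obj C" for X using that by (simp add: Lin_simps)
  show "BangA P (eps P X) \<bullet> del P X = \<one> (Bang P X)" if [simp]: "X \<in> Obj C" for X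
    unfolding P_simps
    by (rule smooth_unique[OF R_free[of X] R_diff_comonoid[of X] smooth_comp[OF R_diff_comonoid[of X] R_diff_comonoid[of "Car (R X)"] _ del(1) BangA_smooth] smooth_id[OF R_diff_comonoid]])
        (simp_all add: Lin_simps R_diff_comonoid)
  show "del P (Bang P X) \<bullet> del P X = BangA P (del P X) \<bullet> del P X" if [simp]: "X \<in> Obj C" for X
    unfolding P_simps
    by (rule smooth_unique[OF R_free[of X] R_diff_comonoid[of "Car (R (Car (R X)))"] smooth_comp[OF R_diff_comonoid[of X] R_diff_comonoid[of "Car (R X)"] _ del(1) del(1)]
          smooth_comp[OF R_diff_comonoid[of X] R_diff_comonoid[of "Car (R X)"] _ del(1) BangA_smooth]])
        (simp_all add: Lin_simps R_diff_comonoid)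
qed

lemma P_coalgebra_modality: "coalgebra_modality C P"
proof (intro coalgebra_modality.intro coalgebra_modality_axioms.intro symmetric_monoidal_category_axioms P_comonad)
  show "cocommutative_comonoid C (Bang P X) (cou P X) (com P X)" if "X \<in> Obj C" for X
    using diff_comonoid.comonoid[OF R_diff_comonoid[OF that]] by simp
  show "cou P Y \<bullet> BangA P f = cou P X" "com P Y \<bullet> BangA P f = (BangA P f \<boxtimes> BangA P f) \<bullet> com P X" if "f \<in> hom X Y" for f X Y
    using that smoothD(4,5)[OF BangA(1)[of f]] by (auto simp: Hom_def)
  show "comonoid_hom C (bang_comonoid P X) (bang_comonoid P (Bang P X)) (del P X)" if "X \<in> Obj C" for X
    using that smoothD(4,5)[OF del(1)[OF that]] by (simp add: comonoid_hom_def bang_comonoid_def Hom_def)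
qed

lemma P_monoidal_comonad: "monoidal_comonad C P"
proof (intro monoidal_comonad.intro monoidal_comonad_axioms.intro symmetric_monoidal_category_axioms P_comonad)
  show "munit P \<in> hom \<I> (Bang P \<I>)" by (simp add: Hom_def)
  show "mtens P X Y \<in> hom (Bang P X \<otimes> Bang P Y) (Bang P (X \<otimes> Y))" if "X \<in> Obj C" "Y \<in> Obj C" for X Y
    using that by (simp add: Hom_def)
  show "mtens P X' Y' \<bullet> (BangA P f \<boxtimes> BangA P g) = BangA P (f \<boxtimes> g) \<bullet> mtens P X Y" if "f \<in> hom X X'" "g \<in> hom Y Y'" for f g X X' Y Y'
  proof -
    have [simp]: "f \<in> Arr C" "Dom C f = X" "Cod C f = X'" "g \<in> Arr C" "Dom C g = Y" "Cod C g = Y'" using that by (auto simp: Hom_def)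
    have [simp]: "X \<in> Obj C" "X' \<in> Obj C" "Y \<in> Obj C" "Y' \<in> Obj C" using Obj_Dom[of f] Obj_Cod[of f] Obj_Dom[of g] Obj_Cod[of g] by auto
    show ?thesis
    proof (rule smooth_unique)
      show "smooth (R X \<otimes>\<^sub>d R Y) (R (X' \<otimes> Y')) (mtens P X' Y' \<bullet> (BangA P f \<boxtimes> BangA P g))"
        by (rule smooth_comp[where R' = "R X' \<otimes>\<^sub>d R Y'"]) (simp_all add: R_diff_comonoid tens_is_diff_comonoid tens_smooth BangA_smooth mtens)
      show "smooth (R X \<otimes>\<^sub>d R Y) (R (X' \<otimes> Y')) (BangA P (f \<boxtimes> g) \<bullet> mtens P X Y)"
        by (rule smooth_comp[where R' = "R (X \<otimes> Y)"]) (simp_all add: R_diff_comonoid tens_is_diff_comonoid BangA_smooth mtens)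
    qed (simp_all add: R_free R_diff_comonoid tens_is_free Lin_simps TensA_Comp' TensA_Comp_left)
  qed
  show "mtens P X (Y \<otimes> Z) \<bullet> (\<one> (Bang P X) \<boxtimes> mtens P Y Z) \<bullet> \<a> (Bang P X) (Bang P Y) (Bang P Z)
        = BangA P (\<a> X Y Z) \<bullet> mtens P (X \<otimes> Y) Z \<bullet> (mtens P X Y \<boxtimes> \<one> (Bang P Z))"
    if [simp]: "X \<in> Obj C" "Y \<in> Obj C" "Z \<in> Obj C" for X Y Z
    unfolding P_simps
  proof (rule smooth_unique)
    note [simp] = R_diff_comonoid tens_is_diff_comonoid BangA_smooth mtens(1) smooth_id[OF R_diff_comonoid]
    have "smooth ((R X \<otimes>\<^sub>d R Y) \<otimes>\<^sub>d R Z) (R X \<otimes>\<^sub>d R (Y \<otimes> Z)) ((\<one> (Car (R X)) \<boxtimes> mtens P Y Z) \<bullet> \<a> (Car (R X)) (Car (R Y)) (Car (R Z)))"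
      by (rule smooth_comp[where R' = "R X \<otimes>\<^sub>d R Y \<otimes>\<^sub>d R Z"]) (simp_all add: Assoc_smooth tens_smooth)
    then show "smooth ((R X \<otimes>\<^sub>d R Y) \<otimes>\<^sub>d R Z) (R (X \<otimes> Y \<otimes> Z)) (mtens P X (Y \<otimes> Z) \<bullet> (\<one> (Car (R X)) \<boxtimes> mtens P Y Z) \<bullet> \<a> (Car (R X)) (Car (R Y)) (Car (R Z)))"
      by (intro smooth_comp[where R' = "R X \<otimes>\<^sub>d R (Y \<otimes> Z)" and h = "(\<one> (Car (R X)) \<boxtimes> mtens P Y Z) \<bullet> \<a> (Car (R X)) (Car (R Y)) (Car (R Z))"]) simp_all
    have "smooth ((R X \<otimes>\<^sub>d R Y) \<otimes>\<^sub>d R Z) (R ((X \<otimes> Y) \<otimes> Z)) (mtens P (X \<otimes> Y) Z \<bullet> (mtens P X Y \<boxtimes> \<one> (Car (R Z))))"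
      by (rule smooth_comp[where R' = "R (X \<otimes> Y) \<otimes>\<^sub>d R Z"]) (simp_all add: tens_smooth)
    then show "smooth ((R X \<otimes>\<^sub>d R Y) \<otimes>\<^sub>d R Z) (R (X \<otimes> Y \<otimes> Z)) (BangA P (\<a> X Y Z) \<bullet> mtens P (X \<otimes> Y) Z \<bullet> (mtens P X Y \<boxtimes> \<one> (Car (R Z))))"
      by (intro smooth_comp[where R' = "R ((X \<otimes> Y) \<otimes> Z)" and h = "mtens P (X \<otimes> Y) Z \<bullet> (mtens P X Y \<boxtimes> \<one> (Car (R Z)))"]) simp_all
  qed (simp_all add: R_free R_diff_comonoid tens_is_free Lin_simps TensA_Comp' TensA_Comp_left Assoc_nat)
  show "BangA P (\<l> X) \<bullet> mtens P \<I> X \<bullet> (munit P \<boxtimes> \<one> (Bang P X)) = \<l> (Bang P X)" if [simp]: "X \<in> Obj C" for X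
    unfolding P_simps
  proof (rule smooth_unique)
    note [simp] = R_diff_comonoid tens_is_diff_comonoid BangA_smooth mtens(1) smooth_id[OF R_diff_comonoid] unit_is_diff_comonoid munit(1)
    have "smooth (unit \<otimes>\<^sub>d R X) (R (\<I> \<otimes> X)) (mtens P \<I> X \<bullet> (munit P \<boxtimes> \<one> (Car (R X))))"
      by (rule smooth_comp[where R' = "R \<I> \<otimes>\<^sub>d R X"]) (simp_all add: tens_smooth)
    then show "smooth (unit \<otimes>\<^sub>d R X) (R X) (BangA P (\<l> X) \<bullet> mtens P \<I> X \<bullet> (munit P \<boxtimes> \<one> (Car (R X))))"
      by (intro smooth_comp[where R' = "R (\<I> \<otimes> X)" and h = "mtens P \<I> X \<bullet> (munit P \<boxtimes> \<one> (Car (R X)))"]) simp_all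
    show "smooth (unit \<otimes>\<^sub>d R X) (R X) (\<l> (Car (R X)))" by (simp add: LUnit_smooth)
  qed (simp_all add: R_free R_diff_comonoid tens_is_free unit_is_free Lin_simps TensA_Comp' LUnit_nat)
  show "BangA P (\<r> X) \<bullet> mtens P X \<I> \<bullet> (\<one> (Bang P X) \<boxtimes> munit P) = \<r> (Bang P X)" if [simp]: "X \<in> Obj C" for X
    unfolding P_simps
  proof (rule smooth_unique)
    note [simp] = R_diff_comonoid tens_is_diff_comonoid BangA_smooth mtens(1) smooth_id[OF R_diff_comonoid] unit_is_diff_comonoid munit(1)
    have "smooth (R X \<otimes>\<^sub>d unit) (R (X \<otimes> \<I>)) (mtens P X \<I> \<bullet> (\<one> (Car (R X)) \<boxtimes> munit P))"
      by (rule smooth_comp[where R' = "R X \<otimes>\<^sub>d R \<I>"]) (simp_all add: tens_smooth)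
    then show "smooth (R X \<otimes>\<^sub>d unit) (R X) (BangA P (\<r> X) \<bullet> mtens P X \<I> \<bullet> (\<one> (Car (R X)) \<boxtimes> munit P))"
      by (intro smooth_comp[where R' = "R (X \<otimes> \<I>)" and h = "mtens P X \<I> \<bullet> (\<one> (Car (R X)) \<boxtimes> munit P)"]) simp_all
    show "smooth (R X \<otimes>\<^sub>d unit) (R X) (\<r> (Car (R X)))" by (simp add: RUnit_smooth)
  qed (simp_all add: R_free R_diff_comonoid tens_is_free unit_is_free Lin_simps TensA_Comp' RUnit_nat)
  show "BangA P (\<s> X Y) \<bullet> mtens P X Y = mtens P Y X \<bullet> \<s> (Bang P X) (Bang P Y)" if [simp]: "X \<in> Obj C" "Y \<in> Obj C" for X Y
    unfolding P_simps
  proof (rule smooth_unique)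
    note [simp] = R_diff_comonoid tens_is_diff_comonoid BangA_smooth mtens(1)
    show "smooth (R X \<otimes>\<^sub>d R Y) (R (Y \<otimes> X)) (BangA P (\<s> X Y) \<bullet> mtens P X Y)"
      by (rule smooth_comp[where R' = "R (X \<otimes> Y)"]) simp_all
    show "smooth (R X \<otimes>\<^sub>d R Y) (R (Y \<otimes> X)) (mtens P Y X \<bullet> \<s> (Car (R X)) (Car (R Y)))"
      by (rule smooth_comp[where R' = "R Y \<otimes>\<^sub>d R X"]) (simp_all add: Symm_smooth)
  qed (simp_all add: R_free R_diff_comonoid tens_is_free Lin_simps Symm_nat)
  show "eps P \<I> \<bullet> munit P = \<one> \<I>" by (simp add: Lin_simps)
  show "eps P (X \<otimes> Y) \<bullet> mtens P X Y = eps P X \<boxtimes> eps P Y" if "X \<in> Obj C" "Y \<in> Obj C" for X Y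
    using that by (simp add: Lin_simps)
  show "del P \<I> \<bullet> munit P = BangA P (munit P) \<bullet> munit P"
  proof (rule smooth_unique)
    note [simp] = R_diff_comonoid tens_is_diff_comonoid BangA_smooth munit(1) del(1) unit_is_diff_comonoid
    show "smooth unit (R (Car (R \<I>))) (del P \<I> \<bullet> munit P)"
      by (rule smooth_comp[where R' = "R \<I>"]) simp_all
    show "smooth unit (R (Car (R \<I>))) (BangA P (munit P) \<bullet> munit P)"
      by (rule smooth_comp[where R' = "R \<I>"]) simp_all
  qed (simp_all add: unit_is_free R_diff_comonoid Lin_simps)
  show "del P (X \<otimes> Y) \<bullet> mtens P X Y
        = BangA P (mtens P X Y) \<bullet> mtens P (Bang P X) (Bang P Y) \<bullet> (del P X \<boxtimes> del P Y)" if [simp]: "X \<in> Obj C" "Y \<in> Obj C" for X Y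
    unfolding P_simps
  proof (rule smooth_unique)
    note [simp] = R_diff_comonoid tens_is_diff_comonoid BangA_smooth mtens(1) del(1)
    let ?Q = "Car (R X)" and ?Q' = "Car (R Y)"
    show "smooth (R X \<otimes>\<^sub>d R Y) (R (Car (R (X \<otimes> Y)))) (del P (X \<otimes> Y) \<bullet> mtens P X Y)"
      by (rule smooth_comp[where R' = "R (X \<otimes> Y)"]) simp_all
    have "smooth (R X \<otimes>\<^sub>d R Y) (R (?Q \<otimes> ?Q')) (mtens P ?Q ?Q' \<bullet> (del P X \<boxtimes> del P Y))"
      by (rule smooth_comp[where R' = "R ?Q \<otimes>\<^sub>d R ?Q'"]) (simp_all add: tens_smooth)
    then show "smooth (R X \<otimes>\<^sub>d R Y) (R (Car (R (X \<otimes> Y)))) (BangA P (mtens P X Y) \<bullet> mtens P ?Q ?Q' \<bullet> (del P X \<boxtimes> del P Y))"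
      by (intro smooth_comp[where R' = "R (?Q \<otimes> ?Q')" and h = "mtens P ?Q ?Q' \<bullet> (del P X \<boxtimes> del P Y)"]) simp_all
  qed (simp_all add: R_free R_diff_comonoid tens_is_free Lin_simps TensA_Comp')
qed

lemma P_monoidal_coalgebra_modality: "monoidal_coalgebra_modality C P"
proof (intro monoidal_coalgebra_modality.intro monoidal_coalgebra_modality_axioms.intro P_coalgebra_modality P_monoidal_comonad)
  show "comonoid_hom C (unit_comonoid C) (bang_comonoid P \<I>) (munit P)"
    using smoothD(4,5)[OF munit(1)] by (simp add: comonoid_hom_def unit_comonoid_def bang_comonoid_def Hom_def)
  show "comonoid_hom C (tensor_comonoid C (bang_comonoid P X) (bang_comonoid P Y)) (bang_comonoid P (X \<otimes> Y)) (mtens P X Y)"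
    if "X \<in> Obj C" "Y \<in> Obj C" for X Y
    using that smoothD(4,5)[OF mtens(1)[OF that]]
    by (simp add: comonoid_hom_def tensor_comonoid_def bang_comonoid_def Hom_def)
  note [simp] = R_diff_comonoid tens_is_diff_comonoid unit_is_diff_comonoid BangA_smooth mtens(1) del(1) munit(1) counit_smooth comult_smooth
  show "bang_coalgebra_hom C P (Bang P X, del P X) (\<I>, munit P) (cou P X)" if [simp]: "X \<in> Obj C" for X
  proof -
    have "munit P \<bullet> Cou (R X) = BangA P (Cou (R X)) \<bullet> del P X"
    proof (rule smooth_unique)
      show "smooth (R X) (R \<I>) (munit P \<bullet> Cou (R X))" by (rule smooth_comp[where R' = unit]) simp_all
      show "smooth (R X) (R \<I>) (BangA P (Cou (R X)) \<bullet> del P X)" by (rule smooth_comp[where R' = "R (Car (R X))"]) simp_all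
    qed (simp_all add: R_free Lin_simps)
    then show ?thesis by (simp add: bang_coalgebra_hom_def Hom_def)
  qed
  show "bang_coalgebra_hom C P (Bang P X, del P X)
        (Bang P X \<otimes> Bang P X, mtens P (Bang P X) (Bang P X) \<bullet> (del P X \<boxtimes> del P X)) (com P X)" if [simp]: "X \<in> Obj C" for X
  proof -
    let ?Q = "Car (R X)"
    have "mtens P ?Q ?Q \<bullet> (del P X \<boxtimes> del P X) \<bullet> Cmu (R X) = BangA P (Cmu (R X)) \<bullet> del P X"
    proof (rule smooth_unique)
      have "smooth (R X) (R ?Q \<otimes>\<^sub>d R ?Q) ((del P X \<boxtimes> del P X) \<bullet> Cmu (R X))"
        by (rule smooth_comp[where R' = "R X \<otimes>\<^sub>d R X"]) (simp_all add: tens_smooth)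
      then show "smooth (R X) (R (?Q \<otimes> ?Q)) (mtens P ?Q ?Q \<bullet> (del P X \<boxtimes> del P X) \<bullet> Cmu (R X))"
        by (intro smooth_comp[where R' = "R ?Q \<otimes>\<^sub>d R ?Q" and h = "(del P X \<boxtimes> del P X) \<bullet> Cmu (R X)"]) simp_all
      show "smooth (R X) (R (?Q \<otimes> ?Q)) (BangA P (Cmu (R X)) \<bullet> del P X)" by (rule smooth_comp[where R' = "R ?Q"]) simp_all
    qed (simp_all add: R_free Lin_simps TensA_Comp_left)
    then show ?thesis by (simp add: bang_coalgebra_hom_def Hom_def)
  qed
qed

lemma P_modality: "monoidal_differential_modality C P"
proof (intro monoidal_differential_modality.intro monoidal_differential_modality_axioms.intro
    linear_symmetric_monoidal_category_axioms P_monoidal_coalgebra_modality)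
  show "der P Y \<bullet> (BangA P f \<boxtimes> f) = BangA P f \<bullet> der P X" if "f \<in> hom X Y" for f X Y
  proof -
    have [simp]: "f \<in> Arr C" "Dom C f = X" "Cod C f = Y" using that by (auto simp: Hom_def)
    have [simp]: "X \<in> Obj C" "Y \<in> Obj C" using Obj_Dom[of f] Obj_Cod[of f] by auto
    show ?thesis using smooth_linear_conv[OF R_diff_comonoid[of X] R_diff_comonoid[of Y] BangA_smooth, of f f] by (simp add: Lin_simps Hom_def)
  qed
  fix X assume [simp]: "X \<in> Obj C"
  interpret R: diff_comonoid C "R X" by (rule R_diff_comonoid) simp
  show "der P X \<in> hom (Bang P X \<otimes> X) (Bang P X)" by (simp add: Hom_def)
  show "cou P X \<bullet> der P X = \<zero> (Bang P X \<otimes> X) \<I>" using R.const_zero by simp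
  show "com P X \<bullet> der P X = ((\<one> (Bang P X) \<boxtimes> der P X) \<oplus>
         ((der P X \<boxtimes> \<one> (Bang P X)) \<bullet> Inv (\<a> (Bang P X) X (Bang P X)) \<bullet> (\<one> (Bang P X) \<boxtimes> \<s> (Bang P X) X)))
        \<bullet> \<a> (Bang P X) (Bang P X) X \<bullet> (com P X \<boxtimes> \<one> X)"
    using R.product by (simp add: tens_act_def RSwap_def Comp_Add')
  show "eps P X \<bullet> der P X = \<l> X \<bullet> (cou P X \<boxtimes> \<one> X)" using R.linear by simp
  show "del P X \<bullet> der P X = der P (Bang P X) \<bullet> (del P X \<boxtimes> der P X) \<bullet> \<a> (Bang P X) (Bang P X) X \<bullet> (com P X \<boxtimes> \<one> X)"
    using smoothD(6)[OF del(1)[of X]] by (simp add: ode_def ext_along_def Lin_simps)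
  show "der P X \<bullet> (der P X \<boxtimes> \<one> X) \<bullet> Inv (\<a> (Bang P X) X X) \<bullet> (\<one> (Bang P X) \<boxtimes> \<s> X X) \<bullet> \<a> (Bang P X) X X
        = der P X \<bullet> (der P X \<boxtimes> \<one> X)"
    using R.commuting by (simp add: commuting_action_def)
qed

end


section \<open>Initiality of the modality\<close>

locale modality_over_biproducts = bip_linear C + monoidal_differential_modality C T
  for C :: "('o, 'm, 'k::{comm_semiring_0,comm_monoid_mult}, 'z) linsmcat_scheme" (structure)
    and T :: "('o, 'm) modality"
begin

definition bang_dcom :: "'o \<Rightarrow> ('o, 'm) dcom" where
  "bang_dcom X = \<lparr>Car = Bang T X, Bas = X, Cou = cou T X, Cmu = com T X, Dif = der T X, Lin = eps T X,
    Pnt = (\<lambda>x. BangA T x \<bullet> munit T)\<rparr>"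

lemma bang_dcom_simps [simp]: "Car (bang_dcom X) = Bang T X" "Bas (bang_dcom X) = X" "Cou (bang_dcom X) = cou T X" "Cmu (bang_dcom X) = com T X"
  "Dif (bang_dcom X) = der T X" "Lin (bang_dcom X) = eps T X" "Pnt (bang_dcom X) x = BangA T x \<bullet> munit T"
  by (simp_all add: bang_dcom_def)

lemma Bang_Obj [simp]: "X \<in> Obj C \<Longrightarrow> Bang T X \<in> Obj C"
  and BangA_typ [simp]: "f \<in> Arr C \<Longrightarrow> BangA T f \<in> Arr C" "f \<in> Arr C \<Longrightarrow> Dom C (BangA T f) = Bang T (Dom C f)"
    "f \<in> Arr C \<Longrightarrow> Cod C (BangA T f) = Bang T (Cod C f)"
  and BangA_Ident [simp]: "X \<in> Obj C \<Longrightarrow> BangA T (\<one> X) = \<one> (Bang T X)"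
  and BangA_Comp: "f \<in> Arr C \<Longrightarrow> g \<in> Arr C \<Longrightarrow> Dom C g = Cod C f \<Longrightarrow> BangA T g \<bullet> BangA T f = BangA T (g \<bullet> f)"
  using Bang_functor unfolding is_functor_def Hom_def by auto

lemma T_typ [simp]:
  assumes "X \<in> Obj C"
  shows "eps T X \<in> Arr C" "Dom C (eps T X) = Bang T X" "Cod C (eps T X) = X"
    "del T X \<in> Arr C" "Dom C (del T X) = Bang T X" "Cod C (del T X) = Bang T (Bang T X)"
    "der T X \<in> Arr C" "Dom C (der T X) = Bang T X \<otimes> X" "Cod C (der T X) = Bang T X"
    "cou T X \<in> Arr C" "Dom C (cou T X) = Bang T X" "Cod C (cou T X) = \<I>"
    "com T X \<in> Arr C" "Dom C (com T X) = Bang T X" "Cod C (com T X) = Bang T X \<otimes> Bang T X"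
  using eps_Hom[OF assms] del_Hom[OF assms] der_Hom[OF assms] cocommutative_comonoid.comonoid_simps[OF comonoid[OF assms]]
  by (auto simp: Hom_def)

lemma T_mon_typ [simp]:
  "munit T \<in> Arr C" "Dom C (munit T) = \<I>" "Cod C (munit T) = Bang T \<I>"
  "X \<in> Obj C \<Longrightarrow> Y \<in> Obj C \<Longrightarrow> mtens T X Y \<in> Arr C"
  "X \<in> Obj C \<Longrightarrow> Y \<in> Obj C \<Longrightarrow> Dom C (mtens T X Y) = Bang T X \<otimes> Bang T Y"
  "X \<in> Obj C \<Longrightarrow> Y \<in> Obj C \<Longrightarrow> Cod C (mtens T X Y) = Bang T (X \<otimes> Y)"
  using munit_Hom mtens_Hom by (auto simp: Hom_def)

lemma T_eqs:
  "f \<in> Arr C \<Longrightarrow> Y = Cod C f \<Longrightarrow> eps T Y \<bullet> BangA T f = f \<bullet> eps T (Dom C f)"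
  "f \<in> Arr C \<Longrightarrow> Y = Cod C f \<Longrightarrow> del T Y \<bullet> BangA T f = BangA T (BangA T f) \<bullet> del T (Dom C f)"
  "f \<in> Arr C \<Longrightarrow> Y = Cod C f \<Longrightarrow> cou T Y \<bullet> BangA T f = cou T (Dom C f)"
  "f \<in> Arr C \<Longrightarrow> Y = Cod C f \<Longrightarrow> com T Y \<bullet> BangA T f = (BangA T f \<boxtimes> BangA T f) \<bullet> com T (Dom C f)"
  "f \<in> Arr C \<Longrightarrow> Y = Cod C f \<Longrightarrow> der T Y \<bullet> (BangA T f \<boxtimes> f) = BangA T f \<bullet> der T (Dom C f)"
  "f \<in> Arr C \<Longrightarrow> g \<in> Arr C \<Longrightarrow> X = Cod C f \<Longrightarrow> Y = Cod C g \<Longrightarrow>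
    mtens T X Y \<bullet> (BangA T f \<boxtimes> BangA T g) = BangA T (f \<boxtimes> g) \<bullet> mtens T (Dom C f) (Dom C g)"
  using eps_natural[of f "Dom C f" "Cod C f"] del_natural[of f "Dom C f" "Cod C f"] cou_natural[of f "Dom C f" "Cod C f"]
    com_natural[of f "Dom C f" "Cod C f"] der_natural[of f "Dom C f" "Cod C f"]
    mtens_natural[of f "Dom C f" "Cod C f" g "Dom C g" "Cod C g"]
  by (auto simp: Hom_def)

lemma munit_comonoid: "cou T \<I> \<bullet> munit T = \<one> \<I>" "com T \<I> \<bullet> munit T = (munit T \<boxtimes> munit T) \<bullet> Inv (\<l> \<I>)"
  using munit_comonoid_hom by (auto simp: comonoid_hom_def unit_comonoid_def bang_comonoid_def)

lemma mtens_comonoid: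
  assumes "X \<in> Obj C" "Y \<in> Obj C"
  shows "cou T (X \<otimes> Y) \<bullet> mtens T X Y = \<l> \<I> \<bullet> (cou T X \<boxtimes> cou T Y)"
    "com T (X \<otimes> Y) \<bullet> mtens T X Y = (mtens T X Y \<boxtimes> mtens T X Y) \<bullet>
      MidSwap C (Bang T X) (Bang T X) (Bang T Y) (Bang T Y) \<bullet> (com T X \<boxtimes> com T Y)"
  using mtens_comonoid_hom[OF assms] by (auto simp: comonoid_hom_def tensor_comonoid_def bang_comonoid_def)

lemma del_comonoid:
  assumes "X \<in> Obj C"
  shows "cou T (Bang T X) \<bullet> del T X = cou T X" "com T (Bang T X) \<bullet> del T X = (del T X \<boxtimes> del T X) \<bullet> com T X"
  using del_comonoid_hom[OF assms] by (auto simp: comonoid_hom_def bang_comonoid_def)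

lemma coalgebra_homs:
  assumes "X \<in> Obj C"
  shows "munit T \<bullet> cou T X = BangA T (cou T X) \<bullet> del T X"
    "mtens T (Bang T X) (Bang T X) \<bullet> (del T X \<boxtimes> del T X) \<bullet> com T X = BangA T (com T X) \<bullet> del T X"
  using cou_coalgebra_hom[OF assms] com_coalgebra_hom[OF assms] assms by (auto simp: bang_coalgebra_hom_def)

text \<open>The points are group-like because \<open>m\<^sub>I\<close> and \<open>T x\<close> are comonoid maps.\<close>

lemma bang_diff_comonoid:
  assumes [simp]: "X \<in> Obj C"
  shows "diff_comonoid C (bang_dcom X)"
proof (intro diff_comonoid.intro diff_comonoid_axioms.intro linear_symmetric_monoidal_category_axioms)
  show "cocommutative_comonoid C (Car (bang_dcom X)) (Cou (bang_dcom X)) (Cmu (bang_dcom X))" using comonoid[OF assms] by simp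
  show "commuting_action C (Bas (bang_dcom X)) (Car (bang_dcom X)) (Dif (bang_dcom X))"
    using interchange_rule[OF assms] by (simp add: commuting_action_def Hom_def)
  show "Cou (bang_dcom X) \<bullet> Dif (bang_dcom X) = \<zero> (Car (bang_dcom X) \<otimes> Bas (bang_dcom X)) \<I>" using constant_rule[OF assms] by simp
  show "Cmu (bang_dcom X) \<bullet> Dif (bang_dcom X) = tens_act (Car (bang_dcom X)) (Dif (bang_dcom X)) (Car (bang_dcom X)) (Dif (bang_dcom X)) (Bas (bang_dcom X)) \<bullet>
      (Cmu (bang_dcom X) \<boxtimes> \<one> (Bas (bang_dcom X)))"
    using product_rule[OF assms] by (simp add: tens_act_def RSwap_def Comp_Add')
  show "Lin (bang_dcom X) \<bullet> Dif (bang_dcom X) = \<l> (Bas (bang_dcom X)) \<bullet> (Cou (bang_dcom X) \<boxtimes> \<one> (Bas (bang_dcom X)))" using linear_rule[OF assms] by simp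
  fix x assume "x \<in> hom \<I> (Bas (bang_dcom X))"
  then have [simp]: "x \<in> Arr C" "Dom C x = \<I>" "Cod C x = X" by (auto simp: Hom_def)
  show "Pnt (bang_dcom X) x \<in> hom \<I> (Car (bang_dcom X))" by (simp add: Hom_def)
  show "Cou (bang_dcom X) \<bullet> Pnt (bang_dcom X) x = \<one> \<I>"
    using Comp_left[OF T_eqs(3)[of x X], of "munit T"] by (simp add: munit_comonoid)
  show "Cmu (bang_dcom X) \<bullet> Pnt (bang_dcom X) x = (Pnt (bang_dcom X) x \<boxtimes> Pnt (bang_dcom X) x) \<bullet> Inv (\<l> \<I>)"
    using Comp_left[OF T_eqs(4)[of x X], of "munit T"] by (simp add: munit_comonoid TensA_Comp_left)
  show "Lin (bang_dcom X) \<bullet> Pnt (bang_dcom X) x = x"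
    using Comp_left[OF T_eqs(1)[of x X], of "munit T"] by (simp add: eps_munit)
qed (simp_all add: Hom_def)

lemma BangA_smooth:
  assumes [simp]: "f \<in> Arr C" "Dom C f = X" "Cod C f = Y"
  shows "smooth (bang_dcom X) (bang_dcom Y) (BangA T f)"
proof -
  have [simp]: "X \<in> Obj C" "Y \<in> Obj C" using Obj_Dom[of f] Obj_Cod[of f] by auto
  show ?thesis
    by (rule smooth_linear[where \<psi> = f])
      (auto simp: bang_diff_comonoid Hom_def T_eqs Comp_left[OF BangA_Comp])
qed

lemma del_smooth:
  assumes [simp]: "X \<in> Obj C"
  shows "smooth (bang_dcom X) (bang_dcom (Bang T X)) (del T X)"
proof -
  have "del T X \<bullet> BangA T x \<bullet> munit T = BangA T (eps T (Bang T X) \<bullet> del T X \<bullet> BangA T x \<bullet> munit T) \<bullet> munit T"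
    if "x \<in> hom \<I> X" for x
  proof -
    have [simp]: "x \<in> Arr C" "Dom C x = \<I>" "Cod C x = X" using that by (auto simp: Hom_def)
    have "del T X \<bullet> BangA T x \<bullet> munit T = BangA T (BangA T x) \<bullet> BangA T (munit T) \<bullet> munit T"
      using Comp_left[OF T_eqs(2)[of x X], of "munit T"] by (simp add: del_munit)
    also have "\<dots> = BangA T (BangA T x \<bullet> munit T) \<bullet> munit T" by (subst Comp_left[OF BangA_Comp]) simp_all
    finally show ?thesis using Comp_left[OF eps_del[OF assms], of "BangA T x \<bullet> munit T"] by simp
  qed
  then show ?thesis
    using del_comonoid[OF assms] chain_rule[OF assms]
    by (simp add: smooth_def ode_def ext_along_def eps_del) (simp add: Hom_def)
qed

lemma munit_smooth: "smooth unit (bang_dcom \<I>) (munit T)"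
proof -
  have [simp]: "zero_obj \<in> Obj C" using zero_obj by (simp add: terminal_object_def)
  show ?thesis
    by (simp add: smooth_def ode_def ext_along_def munit_comonoid eps_munit Hom_def)
qed

text \<open>The chain rule for \<open>m\<close> holds after precomposition with \<open>\<chi>\<close>, and \<open>\<chi>\<close> can be cancelled because it
is a split epimorphism that commutes with the differentials.\<close>

lemma smooth_factor:
  assumes S: "diff_comonoid C S" and R: "diff_comonoid C R" and R': "diff_comonoid C R'"
    and \<chi>: "smooth S R \<chi>" "Bas S = Bas R" "Lin R \<bullet> \<chi> = Lin S"
    and \<psi>: "\<psi> \<in> hom (Car R) (Car S)" "\<chi> \<bullet> \<psi> = \<one> (Car R)"
    and m: "m \<in> hom (Car R) (Car R')" "Cou R' \<bullet> m = Cou R" "Cmu R' \<bullet> m = (m \<boxtimes> m) \<bullet> Cmu R" and m\<chi>: "smooth S R' (m \<bullet> \<chi>)"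
  shows "smooth R R' m"
proof -
  interpret S: diff_comonoid C S by fact
  interpret R: diff_comonoid C R by fact
  interpret R': diff_comonoid C R' by fact
  note [simp] = smoothD(1-3)[OF \<chi>(1)]
  have [simp]: "m \<in> Arr C" "Dom C m = Car R" "Cod C m = Car R'" "\<psi> \<in> Arr C" "Dom C \<psi> = Car R" "Cod C \<psi> = Car S"
    using m \<psi> by (auto simp: Hom_def)
  let ?X = "Bas R" and ?Q = "Car R"
  have \<chi>D: "\<chi> \<bullet> Dif S = Dif R \<bullet> (\<chi> \<boxtimes> \<one> ?X)"
    using smooth_linear_conv[OF S R \<chi>(1), of "\<one> ?X"] \<chi> S.dtyp by (simp add: Hom_def)
  let ?b = "Lin R' \<bullet> m \<bullet> Dif R"
  have "(m \<bullet> Dif R) \<bullet> (\<chi> \<boxtimes> \<one> ?X) = (m \<bullet> \<chi>) \<bullet> Dif S" using S.dtyp \<chi>(2) by (simp add: \<chi>D)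
  also have "\<dots> = Dif R' \<bullet> ((m \<bullet> \<chi>) \<boxtimes> (Lin R' \<bullet> m \<bullet> \<chi> \<bullet> Dif S)) \<bullet> \<a> (Car S) (Car S) ?X \<bullet> (Cmu S \<boxtimes> \<one> ?X)"
    using smoothD(6)[OF m\<chi>] S.dtyp \<chi>(2) by (simp add: ode_def ext_along_def)
  also have "\<dots> = Dif R' \<bullet> (m \<boxtimes> ?b) \<bullet> (\<chi> \<boxtimes> \<chi> \<boxtimes> \<one> ?X) \<bullet> \<a> (Car S) (Car S) ?X \<bullet> (Cmu S \<boxtimes> \<one> ?X)"
    using S.dtyp \<chi>(2) by (simp add: \<chi>D TensA_Comp_left)
  also have "\<dots> = Dif R' \<bullet> (m \<boxtimes> ?b) \<bullet> \<a> ?Q ?Q ?X \<bullet> ((\<chi> \<boxtimes> \<chi>) \<boxtimes> \<one> ?X) \<bullet> (Cmu S \<boxtimes> \<one> ?X)"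
    using S.dtyp \<chi>(2) by (subst Comp_left[OF Assoc_nat]) simp_all
  also have "\<dots> = (Dif R' \<bullet> (m \<boxtimes> ?b) \<bullet> \<a> ?Q ?Q ?X \<bullet> (Cmu R \<boxtimes> \<one> ?X)) \<bullet> (\<chi> \<boxtimes> \<one> ?X)"
    using S.dtyp \<chi>(2) smoothD(5)[OF \<chi>(1)] by (simp add: TensA_Comp')
  finally have e: "(m \<bullet> Dif R) \<bullet> (\<chi> \<boxtimes> \<one> ?X) = (Dif R' \<bullet> (m \<boxtimes> ?b) \<bullet> \<a> ?Q ?Q ?X \<bullet> (Cmu R \<boxtimes> \<one> ?X)) \<bullet> (\<chi> \<boxtimes> \<one> ?X)" .
  \<comment> \<open>Tensoring preserves the splitting of \<open>\<chi>\<close>.\<close>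
  have cancel: "k = (k \<bullet> (\<chi> \<boxtimes> \<one> ?X)) \<bullet> (\<psi> \<boxtimes> \<one> ?X)" if "k \<in> Arr C" "Dom C k = ?Q \<otimes> ?X" for k
    using that \<psi> by (simp add: TensA_Comp')
  have "m \<bullet> Dif R = ((m \<bullet> Dif R) \<bullet> (\<chi> \<boxtimes> \<one> ?X)) \<bullet> (\<psi> \<boxtimes> \<one> ?X)" by (rule cancel) simp_all
  also have "\<dots> = Dif R' \<bullet> (m \<boxtimes> ?b) \<bullet> \<a> ?Q ?Q ?X \<bullet> (Cmu R \<boxtimes> \<one> ?X)" unfolding e by (rule cancel[symmetric]) simp_all
  finally have "ode R (Dif R') (Lin R' \<bullet> m) m" by (simp add: ode_def ext_along_def)
  moreover have "m \<bullet> Pnt R x = Pnt R' (Lin R' \<bullet> m \<bullet> Pnt R x)" if x: "x \<in> hom \<I> ?X" for x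
  proof -
    have xs: "x \<in> hom \<I> (Bas S)" using x \<chi>(2) by simp
    have [simp]: "Pnt S x \<in> Arr C" "Dom C (Pnt S x) = \<I>" "Cod C (Pnt S x) = Car S"
      using S.Pnt_Hom[OF xs] by (auto simp: Hom_def)
    have 1: "\<chi> \<bullet> Pnt S x = Pnt R x"
      using smoothD(7)[OF \<chi>(1) xs] Comp_left[OF \<chi>(3), of "Pnt S x"] S.Lin_Pnt[OF xs] by simp
    have "(m \<bullet> \<chi>) \<bullet> Pnt S x = Pnt R' (Lin R' \<bullet> (m \<bullet> \<chi>) \<bullet> Pnt S x)" by (rule smoothD(7)[OF m\<chi> xs])
    then show ?thesis by (simp add: 1)
  qed
  ultimately show ?thesis using m by (simp add: smooth_def)
qed

text \<open>Let \<open>\<chi>\<close> be the Seely map \<open>T B \<rightarrow> T X \<otimes> T Y\<close> for a biproduct \<open>B\<close> of \<open>X\<close> and \<open>Y\<close>. Its section \<open>\<psi>\<close> is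
the map of coalgebras whose linear part is that of \<open>T X \<otimes> T Y\<close>. The composite \<open>m \<circ> \<chi>\<close> is a map of coalgebras too,
hence equal to \<open>T (\<epsilon> \<circ> m \<circ> \<chi>) \<circ> \<delta>\<close>, which is a composite of smooth maps.\<close>

lemma mtens_smooth:
  assumes [simp]: "X \<in> Obj C" "Y \<in> Obj C"
  shows "smooth (bang_dcom X \<otimes>\<^sub>d bang_dcom Y) (bang_dcom (X \<otimes> Y)) (mtens T X Y)"
proof -
  obtain B p q i j where B: "is_biproduct C (Bas (bang_dcom X)) (Bas (bang_dcom Y)) B p q i j"
    and e: "bang_dcom X \<otimes>\<^sub>d bang_dcom Y = tens_dcom (bang_dcom X) (bang_dcom Y) B p q i j"
    using tens_obtain[OF bang_diff_comonoid[OF assms(1)] bang_diff_comonoid[OF assms(2)]] .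
  interpret D: dcom_pair C "bang_dcom X" "bang_dcom Y" B p q i j
    by (rule dcom_pairI) (simp_all add: bang_diff_comonoid B[simplified])
  have B': "is_biproduct C X Y B p q i j" using B by simp
  note [simp] = biproductD[OF B' assms]
  let ?TX = "Bang T X" and ?TY = "Bang T Y" and ?TB = "Bang T B" and ?L = "Lin D.T"
  let ?m = "mtens T X Y" and ?\<chi> = "(BangA T p \<boxtimes> BangA T q) \<bullet> com T B" and ?\<psi> = "BangA T ?L \<bullet> mtens T ?TX ?TY \<bullet> (del T X \<boxtimes> del T Y)"
  have L: "?L = i \<bullet> \<r> X \<bullet> (eps T X \<boxtimes> cou T Y) \<oplus> j \<bullet> \<l> Y \<bullet> (cou T X \<boxtimes> eps T Y)" by (simp add: tens_dcom_def)
  have [simp]: "?L \<in> Arr C" "Dom C ?L = ?TX \<otimes> ?TY" "Cod C ?L = B" by (simp_all add: L)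
  have \<chi>: "smooth (bang_dcom B) D.T ?\<chi>"
    unfolding e[symmetric]
    using comult_smooth[OF bang_diff_comonoid[of B]]
    by (intro smooth_comp[where R' = "bang_dcom B \<otimes>\<^sub>d bang_dcom B"])
      (simp_all add: bang_diff_comonoid tens_is_diff_comonoid tens_smooth BangA_smooth)
  have L\<chi>: "?L \<bullet> ?\<chi> = eps T B"
  proof -
    have "?L \<bullet> ?\<chi> = ((i \<bullet> \<r> X \<bullet> ((p \<bullet> eps T B) \<boxtimes> cou T B)) \<oplus> (j \<bullet> \<l> Y \<bullet> (cou T B \<boxtimes> (q \<bullet> eps T B)))) \<bullet> com T B"
      by (simp add: L Comp_Add' TensA_Comp_left T_eqs)
    also have "\<dots> = eps T B"
    proof (rule ext1[where e = "cou T B" and d = "com T B"])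
      fix K b assume [simp]: "ctxt_ok K" and v: "var K 0 ?TB (cou T B) (com T B) b"
      note [simp] = comonoid[of B]
      show "app (((i \<bullet> \<r> X \<bullet> ((p \<bullet> eps T B) \<boxtimes> cou T B)) \<oplus> (j \<bullet> \<l> Y \<bullet> (cou T B \<boxtimes> (q \<bullet> eps T B)))) \<bullet> com T B) b = app (eps T B) b"
        using v by (simp add: var_def)
    qed (simp_all add: Hom_def)
    finally show ?thesis .
  qed
  have mon: "BangA T f \<bullet> mtens T ?TX ?TY \<bullet> (del T X \<boxtimes> del T Y) = BangA T g \<bullet> mtens T A A' \<bullet> ((BangA T h \<bullet> del T X) \<boxtimes> (BangA T k \<bullet> del T Y))"
    if [simp]: "g \<in> Arr C" "Dom C g = A \<otimes> A'" "h \<in> Arr C" "Dom C h = ?TX" "Cod C h = A" "k \<in> Arr C" "Dom C k = ?TY" "Cod C k = A'"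
      and f: "f = g \<bullet> (h \<boxtimes> k)" for f g h k A A'
  proof -
    have [simp]: "A \<in> Obj C" "A' \<in> Obj C" using Obj_Cod[of h] Obj_Cod[of k] by auto
    have "BangA T f \<bullet> mtens T ?TX ?TY \<bullet> (del T X \<boxtimes> del T Y) = BangA T g \<bullet> BangA T (h \<boxtimes> k) \<bullet> mtens T ?TX ?TY \<bullet> (del T X \<boxtimes> del T Y)"
      unfolding f by (subst Comp_left[OF BangA_Comp]) simp_all
    also have "\<dots> = BangA T g \<bullet> mtens T A A' \<bullet> (BangA T h \<boxtimes> BangA T k) \<bullet> (del T X \<boxtimes> del T Y)"
      using Comp_left[OF T_eqs(6)[of h k A A'], of "del T X \<boxtimes> del T Y"] by simp
    finally show ?thesis by (simp add: TensA_Comp')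
  qed
  have p\<psi>: "BangA T p \<bullet> ?\<psi> = \<r> ?TX \<bullet> (\<one> ?TX \<boxtimes> cou T Y)"
  proof -
    have "BangA T p \<bullet> ?\<psi> = BangA T (p \<bullet> ?L) \<bullet> mtens T ?TX ?TY \<bullet> (del T X \<boxtimes> del T Y)"
      by (subst Comp_left[OF BangA_Comp]) simp_all
    also have "\<dots> = BangA T (\<r> X) \<bullet> mtens T X \<I> \<bullet> ((BangA T (eps T X) \<bullet> del T X) \<boxtimes> (BangA T (cou T Y) \<bullet> del T Y))"
      by (rule mon) (simp_all add: L Comp_Add')
    also have "\<dots> = BangA T (\<r> X) \<bullet> mtens T X \<I> \<bullet> (\<one> ?TX \<boxtimes> munit T) \<bullet> (\<one> ?TX \<boxtimes> cou T Y)"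
      by (simp add: Bang_eps_del TensA_Comp' flip: coalgebra_homs)
    also have "\<dots> = \<r> ?TX \<bullet> (\<one> ?TX \<boxtimes> cou T Y)"
      using arg_cong[OF mtens_right_unit[of X], of "\<lambda>f. f \<bullet> (\<one> ?TX \<boxtimes> cou T Y)"] by simp
    finally show ?thesis .
  qed
  have q\<psi>: "BangA T q \<bullet> ?\<psi> = \<l> ?TY \<bullet> (cou T X \<boxtimes> \<one> ?TY)"
  proof -
    have "BangA T q \<bullet> ?\<psi> = BangA T (q \<bullet> ?L) \<bullet> mtens T ?TX ?TY \<bullet> (del T X \<boxtimes> del T Y)"
      by (subst Comp_left[OF BangA_Comp]) simp_all
    also have "\<dots> = BangA T (\<l> Y) \<bullet> mtens T \<I> Y \<bullet> ((BangA T (cou T X) \<bullet> del T X) \<boxtimes> (BangA T (eps T Y) \<bullet> del T Y))"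
      by (rule mon) (simp_all add: L Comp_Add')
    also have "\<dots> = BangA T (\<l> Y) \<bullet> mtens T \<I> Y \<bullet> (munit T \<boxtimes> \<one> ?TY) \<bullet> (cou T X \<boxtimes> \<one> ?TY)"
      by (simp add: Bang_eps_del TensA_Comp' flip: coalgebra_homs)
    also have "\<dots> = \<l> ?TY \<bullet> (cou T X \<boxtimes> \<one> ?TY)"
      using arg_cong[OF mtens_left_unit[of Y], of "\<lambda>f. f \<bullet> (cou T X \<boxtimes> \<one> ?TY)"] by simp
    finally show ?thesis .
  qed
  have com\<psi>: "com T B \<bullet> ?\<psi> = (?\<psi> \<boxtimes> ?\<psi>) \<bullet> Cmu D.T"
  proof -
    have "com T B \<bullet> ?\<psi> = (BangA T ?L \<boxtimes> BangA T ?L) \<bullet> com T (?TX \<otimes> ?TY) \<bullet> mtens T ?TX ?TY \<bullet> (del T X \<boxtimes> del T Y)"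
      by (subst Comp_left[OF T_eqs(4)]) simp_all
    also have "\<dots> = (BangA T ?L \<boxtimes> BangA T ?L) \<bullet> (mtens T ?TX ?TY \<boxtimes> mtens T ?TX ?TY) \<bullet>
        MidSwap C (Bang T ?TX) (Bang T ?TX) (Bang T ?TY) (Bang T ?TY) \<bullet> (com T ?TX \<boxtimes> com T ?TY) \<bullet> (del T X \<boxtimes> del T Y)"
      by (subst Comp_left[OF mtens_comonoid(2)]) simp_all
    also have "\<dots> = (BangA T ?L \<boxtimes> BangA T ?L) \<bullet> (mtens T ?TX ?TY \<boxtimes> mtens T ?TX ?TY) \<bullet>
        MidSwap C (Bang T ?TX) (Bang T ?TX) (Bang T ?TY) (Bang T ?TY) \<bullet> ((del T X \<boxtimes> del T X) \<boxtimes> (del T Y \<boxtimes> del T Y)) \<bullet> (com T X \<boxtimes> com T Y)"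
      by (simp add: TensA_Comp' del_comonoid)
    also have "\<dots> = (BangA T ?L \<boxtimes> BangA T ?L) \<bullet> (mtens T ?TX ?TY \<boxtimes> mtens T ?TX ?TY) \<bullet>
        ((del T X \<boxtimes> del T Y) \<boxtimes> (del T X \<boxtimes> del T Y)) \<bullet> MidSwap C ?TX ?TX ?TY ?TY \<bullet> (com T X \<boxtimes> com T Y)"
      by (subst Comp_left[OF MidSwap_nat]) simp_all
    finally show ?thesis by (simp add: TensA_Comp_left)
  qed
  have \<chi>\<psi>: "?\<chi> \<bullet> ?\<psi> = \<one> (?TX \<otimes> ?TY)"
  proof -
    have "?\<chi> \<bullet> ?\<psi> = (BangA T p \<boxtimes> BangA T q) \<bullet> (com T B \<bullet> ?\<psi>)" by simp
    also have "\<dots> = ((BangA T p \<bullet> ?\<psi>) \<boxtimes> (BangA T q \<bullet> ?\<psi>)) \<bullet> Cmu D.T"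
      unfolding com\<psi> by (simp add: TensA_Comp_left)
    also have "\<dots> = ((\<r> ?TX \<bullet> (\<one> ?TX \<boxtimes> cou T Y)) \<boxtimes> (\<l> ?TY \<bullet> (cou T X \<boxtimes> \<one> ?TY))) \<bullet> Cmu D.T"
      unfolding p\<psi> q\<psi> ..
    also have "\<dots> = \<one> (?TX \<otimes> ?TY)"
    proof (rule ext2[where e = "cou T X" and d = "com T X" and e' = "cou T Y" and d' = "com T Y"])
      fix K a b assume [simp]: "ctxt_ok K" and v: "var K 0 ?TX (cou T X) (com T X) a" "var K 1 ?TY (cou T Y) (com T Y) b"
      note [simp] = comonoid[of X] comonoid[of Y]
      show "app (((\<r> ?TX \<bullet> (\<one> ?TX \<boxtimes> cou T Y)) \<boxtimes> (\<l> ?TY \<bullet> (cou T X \<boxtimes> \<one> ?TY))) \<bullet> Cmu D.T) (a \<otimes>\<otimes> b) = app (\<one> (?TX \<otimes> ?TY)) (a \<otimes>\<otimes> b)"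
        using v by (simp add: var_def)
    qed (simp_all add: Hom_def)
    finally show ?thesis .
  qed
  have m\<chi>: "smooth (bang_dcom B) (bang_dcom (X \<otimes> Y)) (?m \<bullet> ?\<chi>)"
  proof -
    \<comment> \<open>Comultiplication is a map of coalgebras, and so is \<open>m\<close> by monoidality of \<open>\<delta>\<close>.\<close>
    have "del T (X \<otimes> Y) \<bullet> ?m \<bullet> ?\<chi> = BangA T ?m \<bullet> mtens T ?TX ?TY \<bullet> (del T X \<boxtimes> del T Y) \<bullet> (BangA T p \<boxtimes> BangA T q) \<bullet> com T B"
      using Comp_left[OF del_mtens[OF assms], of ?\<chi>] by simp
    also have "\<dots> = BangA T ?m \<bullet> mtens T ?TX ?TY \<bullet> (BangA T (BangA T p) \<boxtimes> BangA T (BangA T q)) \<bullet> (del T B \<boxtimes> del T B) \<bullet> com T B"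
      by (simp add: TensA_Comp_left T_eqs)
    also have "\<dots> = BangA T ?m \<bullet> BangA T (BangA T p \<boxtimes> BangA T q) \<bullet> mtens T ?TB ?TB \<bullet> (del T B \<boxtimes> del T B) \<bullet> com T B"
      by (subst Comp_left[OF T_eqs(6)]) simp_all
    also have "\<dots> = BangA T ?m \<bullet> BangA T (BangA T p \<boxtimes> BangA T q) \<bullet> BangA T (com T B) \<bullet> del T B"
      by (simp add: coalgebra_homs)
    also have "\<dots> = BangA T (?m \<bullet> ?\<chi>) \<bullet> del T B"
      by (simp add: Comp_left[OF BangA_Comp] BangA_Comp)
    finally have co: "del T (X \<otimes> Y) \<bullet> ?m \<bullet> ?\<chi> = BangA T (?m \<bullet> ?\<chi>) \<bullet> del T B" .
    have "?m \<bullet> ?\<chi> = BangA T (eps T (X \<otimes> Y)) \<bullet> del T (X \<otimes> Y) \<bullet> ?m \<bullet> ?\<chi>"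
      by (subst Comp_left[OF Bang_eps_del]) simp_all
    also have "\<dots> = BangA T (eps T (X \<otimes> Y) \<bullet> ?m \<bullet> ?\<chi>) \<bullet> del T B"
      unfolding co by (subst Comp_left[OF BangA_Comp]) simp_all
    finally have eq: "?m \<bullet> ?\<chi> = BangA T (eps T (X \<otimes> Y) \<bullet> ?m \<bullet> ?\<chi>) \<bullet> del T B" .
    show ?thesis
      by (subst eq, rule smooth_comp[where R' = "bang_dcom ?TB"]) (simp_all add: bang_diff_comonoid del_smooth BangA_smooth)
  qed
  show ?thesis unfolding e
    by (rule smooth_factor[OF bang_diff_comonoid[of B] D.tens_diff_comonoid bang_diff_comonoid[of "X \<otimes> Y"] \<chi> _ _ _ _ _ _ _ m\<chi>, where \<psi> = ?\<psi>])
      (use L\<chi> \<chi>\<psi> mtens_comonoid[OF assms] in \<open>simp_all add: Hom_def\<close>)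
qed

end

context free_family
begin

text \<open>The components are the smooth maps with linear part \<open>\<epsilon>\<close>. They are the only ones: a morphism is an action map,
and its value at the group-like element of a point \<open>x\<close> is forced, since that element is \<open>P x \<circ> m\<^sub>I\<close>.\<close>

lemma P_initial: "initial_object (modality_category C) P"
proof -
  have "\<exists>!f. f \<in> Hom (modality_category C) P T" if T: "monoidal_differential_modality C T" for T
  proof -
    interpret T: modality_over_biproducts C T by (intro modality_over_biproducts.intro T bip_linear_axioms)
    define \<phi> where "\<phi> = (\<lambda>X\<in>Obj C. lift (R X) (T.bang_dcom X) (Lin (R X)))"
    have \<phi>: "smooth (R X) (T.bang_dcom X) (\<phi> X)" "eps T X \<bullet> \<phi> X = Lin (R X)" if "X \<in> Obj C" for X
      using lift[of "R X" "T.bang_dcom X" "Lin (R X)"] that by (simp_all add: \<phi>_def R_free T.bang_diff_comonoid Hom_def)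
    have [simp]: "\<phi> X \<in> Arr C" "Dom C (\<phi> X) = Car (R X)" "Cod C (\<phi> X) = Bang T X" if "X \<in> Obj C" for X
      using smoothD(1-3)[OF \<phi>(1)[OF that]] by auto
    have \<phi>_left: "eps T X \<bullet> \<phi> X \<bullet> k = Lin (R X) \<bullet> k" if "X \<in> Obj C" "k \<in> Arr C" "Cod C k = Car (R X)" for X k
      using Comp_left[OF \<phi>(2), of X k] that by simp
    note [simp] = R_diff_comonoid T.bang_diff_comonoid R_free BangA_smooth T.BangA_smooth T.del_smooth T.munit_smooth T.mtens_smooth del(1) munit(1) mtens(1) tens_is_diff_comonoid tens_is_free unit_is_free unit_is_diff_comonoid \<phi>
    note Ls = Lin_simps \<phi>_left T.T_eqs T.eps_munit T.eps_mtens T.eps_del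
    have nat: "\<phi> Y \<bullet> BangA P f = BangA T f \<bullet> \<phi> X" if "f \<in> hom X Y" for f X Y
    proof -
      have [simp]: "f \<in> Arr C" "Dom C f = X" "Cod C f = Y" using that by (auto simp: Hom_def)
      have [simp]: "X \<in> Obj C" "Y \<in> Obj C" using Obj_Dom[of f] Obj_Cod[of f] by auto
      show ?thesis
      proof (rule smooth_unique)
        show "smooth (R X) (T.bang_dcom Y) (\<phi> Y \<bullet> BangA P f)" by (rule smooth_comp[where R' = "R Y"]) simp_all
        show "smooth (R X) (T.bang_dcom Y) (BangA T f \<bullet> \<phi> X)" by (rule smooth_comp[where R' = "T.bang_dcom X"]) simp_all
      qed (simp_all add: Ls Comp_left[OF T.T_eqs(1)])
    qed
    have del': "del T X \<bullet> \<phi> X = BangA T (\<phi> X) \<bullet> \<phi> (Car (R X)) \<bullet> del P X" if [simp]: "X \<in> Obj C" for X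
    proof (rule smooth_unique)
      let ?Q = "Car (R X)"
      show "smooth (R X) (T.bang_dcom (Bang T X)) (del T X \<bullet> \<phi> X)" by (rule smooth_comp[where R' = "T.bang_dcom X"]) simp_all
      have "smooth (R X) (T.bang_dcom ?Q) (\<phi> ?Q \<bullet> del P X)" by (rule smooth_comp[where R' = "R ?Q"]) simp_all
      then show "smooth (R X) (T.bang_dcom (Bang T X)) (BangA T (\<phi> X) \<bullet> \<phi> ?Q \<bullet> del P X)"
        by (intro smooth_comp[where R' = "T.bang_dcom ?Q" and h = "\<phi> ?Q \<bullet> del P X"]) simp_all
    qed (simp_all add: Ls Comp_left[OF T.T_eqs(1)] Comp_left[OF T.eps_del])
    have munit': "\<phi> \<I> \<bullet> munit P = munit T"
    proof (rule smooth_unique)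
      show "smooth unit (T.bang_dcom \<I>) (\<phi> \<I> \<bullet> munit P)" by (rule smooth_comp[where R' = "R \<I>"]) simp_all
      show "smooth unit (T.bang_dcom \<I>) (munit T)" by simp
    qed (simp_all add: Ls)
    have mtens': "\<phi> (X \<otimes> Y) \<bullet> mtens P X Y = mtens T X Y \<bullet> (\<phi> X \<boxtimes> \<phi> Y)" if [simp]: "X \<in> Obj C" "Y \<in> Obj C" for X Y
    proof (rule smooth_unique)
      show "smooth (R X \<otimes>\<^sub>d R Y) (T.bang_dcom (X \<otimes> Y)) (\<phi> (X \<otimes> Y) \<bullet> mtens P X Y)" by (rule smooth_comp[where R' = "R (X \<otimes> Y)"]) simp_all
      show "smooth (R X \<otimes>\<^sub>d R Y) (T.bang_dcom (X \<otimes> Y)) (mtens T X Y \<bullet> (\<phi> X \<boxtimes> \<phi> Y))"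
        by (rule smooth_comp[where R' = "T.bang_dcom X \<otimes>\<^sub>d T.bang_dcom Y"]) (simp_all add: tens_smooth)
    qed (simp_all add: Ls Comp_left[OF T.eps_mtens] TensA_Comp')
    have mor: "modality_morphism C P T \<phi>"
      unfolding modality_morphism_def
    proof (intro conjI ballI allI)
      show "\<phi> X \<in> Hom C (Bang P X) (Bang T X)" if "X \<in> Obj C" for X using that by (simp add: Hom_def)
      show "\<phi> Y \<bullet> BangA P f = BangA T f \<bullet> \<phi> X" if "f \<in> Hom C X Y" for f X Y using nat[OF that] .
      show "eps T X \<bullet> \<phi> X = eps P X" if "X \<in> Obj C" for X using that by simp
      show "del T X \<bullet> \<phi> X = BangA T (\<phi> X) \<bullet> \<phi> (Bang P X) \<bullet> del P X" if "X \<in> Obj C" for X using del'[OF that] by simp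
      show "\<phi> \<I> \<bullet> munit P = munit T" by (rule munit')
      show "\<phi> (X \<otimes> Y) \<bullet> mtens P X Y = mtens T X Y \<bullet> (\<phi> X \<boxtimes> \<phi> Y)" if "X \<in> Obj C" "Y \<in> Obj C" for X Y using mtens'[OF that] .
      show "comonoid_hom C (bang_comonoid P X) (bang_comonoid T X) (\<phi> X)" if "X \<in> Obj C" for X
        using that smoothD(4,5)[OF \<phi>(1)[OF that]] by (simp add: comonoid_hom_def bang_comonoid_def Hom_def)
      show "\<phi> X \<bullet> der P X = der T X \<bullet> (\<phi> X \<boxtimes> \<one> X)" if [simp]: "X \<in> Obj C" for X
        using smooth_linear_conv[OF R_diff_comonoid[of X] T.bang_diff_comonoid[of X] \<phi>(1), of "\<one> X"] by (simp add: Hom_def)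
    qed
    have pts: "Pnt (R X) x = BangA P x \<bullet> munit P" if x: "x \<in> hom \<I> X" for x X
    proof -
      have [simp]: "x \<in> Arr C" "Dom C x = \<I>" "Cod C x = X" using x by (auto simp: Hom_def)
      have [simp]: "X \<in> Obj C" using Obj_Cod[of x] by simp
      interpret RI: diff_comonoid C "R \<I>" by simp
      have o: "\<one> \<I> \<in> hom \<I> (Bas (R \<I>))" by (simp add: Hom_def)
      have [simp]: "Pnt (R \<I>) (\<one> \<I>) \<in> Arr C" "Dom C (Pnt (R \<I>) (\<one> \<I>)) = \<I>" "Cod C (Pnt (R \<I>) (\<one> \<I>)) = Car (R \<I>)"
        using RI.Pnt_Hom[OF o] by (auto simp: Hom_def)
      have z: "\<zero> \<I> zero_obj \<in> hom \<I> (Bas unit)" using zero_obj by (simp add: Hom_def terminal_object_def)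
      have m: "munit P = Pnt (R \<I>) (\<one> \<I>)" using smoothD(7)[OF munit(1) z] by (simp add: Lin_simps)
      have "BangA P x \<bullet> Pnt (R \<I>) (\<one> \<I>) = Pnt (R X) (Lin (R X) \<bullet> BangA P x \<bullet> Pnt (R \<I>) (\<one> \<I>))"
        by (rule smoothD(7)[OF BangA_smooth]) (simp_all add: Hom_def)
      also have "Lin (R X) \<bullet> BangA P x \<bullet> Pnt (R \<I>) (\<one> \<I>) = x"
        using RI.Lin_Pnt[OF o] by (simp add: Lin_simps)
      finally show ?thesis unfolding m by simp
    qed
    have unique: "\<psi> X = \<phi> X" if \<psi>: "modality_morphism C P T \<psi>" and [simp]: "X \<in> Obj C" for \<psi> X
    proof -
      have \<psi>_typ [simp]: "\<psi> Y \<in> Arr C" "Dom C (\<psi> Y) = Car (R Y)" "Cod C (\<psi> Y) = Bang T Y" if "Y \<in> Obj C" for Y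
        using \<psi> that by (auto simp: modality_morphism_def Hom_def)
      have p: "\<theta> X \<bullet> Pnt (R X) x = BangA T x \<bullet> munit T" if \<theta>: "modality_morphism C P T \<theta>" and x: "x \<in> hom \<I> X" for \<theta> x
      proof -
        have [simp]: "\<theta> Y \<in> Arr C" "Dom C (\<theta> Y) = Car (R Y)" "Cod C (\<theta> Y) = Bang T Y" if "Y \<in> Obj C" for Y
          using \<theta> that by (auto simp: modality_morphism_def Hom_def)
        have [simp]: "x \<in> Arr C" "Dom C x = \<I>" "Cod C x = X" using x by (auto simp: Hom_def)
        have 1: "\<theta> X \<bullet> BangA P x = BangA T x \<bullet> \<theta> \<I>" "\<theta> \<I> \<bullet> munit P = munit T"
          using \<theta> x unfolding modality_morphism_def by blast+
        show ?thesis using Comp_left[OF 1(1), of "munit P"] by (simp add: pts[OF x] 1(2))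
      qed
      have act: "act_hom X (Car (R X)) (Dif (R X)) (Bang T X) (der T X) (\<theta> X)" if \<theta>: "modality_morphism C P T \<theta>" for \<theta>
        using \<theta> \<open>X \<in> Obj C\<close> unfolding modality_morphism_def act_hom_def by auto
      have "free_action X (Car (R X)) (Dif (R X)) (Pnt (R X))"
        using free_diff_comonoid.free[OF R_free[of X]] by simp
      moreover have "commuting_action C X (Bang T X) (der T X)"
        using diff_comonoid.commuting[OF T.bang_diff_comonoid[of X]] by simp
      ultimately show ?thesis
        using free_action_unparametrised(2)[of X "Car (R X)" "Dif (R X)" "Pnt (R X)" "Bang T X" "der T X" "\<psi> X" "\<phi> X"]
          act[OF \<psi>] act[OF mor] p[OF \<psi>] p[OF mor] by simp
    qed
    show ?thesis
    proof (rule ex1I)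
      show "(P, \<phi>, T) \<in> Hom (modality_category C) P T"
        using mor T P_modality by (auto simp: modality_category_def Hom_def \<phi>_def)
      fix f assume "f \<in> Hom (modality_category C) P T"
      then obtain \<psi> where f: "f = (P, \<psi>, T)" and \<psi>: "modality_morphism C P T \<psi>" "\<psi> \<in> extensional (Obj C)"
        by (auto simp: modality_category_def Hom_def)
      have "\<psi> = \<phi>"
        by (rule extensionalityI[OF \<psi>(2)]) (use unique[OF \<psi>(1)] in \<open>auto simp: \<phi>_def\<close>)
      then show "f = (P, \<phi>, T)" using f by simp
    qed
  qed
  then show ?thesis using P_modality by (simp add: initial_object_def modality_category_def)
qed

end


section \<open>The free action on the points of an object\<close>

lemma is_coproduct_reindex:
  assumes h: "bij_betw h J' J" and c: "is_coproduct C J (\<lambda>_. A) B \<iota>"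
  shows "is_coproduct C J' (\<lambda>_. A) B (\<lambda>j. \<iota> (h j))"
  unfolding is_coproduct_def
proof (intro conjI ballI allI impI)
  note c' = c[unfolded is_coproduct_def]
  show "B \<in> Obj C" using c' by blast
  show "\<iota> (h j) \<in> Hom C A B" if "j \<in> J'" for j using c' bij_betwE[OF h] that by blast
  fix Y f assume Y: "Y \<in> Obj C" and f: "\<forall>j\<in>J'. f j \<in> Hom C A Y"
  let ?f = "\<lambda>j. f (the_inv_into J' h j)"
  have inv: "the_inv_into J' h (h j) = j" if "j \<in> J'" for j
    using h that by (simp add: bij_betw_def the_inv_into_f_f)
  have "\<forall>j\<in>J. ?f j \<in> Hom C A Y"
    using f bij_betw_apply[OF bij_betw_the_inv_into[OF h]] by simp
  then have "\<exists>!k. k \<in> Hom C B Y \<and> (\<forall>j\<in>J. Comp C k (\<iota> j) = ?f j)"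
    using c'[THEN conjunct2, THEN conjunct2, THEN bspec, OF Y, THEN spec, of ?f] by simp
  moreover have "(\<forall>j\<in>J. Comp C k (\<iota> j) = ?f j) \<longleftrightarrow> (\<forall>j\<in>J'. Comp C k (\<iota> (h j)) = f j)" for k
    using bij_betw_imp_surj_on[OF h] inv by auto
  ultimately show "\<exists>!k. k \<in> Hom C B Y \<and> (\<forall>j\<in>J'. Comp C k (\<iota> (h j)) = f j)" by simp
qed

context linear_symmetric_monoidal_category
begin

lemma is_coproduct_iso:
  assumes c: "is_coproduct C J (\<lambda>_. A) B \<iota>" and i: "iso i" "i \<in> hom A' A" and A: "A \<in> Obj C"
  shows "is_coproduct C J (\<lambda>_. A') B (\<lambda>j. \<iota> j \<bullet> i)"
  unfolding is_coproduct_def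
proof (intro conjI ballI allI impI)
  note c' = c[unfolded is_coproduct_def]
  have [simp]: "iso i" "i \<in> Arr C" "Dom C i = A'" "Cod C i = A" using i by (auto simp: Hom_def)
  have \<iota>: "\<iota> j \<in> Arr C" "Dom C (\<iota> j) = A" "Cod C (\<iota> j) = B" if "j \<in> J" for j
    using c' that by (auto simp: Hom_def)
  show B: "B \<in> Obj C" using c' by blast
  show "\<iota> j \<bullet> i \<in> hom A' B" if "j \<in> J" for j using \<iota>[OF that] by (simp add: Hom_def)
  fix Y f assume Y: "Y \<in> Obj C" and f: "\<forall>j\<in>J. f j \<in> Hom C A' Y"
  have f': "f j \<in> Arr C" "Dom C (f j) = A'" "Cod C (f j) = Y" if "j \<in> J" for j
    using f that by (auto simp: Hom_def)
  have "\<forall>j\<in>J. f j \<bullet> Inv i \<in> hom A Y" using f' by (simp add: Hom_def)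
  then have "\<exists>!k. k \<in> hom B Y \<and> (\<forall>j\<in>J. k \<bullet> \<iota> j = f j \<bullet> Inv i)"
    using c'[THEN conjunct2, THEN conjunct2, THEN bspec, OF Y, THEN spec, of "\<lambda>j. f j \<bullet> Inv i"] by simp
  moreover have "k \<bullet> \<iota> j = f j \<bullet> Inv i \<longleftrightarrow> k \<bullet> \<iota> j \<bullet> i = f j" if "k \<in> hom B Y" "j \<in> J" for k j
  proof -
    have [simp]: "k \<in> Arr C" "Dom C k = B" "Cod C k = Y" using that by (auto simp: Hom_def)
    note [simp] = \<iota>[OF that(2)] f'[OF that(2)]
    show ?thesis
    proof
      assume "k \<bullet> \<iota> j = f j \<bullet> Inv i"
      then have "(k \<bullet> \<iota> j) \<bullet> i = (f j \<bullet> Inv i) \<bullet> i" by simp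
      then show "k \<bullet> \<iota> j \<bullet> i = f j" by simp
    next
      assume "k \<bullet> \<iota> j \<bullet> i = f j"
      then have "(k \<bullet> \<iota> j \<bullet> i) \<bullet> Inv i = f j \<bullet> Inv i" by simp
      then show "k \<bullet> \<iota> j = f j \<bullet> Inv i" by simp
    qed
  qed
  ultimately show "\<exists>!k. k \<in> hom B Y \<and> (\<forall>j\<in>J. k \<bullet> \<iota> j \<bullet> i = f j)" by (metis (no_types, lifting))
qed

end

locale algebraically_free = linear_symmetric_monoidal_category C
  for C :: "('o, 'm, 'k::{comm_semiring_0,comm_monoid_mult}, 'z) linsmcat_scheme" (structure) +
  fixes X M :: 'o and u n \<eta> :: 'm
  assumes X_Obj [simp]: "X \<in> Obj C"
    and monoid: "commutative_monoid C M u n" and \<eta>_Hom: "\<eta> \<in> hom X M"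
    and equivalence: "is_iso_of_categories (Mod C M u n) (CAct C X) (restrict_action C \<eta>)
      (\<lambda>(a, f, b). (restrict_action C \<eta> a, f, restrict_action C \<eta> b))"
begin

lemma monoid_typ [simp]: "M \<in> Obj C" "u \<in> Arr C" "Dom C u = \<I>" "Cod C u = M" "n \<in> Arr C" "Dom C n = M \<otimes> M"
  "Cod C n = M" "\<eta> \<in> Arr C" "Dom C \<eta> = X" "Cod C \<eta> = M"
  using commutative_monoid.carrier[OF monoid] commutative_monoid.unit_Hom[OF monoid]
    commutative_monoid.mult_Hom[OF monoid] \<eta>_Hom by (auto simp: Hom_def)

text \<open>The action of the free module \<open>V \<otimes> M\<close>.\<close>

abbreviation extend :: "'o \<Rightarrow> 'm" where "extend V \<equiv> (\<one> V \<boxtimes> n) \<bullet> \<a> V M M"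

abbreviation mult_gen :: 'm where "mult_gen \<equiv> n \<bullet> (\<one> M \<boxtimes> \<eta>)"

lemma extend_module:
  assumes [simp]: "V \<in> Obj C"
  shows "right_module C M u n (V \<otimes> M) (extend V)"
  unfolding right_module_def
proof (intro conjI)
  have "(extend V \<bullet> (\<one> (V \<otimes> M) \<boxtimes> u)) \<bullet> Inv (\<r> (V \<otimes> M)) = \<r> (V \<otimes> M) \<bullet> Inv (\<r> (V \<otimes> M))"
  proof (rule ext2)
    fix K v m assume [simp]: "ctxt_ok K" and v: "var K 0 V e d v" "var K 1 M e' d' m"
    show "app ((extend V \<bullet> (\<one> (V \<otimes> M) \<boxtimes> u)) \<bullet> Inv (\<r> (V \<otimes> M))) (v \<otimes>\<otimes> m)
        = app (\<r> (V \<otimes> M) \<bullet> Inv (\<r> (V \<otimes> M))) (v \<otimes>\<otimes> m)"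
      using v app_eq[OF commutative_monoid.right_unit[OF monoid], of "m \<otimes>\<otimes> star K"] by (simp add: var_def)
  qed (simp_all add: Hom_def)
  then show "extend V \<bullet> (\<one> (V \<otimes> M) \<boxtimes> u) = \<r> (V \<otimes> M)"
    by (rule iso_epi[rotated -1]) simp_all
  show "extend V \<bullet> (extend V \<boxtimes> \<one> M) = extend V \<bullet> (\<one> (V \<otimes> M) \<boxtimes> n) \<bullet> \<a> (V \<otimes> M) M M"
  proof (rule ext4[where Y = M and W = M and V = M])
    fix K v m m' m'' assume [simp]: "ctxt_ok K"
      and v: "var K 0 V e d v" "var K 1 M e' d' m" "var K 2 M e'' d'' m'" "var K 3 M e3 d3 m''"
    show "app (extend V \<bullet> (extend V \<boxtimes> \<one> M)) (((v \<otimes>\<otimes> m) \<otimes>\<otimes> m') \<otimes>\<otimes> m'')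
        = app (extend V \<bullet> (\<one> (V \<otimes> M) \<boxtimes> n) \<bullet> \<a> (V \<otimes> M) M M) (((v \<otimes>\<otimes> m) \<otimes>\<otimes> m') \<otimes>\<otimes> m'')"
      using v app_eq[OF commutative_monoid.assoc[OF monoid], of "(m \<otimes>\<otimes> m') \<otimes>\<otimes> m''"] by (simp add: var_def)
  qed (simp_all add: Hom_def)
qed (simp_all add: Hom_def)

lemma extend_gen:
  assumes [simp]: "V \<in> Obj C"
  shows "extend V \<bullet> (\<one> (V \<otimes> M) \<boxtimes> \<eta>) = (\<one> V \<boxtimes> mult_gen) \<bullet> \<a> V M X"
proof (rule ext3[where Y = M and W = X])
  fix K v m x assume [simp]: "ctxt_ok K" and v: "var K 0 V e d v" "var K 1 M e' d' m" "var K 2 X e'' d'' x"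
  show "app (extend V \<bullet> (\<one> (V \<otimes> M) \<boxtimes> \<eta>)) ((v \<otimes>\<otimes> m) \<otimes>\<otimes> x) = app ((\<one> V \<boxtimes> mult_gen) \<bullet> \<a> V M X) ((v \<otimes>\<otimes> m) \<otimes>\<otimes> x)"
    using v by (simp add: var_def)
qed (simp_all add: Hom_def)

lemma extend_unit:
  assumes [simp]: "V \<in> Obj C"
  shows "extend V \<bullet> (((\<one> V \<boxtimes> u) \<bullet> Inv (\<r> V)) \<boxtimes> \<one> M) = \<one> (V \<otimes> M)"
proof (rule ext2)
  fix K v m assume [simp]: "ctxt_ok K" and v: "var K 0 V e d v" "var K 1 M e' d' m"
  show "app (extend V \<bullet> (((\<one> V \<boxtimes> u) \<bullet> Inv (\<r> V)) \<boxtimes> \<one> M)) (v \<otimes>\<otimes> m) = app (\<one> (V \<otimes> M)) (v \<otimes>\<otimes> m)"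
    using v app_eq[OF commutative_monoid.left_unit[OF monoid], of "star K \<otimes>\<otimes> m"] by (simp add: var_def)
qed (simp_all add: Hom_def)

lemma restrict_commuting:
  assumes "right_module C M u n A \<rho>"
  shows "commuting_action C X A (\<rho> \<bullet> (\<one> A \<boxtimes> \<eta>))"
proof -
  have "restrict_action C \<eta> (A, \<rho>) \<in> Obj (CAct C X)"
    using equivalence assms unfolding is_iso_of_categories_def is_functor_def by (auto simp: Mod_def action_category_def)
  then show ?thesis by (simp add: CAct_def action_category_def restrict_action_def)
qed

lemma extend_commuting:
  assumes "V \<in> Obj C"
  shows "commuting_action C X (V \<otimes> M) ((\<one> V \<boxtimes> mult_gen) \<bullet> \<a> V M X)"
  using restrict_commuting[OF extend_module[OF assms]] extend_gen[OF assms] by simp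

text \<open>Fullness of the functor: an action map into \<open>A\<close> out of a restricted module is a map of modules.\<close>

lemma act_hom_module_hom:
  assumes \<alpha>: "commuting_action C X A \<alpha>"
  obtains \<rho> where "right_module C M u n A \<rho>" "\<rho> \<bullet> (\<one> A \<boxtimes> \<eta>) = \<alpha>"
    "\<And>V \<sigma> F. right_module C M u n V \<sigma> \<Longrightarrow> act_hom X V (\<sigma> \<bullet> (\<one> V \<boxtimes> \<eta>)) A \<alpha> F \<Longrightarrow> F \<bullet> \<sigma> = \<rho> \<bullet> (F \<boxtimes> \<one> M)"
proof -
  let ?FO = "restrict_action C \<eta>" let ?FA = "\<lambda>(a, f, b). (?FO a, f, ?FO b)"
  obtain GO GA where G: "is_functor (CAct C X) (Mod C M u n) GO GA"
    and GF: "\<And>a. a \<in> Obj (Mod C M u n) \<Longrightarrow> GO (?FO a) = a"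
    and FG: "\<And>a. a \<in> Obj (CAct C X) \<Longrightarrow> ?FO (GO a) = a" "\<And>f. f \<in> Arr (CAct C X) \<Longrightarrow> ?FA (GA f) = f"
    using equivalence unfolding is_iso_of_categories_def by blast
  have A: "(A, \<alpha>) \<in> Obj (CAct C X)" using \<alpha> by (simp add: CAct_def action_category_def)
  obtain A' \<rho> where \<rho>: "GO (A, \<alpha>) = (A', \<rho>)" by force
  have [simp]: "A' = A" and \<rho>\<alpha>: "\<rho> \<bullet> (\<one> A \<boxtimes> \<eta>) = \<alpha>" using FG(1)[OF A] \<rho> by (auto simp: restrict_action_def)
  have "(A, \<rho>) \<in> Obj (Mod C M u n)" using G A \<rho> unfolding is_functor_def by fastforce
  then have mod: "right_module C M u n A \<rho>" by (simp add: Mod_def action_category_def)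
  have "F \<bullet> \<sigma> = \<rho> \<bullet> (F \<boxtimes> \<one> M)"
    if \<sigma>: "right_module C M u n V \<sigma>" and F: "act_hom X V (\<sigma> \<bullet> (\<one> V \<boxtimes> \<eta>)) A \<alpha> F" for V \<sigma> F
  proof -
    let ?f = "(?FO (V, \<sigma>), F, (A, \<alpha>))"
    have f: "?f \<in> Hom (CAct C X) (?FO (V, \<sigma>)) (A, \<alpha>)"
      using restrict_commuting[OF \<sigma>] \<alpha> F by (auto simp: CAct_def action_category_def restrict_action_def Hom_def act_hom_def)
    have g: "GA ?f \<in> Hom (Mod C M u n) (GO (?FO (V, \<sigma>))) (A, \<rho>)"
      using G[unfolded is_functor_def, THEN conjunct2, THEN conjunct1, THEN spec, THEN spec, THEN bspec, OF f] \<rho> by simp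
    have "GO (?FO (V, \<sigma>)) = (V, \<sigma>)" using \<sigma> by (intro GF) (simp add: Mod_def action_category_def)
    moreover have "?FA (GA ?f) = ?f" using f by (intro FG) (simp add: Hom_def)
    ultimately have "(V, \<sigma>) = fst (GA ?f)" "F = fst (snd (GA ?f))" "(A, \<rho>) = snd (snd (GA ?f))" "GA ?f \<in> Arr (Mod C M u n)"
      using g by (auto simp: Hom_def Mod_def action_category_def)
    then have "((V, \<sigma>), F, (A, \<rho>)) \<in> Arr (Mod C M u n)" by (metis prod.collapse)
    then show ?thesis by (simp add: Mod_def action_category_def)
  qed
  then show thesis using that mod \<rho>\<alpha> by blast
qed

text \<open>By the previous lemma an action map out of \<open>V \<otimes> M\<close> is a map of modules, so it is determined by its
restriction along \<open>v \<mapsto> v \<otimes> 1\<close>.\<close>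

lemma extend_universal:
  assumes [simp]: "V \<in> Obj C" and \<alpha>: "commuting_action C X A \<alpha>" and g: "g \<in> hom V A"
  shows "\<exists>!F. act_hom X (V \<otimes> M) ((\<one> V \<boxtimes> mult_gen) \<bullet> \<a> V M X) A \<alpha> F \<and> F \<bullet> (\<one> V \<boxtimes> u) \<bullet> Inv (\<r> V) = g"
proof -
  obtain \<rho> where \<rho>: "right_module C M u n A \<rho>" "\<rho> \<bullet> (\<one> A \<boxtimes> \<eta>) = \<alpha>"
    and hom: "\<And>V \<sigma> F. right_module C M u n V \<sigma> \<Longrightarrow> act_hom X V (\<sigma> \<bullet> (\<one> V \<boxtimes> \<eta>)) A \<alpha> F \<Longrightarrow> F \<bullet> \<sigma> = \<rho> \<bullet> (F \<boxtimes> \<one> M)"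
    using act_hom_module_hom[OF \<alpha>] by blast
  have [simp]: "A \<in> Obj C" "\<rho> \<in> Arr C" "Dom C \<rho> = A \<otimes> M" "Cod C \<rho> = A"
    and \<rho>u: "\<rho> \<bullet> (\<one> A \<boxtimes> u) = \<r> A" and \<rho>n: "\<rho> \<bullet> (\<rho> \<boxtimes> \<one> M) = \<rho> \<bullet> (\<one> A \<boxtimes> n) \<bullet> \<a> A M M"
    using \<rho>(1) by (auto simp: right_module_def Hom_def)
  have [simp]: "g \<in> Arr C" "Dom C g = V" "Cod C g = A" using g by (auto simp: Hom_def)
  let ?F = "\<rho> \<bullet> (g \<boxtimes> \<one> M)" let ?D = "(\<one> V \<boxtimes> mult_gen) \<bullet> \<a> V M X"
  have "?F \<bullet> ?D = \<alpha> \<bullet> (?F \<boxtimes> \<one> X)"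
    unfolding \<rho>(2)[symmetric]
  proof (rule ext3[where Y = M and W = X])
    fix K v m x assume [simp]: "ctxt_ok K" and v: "var K 0 V e d v" "var K 1 M e' d' m" "var K 2 X e'' d'' x"
    show "app (?F \<bullet> ?D) ((v \<otimes>\<otimes> m) \<otimes>\<otimes> x) = app ((\<rho> \<bullet> (\<one> A \<boxtimes> \<eta>)) \<bullet> (?F \<boxtimes> \<one> X)) ((v \<otimes>\<otimes> m) \<otimes>\<otimes> x)"
      using v app_eq[OF \<rho>n, of "(app g v \<otimes>\<otimes> m) \<otimes>\<otimes> app \<eta> x"] by (simp add: var_def)
  qed (simp_all add: Hom_def)
  then have 1: "act_hom X (V \<otimes> M) ?D A \<alpha> ?F" by (simp add: act_hom_def Hom_def)
  have 2: "?F \<bullet> (\<one> V \<boxtimes> u) \<bullet> Inv (\<r> V) = g"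
  proof (rule ext1)
    fix K v assume [simp]: "ctxt_ok K" and v: "var K 0 V e d v"
    show "app (?F \<bullet> (\<one> V \<boxtimes> u) \<bullet> Inv (\<r> V)) v = app g v"
      using v app_eq[OF \<rho>u, of "app g v \<otimes>\<otimes> star K"] by (simp add: var_def)
  qed (simp_all add: Hom_def)
  have 3: "F = ?F" if F: "act_hom X (V \<otimes> M) ?D A \<alpha> F" and Fg: "F \<bullet> (\<one> V \<boxtimes> u) \<bullet> Inv (\<r> V) = g" for F
  proof -
    have [simp]: "F \<in> Arr C" "Dom C F = V \<otimes> M" "Cod C F = A" using F by (auto simp: act_hom_def Hom_def)
    have "F = F \<bullet> extend V \<bullet> (((\<one> V \<boxtimes> u) \<bullet> Inv (\<r> V)) \<boxtimes> \<one> M)" by (subst extend_unit) simp_all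
    also have "\<dots> = (F \<bullet> extend V) \<bullet> (((\<one> V \<boxtimes> u) \<bullet> Inv (\<r> V)) \<boxtimes> \<one> M)" by simp
    also have "F \<bullet> extend V = \<rho> \<bullet> (F \<boxtimes> \<one> M)"
      using hom[OF extend_module, of V F] F extend_gen[of V] by simp
    also have "(\<rho> \<bullet> (F \<boxtimes> \<one> M)) \<bullet> (((\<one> V \<boxtimes> u) \<bullet> Inv (\<r> V)) \<boxtimes> \<one> M) = ?F"
      by (simp add: TensA_Comp' flip: Fg)
    finally show ?thesis .
  qed
  show ?thesis using 1 2 3 by blast
qed

text \<open>Action maps \<open>W \<otimes> K \<otimes> M \<rightarrow> A\<close> correspond to maps \<open>W \<otimes> K \<rightarrow> A\<close> and, as \<open>W \<otimes> K\<close> is a coproduct, to families of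
maps \<open>W \<rightarrow> A\<close>.\<close>

lemma free_action_points:
  assumes K: "is_coproduct C (hom \<I> X) (\<lambda>_. \<I>) K \<iota>"
    and pres: "\<And>W. W \<in> Obj C \<Longrightarrow> is_coproduct C (hom \<I> X) (\<lambda>_. W \<otimes> \<I>) (W \<otimes> K) (\<lambda>x. \<one> W \<boxtimes> \<iota> x)"
  shows "free_action X (K \<otimes> M) ((\<one> K \<boxtimes> mult_gen) \<bullet> \<a> K M X) (\<lambda>x. (\<iota> x \<boxtimes> u) \<bullet> Inv (\<l> \<I>))"
  unfolding free_action_def
proof (intro conjI ballI allI impI)
  have [simp]: "K \<in> Obj C" and \<iota>: "\<And>x. x \<in> hom \<I> X \<Longrightarrow> \<iota> x \<in> hom \<I> K" using K by (auto simp: is_coproduct_def)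
  let ?pt = "\<lambda>x. (\<iota> x \<boxtimes> u) \<bullet> Inv (\<l> \<I>)" and ?D = "(\<one> K \<boxtimes> mult_gen) \<bullet> \<a> K M X"
  show "X \<in> Obj C" by simp
  show "commuting_action C X (K \<otimes> M) ?D" by (rule extend_commuting) simp
  show "?pt x \<in> hom \<I> (K \<otimes> M)" if "x \<in> hom \<I> X" for x using \<iota>[OF that] by (auto simp: Hom_def)
  fix W A \<alpha> a assume [simp]: "W \<in> Obj C" and \<alpha>: "commuting_action C X A \<alpha>" and a: "\<forall>x \<in> hom \<I> X. a x \<in> hom W A"
  let ?V = "W \<otimes> K" let ?E = "(\<one> ?V \<boxtimes> mult_gen) \<bullet> \<a> ?V M X" and ?WD = "(\<one> W \<boxtimes> ?D) \<bullet> \<a> W (K \<otimes> M) X"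
  note [simp] = commuting_actionD[OF \<alpha>]
  have "\<forall>x \<in> hom \<I> X. a x \<bullet> \<r> W \<in> hom (W \<otimes> \<I>) A" using a by (simp add: Hom_def)
  then have copr: "\<exists>!g. g \<in> hom ?V A \<and> (\<forall>x \<in> hom \<I> X. g \<bullet> (\<one> W \<boxtimes> \<iota> x) = a x \<bullet> \<r> W)"
    using pres[of W, unfolded is_coproduct_def, THEN conjunct2, THEN conjunct2, THEN bspec, of A, THEN spec, of "\<lambda>x. a x \<bullet> \<r> W"]
    by simp
  then obtain g where g: "g \<in> hom ?V A" "\<And>x. x \<in> hom \<I> X \<Longrightarrow> g \<bullet> (\<one> W \<boxtimes> \<iota> x) = a x \<bullet> \<r> W" by blast
  note univ = extend_universal[OF _ \<alpha> g(1), simplified]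
  have aE: "\<a> W K M \<bullet> ?E = ?WD \<bullet> (\<a> W K M \<boxtimes> \<one> X)"
  proof (rule ext4[where Y = K and W = M and V = X])
    fix L w k m x assume [simp]: "ctxt_ok L" and v: "var L 0 W e d w" "var L 1 K e' d' k" "var L 2 M e'' d'' m" "var L 3 X e3 d3 x"
    show "app (\<a> W K M \<bullet> ?E) (((w \<otimes>\<otimes> k) \<otimes>\<otimes> m) \<otimes>\<otimes> x) = app (?WD \<bullet> (\<a> W K M \<boxtimes> \<one> X)) (((w \<otimes>\<otimes> k) \<otimes>\<otimes> m) \<otimes>\<otimes> x)"
      using v by (simp add: var_def)
  qed (simp_all add: Hom_def)
  have act: "act_hom X (W \<otimes> K \<otimes> M) ?WD A \<alpha> F \<longleftrightarrow> act_hom X (?V \<otimes> M) ?E A \<alpha> (F \<bullet> \<a> W K M)"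
    if [simp]: "F \<in> Arr C" "Dom C F = W \<otimes> K \<otimes> M" "Cod C F = A" for F
  proof -
    have "(F \<bullet> \<a> W K M) \<bullet> ?E = (F \<bullet> ?WD) \<bullet> (\<a> W K M \<boxtimes> \<one> X)" using aE by simp
    moreover have "\<alpha> \<bullet> ((F \<bullet> \<a> W K M) \<boxtimes> \<one> X) = (\<alpha> \<bullet> (F \<boxtimes> \<one> X)) \<bullet> (\<a> W K M \<boxtimes> \<one> X)"
      by (simp add: TensA_Comp')
    moreover have "(F \<bullet> ?WD) \<bullet> (\<a> W K M \<boxtimes> \<one> X) = (\<alpha> \<bullet> (F \<boxtimes> \<one> X)) \<bullet> (\<a> W K M \<boxtimes> \<one> X) \<longleftrightarrow> F \<bullet> ?WD = \<alpha> \<bullet> (F \<boxtimes> \<one> X)"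
      using iso_epi[of "\<a> W K M \<boxtimes> \<one> X" "F \<bullet> ?WD" "\<alpha> \<bullet> (F \<boxtimes> \<one> X)"] by (auto simp del: Comp_assoc')
    ultimately show ?thesis by (simp add: act_hom_def Hom_def)
  qed
  have pt: "F \<bullet> (\<one> W \<boxtimes> ?pt x) \<bullet> Inv (\<r> W) = ((F \<bullet> \<a> W K M) \<bullet> (\<one> ?V \<boxtimes> u) \<bullet> Inv (\<r> ?V)) \<bullet> (\<one> W \<boxtimes> \<iota> x) \<bullet> Inv (\<r> W)"
    if F [simp]: "F \<in> Arr C" "Dom C F = W \<otimes> K \<otimes> M" "Cod C F = A" and x: "x \<in> hom \<I> X" for F x
  proof (rule ext1)
    have [simp]: "\<iota> x \<in> Arr C" "Dom C (\<iota> x) = \<I>" "Cod C (\<iota> x) = K" using \<iota>[OF x] by (auto simp: Hom_def)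
    fix L w assume [simp]: "ctxt_ok L" and v: "var L 0 W e d w"
    show "app (F \<bullet> (\<one> W \<boxtimes> ?pt x) \<bullet> Inv (\<r> W)) w
        = app (((F \<bullet> \<a> W K M) \<bullet> (\<one> ?V \<boxtimes> u) \<bullet> Inv (\<r> ?V)) \<bullet> (\<one> W \<boxtimes> \<iota> x) \<bullet> Inv (\<r> W)) w"
      using v by (simp add: var_def)
  qed (use \<iota>[OF x] in \<open>auto simp: Hom_def\<close>)
  obtain G where G: "act_hom X (?V \<otimes> M) ?E A \<alpha> G" "G \<bullet> (\<one> ?V \<boxtimes> u) \<bullet> Inv (\<r> ?V) = g" using univ by blast
  have [simp]: "G \<in> Arr C" "Dom C G = ?V \<otimes> M" "Cod C G = A" using G by (auto simp: act_hom_def Hom_def)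
  let ?F = "G \<bullet> Inv (\<a> W K M)"
  have Fa: "?F \<bullet> \<a> W K M = G" by simp
  have gx: "g \<bullet> (\<one> W \<boxtimes> \<iota> x) \<bullet> Inv (\<r> W) = a x" if "x \<in> hom \<I> X" for x
  proof -
    have [simp]: "a x \<in> Arr C" "Dom C (a x) = W" "Cod C (a x) = A" "\<iota> x \<in> Arr C" "Dom C (\<iota> x) = \<I>" "Cod C (\<iota> x) = K"
      "g \<in> Arr C" "Dom C g = ?V" "Cod C g = A"
      using a \<iota> g that by (auto simp: Hom_def)
    have "g \<bullet> (\<one> W \<boxtimes> \<iota> x) \<bullet> Inv (\<r> W) = (g \<bullet> (\<one> W \<boxtimes> \<iota> x)) \<bullet> Inv (\<r> W)" by simp
    then show ?thesis unfolding g(2)[OF that] by simp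
  qed
  show "\<exists>!F. act_hom X (W \<otimes> K \<otimes> M) ?WD A \<alpha> F \<and> (\<forall>x \<in> hom \<I> X. F \<bullet> (\<one> W \<boxtimes> ?pt x) \<bullet> Inv (\<r> W) = a x)"
  proof (rule ex1I[of _ ?F])
    show "act_hom X (W \<otimes> K \<otimes> M) ?WD A \<alpha> ?F \<and> (\<forall>x \<in> hom \<I> X. ?F \<bullet> (\<one> W \<boxtimes> ?pt x) \<bullet> Inv (\<r> W) = a x)"
    proof (intro conjI ballI)
      show "act_hom X (W \<otimes> K \<otimes> M) ?WD A \<alpha> ?F" using act[of ?F] G(1) unfolding Fa by simp
      show "?F \<bullet> (\<one> W \<boxtimes> ?pt x) \<bullet> Inv (\<r> W) = a x" if "x \<in> hom \<I> X" for x
        using pt[of ?F x] that gx[OF that] unfolding Fa G(2) by (simp del: Comp_assoc')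
    qed
    fix F assume F: "act_hom X (W \<otimes> K \<otimes> M) ?WD A \<alpha> F \<and> (\<forall>x \<in> hom \<I> X. F \<bullet> (\<one> W \<boxtimes> ?pt x) \<bullet> Inv (\<r> W) = a x)"
    have F' [simp]: "F \<in> Arr C" "Dom C F = W \<otimes> K \<otimes> M" "Cod C F = A" using F by (auto simp: act_hom_def Hom_def)
    let ?g = "(F \<bullet> \<a> W K M) \<bullet> (\<one> ?V \<boxtimes> u) \<bullet> Inv (\<r> ?V)"
    have "?g \<bullet> (\<one> W \<boxtimes> \<iota> x) = a x \<bullet> \<r> W" if x: "x \<in> hom \<I> X" for x
    proof -
      have [simp]: "a x \<in> Arr C" "Dom C (a x) = W" "Cod C (a x) = A" "\<iota> x \<in> Arr C" "Dom C (\<iota> x) = \<I>" "Cod C (\<iota> x) = K"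
        using a \<iota> x by (auto simp: Hom_def)
      have "?g \<bullet> (\<one> W \<boxtimes> \<iota> x) = (?g \<bullet> (\<one> W \<boxtimes> \<iota> x) \<bullet> Inv (\<r> W)) \<bullet> \<r> W" by simp
      then show ?thesis using F x pt[OF F' x] by simp
    qed
    moreover have "?g \<in> hom ?V A" by (simp add: Hom_def)
    ultimately have "?g = g" using copr g by blast
    then have "F \<bullet> \<a> W K M = G" using univ G act[OF F'] F by blast
    from this[symmetric] show "F = ?F" by simp
  qed
qed

end

theorem mainTheorem3:
  fixes C :: "('o, 'm, 'k::{comm_semiring_0,comm_monoid_mult}) linsmcat"
    and S :: "'o \<Rightarrow> 'o" and u n \<eta> :: "'o \<Rightarrow> 'm"
    and small :: "'i set \<Rightarrow> bool"
  assumes "linear_symmetric_monoidal_category C"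
    and "has_finite_biproducts C"
    and "algebraically_free_commutative_monoids C S u n \<eta>"
    and "smallness small"
    and "has_small_points C small"
    and "has_small_coproducts_of_unit C small"
    and "tensor_preserves_small_coproducts_of_unit C small"
  shows "\<exists>P. initial_object (modality_category C) P \<and>
    (\<forall>X\<in>Obj C. \<exists>\<iota>. is_coproduct C (Hom C (UnitO C) X) (\<lambda>_. S X) (Bang P X) \<iota>)"
proof -
  interpret linear_symmetric_monoidal_category C by fact
  let ?good = "\<lambda>X r. free_diff_comonoid C r \<and> Bas r = X \<and> (\<exists>\<iota>. is_coproduct C (Hom C (UnitO C) X) (\<lambda>_. S X) (Car r) \<iota>)"
  have "\<exists>r. ?good X r" if X [simp]: "X \<in> Obj C" for X
  proof -
    interpret algebraically_free C X "S X" "u X" "n X" "\<eta> X"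
      by (intro algebraically_free.intro algebraically_free_axioms.intro assms(1))
        (use assms(3) X in \<open>auto simp: algebraically_free_commutative_monoids_def free_commutative_monoid_def\<close>)
    let ?J = "Hom C (UnitO C) X"
    \<comment> \<open>The coproducts are indexed by subsets of another type, hence the reindexing along a bijection.\<close>
    obtain J where J: "small J" "?J \<approx> J" using assms(5) X unfolding has_small_points_def by blast
    then obtain h where h: "bij_betw h ?J J" unfolding eqpoll_def by blast
    obtain K \<kappa> where \<kappa>: "is_coproduct C J (\<lambda>_. UnitO C) K \<kappa>"
      using assms(6) J(1) unfolding has_small_coproducts_of_unit_def by blast
    let ?\<iota> = "\<lambda>x. \<kappa> (h x)"
    note pres = assms(7)[unfolded tensor_preserves_small_coproducts_of_unit_def, rule_format, OF J(1) \<kappa>]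
    have K: "is_coproduct C ?J (\<lambda>_. UnitO C) K ?\<iota>" by (rule is_coproduct_reindex[OF h \<kappa>])
    have free: "free_action X (TensO C K (S X)) (Comp C (TensA C (Ident C K) mult_gen) (Assoc C K (S X) X))
        (\<lambda>x. Comp C (TensA C (?\<iota> x) (u X)) (iso_inv C (LUnit C (UnitO C))))"
      by (rule free_action_points[OF K is_coproduct_reindex[OF h pres[THEN conjunct1]]])
    have "is_coproduct C ?J (\<lambda>_. S X) (TensO C K (S X)) (\<lambda>x. Comp C (TensA C (?\<iota> x) (Ident C (S X))) (iso_inv C (LUnit C (S X))))"
      by (rule is_coproduct_iso[OF is_coproduct_reindex[OF h pres[THEN conjunct2]]]) (simp_all add: Hom_def)
    then show ?thesis using free_action_diff_comonoid[OF free assms(2)] by fastforce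
  qed
  then obtain R where R: "\<And>X. X \<in> Obj C \<Longrightarrow> ?good X (R X)" by metis
  interpret free_family C R
    by (intro free_family.intro free_family_axioms.intro bip_linear.intro bip_linear_axioms.intro assms(1,2))
      (use R in blast)+
  show ?thesis using P_initial R by (intro exI[of _ P]) auto
qed

end
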